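(* Let $a,b>0$, $I=[-a,b]$, and let $h:I\to(0,\infty)$ be a continuous function such that: (i) $x=0$ is the only point of global maximum of $h$ on $I$; (ii) $h$ is $C^1$ on $I\setminus\{0\}$, and in a neighborhood of $x=0$ it admits the expansion $$h(x)=\begin{cases} M-c_+x^m+O(x^{m+1}), & x>0,\\ M-c_-|x|^m+O(|x|^{m+1}), & x<0,\end{cases}$$ where $M,m,c_\pm$ are real numbers with $M>0$, $c_\pm>0$, $m\ge 1$. Let $\alpha=2(m+2)^{-1}$, and let $\Delta_\epsilon$, $\mathbf Q_\epsilon$, $\mathcal L_\epsilon$ be as defined in the context. Then there exist numbers $R_0>0$ and $\epsilon_0>0$, depending on the function $h$, such that $$\left\|\left(\Delta_\epsilon-\frac{\pi^2}{M^2\epsilon^2}\mathbf I_\epsilon\right)^{-1}-\mathbf Q_\epsilon^{-1}\oplus\boldsymbol 0\right\|\le R_0\,\epsilon^{3\alpha},\qquad\forall\,\epsilon\in(0,\epsilon_0),$$ where $\mathbf I_\epsilon$ is the identity operator on $L^2(\Omega_\epsilon)$, $\boldsymbol 0$ is the zero operator on the subspace $\mathcal L_\epsilon^\perp\subset L^2(\Omega_\epsilon)$, and $\mathbf Q_\epsilon^{-1}$ is regarded as an operator on $\mathcal L_\epsilon$.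
   Context: For $\epsilon>0$, $\Omega_\epsilon=\{(x,y): x\in I,\ 0<y<\epsilon h(x)\}$, and $\Delta_\epsilon$ is the positive Dirichlet Laplacian in $\Omega_\epsilon$, i.e. the self-adjoint operator on $L^2(\Omega_\epsilon)$ associated with the form $\int_{\Omega_\epsilon}|\nabla\psi|^2dx\,dy$ on $H^1_0(\Omega_\epsilon)$. $\mathcal L_\epsilon\subset L^2(\Omega_\epsilon)$ is the subspace of functions $$\psi_\chi(x,y)=\chi(x)\sqrt{\frac{2}{\epsilon h(x)}}\,\sin\frac{\pi y}{\epsilon h(x)},\qquad \chi\in L^2(I).$$ The map $\chi\mapsto\psi_\chi$ is an isometric isomorphism of $L^2(I)$ onto $\mathcal L_\epsilon$, and operators acting in $L^2(I)$ are identified with operators acting in $\mathcal L_\epsilon$ through it. The direct sum $\oplus$ is with respect to $L^2(\Omega_\epsilon)=\mathcal L_\epsilon\oplus\mathcal L_\epsilon^\perp$. $\mathbf Q_\epsilon$ is the self-adjoint operator on $L^2(I)$ $$\mathbf Q_\epsilon u=-\frac{d^2u}{dx^2}+W_\epsilon(x)u,\qquad u(-a)=u(b)=0,$$ associated with the quadratic form $\mathbf q_\epsilon[\chi]=\int_I(\chi'(x)^2+W_\epsilon(x)\chi^2(x))\,dx$ defined on $H^1_0(I)$, where $$W_\epsilon(x)=\frac{\pi^2}{\epsilon^2}\left(\frac1{h^2(x)}-\frac1{M^2}\right)+v(x),\qquad v(x)=\left(\frac{\pi^2}{3}+\frac14\right)\frac{h'(x)^2}{h^2(x)}.$$ $\|\cdot\|$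 is the operator norm.
   Formalization: It is assumed explicitly that the form q_ε is defined on all of H^1_0(I), i.e. W_ε χ² is integrable for every χ in H^1_0(I) (equivalently h' is in L²(I)); (i) and (ii) alone do not imply this, and without it Q_ε as described does not exist. *)

theory Defs
  imports "HOL-Analysis.Analysis" "HOL-Library.Landau_Symbols"
begin

text \<open>
  Real-valued $L^2$ spaces are handled through representatives: an element of $L^2(M)$ is a
  square-integrable function, taken up to equality almost everywhere.
\<close>

definition leb :: "'a::euclidean_space set \<Rightarrow> 'a measure" where
  "leb S = restrict_space lborel S"

definition L2 :: "'a measure \<Rightarrow> ('a \<Rightarrow> 'b::euclidean_space) set" where
  "L2 M = {f \<in> borel_measurable M. integrable M (\<lambda>x. (norm (f x))\<^sup>2)}"

definition l2inner :: "'a measure \<Rightarrow> ('a \<Rightarrow> 'b::euclidean_space) \<Rightarrow> ('a \<Rightarrow> 'b) \<Rightarrow> real" where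
  "l2inner M f g = (\<integral>x. f x \<bullet> g x \<partial>M)"

definition l2norm :: "'a measure \<Rightarrow> ('a \<Rightarrow> 'b::euclidean_space) \<Rightarrow> real" where
  "l2norm M f = sqrt (l2inner M f f)"

text \<open>
  Operator norm on $L^2(M)$, with value $\infty$ when the operator is unbounded or takes a value
  outside $L^2(M)$.
\<close>

definition l2_opnorm :: "'a measure \<Rightarrow> (('a \<Rightarrow> real) \<Rightarrow> ('a \<Rightarrow> real)) \<Rightarrow> ereal" where
  "l2_opnorm M T =
     (SUP f\<in>{f \<in> L2 M. l2norm M f \<le> 1}. if T f \<in> L2 M then ereal (l2norm M (T f)) else \<infinity>)"

definition partial :: "'a::euclidean_space \<Rightarrow> ('a \<Rightarrow> real) \<Rightarrow> 'a \<Rightarrow> real" where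
  "partial i f x = frechet_derivative f (at x) i"

definition gradient :: "('a::euclidean_space \<Rightarrow> real) \<Rightarrow> 'a \<Rightarrow> 'a" where
  "gradient f x = (\<Sum>i\<in>Basis. partial i f x *\<^sub>R i)"

primrec Ck :: "nat \<Rightarrow> ('a::euclidean_space \<Rightarrow> real) \<Rightarrow> bool" where
  "Ck 0 f \<longleftrightarrow> continuous_on UNIV f"
| "Ck (Suc k) f \<longleftrightarrow> (\<forall>x. f differentiable (at x)) \<and> (\<forall>i\<in>Basis. Ck k (partial i f))"

text \<open>
  The sets below are not required to be open; the Dirichlet condition is imposed on the boundary
  of the interior.
\<close>

definition test_functions :: "'a::euclidean_space set \<Rightarrow> ('a \<Rightarrow> real) set" where
  "test_functions S =
     {\<phi>. (\<forall>k. Ck k \<phi>) \<and> (\<exists>K. compact K \<and> K \<subseteq> interior S \<and> (\<forall>x. x \<notin> K \<longrightarrow> \<phi> x = 0))}"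

text \<open>
  $H^1_0$ is the closure of the test functions in the $H^1$ norm; the weak gradient is the $L^2$
  limit of the gradients of the approximating test functions.
\<close>

definition has_H10_gradient ::
  "'a::euclidean_space set \<Rightarrow> ('a \<Rightarrow> real) \<Rightarrow> ('a \<Rightarrow> 'a) \<Rightarrow> bool" where
  "has_H10_gradient S u g \<longleftrightarrow> u \<in> L2 (leb S) \<and> g \<in> L2 (leb S) \<and>
     (\<exists>\<phi>. (\<forall>n. \<phi> n \<in> test_functions S) \<and>
        (\<lambda>n. l2norm (leb S) (\<lambda>x. \<phi> n x - u x)) \<longlonglongrightarrow> 0 \<and>
        (\<lambda>n. l2norm (leb S) (\<lambda>x. gradient (\<phi> n) x - g x)) \<longlonglongrightarrow> 0)"

definition H10 :: "'a::euclidean_space set \<Rightarrow> ('a \<Rightarrow> real) set" where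
  "H10 S = {u. \<exists>g. has_H10_gradient S u g}"

definition wgrad :: "'a::euclidean_space set \<Rightarrow> ('a \<Rightarrow> real) \<Rightarrow> 'a \<Rightarrow> 'a" where
  "wgrad S u = (SOME g. has_H10_gradient S u g)"

text \<open>Unbounded operators on $L^2(M)$ are represented by their graphs.\<close>

type_synonym 'a l2op = "(('a \<Rightarrow> real) \<times> ('a \<Rightarrow> real)) set"

text \<open>
  The operator associated with the bilinear form \<open>q\<close> on the form domain \<open>V\<close>, as in the first
  representation theorem.
\<close>

definition form_operator ::
  "'a measure \<Rightarrow> ('a \<Rightarrow> real) set \<Rightarrow> (('a \<Rightarrow> real) \<Rightarrow> ('a \<Rightarrow> real) \<Rightarrow> real) \<Rightarrow> 'a l2op" where
  "form_operator M V q = {(u, f). u \<in> V \<and> f \<in> L2 M \<and> (\<forall>w\<in>V. q u w = l2inner M f w)}"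

definition minus_scalar :: "'a l2op \<Rightarrow> real \<Rightarrow> 'a l2op" where
  "minus_scalar A c = {(u, \<lambda>x. f x - c * u x) |u f. (u, f) \<in> A}"

definition inv_op :: "'a l2op \<Rightarrow> ('a \<Rightarrow> real) \<Rightarrow> ('a \<Rightarrow> real)" where
  "inv_op A f = (SOME u. (u, f) \<in> A)"

definition boundedly_invertible :: "'a measure \<Rightarrow> 'a l2op \<Rightarrow> bool" where
  "boundedly_invertible M A \<longleftrightarrow>
     (\<forall>f\<in>L2 M. \<exists>u. (u, f) \<in> A) \<and>
     (\<forall>u u' f. (u, f) \<in> A \<and> (u', f) \<in> A \<longrightarrow> (AE x in M. u x = u' x)) \<and>
     l2_opnorm M (inv_op A) < \<infinity>"

definition proj :: "'a measure \<Rightarrow> ('a \<Rightarrow> real) set \<Rightarrow> ('a \<Rightarrow> real) \<Rightarrow> ('a \<Rightarrow> real)" where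
  "proj M L f = (SOME g. g \<in> L \<and> (\<forall>k\<in>L. l2inner M (\<lambda>x. f x - g x) k = 0))"

text \<open>The operator $S \oplus T$ with respect to $L^2(M) = L \oplus L^\perp$.\<close>

definition direct_sum ::
  "'a measure \<Rightarrow> ('a \<Rightarrow> real) set \<Rightarrow> (('a \<Rightarrow> real) \<Rightarrow> ('a \<Rightarrow> real)) \<Rightarrow>
     (('a \<Rightarrow> real) \<Rightarrow> ('a \<Rightarrow> real)) \<Rightarrow> ('a \<Rightarrow> real) \<Rightarrow> ('a \<Rightarrow> real)" where
  "direct_sum M L S T f =
     (\<lambda>x. S (proj M L f) x + T (\<lambda>y. f y - proj M L f y) x)"

definition strip :: "real \<Rightarrow> real \<Rightarrow> (real \<Rightarrow> real) \<Rightarrow> real \<Rightarrow> (real \<times> real) set" where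
  "strip a b h \<epsilon> = {(x, y). x \<in> {-a..b} \<and> 0 < y \<and> y < \<epsilon> * h x}"

definition dirichlet_laplacian :: "'a::euclidean_space set \<Rightarrow> 'a l2op" where
  "dirichlet_laplacian S =
     form_operator (leb S) (H10 S) (\<lambda>u w. \<integral>x. wgrad S u x \<bullet> wgrad S w x \<partial>leb S)"

text \<open>
  The parameter \<open>h'\<close> stands for the derivative of \<open>h\<close> away from 0; its value at 0 is irrelevant.
\<close>

definition W_pot ::
  "(real \<Rightarrow> real) \<Rightarrow> (real \<Rightarrow> real) \<Rightarrow> real \<Rightarrow> real \<Rightarrow> real \<Rightarrow> real" where
  "W_pot h h' M \<epsilon> x =
     pi\<^sup>2 / \<epsilon>\<^sup>2 * (1 / (h x)\<^sup>2 - 1 / M\<^sup>2) + (pi\<^sup>2 / 3 + 1 / 4) * ((h' x)\<^sup>2 / (h x)\<^sup>2)"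

definition schroedinger :: "real set \<Rightarrow> (real \<Rightarrow> real) \<Rightarrow> real l2op" where
  "schroedinger S W =
     form_operator (leb S) (H10 S)
       (\<lambda>u w. \<integral>x. (wgrad S u x * wgrad S w x + W x * (u x * w x)) \<partial>leb S)"

definition mode :: "(real \<Rightarrow> real) \<Rightarrow> real \<Rightarrow> (real \<Rightarrow> real) \<Rightarrow> real \<times> real \<Rightarrow> real" where
  "mode h \<epsilon> \<eta> = (\<lambda>(x, y). \<eta> x * sqrt (2 / (\<epsilon> * h x)) * sin (pi * y / (\<epsilon> * h x)))"

definition mode_space :: "real \<Rightarrow> real \<Rightarrow> (real \<Rightarrow> real) \<Rightarrow> real \<Rightarrow> (real \<times> real \<Rightarrow> real) set" where
  "mode_space a b h \<epsilon> = mode h \<epsilon> ` L2 (leb {-a..b})"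

text \<open>
  An operator on $L^2([-a,b])$ regarded as an operator on the mode space via \<open>mode\<close>.
\<close>

definition on_modes ::
  "real \<Rightarrow> real \<Rightarrow> (real \<Rightarrow> real) \<Rightarrow> real \<Rightarrow> ((real \<Rightarrow> real) \<Rightarrow> (real \<Rightarrow> real)) \<Rightarrow>
     (real \<times> real \<Rightarrow> real) \<Rightarrow> (real \<times> real \<Rightarrow> real)" where
  "on_modes a b h \<epsilon> B g =
     mode h \<epsilon> (B (SOME \<eta>. \<eta> \<in> L2 (leb {-a..b}) \<and>
                          (AE p in leb (strip a b h \<epsilon>). g p = mode h \<epsilon> \<eta> p)))"

end

theory Submission imports Defs "HOL-Real_Asymp.Real_Asymp" begin

text \<open>
  Write $L=\epsilon h$, $\lambda=h'/h$, $r=\epsilon^{\alpha}$ and split $u=\psi_\chi+V$ with $V$ fibrewise orthogonal to the first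
  transverse mode. The shifted Dirichlet form is $\mathbf q_\epsilon$ on the modes and at least
  $\|\partial_xV\|^2+\pi^2\|V\|^2/\max L^2$ on the complement, by the gap above the first Dirichlet eigenvalue
  of a fibre. The two parts are coupled only through $\lambda$: since $\int\lambda^2w^2\le 2\|\lambda\|^2\|w\|\|w'\|$ in one
  variable, and $\|\chi\|^2\le Cr^2\mathbf q_\epsilon[\chi]$ by the uncertainty principle near the maximum of $h$, the coupling has
  relative size $O(\sqrt r)$. Comparing $u=(\Delta_\epsilon-\pi^2/(M\epsilon)^2)^{-1}f$ with the mode of
  $\mathbf Q_\epsilon^{-1}\chi_f$ then gives an error of order $(\epsilon+\sqrt r\,r)^2=O(r^3)$.
\<close>

section \<open>Square integrable functions\<close>

text \<open>The expansion at 0 controls h but not h', so \<lambda> may be unbounded. It is square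
  integrable because the form of Q is assumed to be defined on all of H^1_0; hence every use of
  \<lambda> rests on the bound sup w^2 <= 2 |w| |w'|, and modes, whose x-derivative contains
  \<lambda>, are reached by smoothing ln L. The coupling pairs \<chi>' with the mode coefficient of
  V_x, which is not small by itself. Differentiating the orthogonality of V along the axis turns
  this coefficient into \<lambda> times the pairing of V with \<open>tau\<close>, and V has L^2 norm
  O(\<epsilon>) times its form norm. The rest of the coupling pairs \<lambda> \<chi> with V_x and
  costs the square root of the length R = O(r) in |\<chi>| <= R q^(1/2). The error is a square
  because the coupling acts twice. With E = O(\<epsilon>) and relative coupling D, the form norm of
  V is O(E + D R); V perturbs the mode part by D times that; and passing to L^2 norms multiplies the
  two by E and R, which gives (E + D R)^2. The assumption m >= 1 makes \<epsilon> = O(r^(3/2)), the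
  size of D R.\<close>

abbreviation l2_lim :: "'a measure \<Rightarrow> (nat \<Rightarrow> 'a \<Rightarrow> 'b::euclidean_space) \<Rightarrow> ('a \<Rightarrow> 'b) \<Rightarrow> bool" where
  "l2_lim M f g \<equiv> (\<lambda>n. l2norm M (\<lambda>x. f n x - g x)) \<longlonglongrightarrow> 0"

lemma L2_measurable [measurable_dest]: "f \<in> L2 M \<Longrightarrow> f \<in> borel_measurable M"
  by (simp add: L2_def)

lemma L2_integrable_sq: "f \<in> L2 M \<Longrightarrow> integrable M (\<lambda>x. (norm (f x))\<^sup>2)"
  by (simp add: L2_def)

lemma L2_dominated:
  fixes f :: "'a \<Rightarrow> 'b::euclidean_space"
  assumes "f \<in> borel_measurable M" and "integrable M w"
    and "\<And>x. x \<in> space M \<Longrightarrow> (norm (f x))\<^sup>2 \<le> w x"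
  shows "f \<in> L2 M"
proof -
  have "integrable M (\<lambda>x. (norm (f x))\<^sup>2)"
    using assms by (intro Bochner_Integration.integrable_bound[OF assms(2)])
      (auto intro!: AE_I2 intro: order_trans[OF _ abs_ge_self])
  then show ?thesis using assms by (simp add: L2_def)
qed

lemma norm_add_sq_le: "(norm (x + y))\<^sup>2 \<le> 2 * (norm x)\<^sup>2 + 2 * (norm (y::'b::euclidean_space))\<^sup>2"
proof -
  have "0 \<le> (norm (x - y))\<^sup>2" by simp
  then show ?thesis by (simp add: power2_norm_eq_inner inner_simps inner_commute)
qed

lemma L2_add:
  fixes f g :: "'a \<Rightarrow> 'b::euclidean_space"
  assumes "f \<in> L2 M" "g \<in> L2 M" shows "(\<lambda>x. f x + g x) \<in> L2 M"
proof (rule L2_dominated)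
  show "integrable M (\<lambda>x. 2 * (norm (f x))\<^sup>2 + 2 * (norm (g x))\<^sup>2)"
    using L2_integrable_sq[OF assms(1)] L2_integrable_sq[OF assms(2)] by auto
  show "(\<lambda>x. f x + g x) \<in> borel_measurable M" using assms L2_measurable by auto
qed (rule norm_add_sq_le)

lemma L2_bounded_mult:
  fixes f :: "'a \<Rightarrow> 'b::euclidean_space" and k :: "'a \<Rightarrow> real"
  assumes "f \<in> L2 M" and "k \<in> borel_measurable M" and "\<And>x. x \<in> space M \<Longrightarrow> \<bar>k x\<bar> \<le> B"
  shows "(\<lambda>x. k x *\<^sub>R f x) \<in> L2 M"
proof (rule L2_dominated)
  show "integrable M (\<lambda>x. B\<^sup>2 * (norm (f x))\<^sup>2)"
    using L2_integrable_sq[OF assms(1)] by auto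
  show "(\<lambda>x. k x *\<^sub>R f x) \<in> borel_measurable M" using assms L2_measurable by auto
  show "(norm (k x *\<^sub>R f x))\<^sup>2 \<le> B\<^sup>2 * (norm (f x))\<^sup>2" if "x \<in> space M" for x
    using assms(3)[OF that]
    by (simp add: power_mult_distrib) (metis abs_ge_zero mult_right_mono power2_abs power_mono zero_le_power2)
qed

lemma L2_scaleR:
  fixes f :: "'a \<Rightarrow> 'b::euclidean_space"
  shows "f \<in> L2 M \<Longrightarrow> (\<lambda>x. c *\<^sub>R f x) \<in> L2 M"
  by (rule L2_bounded_mult[where B="\<bar>c\<bar>"]) auto

lemma L2_mult_const: "f \<in> L2 M \<Longrightarrow> (\<lambda>x. c * f x) \<in> L2 M" for c :: real
  using L2_scaleR[of f M c] by simp

lemma L2_diff: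
  fixes f g :: "'a \<Rightarrow> 'b::euclidean_space"
  assumes "f \<in> L2 M" "g \<in> L2 M" shows "(\<lambda>x. f x - g x) \<in> L2 M"
  using L2_add[OF assms(1) L2_scaleR[OF assms(2), of "-1"]] by simp

lemma L2_zero: "(\<lambda>x. 0) \<in> L2 M"
  by (simp add: L2_def)

lemma L2_inner_integrable:
  fixes f g :: "'a \<Rightarrow> 'b::euclidean_space"
  assumes "f \<in> L2 M" "g \<in> L2 M" shows "integrable M (\<lambda>x. f x \<bullet> g x)"
proof (rule Bochner_Integration.integrable_bound)
  show "integrable M (\<lambda>x. (norm (f x))\<^sup>2 + (norm (g x))\<^sup>2)"
    using L2_integrable_sq[OF assms(1)] L2_integrable_sq[OF assms(2)] by auto
  show "(\<lambda>x. f x \<bullet> g x) \<in> borel_measurable M" using assms L2_measurable by auto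
  show "AE x in M. norm (f x \<bullet> g x) \<le> norm ((norm (f x))\<^sup>2 + (norm (g x))\<^sup>2)"
  proof (rule AE_I2)
    fix x
    have "\<bar>f x \<bullet> g x\<bar> \<le> norm (f x) * norm (g x)" by (rule Cauchy_Schwarz_ineq2)
    also have "2 * (norm (f x) * norm (g x)) \<le> (norm (f x))\<^sup>2 + (norm (g x))\<^sup>2"
      using sum_squares_bound[of "norm (f x)" "norm (g x)"] by (simp add: mult.assoc)
    finally show "norm (f x \<bullet> g x) \<le> norm ((norm (f x))\<^sup>2 + (norm (g x))\<^sup>2)"
      by (smt (verit) real_norm_def zero_le_power2 norm_ge_zero mult_nonneg_nonneg)
  qed
qed

lemma L2_mult_integrable: "f \<in> L2 M \<Longrightarrow> g \<in> L2 M \<Longrightarrow> integrable M (\<lambda>x. f x * g x)"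
  for f g :: "'a \<Rightarrow> real"
  using L2_inner_integrable[of f M g] by simp

lemma l2inner_commute: "l2inner M f g = l2inner M g f"
  by (simp add: l2inner_def inner_commute)

lemma l2inner_nonneg: "0 \<le> l2inner M f f"
  by (simp add: l2inner_def)

lemma l2norm_nonneg: "0 \<le> l2norm M f"
  by (simp add: l2norm_def l2inner_nonneg)

lemma l2norm_sq: "(l2norm M f)\<^sup>2 = l2inner M f f"
  by (simp add: l2norm_def l2inner_nonneg)

lemma l2inner_add_left:
  assumes "f \<in> L2 M" "g \<in> L2 M" "k \<in> L2 M"
  shows "l2inner M (\<lambda>x. f x + g x) k = l2inner M f k + l2inner M g k"
  using L2_inner_integrable[OF assms(1,3)] L2_inner_integrable[OF assms(2,3)]
  by (simp add: l2inner_def inner_add_left)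

lemma l2inner_scaleR_left: "l2inner M (\<lambda>x. c *\<^sub>R f x) k = c * l2inner M f k"
  by (simp add: l2inner_def)

lemma l2inner_diff_left:
  assumes "f \<in> L2 M" "g \<in> L2 M" "k \<in> L2 M"
  shows "l2inner M (\<lambda>x. f x - g x) k = l2inner M f k - l2inner M g k"
  using L2_inner_integrable[OF assms(1,3)] L2_inner_integrable[OF assms(2,3)]
  by (simp add: l2inner_def inner_diff_left)

lemma l2inner_add_right:
  assumes "f \<in> L2 M" "g \<in> L2 M" "k \<in> L2 M"
  shows "l2inner M k (\<lambda>x. f x + g x) = l2inner M k f + l2inner M k g"
  using l2inner_add_left[OF assms] by (simp add: l2inner_commute)

lemma l2inner_diff_right:
  assumes "f \<in> L2 M" "g \<in> L2 M" "k \<in> L2 M"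
  shows "l2inner M k (\<lambda>x. f x - g x) = l2inner M k f - l2inner M k g"
  using l2inner_diff_left[OF assms] by (simp add: l2inner_commute)

lemma l2inner_scaleR_right: "l2inner M k (\<lambda>x. c *\<^sub>R f x) = c * l2inner M k f"
  by (simp add: l2inner_def)

text \<open>The degenerate cases are the useful ones: with \<open>A = 0\<close> or
  \<open>C = 0\<close> the conclusion reads \<open>B = 0\<close>, which yields the Euler equation of
  a minimiser and later the vanishing of the transverse mixed term.\<close>

lemma quadratic_nonneg_discr:
  fixes A B C :: real
  assumes "\<And>t. 0 \<le> A + 2 * t * B + t\<^sup>2 * C" and "0 \<le> A" and "0 \<le> C"
  shows "\<bar>B\<bar> \<le> sqrt A * sqrt C"
proof -
  have "B\<^sup>2 \<le> A * C"
  proof (cases "C = 0")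
    case True
    have "B = 0"
    proof (rule ccontr)
      assume "B \<noteq> 0"
      \<comment> \<open>For \<open>C = 0\<close> this value of t gives the quadratic the value
        -1.\<close>
      with assms(1)[of "- (A + 1) / (2 * B)"] True show False by (simp add: field_simps)
    qed
    then show ?thesis using True by simp
  next
    case False
    have "0 \<le> (A + 2 * (-B/C) * B + (-B/C)\<^sup>2 * C) * C"
      by (rule mult_nonneg_nonneg[OF assms(1) assms(3)])
    also have "\<dots> = A * C - B\<^sup>2" using False by (simp add: field_simps power2_eq_square)
    finally show ?thesis by simp
  qed
  then have "\<bar>B\<bar> \<le> sqrt (A * C)" by (simp add: real_le_rsqrt)
  then show ?thesis by (simp add: real_sqrt_mult)
qed

lemma l2inner_add_square:
  assumes "f \<in> L2 M" "g \<in> L2 M"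
  shows "l2inner M (\<lambda>x. f x + t *\<^sub>R g x) (\<lambda>x. f x + t *\<^sub>R g x) =
    l2inner M f f + 2 * t * l2inner M f g + t\<^sup>2 * l2inner M g g"
proof -
  have "l2inner M (\<lambda>x. f x + t *\<^sub>R g x) (\<lambda>x. f x + t *\<^sub>R g x) =
    l2inner M f (\<lambda>x. f x + t *\<^sub>R g x) + l2inner M (\<lambda>x. t *\<^sub>R g x) (\<lambda>x. f x + t *\<^sub>R g x)"
    using assms by (intro l2inner_add_left L2_add L2_scaleR)
  also have "\<dots> = l2inner M f f + l2inner M f (\<lambda>x. t *\<^sub>R g x)
      + (l2inner M (\<lambda>x. t *\<^sub>R g x) f + l2inner M (\<lambda>x. t *\<^sub>R g x) (\<lambda>x. t *\<^sub>R g x))"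
    using assms by (simp only: l2inner_add_right L2_scaleR)
  finally show ?thesis
    by (simp add: l2inner_scaleR_left l2inner_scaleR_right l2inner_commute[of M g f] power2_eq_square)
qed

lemma l2inner_Cauchy_Schwarz:
  assumes "f \<in> L2 M" "g \<in> L2 M"
  shows "\<bar>l2inner M f g\<bar> \<le> l2norm M f * l2norm M g"
  unfolding l2norm_def
proof (rule quadratic_nonneg_discr)
  show "0 \<le> l2inner M f f + 2 * t * l2inner M f g + t\<^sup>2 * l2inner M g g" for t
    unfolding l2inner_add_square[OF assms, symmetric] by (rule l2inner_nonneg)
qed (auto simp: l2inner_nonneg)

lemma l2norm_triangle:
  assumes "f \<in> L2 M" "g \<in> L2 M"
  shows "l2norm M (\<lambda>x. f x + g x) \<le> l2norm M f + l2norm M g"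
proof (rule power2_le_imp_le)
  have "(l2norm M (\<lambda>x. f x + g x))\<^sup>2 = (l2norm M f)\<^sup>2 + 2 * l2inner M f g + (l2norm M g)\<^sup>2"
    using l2inner_add_square[OF assms, of 1] by (simp add: l2norm_sq)
  also have "\<dots> \<le> (l2norm M f + l2norm M g)\<^sup>2"
    using l2inner_Cauchy_Schwarz[OF assms] by (simp add: power2_sum)
  finally show "(l2norm M (\<lambda>x. f x + g x))\<^sup>2 \<le> (l2norm M f + l2norm M g)\<^sup>2" .
qed (simp add: l2norm_nonneg)

lemma l2norm_scaleR: "l2norm M (\<lambda>x. c *\<^sub>R f x) = \<bar>c\<bar> * l2norm M f"
  by (simp add: l2norm_def l2inner_scaleR_left l2inner_scaleR_right real_sqrt_mult
      mult.assoc[symmetric] flip: power2_eq_square)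

lemma l2norm_minus_commute: "l2norm M (\<lambda>x. f x - g x) = l2norm M (\<lambda>x. g x - f x)"
  using l2norm_scaleR[of M "-1" "\<lambda>x. f x - g x"] by simp

lemma l2norm_triangle_diff:
  assumes "f \<in> L2 M" "g \<in> L2 M" "k \<in> L2 M"
  shows "l2norm M (\<lambda>x. f x - k x) \<le> l2norm M (\<lambda>x. f x - g x) + l2norm M (\<lambda>x. g x - k x)"
  using l2norm_triangle[OF L2_diff[OF assms(1,2)] L2_diff[OF assms(2,3)]] by simp

lemma l2norm_diff_abs:
  assumes "f \<in> L2 M" "g \<in> L2 M"
  shows "\<bar>l2norm M f - l2norm M g\<bar> \<le> l2norm M (\<lambda>x. f x - g x)"
  using l2norm_triangle_diff[OF assms L2_zero] l2norm_triangle_diff[OF assms(2,1) L2_zero]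
    l2norm_minus_commute[of M f g] by simp

lemma l2norm_mono:
  assumes "f \<in> borel_measurable M" "g \<in> L2 M" "\<And>x. x \<in> space M \<Longrightarrow> norm (f x) \<le> norm (g x)"
  shows "l2norm M f \<le> l2norm M g"
proof -
  have "integrable M (\<lambda>x. (norm (g x))\<^sup>2)" using assms(2) by (rule L2_integrable_sq)
  then have "(\<integral>x. (norm (f x))\<^sup>2 \<partial>M) \<le> (\<integral>x. (norm (g x))\<^sup>2 \<partial>M)"
    using assms by (intro integral_mono_AE') (auto intro!: AE_I2 power_mono)
  then show ?thesis by (simp add: l2norm_def l2inner_def power2_norm_eq_inner)
qed

lemma l2norm_bounded_mult:
  fixes f :: "'a \<Rightarrow> 'b::euclidean_space"
  assumes "f \<in> L2 M" and "k \<in> borel_measurable M" and "\<And>x. x \<in> space M \<Longrightarrow> \<bar>k x\<bar> \<le> B" and "B \<ge> 0"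
  shows "l2norm M (\<lambda>x. k x *\<^sub>R f x) \<le> B * l2norm M f"
proof -
  have "l2norm M (\<lambda>x. k x *\<^sub>R f x) \<le> l2norm M (\<lambda>x. B *\<^sub>R f x)"
  proof (rule l2norm_mono)
    show "(\<lambda>x. B *\<^sub>R f x) \<in> L2 M" by (rule L2_scaleR[OF assms(1)])
    show "(\<lambda>x. k x *\<^sub>R f x) \<in> borel_measurable M" using assms L2_measurable by auto
  qed (use assms in \<open>auto intro!: mult_right_mono\<close>)
  then show ?thesis using assms(4) by (simp add: l2norm_scaleR)
qed

lemma l2norm_zero_iff:
  assumes "f \<in> L2 M"
  shows "l2norm M f = 0 \<longleftrightarrow> (AE x in M. f x = 0)"
proof -
  have "integrable M (\<lambda>x. f x \<bullet> f x)" by (rule L2_inner_integrable[OF assms assms])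
  then have "l2inner M f f = 0 \<longleftrightarrow> (AE x in M. f x \<bullet> f x = 0)"
    unfolding l2inner_def by (rule integral_nonneg_eq_0_iff_AE) simp
  then show ?thesis by (simp add: l2norm_def)
qed

lemma l2inner_cong_AE:
  assumes "AE x in M. f x = f' x" "AE x in M. g x = g' x"
    and "f \<in> borel_measurable M" "f' \<in> borel_measurable M" "g \<in> borel_measurable M" "g' \<in> borel_measurable M"
  shows "l2inner M f g = l2inner M f' g'"
  unfolding l2inner_def
proof (rule integral_cong_AE)
  show "AE x in M. f x \<bullet> g x = f' x \<bullet> g' x" using assms(1,2) by eventually_elim simp
qed (use assms in auto)

lemma l2norm_cong_AE:
  assumes "AE x in M. f x = g x" "f \<in> borel_measurable M" "g \<in> borel_measurable M"
  shows "l2norm M f = l2norm M g"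
  unfolding l2norm_def using l2inner_cong_AE[OF assms(1,1,2,3,2,3)] by simp

lemma L2_cong_AE:
  assumes "f \<in> L2 M" "AE x in M. f x = g x" "g \<in> borel_measurable M"
  shows "g \<in> L2 M"
proof -
  have "integrable M (\<lambda>x. (norm (g x))\<^sup>2)"
    by (rule integrable_cong_AE_imp[OF L2_integrable_sq[OF assms(1)]]) (use assms in auto)
  then show ?thesis using assms by (simp add: L2_def)
qed

lemma L2_Pair:
  fixes f :: "'a \<Rightarrow> 'b::euclidean_space" and g :: "'a \<Rightarrow> 'c::euclidean_space"
  shows "(\<lambda>x. (f x, g x)) \<in> L2 M \<longleftrightarrow> f \<in> L2 M \<and> g \<in> L2 M"
proof
  assume A: "(\<lambda>x. (f x, g x)) \<in> L2 M"
  then have m: "(\<lambda>x. (f x, g x)) \<in> borel_measurable M" by (rule L2_measurable)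
  have "(\<lambda>x. fst (f x, g x)) \<in> borel_measurable M" "(\<lambda>x. snd (f x, g x)) \<in> borel_measurable M"
    by (rule borel_measurable_continuous_on[OF _ m], intro continuous_intros)+
  then have "f \<in> borel_measurable M" "g \<in> borel_measurable M" by simp_all
  then show "f \<in> L2 M \<and> g \<in> L2 M"
    using L2_integrable_sq[OF A]
    by (auto intro!: L2_dominated[where w="\<lambda>x. (norm (f x, g x))\<^sup>2"] simp: norm_Pair)
next
  assume A: "f \<in> L2 M \<and> g \<in> L2 M"
  then have "integrable M (\<lambda>x. (norm (f x))\<^sup>2 + (norm (g x))\<^sup>2)"
    by (auto dest: L2_integrable_sq)
  moreover have "(\<lambda>x. (f x, g x)) \<in> borel_measurable M" using A L2_measurable by auto
  ultimately show "(\<lambda>x. (f x, g x)) \<in> L2 M" by (auto simp: L2_def norm_Pair)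
qed

lemma l2inner_Pair:
  assumes "f \<in> L2 M" "g \<in> L2 M" "f' \<in> L2 M" "g' \<in> L2 M"
  shows "l2inner M (\<lambda>x. (f x, g x)) (\<lambda>x. (f' x, g' x)) = l2inner M f f' + l2inner M g g'"
  using L2_inner_integrable[OF assms(1,3)] L2_inner_integrable[OF assms(2,4)]
  by (simp add: l2inner_def)

lemma l2norm_Pair_sq:
  assumes "f \<in> L2 M" "g \<in> L2 M"
  shows "(l2norm M (\<lambda>x. (f x, g x)))\<^sup>2 = (l2norm M f)\<^sup>2 + (l2norm M g)\<^sup>2"
  by (simp add: l2norm_sq l2inner_Pair assms)

lemma l2inner_tendsto:
  assumes L: "\<And>n. f n \<in> L2 M" "\<And>n. g n \<in> L2 M" "f0 \<in> L2 M" "g0 \<in> L2 M"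
    and f: "l2_lim M f f0" and g: "l2_lim M g g0"
  shows "(\<lambda>n. l2inner M (f n) (g n)) \<longlonglongrightarrow> l2inner M f0 g0"
proof -
  have n: "(\<lambda>n. l2norm M (g n)) \<longlonglongrightarrow> l2norm M g0"
  proof (rule LIM_zero_cancel, rule Lim_null_comparison[OF _ g], rule always_eventually, rule allI)
    show "norm (l2norm M (g n) - l2norm M g0) \<le> l2norm M (\<lambda>x. g n x - g0 x)" for n
      using l2norm_diff_abs[OF L(2,4)] by simp
  qed
  have b: "norm (l2inner M (f n) (g n) - l2inner M f0 g0) \<le>
      l2norm M (\<lambda>x. f n x - f0 x) * l2norm M (g n) + l2norm M f0 * l2norm M (\<lambda>x. g n x - g0 x)" for n
  proof -
    have "l2inner M (f n) (g n) - l2inner M f0 g0 =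
        l2inner M (\<lambda>x. f n x - f0 x) (g n) + l2inner M f0 (\<lambda>x. g n x - g0 x)"
      by (simp add: l2inner_diff_left l2inner_diff_right L)
    then show ?thesis
      using l2inner_Cauchy_Schwarz[OF L2_diff[OF L(1,3)] L(2), of n n]
        l2inner_Cauchy_Schwarz[OF L(3) L2_diff[OF L(2,4)], of n] by simp
  qed
  have "(\<lambda>n. l2norm M (\<lambda>x. f n x - f0 x) * l2norm M (g n)
      + l2norm M f0 * l2norm M (\<lambda>x. g n x - g0 x)) \<longlonglongrightarrow> 0 * l2norm M g0 + l2norm M f0 * 0"
    by (intro tendsto_intros f g n)
  then have "(\<lambda>n. l2inner M (f n) (g n) - l2inner M f0 g0) \<longlonglongrightarrow> 0"
    by (intro Lim_null_comparison[OF always_eventually[OF allI[OF b]]]) simp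
  then show ?thesis by (rule LIM_zero_cancel)
qed

lemma l2norm_tendsto:
  assumes "\<And>n. f n \<in> L2 M" "f0 \<in> L2 M" "l2_lim M f f0"
  shows "(\<lambda>n. l2norm M (f n)) \<longlonglongrightarrow> l2norm M f0"
  unfolding l2norm_def using l2inner_tendsto[OF assms(1,1,2,2,3,3)] by (intro tendsto_intros)

lemma l2norm_tendsto_squeeze:
  assumes "g \<longlonglongrightarrow> 0" "\<And>n. l2norm M (f n) \<le> g n"
  shows "(\<lambda>n. l2norm M (f n)) \<longlonglongrightarrow> 0"
  by (rule Lim_null_comparison[OF always_eventually assms(1)]) (use assms(2) in \<open>simp add: l2norm_nonneg\<close>)

section \<open>Convergence and completeness in L^2 over a finite measure\<close>

lemma (in finite_measure) L2_norm_integral_le: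
  fixes f :: "'a \<Rightarrow> 'b::euclidean_space"
  assumes "f \<in> L2 M"
  shows "integrable M f" "(\<integral>x. norm (f x) \<partial>M) \<le> l2norm M f * sqrt (measure M (space M))"
proof -
  have n: "(\<lambda>x. norm (f x)) \<in> L2 M" using assms by (auto simp: L2_def)
  have o: "(\<lambda>x. 1::real) \<in> L2 M" by (simp add: L2_def)
  have "integrable M (\<lambda>x. norm (f x))" using L2_mult_integrable[OF n o] by simp
  then show "integrable M f" using assms L2_measurable by (simp add: integrable_norm_iff)
  have "l2norm M (\<lambda>x. norm (f x)) = l2norm M f"
    by (simp add: l2norm_def l2inner_def flip: power2_eq_square power2_norm_eq_inner)
  moreover have "l2norm M (\<lambda>x. 1::real) = sqrt (measure M (space M))"
    by (simp add: l2norm_def l2inner_def)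
  ultimately show "(\<integral>x. norm (f x) \<partial>M) \<le> l2norm M f * sqrt (measure M (space M))"
    using l2inner_Cauchy_Schwarz[OF n o] by (simp add: l2inner_def)
qed

text \<open>Finiteness of the measure makes L^2 convergence imply L^1 convergence, which has almost
  everywhere convergent subsequences.\<close>

lemma (in finite_measure) l2_limit_AE_subseq:
  fixes f :: "nat \<Rightarrow> 'a \<Rightarrow> 'b::euclidean_space"
  assumes "\<And>n. f n \<in> L2 M" "f0 \<in> L2 M" "l2_lim M f f0"
  obtains r where "strict_mono r" "AE x in M. (\<lambda>n. f (r n) x) \<longlonglongrightarrow> f0 x"
proof -
  have "(\<lambda>n. l2norm M (\<lambda>x. f n x - f0 x) * sqrt (measure M (space M))) \<longlonglongrightarrow> 0"
    using tendsto_mult_right[OF assms(3), of "sqrt (measure M (space M))"] by simp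
  then have "(\<lambda>n. \<integral>x. norm (f n x - f0 x) \<partial>M) \<longlonglongrightarrow> 0"
    by (rule Lim_null_comparison[OF always_eventually, rotated])
      (use L2_norm_integral_le(2)[OF L2_diff[OF assms(1,2)]] in auto)
  then obtain r where r: "strict_mono r" "AE x in M. (\<lambda>n. f (r n) x - f0 x) \<longlonglongrightarrow> 0"
    using tendsto_L1_AE_subseq[of M "\<lambda>n x. f n x - f0 x"] L2_norm_integral_le(1)[OF L2_diff[OF assms(1,2)]]
    by blast
  show thesis
    by (rule that[OF r(1)]) (use r(2) in \<open>auto simp: LIM_zero_iff\<close>)
qed

text \<open>Riesz-Fischer. Over a finite measure an L^2 Cauchy sequence is L^1 Cauchy, so a
  subsequence converges almost everywhere; Fatou's lemma along that subsequence bounds the L^2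
  distance of every late term to the pointwise limit.\<close>

lemma (in finite_measure) L2_complete:
  fixes f :: "nat \<Rightarrow> 'a \<Rightarrow> 'b::euclidean_space"
  assumes L: "\<And>n. f n \<in> L2 M"
    and C: "\<And>e. e > 0 \<Longrightarrow> \<exists>N. \<forall>m\<ge>N. \<forall>n\<ge>N. l2norm M (\<lambda>x. f m x - f n x) < e"
  obtains f0 where "f0 \<in> L2 M" "l2_lim M f f0"
proof -
  define K where "K = sqrt (measure M (space M)) + 1"
  have K: "K > 0" unfolding K_def by (simp add: add_nonneg_pos)
  have "\<exists>N. \<forall>i\<ge>N. \<forall>j\<ge>N. (LINT x|M. norm (f i x - f j x)) < e" if "e > 0" for e
  proof -
    obtain N where N: "\<forall>m\<ge>N. \<forall>n\<ge>N. l2norm M (\<lambda>x. f m x - f n x) < e / K"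
      using C[OF divide_pos_pos[OF \<open>e > 0\<close> K]] by blast
    have "(LINT x|M. norm (f i x - f j x)) < e" if "i \<ge> N" "j \<ge> N" for i j
    proof -
      have "(LINT x|M. norm (f i x - f j x)) \<le> l2norm M (\<lambda>x. f i x - f j x) * K"
        using L2_norm_integral_le(2)[OF L2_diff[OF L L], of i j]
          l2norm_nonneg[of M "\<lambda>x. f i x - f j x"] unfolding K_def by (simp add: algebra_simps)
      also have "\<dots> < e" using N that K by (simp add: pos_less_divide_eq)
      finally show ?thesis .
    qed
    then show ?thesis by blast
  qed
  then obtain r where r: "strict_mono r" "AE x in M. Cauchy (\<lambda>i. f (r i) x)"
    by (rule cauchy_L1_AE_cauchy_subseq[of M f, rotated, OF _ that]) (use L2_norm_integral_le(1)[OF L] in auto)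
  define f0 where "f0 = (\<lambda>x. lim (\<lambda>i. f (r i) x))"
  have [measurable]: "f n \<in> borel_measurable M" for n using L L2_measurable by blast
  have f0 [measurable]: "f0 \<in> borel_measurable M" unfolding f0_def by measurable
  have lim: "AE x in M. (\<lambda>i. f (r i) x) \<longlonglongrightarrow> f0 x"
    using r(2) unfolding f0_def by eventually_elim (metis Cauchy_convergent_iff convergent_LIMSEQ_iff)
  have main: "\<exists>N. \<forall>m\<ge>N. (\<integral>\<^sup>+x. ennreal ((norm (f m x - f0 x))\<^sup>2) \<partial>M) \<le> ennreal (e\<^sup>2)" if e: "e > 0" for e
  proof -
    obtain N where N: "\<forall>m\<ge>N. \<forall>n\<ge>N. l2norm M (\<lambda>x. f m x - f n x) < e" using C[OF e] by blast
    have "(\<integral>\<^sup>+x. ennreal ((norm (f m x - f0 x))\<^sup>2) \<partial>M) \<le> ennreal (e\<^sup>2)" if m: "m \<ge> N" for m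
    proof -
      have "(\<integral>\<^sup>+x. ennreal ((norm (f m x - f0 x))\<^sup>2) \<partial>M) \<le>
          (\<integral>\<^sup>+x. liminf (\<lambda>i. ennreal ((norm (f m x - f (r i) x))\<^sup>2)) \<partial>M)"
      proof (rule nn_integral_mono_AE)
        show "AE x in M. ennreal ((norm (f m x - f0 x))\<^sup>2) \<le> liminf (\<lambda>i. ennreal ((norm (f m x - f (r i) x))\<^sup>2))"
          using lim
        proof eventually_elim
          case (elim x)
          have "(\<lambda>i. ennreal ((norm (f m x - f (r i) x))\<^sup>2)) \<longlonglongrightarrow> ennreal ((norm (f m x - f0 x))\<^sup>2)"
            by (intro tendsto_intros elim tendsto_ennrealI)
          then show ?case by (intro eq_refl lim_imp_Liminf[symmetric]) simp_all
        qed
      qed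
      also have "\<dots> \<le> liminf (\<lambda>i. \<integral>\<^sup>+x. ennreal ((norm (f m x - f (r i) x))\<^sup>2) \<partial>M)"
        by (rule nn_integral_liminf) auto
      also have "\<dots> \<le> ennreal (e\<^sup>2)"
      proof (rule Liminf_le)
        show "\<forall>\<^sub>F i in sequentially. (\<integral>\<^sup>+x. ennreal ((norm (f m x - f (r i) x))\<^sup>2) \<partial>M) \<le> ennreal (e\<^sup>2)"
          using eventually_ge_at_top[of N]
        proof eventually_elim
          case (elim i)
          have "r i \<ge> N" using elim seq_suble[OF r(1), of i] by simp
          then have "l2norm M (\<lambda>x. f m x - f (r i) x) < e" using N m by simp
          then have "(l2norm M (\<lambda>x. f m x - f (r i) x))\<^sup>2 \<le> e\<^sup>2"
            by (intro power_mono) (auto simp: l2norm_nonneg)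
          moreover have "(\<integral>\<^sup>+x. ennreal ((norm (f m x - f (r i) x))\<^sup>2) \<partial>M) = ennreal ((l2norm M (\<lambda>x. f m x - f (r i) x))\<^sup>2)"
            using L2_integrable_sq[OF L2_diff[OF L L], of m "r i"]
            by (subst nn_integral_eq_integral) (auto simp: l2norm_sq l2inner_def power2_norm_eq_inner)
          ultimately show ?case by (simp add: ennreal_leI)
        qed
      qed simp
      finally show ?thesis .
    qed
    then show ?thesis by blast
  qed
  have D: "(\<lambda>x. f m x - f0 x) \<in> L2 M \<and> l2norm M (\<lambda>x. f m x - f0 x) \<le> e"
    if "(\<integral>\<^sup>+x. ennreal ((norm (f m x - f0 x))\<^sup>2) \<partial>M) \<le> ennreal (e\<^sup>2)" "e > 0" for m e
  proof -
    have i: "integrable M (\<lambda>x. (norm (f m x - f0 x))\<^sup>2)"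
      using that(1) by (intro integrableI_bounded) (auto intro: le_less_trans[OF _ ennreal_less_top])
    have "(l2norm M (\<lambda>x. f m x - f0 x))\<^sup>2 \<le> e\<^sup>2"
      using that nn_integral_eq_integral[OF i] by (simp add: l2norm_sq l2inner_def power2_norm_eq_inner)
    then show ?thesis using i that(2) by (auto simp: L2_def intro: power2_le_imp_le)
  qed
  have f0L: "f0 \<in> L2 M"
  proof -
    obtain m where "(\<lambda>x. f m x - f0 x) \<in> L2 M" using main[of 1] D[of _ 1] by auto
    from L2_diff[OF L[of m] this] show ?thesis by simp
  qed
  have "l2_lim M f f0"
  proof (rule LIMSEQ_I)
    fix e :: real assume e: "e > 0"
    then obtain N where "\<forall>m\<ge>N. l2norm M (\<lambda>x. f m x - f0 x) \<le> e / 2"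
      using main[of "e/2"] D[of _ "e/2"] by auto
    then show "\<exists>N. \<forall>n\<ge>N. norm (l2norm M (\<lambda>x. f n x - f0 x) - 0) < e"
      using e by (intro exI[of _ N]) (fastforce simp: l2norm_nonneg)
  qed
  with f0L show thesis by (rule that)
qed

section \<open>Smooth functions\<close>

lemma partial_eqI: "(f has_derivative f') (at x) \<Longrightarrow> partial i f x = f' i"
  unfolding partial_def using frechet_derivative_at by metis

lemma partial_has_derivative:
  "f differentiable (at x) \<Longrightarrow> (f has_derivative (\<lambda>i. partial i f x)) (at x)"
  unfolding partial_def using frechet_derivative_works by (metis eta_contract_eq)

lemma Ck_Suc_imp: "Ck (Suc k) f \<Longrightarrow> Ck k f"
proof (induction k arbitrary: f)
  case 0
  then show ?case by (auto intro!: continuous_at_imp_continuous_on differentiable_imp_continuous_within)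
next
  case (Suc k)
  have "Ck k (partial i f)" if "i \<in> Basis" for i
    using Suc.prems that by (intro Suc.IH) auto
  with Suc.prems show ?case by auto
qed

lemma Ck_const: "Ck k (\<lambda>x::'a::euclidean_space. c)"
proof (induction k arbitrary: c)
  case (Suc k)
  have "partial i (\<lambda>x::'a. c) = (\<lambda>x. 0)" for i
    by (rule ext, rule partial_eqI) auto
  then show ?case by (simp add: Suc)
qed simp

lemma Ck_inner_left: "Ck k (\<lambda>x. x \<bullet> v)"
proof (cases k)
  case (Suc j)
  have "partial i (\<lambda>x. x \<bullet> v) = (\<lambda>x. i \<bullet> v)" for i
    by (rule ext, rule partial_eqI) (auto intro!: derivative_eq_intros)
  then show ?thesis using Suc by (simp add: Ck_const)
qed (auto intro!: continuous_intros)

lemma Ck_add: "Ck k f \<Longrightarrow> Ck k g \<Longrightarrow> Ck k (\<lambda>x. f x + g x)"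
proof (induction k arbitrary: f g)
  case (Suc k)
  then have d: "f differentiable (at x)" "g differentiable (at x)" for x by auto
  have "partial i (\<lambda>x. f x + g x) = (\<lambda>x. partial i f x + partial i g x)" for i
    by (rule ext, rule partial_eqI)
      (auto intro!: derivative_eq_intros partial_has_derivative d)
  then show ?case using Suc d by simp
qed (auto intro!: continuous_intros)

lemma partial_mult:
  assumes "f differentiable (at x)" "g differentiable (at x)"
  shows "partial i (\<lambda>x. f x * g x) x = f x * partial i g x + partial i f x * g x"
  by (rule partial_eqI) (auto intro!: derivative_eq_intros partial_has_derivative assms)

lemma Ck_mult: "Ck k f \<Longrightarrow> Ck k g \<Longrightarrow> Ck k (\<lambda>x. f x * g x)"
proof (induction k arbitrary: f g)
  case (Suc k)
  then have d: "f differentiable (at x)" "g differentiable (at x)" for x by auto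
  have "partial i (\<lambda>x. f x * g x) = (\<lambda>x. f x * partial i g x + partial i f x * g x)" for i
    by (rule ext, rule partial_mult) (auto intro!: d)
  moreover have "Ck k (\<lambda>x. f x * partial i g x + partial i f x * g x)" if "i \<in> Basis" for i
    using Suc.prems(1,2)[THEN Ck_Suc_imp] Suc.prems that by (intro Ck_add Suc.IH) simp_all
  ultimately show ?case using Suc.prems by simp
qed (auto intro!: continuous_intros)

lemma partial_real_scale:
  fixes s :: "real \<Rightarrow> real"
  assumes "s differentiable (at x)"
  shows "partial c s x = partial 1 s x * c"
proof -
  have "linear (\<lambda>i. partial i s x)" by (rule has_derivative_linear[OF partial_has_derivative[OF assms]])
  from linear_cmul[OF this, of c 1] show ?thesis by (simp add: mult.commute)
qed

lemma partial_compose: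
  fixes s :: "real \<Rightarrow> real"
  assumes "s differentiable (at (g x))" "g differentiable (at x)"
  shows "partial i (\<lambda>x. s (g x)) x = partial 1 s (g x) * partial i g x"
proof (rule partial_eqI)
  have "((\<lambda>x. s (g x)) has_derivative (\<lambda>i. partial (partial i g x) s (g x))) (at x)"
    by (rule has_derivative_compose[OF partial_has_derivative[OF assms(2)] partial_has_derivative[OF assms(1)]])
  then show "((\<lambda>x. s (g x)) has_derivative (\<lambda>i. partial 1 s (g x) * partial i g x)) (at x)"
    by (subst (asm) partial_real_scale[OF assms(1)])
qed

lemma Ck_compose:
  fixes s :: "real \<Rightarrow> real"
  shows "Ck k s \<Longrightarrow> Ck k g \<Longrightarrow> Ck k (\<lambda>x. s (g x))"
proof (induction k arbitrary: s g)
  case 0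
  then show ?case using continuous_on_compose[of UNIV g s] by (auto simp: o_def intro: continuous_on_subset)
next
  case (Suc k)
  then have d: "s differentiable (at x)" "g differentiable (at y)" for x y by auto
  have "partial i (\<lambda>x. s (g x)) = (\<lambda>x. partial 1 s (g x) * partial i g x)" for i
    by (rule ext, rule partial_compose) (auto intro!: d)
  moreover have "Ck k (\<lambda>x. partial 1 s (g x) * partial i g x)" if "i \<in> Basis" for i
    using Suc.prems(2)[THEN Ck_Suc_imp] Suc.prems that
    by (intro Ck_mult Suc.IH[of "partial 1 s" g]) simp_all
  moreover have "(\<lambda>x. s (g x)) differentiable (at x)" for x
    by (rule differentiable_compose[OF d(1) d(2)])
  ultimately show ?case by simp
qed

definition smooth :: "('a::euclidean_space \<Rightarrow> real) \<Rightarrow> bool" where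
  "smooth f \<longleftrightarrow> (\<forall>k. Ck k f)"

lemma smooth_const: "smooth (\<lambda>x. c)" by (simp add: smooth_def Ck_const)
lemma smooth_inner: "smooth (\<lambda>x. x \<bullet> v)" by (simp add: smooth_def Ck_inner_left)
lemma smooth_add: "smooth f \<Longrightarrow> smooth g \<Longrightarrow> smooth (\<lambda>x. f x + g x)" by (simp add: smooth_def Ck_add)
lemma smooth_mult: "smooth f \<Longrightarrow> smooth g \<Longrightarrow> smooth (\<lambda>x. f x * g x)" by (simp add: smooth_def Ck_mult)
lemma smooth_compose: "smooth s \<Longrightarrow> smooth g \<Longrightarrow> smooth (\<lambda>x. s (g x))" for s :: "real \<Rightarrow> real"
  by (simp add: smooth_def Ck_compose)
lemma smooth_cmult: "smooth f \<Longrightarrow> smooth (\<lambda>x. c * f x)" by (rule smooth_mult[OF smooth_const])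
lemma smooth_diff: "smooth f \<Longrightarrow> smooth g \<Longrightarrow> smooth (\<lambda>x. f x - g x)"
  using smooth_add[OF _ smooth_cmult[of g "-1"]] by simp
lemma smooth_ident: "smooth (\<lambda>x::real. x)" using smooth_inner[of "1::real"] by simp
lemma smooth_fst: "smooth (\<lambda>p::real \<times> real. fst p)" using smooth_inner[of "(1, 0) :: real \<times> real"] by (simp add: inner_prod_def)
lemma smooth_snd: "smooth (\<lambda>p::real \<times> real. snd p)" using smooth_inner[of "(0, 1) :: real \<times> real"] by (simp add: inner_prod_def)
lemma smooth_prod: "(\<And>i. i \<in> I \<Longrightarrow> smooth (f i)) \<Longrightarrow> smooth (\<lambda>x. \<Prod>i\<in>I. f i x)"
  by (induction I rule: infinite_finite_induct) (auto intro!: smooth_const smooth_mult)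

lemma smooth_differentiable: "smooth f \<Longrightarrow> f differentiable (at x)"
  unfolding smooth_def using Ck.simps(2) by blast
lemma smooth_partial: "smooth f \<Longrightarrow> i \<in> Basis \<Longrightarrow> smooth (partial i f)"
  unfolding smooth_def using Ck.simps(2) by blast
lemma smooth_continuous_on: "smooth f \<Longrightarrow> continuous_on S f"
  unfolding smooth_def using Ck.simps(1) continuous_on_subset by blast
lemma smooth_has_derivative: "smooth f \<Longrightarrow> (f has_derivative (\<lambda>i. partial i f x)) (at x)"
  by (intro partial_has_derivative smooth_differentiable)
lemma smooth_measurable: "smooth f \<Longrightarrow> f \<in> borel_measurable borel"
  by (intro borel_measurable_continuous_onI smooth_continuous_on)

text \<open>A class of differentiable functions closed under partial differentiation has derivatives
  of all orders by induction. Exhibiting such a class replaces formulas for the k-th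
  derivative.\<close>

lemma smooth_coinduct:
  assumes "P f" and step: "\<And>f. P f \<Longrightarrow> (\<forall>x. f differentiable (at x)) \<and> (\<forall>i\<in>Basis. P (partial i f))"
  shows "smooth f"
proof -
  have "P f \<Longrightarrow> Ck k f" for k f
  proof (induction k arbitrary: f)
    case 0
    then show ?case using step
      by (auto intro!: continuous_at_imp_continuous_on differentiable_imp_continuous_within)
  next
    case (Suc k) then show ?case using step by auto
  qed
  then show ?thesis using assms(1) by (simp add: smooth_def)
qed

lemma partial_real: "(f has_real_derivative d) (at x) \<Longrightarrow> partial 1 f x = d"
  using partial_eqI[of f "(*) d" x 1] by (simp add: has_field_derivative_def)

lemma smooth_has_real_derivative:
  fixes f :: "real \<Rightarrow> real"
  assumes "smooth f" shows "(f has_real_derivative partial 1 f x) (at x)"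
  using smooth_has_derivative[OF assms, of x]
  by (subst (asm) partial_real_scale[OF smooth_differentiable[OF assms]]) (simp add: has_field_derivative_def)

lemma smooth_real_coinduct:
  fixes f :: "real \<Rightarrow> real"
  assumes "P f" and step: "\<And>f. P f \<Longrightarrow> \<exists>f'. P f' \<and> (\<forall>x. (f has_real_derivative f' x) (at x))"
  shows "smooth f"
  using assms(1)
proof (rule smooth_coinduct)
  fix f assume "P f"
  then obtain f' where f': "P f'" "\<And>x. (f has_real_derivative f' x) (at x)" using step by blast
  then have "partial 1 f = f'" using partial_real by blast
  then show "(\<forall>x. f differentiable (at x)) \<and> (\<forall>i\<in>Basis. P (partial i f))"
    using f' by (auto simp: real_differentiable_def)
qed

text \<open>The invariant class consists of the smooth functions with \<open>f\<close>
  added.\<close>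

lemma smooth_antiderivative:
  fixes f :: "real \<Rightarrow> real"
  assumes "smooth f'" "\<And>x. (f has_real_derivative f' x) (at x)"
  shows "smooth f"
proof -
  show ?thesis
  proof (rule smooth_real_coinduct[where P="\<lambda>g. g = f \<or> smooth g"])
    fix g assume "g = f \<or> smooth g"
    then show "\<exists>f'. (f' = f \<or> smooth f') \<and> (\<forall>x. (g has_real_derivative f' x) (at x))"
      using assms smooth_partial[of g 1] smooth_has_real_derivative[of g] by (metis Basis_real_def insertI1)
  qed simp
qed

lemma smooth_exp: "smooth (exp :: real \<Rightarrow> real)"
  by (rule smooth_real_coinduct[where P="\<lambda>g. g = exp"]) (auto intro!: derivative_eq_intros)

lemma smooth_sin: "smooth (sin :: real \<Rightarrow> real)"
proof (rule smooth_real_coinduct[where P="\<lambda>g. g \<in> {sin, cos, \<lambda>x. - sin x, \<lambda>x. - cos x}"])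
  fix f :: "real \<Rightarrow> real" assume "f \<in> {sin, cos, \<lambda>x. - sin x, \<lambda>x. - cos x}"
  then consider "f = sin" | "f = cos" | "f = (\<lambda>x. - sin x)" | "f = (\<lambda>x. - cos x)" by blast
  then show "\<exists>f'. f' \<in> {sin, cos, \<lambda>x. - sin x, \<lambda>x. - cos x} \<and> (\<forall>x. (f has_real_derivative f' x) (at x))"
  proof cases
    case 1 then show ?thesis by (intro exI[of _ cos]) (auto intro!: derivative_eq_intros)
  next
    case 2 then show ?thesis by (intro exI[of _ "\<lambda>x. - sin x"]) (auto intro!: derivative_eq_intros)
  next
    case 3 then show ?thesis by (intro exI[of _ "\<lambda>x. - cos x"]) (auto intro!: derivative_eq_intros)
  next
    case 4 then show ?thesis by (intro exI[of _ "sin"]) (auto intro!: derivative_eq_intros)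
  qed
qed simp

section \<open>Cut-off functions built from exp(-1/t)\<close>

definition flat :: "real poly \<Rightarrow> real \<Rightarrow> real" where
  "flat p t = (if t > 0 then poly p (1 / t) * exp (- 1 / t) else 0)"

text \<open>The power y^k is kept general because the induction on \<open>p\<close> raises it by one
  at each coefficient.\<close>

lemma poly_exp_decay: "((\<lambda>y. y ^ k * poly p y * exp (- y)) \<longlongrightarrow> (0::real)) at_top"
proof (induction p arbitrary: k)
  case (pCons a p)
  have "((\<lambda>y. a * (y ^ k / exp y) + y ^ Suc k * poly p y * exp (- y)) \<longlongrightarrow> a * 0 + (0::real)) at_top"
    by (intro tendsto_intros pCons.IH tendsto_power_div_exp_0)
  then show ?case by (simp add: algebra_simps exp_minus divide_inverse)
qed simp

lemma flat_tendsto_0: "(flat p \<longlongrightarrow> 0) (at 0)"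
proof -
  have "((\<lambda>t. poly p (inverse t) * exp (- inverse t)) \<longlongrightarrow> 0) (at_right (0::real))"
    using filterlim_compose[OF poly_exp_decay[of 0 p] filterlim_inverse_at_top_right] by simp
  then have "(flat p \<longlongrightarrow> 0) (at_right 0)"
    by (rule Lim_transform_eventually)
      (auto simp: flat_def eventually_at_filter inverse_eq_divide)
  moreover have "(flat p \<longlongrightarrow> 0) (at_left 0)"
    by (rule Lim_transform_eventually[OF tendsto_const]) (auto simp: flat_def eventually_at_filter)
  ultimately show ?thesis by (simp add: filterlim_split_at_real)
qed

text \<open>The functions p(1/t) exp(-1/t), continued by 0, are invariant under differentiation:
  each derivative of 1/t contributes a factor (1/t)^2, whence the polynomial X^2 (p - p'). They are
  the invariant class for \<open>smooth_real_coinduct\<close>.\<close>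

lemma flat_has_derivative: "(flat p has_real_derivative flat ([:0, 0, 1:] * (p - pderiv p)) t) (at t)"
proof -
  consider "t > 0" | "t < 0" | "t = 0" by linarith
  then show ?thesis
  proof cases
    case 1
    have "((\<lambda>t. poly p (1 / t) * exp (- 1 / t)) has_real_derivative flat ([:0, 0, 1:] * (p - pderiv p)) t) (at t)"
      using 1 by (auto intro!: derivative_eq_intros simp: flat_def divide_simps power2_eq_square algebra_simps)
    moreover have "\<forall>\<^sub>F x in nhds t. flat p x = poly p (1 / x) * exp (- 1 / x)"
      using eventually_nhds_in_open[of "{0<..}" t] 1 by (auto simp: flat_def elim: eventually_mono)
    ultimately show ?thesis by (subst DERIV_cong_ev[OF refl _ refl])
  next
    case 2
    have "((\<lambda>t. 0) has_real_derivative flat ([:0, 0, 1:] * (p - pderiv p)) t) (at t)"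
      using 2 by (auto simp: flat_def)
    moreover have "\<forall>\<^sub>F x in nhds t. flat p x = 0"
      using eventually_nhds_in_open[of "{..<0}" t] 2 by (auto simp: flat_def elim: eventually_mono)
    ultimately show ?thesis by (subst DERIV_cong_ev[OF refl _ refl])
  next
    case 3
    \<comment> \<open>At 0 the difference quotient of \<open>flat p\<close> is
      \<open>flat (pCons 0 p)\<close>, since dividing by t is one more factor 1/t.\<close>
    have "(flat (pCons 0 p) \<longlongrightarrow> 0) (at 0)" by (rule flat_tendsto_0)
    moreover have "flat (pCons 0 p) x = (flat p x - flat p 0) / (x - 0)" if "x \<noteq> 0" for x
      using that by (simp add: flat_def field_simps)
    ultimately have "((\<lambda>x. (flat p x - flat p 0) / (x - 0)) \<longlongrightarrow> 0) (at 0)"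
      by (metis (mono_tags, lifting) Lim_cong_within)
    then show ?thesis using 3 by (simp add: has_field_derivative_iff flat_def)
  qed
qed

lemma smooth_flat: "smooth (flat p)"
  by (rule smooth_real_coinduct[where P="\<lambda>g. \<exists>p. g = flat p"]) (use flat_has_derivative in blast)+

definition flat1 :: "real \<Rightarrow> real" where "flat1 = flat 1"

lemma flat1_eq: "flat1 t = (if t > 0 then exp (- 1 / t) else 0)"
  by (simp add: flat1_def flat_def)

lemma smooth_flat1: "smooth flat1" by (simp add: flat1_def smooth_flat)

lemma flat1_bounds: "0 \<le> flat1 t" "flat1 t \<le> 1" "flat1 t \<noteq> 0 \<longleftrightarrow> t > 0"
  by (auto simp: flat1_eq)

lemma flat1_scaled_tendsto: "(\<lambda>n. flat1 (real (Suc n) * t)) \<longlonglongrightarrow> (if t > 0 then 1 else 0)"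
proof (cases "t > 0")
  case True
  have "(\<lambda>n. exp (- (inverse (real (Suc n)) / t))) \<longlonglongrightarrow> exp (- (0 / t))"
    by (intro tendsto_intros LIMSEQ_inverse_real_of_nat) (use True in simp)
  then show ?thesis using True by (simp add: flat1_eq inverse_eq_divide mult.commute)
next
  case False
  then show ?thesis by (simp add: flat1_eq zero_less_mult_iff)
qed

text \<open>The bumps vanish exactly off the open box and tend to its indicator as n grows. So they
  are test functions, and integrals against them recover integrals over boxes.\<close>

definition box_bump :: "'a::euclidean_space \<Rightarrow> 'a \<Rightarrow> nat \<Rightarrow> 'a \<Rightarrow> real" where
  "box_bump a b n x = (\<Prod>i\<in>Basis. flat1 (real (Suc n) * (x \<bullet> i - a \<bullet> i)) * flat1 (real (Suc n) * (b \<bullet> i - x \<bullet> i)))"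

lemma smooth_box_bump: "smooth (box_bump a b n)"
  unfolding box_bump_def[abs_def]
  by (intro smooth_prod smooth_mult smooth_compose[OF smooth_flat1] smooth_cmult smooth_diff smooth_inner smooth_const)

lemma box_bump_bounds: "0 \<le> box_bump a b n x" "box_bump a b n x \<le> 1"
  unfolding box_bump_def by (auto intro!: prod_nonneg prod_le_1 mult_le_one simp: flat1_bounds)

lemma box_bump_nonzero: "box_bump a b n x \<noteq> 0 \<longleftrightarrow> x \<in> box a b"
  unfolding box_bump_def by (auto simp: flat1_bounds mem_box zero_less_mult_iff)

lemma box_bump_tendsto: "(\<lambda>n. box_bump a b n x) \<longlonglongrightarrow> indicator (box a b) x"
proof -
  have "(\<lambda>n. box_bump a b n x) \<longlonglongrightarrow> (\<Prod>i\<in>Basis. (if x \<bullet> i - a \<bullet> i > 0 then 1 else 0) * (if b \<bullet> i - x \<bullet> i > 0 then 1 else 0))"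
    unfolding box_bump_def by (intro tendsto_prod tendsto_mult flat1_scaled_tendsto)
  moreover have "(\<Prod>i\<in>Basis. (if x \<bullet> i - a \<bullet> i > 0 then 1 else 0) * (if b \<bullet> i - x \<bullet> i > 0 then 1 else 0)) = (indicator (box a b) x :: real)"
    by (auto simp: indicator_def mem_box intro!: prod.neutral prod_zero)
  ultimately show ?thesis by simp
qed

section \<open>The representation theorem\<close>

lemma LIMSEQ_null_squeeze: "g \<longlonglongrightarrow> 0 \<Longrightarrow> (\<And>n. \<bar>f n\<bar> \<le> g n) \<Longrightarrow> f \<longlonglongrightarrow> (0::real)"
  by (rule Lim_null_comparison[of f g, OF always_eventually]) auto

text \<open>Riesz representation for a symmetric, bounded, coercive form, by minimising the energy B
  u u - 2 l u. It is formulated for vector-valued functions in an L^2-closed set, so that pairs of a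
  function and its weak gradient can later serve as the space.\<close>

lemma closed_subspace_representation:
  fixes V :: "('a \<Rightarrow> 'b::euclidean_space) set" and B :: "('a \<Rightarrow> 'b) \<Rightarrow> ('a \<Rightarrow> 'b) \<Rightarrow> real"
  assumes M: "finite_measure M" and V: "V \<subseteq> L2 M" "(\<lambda>x. 0) \<in> V"
    and lin: "\<And>f g c. f \<in> V \<Longrightarrow> g \<in> V \<Longrightarrow> (\<lambda>x. f x + c *\<^sub>R g x) \<in> V"
    and closed: "\<And>f f0. (\<And>n::nat. f n \<in> V) \<Longrightarrow> f0 \<in> L2 M \<Longrightarrow>
      l2_lim M f f0 \<Longrightarrow> f0 \<in> V"
    and Blin: "\<And>f g k c. f \<in> V \<Longrightarrow> g \<in> V \<Longrightarrow> k \<in> V \<Longrightarrow> B (\<lambda>x. f x + c *\<^sub>R g x) k = B f k + c * B g k"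
    and Bsym: "\<And>f g. f \<in> V \<Longrightarrow> g \<in> V \<Longrightarrow> B f g = B g f"
    and coer: "\<kappa> > 0" "\<And>f. f \<in> V \<Longrightarrow> \<kappa> * (l2norm M f)\<^sup>2 \<le> B f f"
    and Bbd: "\<And>f g. f \<in> V \<Longrightarrow> g \<in> V \<Longrightarrow> \<bar>B f g\<bar> \<le> C * l2norm M f * l2norm M g"
    and llin: "\<And>f g c. f \<in> V \<Longrightarrow> g \<in> V \<Longrightarrow> l (\<lambda>x. f x + c *\<^sub>R g x) = l f + c * l g"
    and lbd: "\<And>f. f \<in> V \<Longrightarrow> \<bar>l f\<bar> \<le> K * l2norm M f"
  shows "\<exists>u\<in>V. \<forall>w\<in>V. B u w = l w"
proof -
  define J where "J = (\<lambda>u. B u u - 2 * l u)"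
  have Jexp: "J (\<lambda>x. f x + t *\<^sub>R g x) = J f + 2 * t * (B f g - l g) + t\<^sup>2 * B g g"
    if "f \<in> V" "g \<in> V" for f g t
  proof -
    have fg: "(\<lambda>x. f x + t *\<^sub>R g x) \<in> V" by (rule lin[OF that])
    have "B (\<lambda>x. f x + t *\<^sub>R g x) (\<lambda>x. f x + t *\<^sub>R g x) =
        B f (\<lambda>x. f x + t *\<^sub>R g x) + t * B g (\<lambda>x. f x + t *\<^sub>R g x)"
      by (rule Blin[OF that fg])
    moreover have "B f (\<lambda>x. f x + t *\<^sub>R g x) = B f f + t * B g f"
      using Bsym[OF that(1) fg] Blin[OF that that(1), of t] by simp
    moreover have "B g (\<lambda>x. f x + t *\<^sub>R g x) = B f g + t * B g g"
      using Bsym[OF that(2) fg] Blin[OF that that(2), of t] by simp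
    ultimately show ?thesis
      using Bsym[OF that] llin[OF that, of t] by (simp add: J_def power2_eq_square algebra_simps)
  qed
  have low: "- (K\<^sup>2 / \<kappa>) \<le> J f" if "f \<in> V" for f
  proof -
    have "0 \<le> (\<kappa> * l2norm M f - K)\<^sup>2" by simp
    then have "0 \<le> (\<kappa> * l2norm M f - K)\<^sup>2 / \<kappa>" using coer(1) by simp
    also have "\<dots> = \<kappa> * (l2norm M f)\<^sup>2 - 2 * (K * l2norm M f) + K\<^sup>2 / \<kappa>"
      using coer(1) by (simp add: power2_eq_square field_simps)
    also have "\<dots> \<le> J f + K\<^sup>2 / \<kappa>"
      using coer(2)[OF that] lbd[OF that] by (simp add: J_def)
    finally show ?thesis by simp
  qed
  define I where "I = Inf (J ` V)"
  have bb: "bdd_below (J ` V)" using low by (intro bdd_belowI2)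
  have I: "I \<le> J f" if "f \<in> V" for f
    unfolding I_def by (intro cINF_lower[OF bb that])
  have "\<exists>u\<in>V. J u < I + 1 / real (Suc n)" for n
  proof -
    have "Inf (J ` V) < I + 1 / real (Suc n)" by (simp add: I_def)
    then show ?thesis using cInf_lessD[of "J ` V"] V(2) by blast
  qed
  then obtain u where u: "\<And>n. u n \<in> V" "\<And>n. J (u n) < I + 1 / real (Suc n)" by metis
  \<comment> \<open>Parallelogram identity: half of \<open>B D D\<close> is the energy of
    \<open>u m\<close> plus that of \<open>u n\<close> minus twice that of their midpoint, and the
    midpoint has energy at least \<open>I\<close>. Hence a minimising sequence is Cauchy.\<close>
  have par: "\<kappa> * (l2norm M (\<lambda>x. u m x - u n x))\<^sup>2 \<le> 2 / real (Suc m) + 2 / real (Suc n)" for m n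
  proof -
    define D where "D = (\<lambda>x. u m x + (-1) *\<^sub>R u n x)"
    have D: "D \<in> V" unfolding D_def by (rule lin[OF u(1) u(1)])
    have 1: "J (\<lambda>x. u n x + 1 *\<^sub>R D x) = J (u n) + 2 * (B (u n) D - l D) + B D D"
      using Jexp[OF u(1) D, of n 1] by simp
    have 2: "J (\<lambda>x. u n x + (1/2) *\<^sub>R D x) = J (u n) + (B (u n) D - l D) + B D D / 4"
      using Jexp[OF u(1) D, of n "1/2"] by (simp add: power2_eq_square)
    have 3: "(\<lambda>x. u n x + 1 *\<^sub>R D x) = u m" by (simp add: D_def)
    have "I \<le> J (\<lambda>x. u n x + (1/2) *\<^sub>R D x)" by (intro I lin u D)
    then have "B D D \<le> 2 / real (Suc m) + 2 / real (Suc n)"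
      using 1 2 u(2)[of m] u(2)[of n] unfolding 3 by simp
    moreover have "D = (\<lambda>x. u m x - u n x)" by (simp add: D_def)
    ultimately show ?thesis using coer(2)[OF D] by simp
  qed
  obtain u0 where u0: "u0 \<in> L2 M" "l2_lim M u u0"
  proof (rule finite_measure.L2_complete[OF M, of u])
    show "u n \<in> L2 M" for n using u(1) V(1) by auto
    fix e :: real assume e: "e > 0"
    obtain N where N: "4 / (\<kappa> * e\<^sup>2) < real N" using reals_Archimedean2 by blast
    have "l2norm M (\<lambda>x. u m x - u n x) < e" if "m \<ge> N" "n \<ge> N" for m n
    proof -
      have "0 < 4 / (\<kappa> * e\<^sup>2)" using e coer(1) by simp
      then have "N > 0" using N by (metis less_trans of_nat_0_less_iff)
      then have "2 / real (Suc m) + 2 / real (Suc n) \<le> 2 / real N + 2 / real N"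
        using that by (intro add_mono divide_left_mono) auto
      also have "\<dots> < \<kappa> * e\<^sup>2" using N e coer(1) \<open>N > 0\<close> by (simp add: field_simps)
      finally have "\<kappa> * (l2norm M (\<lambda>x. u m x - u n x))\<^sup>2 < \<kappa> * e\<^sup>2" using par[of m n] by linarith
      then show ?thesis using coer(1) e by (simp add: power_less_imp_less_base)
    qed
    then show "\<exists>N. \<forall>m\<ge>N. \<forall>n\<ge>N. l2norm M (\<lambda>x. u m x - u n x) < e" by blast
  qed
  have u0V: "u0 \<in> V" by (rule closed[OF u(1) u0])
  have "(\<lambda>n. J (u n)) \<longlonglongrightarrow> J u0"
  proof -
    define D where "D = (\<lambda>n x. u n x + (-1) *\<^sub>R u0 x)"
    have D: "D n \<in> V" for n unfolding D_def by (intro lin u u0V)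
    have Dn: "(\<lambda>n. l2norm M (D n)) \<longlonglongrightarrow> 0" using u0(2) by (simp add: D_def)
    have Ju: "J (u n) - J u0 = 2 * (B u0 (D n) - l (D n)) + B (D n) (D n)" for n
      using Jexp[OF u0V D, of 1 n] by (simp add: D_def)
    have le: "\<bar>J (u n) - J u0\<bar> \<le> 2 * (C * l2norm M u0 * l2norm M (D n) + K * l2norm M (D n))
        + C * l2norm M (D n) * l2norm M (D n)" for n
          proof -
      have "\<bar>2 * (x - y) + z\<bar> \<le> 2 * (x' + y') + z'" if "\<bar>x\<bar> \<le> x'" "\<bar>y\<bar> \<le> y'" "\<bar>z\<bar> \<le> z'" for x y z x' y' z' :: real
        using that by (auto simp: abs_le_iff)
      then show ?thesis unfolding Ju using Bbd[OF u0V D] lbd[OF D] Bbd[OF D D] by blast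
    qed
    have "(\<lambda>n. 2 * (C * l2norm M u0 * l2norm M (D n) + K * l2norm M (D n))
        + C * l2norm M (D n) * l2norm M (D n)) \<longlonglongrightarrow> 2 * (C * l2norm M u0 * 0 + K * 0) + C * 0 * 0"
      by (intro tendsto_intros Dn)
    then have "(\<lambda>n. 2 * (C * l2norm M u0 * l2norm M (D n) + K * l2norm M (D n))
        + C * l2norm M (D n) * l2norm M (D n)) \<longlonglongrightarrow> 0" by simp
    then have "(\<lambda>n. J (u n) - J u0) \<longlonglongrightarrow> 0" by (rule LIMSEQ_null_squeeze) (rule le)
    then show ?thesis by (rule LIM_zero_cancel)
  qed
  moreover have "(\<lambda>n. I + 1 / real (Suc n)) \<longlonglongrightarrow> I + 0"
    using LIMSEQ_inverse_real_of_nat by (intro tendsto_intros) (simp add: inverse_eq_divide)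
  ultimately have Ju0: "J u0 \<le> I"
    using u(2) by (intro LIMSEQ_le[of "\<lambda>n. J (u n)" _ "\<lambda>n. I + 1 / real (Suc n)"]) (auto intro: less_imp_le)
  show ?thesis
  proof (intro bexI[OF _ u0V] ballI)
    fix w assume w: "w \<in> V"
    \<comment> \<open>Minimality along the line through \<open>u0\<close> in direction
      \<open>w\<close> gives a nonnegative quadratic without constant term, so its linear
      coefficient vanishes.\<close>
    have "\<bar>B u0 w - l w\<bar> \<le> sqrt 0 * sqrt (B w w)"
    proof (rule quadratic_nonneg_discr)
      show "0 \<le> 0 + 2 * t * (B u0 w - l w) + t\<^sup>2 * B w w" for t
        using Jexp[OF u0V w, of t] I[OF lin[OF u0V w, of t]] Ju0 by simp
      have "0 \<le> \<kappa> * (l2norm M w)\<^sup>2" using coer(1) by simp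
      then show "0 \<le> B w w" using coer(2)[OF w] by linarith
    qed simp
    then show "B u0 w = l w" by simp
  qed
qed

text \<open>The representation result with the inner product as form and the pairing with
  \<open>f\<close> as functional.\<close>

lemma L2_orthogonal_projection:
  fixes V :: "('a \<Rightarrow> 'b::euclidean_space) set"
  assumes M: "finite_measure M" and V: "V \<subseteq> L2 M" "(\<lambda>x. 0) \<in> V"
    and lin: "\<And>f g c. f \<in> V \<Longrightarrow> g \<in> V \<Longrightarrow> (\<lambda>x. f x + c *\<^sub>R g x) \<in> V"
    and closed: "\<And>f f0. (\<And>n::nat. f n \<in> V) \<Longrightarrow> f0 \<in> L2 M \<Longrightarrow>
      l2_lim M f f0 \<Longrightarrow> f0 \<in> V"
    and f: "f \<in> L2 M"
  shows "\<exists>u\<in>V. \<forall>w\<in>V. l2inner M (\<lambda>x. f x - u x) w = 0"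
proof -
  have V': "g \<in> L2 M" if "g \<in> V" for g using that V by auto
  have "\<exists>u\<in>V. \<forall>w\<in>V. l2inner M u w = l2inner M f w"
  proof (rule closed_subspace_representation[where \<kappa> = 1 and C = 1 and K = "l2norm M f", OF M V lin closed])
    show "l2inner M (\<lambda>x. g x + c *\<^sub>R k x) w = l2inner M g w + c * l2inner M k w"
      if "g \<in> V" "k \<in> V" "w \<in> V" for g k w c
      using that by (simp add: l2inner_add_left l2inner_scaleR_left L2_scaleR V')
    show "l2inner M f (\<lambda>x. g x + c *\<^sub>R k x) = l2inner M f g + c * l2inner M f k"
      if "g \<in> V" "k \<in> V" for g k c
      using that by (simp add: l2inner_add_right l2inner_scaleR_right L2_scaleR V' f)
    show "\<bar>l2inner M g k\<bar> \<le> 1 * l2norm M g * l2norm M k" if "g \<in> V" "k \<in> V" for g k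
      using l2inner_Cauchy_Schwarz[OF V' V'] that by simp
    show "\<bar>l2inner M f g\<bar> \<le> l2norm M f * l2norm M g" if "g \<in> V" for g
      using l2inner_Cauchy_Schwarz[OF f V'] that by simp
  qed (simp_all add: l2norm_sq l2inner_commute)
  then show ?thesis by (simp add: l2inner_diff_left V' f)  (metis)
qed

section \<open>Test functions and $H^1_0$\<close>

lemma space_leb [simp]: "space (leb S) = S"
  by (simp add: leb_def space_restrict_space)

lemma borel_measurable_leb: "f \<in> borel_measurable borel \<Longrightarrow> f \<in> borel_measurable (leb S)"
  unfolding leb_def by (intro measurable_restrict_space1) simp

lemma smooth_measurable_leb: "smooth f \<Longrightarrow> f \<in> borel_measurable (leb S)"
  by (intro borel_measurable_leb smooth_measurable)

lemma leb_measurable_iff: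
  fixes f :: "'a::euclidean_space \<Rightarrow> 'b::real_normed_vector"
  shows "S \<in> sets borel \<Longrightarrow> f \<in> borel_measurable (leb S) \<longleftrightarrow> (\<lambda>x. indicator S x *\<^sub>R f x) \<in> borel_measurable borel"
  unfolding leb_def by (subst borel_measurable_restrict_space_iff) auto

lemma integral_leb:
  fixes f :: "'a::euclidean_space \<Rightarrow> 'b::{banach, second_countable_topology}"
  shows "S \<in> sets borel \<Longrightarrow> (\<integral>x. f x \<partial>leb S) = (\<integral>x. indicator S x *\<^sub>R f x \<partial>lborel)"
  unfolding leb_def by (subst integral_restrict_space) auto

lemma integrable_leb:
  fixes f :: "'a::euclidean_space \<Rightarrow> 'b::{banach, second_countable_topology}"
  shows "S \<in> sets borel \<Longrightarrow> integrable (leb S) f \<longleftrightarrow> integrable lborel (\<lambda>x. indicator S x *\<^sub>R f x)"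
  unfolding leb_def by (subst integrable_restrict_space) auto

lemma AE_leb_iff: "S \<in> sets borel \<Longrightarrow> (AE x in leb S. P x) \<longleftrightarrow> (AE x in lborel. x \<in> S \<longrightarrow> P x)"
  unfolding leb_def by (subst AE_restrict_space_iff) auto

lemma finite_measure_leb:
  assumes "S \<in> sets borel" "bounded S" shows "finite_measure (leb S)"
proof
  have "emeasure lborel S < \<infinity>" by (rule emeasure_bounded_finite[OF assms(2)])
  then show "emeasure (leb S) (space (leb S)) \<noteq> \<infinity>"
    unfolding leb_def using assms by (simp add: emeasure_restrict_space space_restrict_space)
qed

lemma test_functionsD:
  assumes "\<phi> \<in> test_functions S"
  shows "smooth \<phi>" "\<exists>K. compact K \<and> K \<subseteq> interior S \<and> (\<forall>x. x \<notin> K \<longrightarrow> \<phi> x = 0)"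
  using assms by (auto simp: test_functions_def smooth_def)

lemma test_functionsI:
  "smooth \<phi> \<Longrightarrow> compact K \<Longrightarrow> K \<subseteq> interior S \<Longrightarrow> (\<And>x. x \<notin> K \<Longrightarrow> \<phi> x = 0) \<Longrightarrow> \<phi> \<in> test_functions S"
  by (auto simp: test_functions_def smooth_def)

lemma test_functions_zero: "\<phi> \<in> test_functions S \<Longrightarrow> x \<notin> interior S \<Longrightarrow> \<phi> x = 0"
  using test_functionsD(2) by blast

lemma test_functions_zero': "\<phi> \<in> test_functions S \<Longrightarrow> x \<notin> S \<Longrightarrow> \<phi> x = 0"
  using test_functions_zero interior_subset by blast

lemma test_bounded:
  fixes \<phi> :: "'a::euclidean_space \<Rightarrow> real"
  assumes "\<phi> \<in> test_functions A" obtains B where "\<And>p. \<bar>\<phi> p\<bar> \<le> B"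
proof -
  obtain K where K: "compact K" "\<forall>x. x \<notin> K \<longrightarrow> \<phi> x = 0" using test_functionsD(2)[OF assms] by blast
  have "bounded (\<phi> ` K)"
    by (rule compact_imp_bounded[OF compact_continuous_image[OF smooth_continuous_on[OF test_functionsD(1)[OF assms]] K(1)]])
  then obtain b where b: "b > 0" "\<forall>x\<in>K. \<bar>\<phi> x\<bar> \<le> b" by (auto simp: bounded_pos)
  have "\<bar>\<phi> p\<bar> \<le> b" for p using b K(2)[rule_format, of p] by (cases "p \<in> K") simp_all
  then show thesis by (rule that)
qed

lemma partial_zero_outside:
  assumes "closed K" "\<And>x. x \<notin> K \<Longrightarrow> \<phi> x = 0" "x \<notin> K"
  shows "partial i \<phi> x = 0"
proof -
  have "(\<phi> has_derivative (\<lambda>_. 0)) (at x)"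
    by (rule has_derivative_transform_within_open[of "\<lambda>_. 0" _ x UNIV "- K"]) (use assms in auto)
  then show ?thesis by (rule partial_eqI)
qed

lemma test_functions_partial:
  assumes "\<phi> \<in> test_functions S" "i \<in> Basis" shows "partial i \<phi> \<in> test_functions S"
proof -
  obtain K where K: "compact K" "K \<subseteq> interior S" "\<forall>x. x \<notin> K \<longrightarrow> \<phi> x = 0"
    using test_functionsD(2)[OF assms(1)] by blast
  show ?thesis
    by (rule test_functionsI[OF smooth_partial[OF test_functionsD(1)[OF assms(1)] assms(2)] K(1,2)])
      (rule partial_zero_outside[OF compact_imp_closed[OF K(1)]], use K(3) in auto)
qed

lemma test_functions_mult:
  assumes "\<phi> \<in> test_functions S" "smooth f" shows "(\<lambda>x. \<phi> x * f x) \<in> test_functions S"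
proof -
  obtain K where K: "compact K" "K \<subseteq> interior S" "\<forall>x. x \<notin> K \<longrightarrow> \<phi> x = 0"
    using test_functionsD(2)[OF assms(1)] by blast
  show ?thesis
    by (rule test_functionsI[OF smooth_mult[OF test_functionsD(1)[OF assms(1)] assms(2)] K(1,2)]) (use K in auto)
qed

lemma test_functions_lincomb:
  assumes "\<phi> \<in> test_functions S" "\<psi> \<in> test_functions S" shows "(\<lambda>x. \<phi> x + c * \<psi> x) \<in> test_functions S"
proof -
  obtain K where K: "compact K" "K \<subseteq> interior S" "\<forall>x. x \<notin> K \<longrightarrow> \<phi> x = 0"
    using test_functionsD(2)[OF assms(1)] by blast
  obtain L where L: "compact L" "L \<subseteq> interior S" "\<forall>x. x \<notin> L \<longrightarrow> \<psi> x = 0"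
    using test_functionsD(2)[OF assms(2)] by blast
  show ?thesis
  proof (rule test_functionsI[of _ "K \<union> L"])
    show "smooth (\<lambda>x. \<phi> x + c * \<psi> x)"
      using assms by (intro smooth_add smooth_cmult test_functionsD(1))
  qed (use K L in auto)
qed

lemma test_functions_0: "(\<lambda>x. 0) \<in> test_functions S"
  by (rule test_functionsI[of _ "{}"]) (auto intro: smooth_const)

lemma test_functions_integrable:
  assumes "\<phi> \<in> test_functions S" shows "integrable lborel \<phi>"
proof -
  obtain K where K: "compact K" "\<forall>x. x \<notin> K \<longrightarrow> \<phi> x = 0"
    using test_functionsD(2)[OF assms(1)] by blast
  have "integrable lborel (\<lambda>x. indicator K x *\<^sub>R \<phi> x)"
    by (rule borel_integrable_compact[OF K(1) smooth_continuous_on[OF test_functionsD(1)[OF assms]]])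
  moreover have "(\<lambda>x. indicator K x *\<^sub>R \<phi> x) = \<phi>" using K(2) by (auto simp: fun_eq_iff indicator_def)
  ultimately show ?thesis by simp
qed

lemma test_functions_L2:
  assumes "S \<in> sets borel" "\<phi> \<in> test_functions S" shows "\<phi> \<in> L2 (leb S)"
proof -
  have "integrable lborel (\<lambda>x. \<phi> x * \<phi> x)"
    by (rule test_functions_integrable[OF test_functions_mult[OF assms(2) test_functionsD(1)[OF assms(2)]]])
  moreover have "(\<lambda>x. indicator S x *\<^sub>R (norm (\<phi> x))\<^sup>2) = (\<lambda>x. \<phi> x * \<phi> x)"
    using test_functions_zero'[OF assms(2)] by (auto simp: fun_eq_iff indicator_def power2_eq_square)
  ultimately show ?thesis
    using assms by (auto simp: L2_def integrable_leb intro!: smooth_measurable_leb test_functionsD(1)[OF assms(2)])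
qed

lemma test_functions_integral_leb:
  assumes "S \<in> sets borel" "\<phi> \<in> test_functions S" shows "(\<integral>x. \<phi> x * f x \<partial>leb S) = (\<integral>x. \<phi> x * f x \<partial>lborel)"
  unfolding integral_leb[OF assms(1)]
  by (rule Bochner_Integration.integral_cong) (auto simp: indicator_def test_functions_zero'[OF assms(2)])

lemma gradient_inner: "i \<in> Basis \<Longrightarrow> gradient f x \<bullet> i = partial i f x"
  unfolding gradient_def by simp

lemma test_functions_gradient_zero: "\<phi> \<in> test_functions S \<Longrightarrow> x \<notin> interior S \<Longrightarrow> gradient \<phi> x = 0"
  unfolding gradient_def by (intro sum.neutral ballI) (simp add: test_functions_zero[OF test_functions_partial])

lemma L2_sum:
  fixes f :: "'i \<Rightarrow> 'a \<Rightarrow> 'b::euclidean_space"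
  shows "(\<And>i. i \<in> I \<Longrightarrow> f i \<in> L2 M) \<Longrightarrow> (\<lambda>x. \<Sum>i\<in>I. f i x) \<in> L2 M"
  by (induction I rule: infinite_finite_induct) (auto intro: L2_zero L2_add)

lemma L2_scaleR_vec:
  fixes f :: "'a \<Rightarrow> real" and v :: "'b::euclidean_space"
  assumes "f \<in> L2 M" shows "(\<lambda>x. f x *\<^sub>R v) \<in> L2 M"
proof (rule L2_dominated)
  show "integrable M (\<lambda>x. (norm v)\<^sup>2 * (norm (f x))\<^sup>2)"
    using L2_integrable_sq[OF assms] by simp
qed (use L2_measurable[OF assms] in \<open>auto simp: power_mult_distrib\<close>)

lemma test_functions_gradient_L2:
  assumes "S \<in> sets borel" "\<phi> \<in> test_functions S" shows "gradient \<phi> \<in> L2 (leb S)"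
  unfolding gradient_def[abs_def]
  by (intro L2_sum L2_scaleR_vec test_functions_L2 test_functions_partial assms)

lemma L2_inner_const:
  fixes g :: "'a \<Rightarrow> 'b::euclidean_space"
  assumes "g \<in> L2 M" shows "(\<lambda>x. g x \<bullet> v) \<in> L2 M"
proof (rule L2_dominated)
  show "integrable M (\<lambda>x. (norm v)\<^sup>2 * (norm (g x))\<^sup>2)"
    using L2_integrable_sq[OF assms] by simp
  show "(norm (g x \<bullet> v))\<^sup>2 \<le> (norm v)\<^sup>2 * (norm (g x))\<^sup>2" for x
    using power_mono[OF Cauchy_Schwarz_ineq2[of "g x" v], of 2] by (simp add: power_mult_distrib mult.commute)
qed (use L2_measurable[OF assms] in auto)

lemma smooth_line_derivative:
  assumes "smooth \<phi>"
  shows "((\<lambda>t. \<phi> (x + t *\<^sub>R i)) has_real_derivative partial i \<phi> (x + t *\<^sub>R i)) (at t)"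
proof -
  have 1: "((\<lambda>t. x + t *\<^sub>R i) has_derivative (\<lambda>s. s *\<^sub>R i)) (at t)"
    by (auto intro!: derivative_eq_intros)
  have "((\<lambda>t. \<phi> (x + t *\<^sub>R i)) has_derivative (\<lambda>s. partial (s *\<^sub>R i) \<phi> (x + t *\<^sub>R i))) (at t)"
    by (rule has_derivative_compose[OF 1 smooth_has_derivative[OF assms]])
  moreover have "partial (s *\<^sub>R i) \<phi> y = partial i \<phi> y * s" for s :: real and y
    using linear_cmul[OF has_derivative_linear[OF smooth_has_derivative[OF assms, of y]], of s i] by simp
  ultimately show ?thesis by (simp add: has_field_derivative_def)
qed

text \<open>Translation invariance: the difference quotients have integral 0, and they converge
  boundedly to the partial derivative while living on a common ball. The argument is the same in
  every dimension.\<close>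

lemma integral_partial_test_function:
  assumes "\<phi> \<in> test_functions S" "i \<in> Basis"
  shows "(\<integral>x. partial i \<phi> x \<partial>lborel) = 0"
proof -
  note sm = test_functionsD(1)[OF assms(1)]
  obtain K where K: "compact K" "\<forall>x. x \<notin> K \<longrightarrow> \<phi> x = 0"
    using test_functionsD(2)[OF assms(1)] by blast
  obtain R where R: "K \<subseteq> cball 0 R"
    using bounded_subset_ballD[OF compact_imp_bounded[OF K(1)], of 0] ball_subset_cball by (metis subset_trans)
  have pz: "partial i \<phi> x = 0" if "x \<notin> K" for x
    using partial_zero_outside[of K \<phi>] K that compact_imp_closed by blast
  have cont: "continuous_on UNIV (partial i \<phi>)" by (rule smooth_continuous_on[OF smooth_partial[OF sm assms(2)]])
  obtain B where B: "\<And>x. \<bar>partial i \<phi> x\<bar> \<le> B" "B \<ge> 0"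
  proof -
    have "bounded (partial i \<phi> ` K)"
      by (rule compact_imp_bounded[OF compact_continuous_image[OF continuous_on_subset[OF cont] K(1)]]) simp
    then obtain b where b: "b > 0" "\<forall>x\<in>K. \<bar>partial i \<phi> x\<bar> \<le> b" by (auto simp: bounded_pos)
    show thesis by (rule that[of b]) (use b pz in \<open>metis abs_zero less_imp_le\<close>, use b in simp)
  qed
  define t where "t n = 1 / real (Suc n)" for n
  have t: "0 < t n" "t n \<le> 1" for n by (auto simp: t_def)
  have t0: "t \<longlonglongrightarrow> 0" using LIMSEQ_inverse_real_of_nat by (simp add: t_def[abs_def] inverse_eq_divide)
  define q where "q n x = (\<phi> (x + t n *\<^sub>R i) - \<phi> x) / t n" for n x
  have int0: "integrable lborel \<phi>" by (rule test_functions_integrable[OF assms(1)])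
  have m: "\<phi> \<in> borel_measurable borel" by (rule smooth_measurable[OF sm])
  have tr: "integrable lborel (\<lambda>x. \<phi> (x + c))" "(\<integral>x. \<phi> (x + c) \<partial>lborel) = (\<integral>x. \<phi> x \<partial>lborel)" for c
  proof -
    have "integrable (distr lborel borel ((+) c)) \<phi>" using int0 by (simp add: lborel_distr_plus)
    then show "integrable lborel (\<lambda>x. \<phi> (x + c))"
      by (subst (asm) integrable_distr_eq) (auto simp: m add.commute)
    have "(\<integral>x. \<phi> x \<partial>distr lborel borel ((+) c)) = (\<integral>x. \<phi> (c + x) \<partial>lborel)"
      by (rule integral_distr) (auto simp: m)
    then show "(\<integral>x. \<phi> (x + c) \<partial>lborel) = (\<integral>x. \<phi> x \<partial>lborel)"
      by (simp add: lborel_distr_plus add.commute)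
  qed
  have q0: "(\<integral>x. q n x \<partial>lborel) = 0" for n
    unfolding q_def using tr[of "t n *\<^sub>R i"] int0 by simp
  have lim: "(\<lambda>n. q n x) \<longlonglongrightarrow> partial i \<phi> x" for x
  proof -
    have "((\<lambda>h. (\<phi> (x + (0 + h) *\<^sub>R i) - \<phi> (x + 0 *\<^sub>R i)) / h) \<longlongrightarrow> partial i \<phi> (x + 0 *\<^sub>R i)) (at 0)"
      using smooth_line_derivative[OF sm, of x i 0] unfolding DERIV_def .
    moreover have "filterlim t (at 0) sequentially"
      using t0 t(1)[THEN less_imp_neq] by (simp add: filterlim_at)
    ultimately show ?thesis unfolding q_def
      using filterlim_compose[of _ _ "at 0" t sequentially] by force
  qed
  \<comment> \<open>The steps \<open>t n\<close> are at most 1, so all quotients vanish outside the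
    ball enlarged by 1; inside it the mean value theorem applies.\<close>
  have bd: "\<bar>q n x\<bar> \<le> B * indicator (cball 0 (R + 1)) x" for n x
  proof (cases "x \<in> cball 0 (R + 1)")
    case True
    obtain z where "\<phi> (x + t n *\<^sub>R i) - \<phi> (x + 0 *\<^sub>R i) = (t n - 0) * partial i \<phi> (x + z *\<^sub>R i)"
      using MVT2[of 0 "t n" "\<lambda>t. \<phi> (x + t *\<^sub>R i)" "\<lambda>s. partial i \<phi> (x + s *\<^sub>R i)"] smooth_line_derivative[OF sm] t[of n]
      by metis
    then have "q n x = partial i \<phi> (x + z *\<^sub>R i)" using t[of n] by (simp add: q_def)
    then show ?thesis using B True by simp
  next
    case False
    then have "x \<notin> K" using R by auto
    moreover have "x + t n *\<^sub>R i \<notin> K"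
    proof
      assume "x + t n *\<^sub>R i \<in> K"
      then have "norm (x + t n *\<^sub>R i) \<le> R" using R by auto
      moreover have "norm x \<le> norm (x + t n *\<^sub>R i) + norm (t n *\<^sub>R i)"
        using norm_triangle_ineq4[of "x + t n *\<^sub>R i" "t n *\<^sub>R i"] by simp
      moreover have "norm (t n *\<^sub>R i) \<le> 1" using t[of n] assms(2) by simp
      ultimately show False using False by simp
    qed
    ultimately show ?thesis using K(2) B(2) by (simp add: q_def indicator_def)
  qed
  have "(\<lambda>n. \<integral>x. q n x \<partial>lborel) \<longlonglongrightarrow> (\<integral>x. partial i \<phi> x \<partial>lborel)"
  proof (rule integral_dominated_convergence[where w="\<lambda>x. B * indicator (cball 0 (R + 1)) x"])
    show "partial i \<phi> \<in> borel_measurable lborel" using smooth_measurable[OF smooth_partial[OF sm assms(2)]] by simp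
    show "q n \<in> borel_measurable lborel" for n unfolding q_def using m by measurable
    have "integrable lborel (indicator (cball 0 (R + 1)) :: 'a \<Rightarrow> real)"
      using emeasure_bounded_finite[of "cball (0::'a) (R + 1)"] by (auto intro!: integrable_real_indicator)
    then show "integrable lborel (\<lambda>x::'a. B * indicator (cball 0 (R + 1)) x)" by simp
  qed (use lim bd in auto)
  then show ?thesis using q0 LIMSEQ_unique[OF tendsto_const, of 0] by auto
qed

lemma test_function_integration_by_parts:
  assumes "\<phi> \<in> test_functions S" "smooth \<psi>" "i \<in> Basis"
  shows "(\<integral>x. partial i \<phi> x * \<psi> x \<partial>lborel) = - (\<integral>x. \<phi> x * partial i \<psi> x \<partial>lborel)"
proof -
  note sm = test_functionsD(1)[OF assms(1)]
  have "partial i (\<lambda>x. \<phi> x * \<psi> x) = (\<lambda>x. \<phi> x * partial i \<psi> x + partial i \<phi> x * \<psi> x)"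
    by (rule ext, rule partial_mult) (auto intro!: smooth_differentiable sm assms)
  then have "0 = (\<integral>x. \<phi> x * partial i \<psi> x + partial i \<phi> x * \<psi> x \<partial>lborel)"
    using integral_partial_test_function[OF test_functions_mult[OF assms(1,2)] assms(3)] by simp
  also have "\<dots> = (\<integral>x. \<phi> x * partial i \<psi> x \<partial>lborel) + (\<integral>x. partial i \<phi> x * \<psi> x \<partial>lborel)"
    by (intro Bochner_Integration.integral_add test_functions_integrable[of _ S] test_functions_mult
        test_functions_partial smooth_partial assms)
  finally show ?thesis by simp
qed

lemma box_Int_box_ex: "\<exists>p q. box a b \<inter> box c d = box p (q::'a::euclidean_space)"
  using box_Int_box[of a b c d] by blast

lemma AE_lborel_cbox_box: "AE x in lborel. x \<in> cbox c d \<longrightarrow> x \<in> box c (d::'a::euclidean_space)"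
proof (rule AE_I[of _ _ "cbox c d - box c d"])
  show "emeasure lborel (cbox c d - box c d) = 0"
    using box_subset_cbox[of c d] by (subst emeasure_Diff) (auto simp: emeasure_lborel_box_eq emeasure_lborel_cbox_eq)
qed auto

text \<open>Fundamental lemma of the calculus of variations. Box bumps give vanishing integrals of
  \<open>g\<close> over boxes, boxes form an intersection-stable generator of the Borel sets, and a
  function whose integrals over all Borel sets vanish is 0 almost everywhere. The conclusion is
  confined to the interior because test functions see nothing else.\<close>

lemma test_functions_fundamental:
  fixes g :: "'a::euclidean_space \<Rightarrow> real"
  assumes S: "S \<in> sets borel" and g: "g \<in> L2 (leb S)"
    and orth: "\<And>\<psi>. \<psi> \<in> test_functions S \<Longrightarrow> l2inner (leb S) g \<psi> = 0"
  shows "AE x in leb S. x \<in> interior S \<longrightarrow> g x = 0"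
proof -
  define G where "G = (\<lambda>x. indicator S x * g x)"
  have G[measurable]: "G \<in> borel_measurable borel"
    using leb_measurable_iff[OF S, of g] L2_measurable[OF g] by (simp add: G_def)
  have G2: "integrable lborel (\<lambda>x. (G x)\<^sup>2)"
    using L2_integrable_sq[OF g] unfolding integrable_leb[OF S]
    by (rule Bochner_Integration.integrable_cong[THEN iffD1, rotated -1]) (auto simp: G_def indicator_def)
  have GT: "(\<integral>x. G x * \<psi> x \<partial>lborel) = 0" if "\<psi> \<in> test_functions S" for \<psi>
    using orth[OF that] unfolding l2inner_def integral_leb[OF S] G_def by (simp add: mult.assoc)
  \<comment> \<open>Localising to a box whose closed hull lies in the interior makes
    \<open>G\<close> integrable there and keeps the bumps of all its sub-boxes admissible as test
    functions.\<close>
  have box0: "AE x in lborel. x \<in> box c d \<longrightarrow> G x = 0" if cd: "cbox c d \<subseteq> interior S" for c d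
  proof -
    define D where "D = box c d"
    have Dm[measurable]: "D \<in> sets borel" by (simp add: D_def)
    have Di: "integrable lborel (indicator D :: 'a \<Rightarrow> real)"
      using emeasure_bounded_finite[of D] by (auto intro!: integrable_real_indicator simp: D_def)
    have GD: "integrable lborel (\<lambda>x. indicator D x * G x)"
    proof (rule Bochner_Integration.integrable_bound)
      show "integrable lborel (\<lambda>x. indicator D x + (G x)\<^sup>2)" using Di G2 by simp
      have "\<bar>G x\<bar> \<le> 1 + (G x)\<^sup>2" for x
      proof -
        have "0 \<le> (\<bar>G x\<bar> - 1)\<^sup>2" by simp
        then show ?thesis by (simp add: power2_diff)
      qed
      then show "AE x in lborel. norm (indicator D x * G x) \<le> norm (indicator D x + (G x)\<^sup>2)"
        by (auto simp: indicator_def)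
    qed simp
    have SI: "set_integrable lborel A (\<lambda>x. indicator D x * G x)" if "A \<in> sets borel" for A
      unfolding set_integrable_def using integrable_mult_indicator[OF _ GD, of A] that by simp
    have basic: "(LINT x:box a b|lborel. indicator D x * G x) = 0" for a b
    proof -
      obtain p q where pq: "box a b \<inter> D = box p q" using box_Int_box_ex unfolding D_def by blast
      show ?thesis
      proof (cases "box p q = {}")
        case True
        then have "indicator (box a b) x * (indicator D x * G x) = 0" for x
          using pq by (auto simp: indicator_def)
        then have "(\<lambda>x. indicator (box a b) x *\<^sub>R (indicator D x * G x)) = (\<lambda>x. 0)" by auto
        then show ?thesis unfolding set_lebesgue_integral_def by (simp only: integral_zero)
      next
        case False
        have "closure (box p q) \<subseteq> closure (box c d)" using pq by (intro closure_mono) (auto simp: D_def)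
        moreover have "closure (box c d) \<subseteq> cbox c d" by (rule closure_minimal) (auto simp: box_subset_cbox)
        ultimately have K: "cbox p q \<subseteq> interior S" using False cd by (simp add: closure_box)
        have T: "box_bump p q n \<in> test_functions S" for n
          by (rule test_functionsI[OF smooth_box_bump compact_cbox K]) (metis box_bump_nonzero box_subset_cbox subsetD)
        have "(\<lambda>n. \<integral>x. G x * box_bump p q n x \<partial>lborel) \<longlonglongrightarrow> (\<integral>x. G x * indicator (box p q) x \<partial>lborel)"
        proof (rule integral_dominated_convergence[where w="\<lambda>x. \<bar>indicator D x * G x\<bar>"])
          show "integrable lborel (\<lambda>x. \<bar>indicator D x * G x\<bar>)" using GD by simp
          show "AE x in lborel. (\<lambda>n. G x * box_bump p q n x) \<longlonglongrightarrow> G x * indicator (box p q) x"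
            by (intro AE_I2 tendsto_intros box_bump_tendsto)
          show "AE x in lborel. norm (G x * box_bump p q n x) \<le> \<bar>indicator D x * G x\<bar>" for n
          proof (rule AE_I2)
            fix x
            show "norm (G x * box_bump p q n x) \<le> \<bar>indicator D x * G x\<bar>"
            proof (cases "x \<in> box p q")
              case True
              then have "x \<in> D" using pq by auto
              then show ?thesis using box_bump_bounds[of p q n x] by (simp add: abs_mult mult_left_le)
            next
              case False
              then show ?thesis using box_bump_nonzero[of p q n x] by simp
            qed
          qed
          show "(\<lambda>x. G x * box_bump p q n x) \<in> borel_measurable lborel" for n
            using smooth_measurable[OF smooth_box_bump] by measurable
        qed measurable
        then have "(\<integral>x. G x * indicator (box p q) x \<partial>lborel) = 0"
          unfolding GT[OF T] by (simp add: LIMSEQ_const_iff)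
        moreover have "(\<lambda>x. indicator (box a b) x *\<^sub>R (indicator D x * G x)) = (\<lambda>x. G x * indicator (box p q) x)"
          unfolding pq[symmetric] by (auto simp: indicator_def)
        ultimately show ?thesis unfolding set_lebesgue_integral_def by (simp only:)
      qed
    qed
    have total: "(\<integral>x. indicator D x * G x \<partial>lborel) = 0"
    proof -
      have "(\<lambda>x. indicator (box c d) x *\<^sub>R (indicator D x * G x)) = (\<lambda>x. indicator D x * G x)"
        by (auto simp: D_def indicator_def)
      then show ?thesis using basic[of c d] unfolding set_lebesgue_integral_def by (simp only:)
    qed
    have all: "(LINT x:A|lborel. indicator D x * G x) = 0" if "A \<in> sets borel" for A
    proof -
      have "A \<in> sigma_sets UNIV (range (\<lambda>(a, b). box a b :: 'a set))"
        using that unfolding borel_eq_box by simp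
      then show ?thesis
      proof (rule sigma_sets_induct_disjoint[rotated 2])
        show "Int_stable (range (\<lambda>(a, b). box a b :: 'a set))"
          unfolding Int_stable_def using box_Int_box_ex by (auto simp: image_iff)
      next
        fix A assume "A \<in> range (\<lambda>(a, b). box a b :: 'a set)"
        then show "(LINT x:A|lborel. indicator D x * G x) = 0" using basic by auto
      next
        show "(LINT x:{}|lborel. indicator D x * G x) = 0" by (simp add: set_lebesgue_integral_def)
      next
        fix A assume A: "A \<in> sigma_sets UNIV (range (\<lambda>(a, b). box a b :: 'a set))"
          "(LINT x:A|lborel. indicator D x * G x) = 0"
        then have Am: "A \<in> sets borel" unfolding borel_eq_box by simp
        have "(\<lambda>x. indicator (UNIV - A) x *\<^sub>R (indicator D x * G x)) =
            (\<lambda>x. indicator D x * G x - indicator A x *\<^sub>R (indicator D x * G x))"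
          by (auto simp: indicator_def)
        then have "(LINT x:UNIV - A|lborel. indicator D x * G x)
            = (\<integral>x. indicator D x * G x - indicator A x *\<^sub>R (indicator D x * G x) \<partial>lborel)"
          unfolding set_lebesgue_integral_def by (simp only:)
        also have "\<dots> = (\<integral>x. indicator D x * G x \<partial>lborel) - (LINT x:A|lborel. indicator D x * G x)"
          unfolding set_lebesgue_integral_def
          by (rule Bochner_Integration.integral_diff[OF GD SI[OF Am, unfolded set_integrable_def]])
        finally show "(LINT x:UNIV - A|lborel. indicator D x * G x) = 0" using A(2) total by simp
      next
        fix A :: "nat \<Rightarrow> 'a set"
        assume A: "disjoint_family A" "range A \<subseteq> sigma_sets UNIV (range (\<lambda>(a, b). box a b :: 'a set))"
          "\<And>i. (LINT x:A i|lborel. indicator D x * G x) = 0"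
        then have Am: "A i \<in> sets borel" for i unfolding borel_eq_box by auto
        then have "(LINT x:(\<Union>i. A i)|lborel. indicator D x * G x) = (\<Sum>i. (LINT x:A i|lborel. indicator D x * G x))"
          using A(1) by (intro lebesgue_integral_countable_add SI) (auto simp: disjoint_family_on_def)
        then show "(LINT x:(\<Union>i. A i)|lborel. indicator D x * G x) = 0" using A(3) by simp
      qed auto
    qed
    have "AE x in lborel. indicator D x * G x = 0" by (rule sigma_finite_measure.density_zero[OF lborel.sigma_finite_measure_axioms GD]) (simp add: all)
    then show ?thesis by eventually_elim (auto simp: D_def)
  qed
  \<comment> \<open>Countably many closed boxes exhaust the interior, and the boundary of each is a
    null set.\<close>
  obtain \<D> where \<D>: "countable \<D>" "\<And>X. X \<in> \<D> \<Longrightarrow> X \<subseteq> interior S" "\<And>X. X \<in> \<D> \<Longrightarrow> \<exists>a b. X = cbox a b"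
      "\<Union>\<D> = interior S"
    by (rule open_countable_Union_open_cbox[OF open_interior[of S]], rule that) auto
  have "AE x in lborel. \<forall>X\<in>\<D>. x \<in> X \<longrightarrow> G x = 0"
  proof (rule AE_ball_countable[OF \<D>(1), THEN iffD2], rule ballI)
    fix X assume X: "X \<in> \<D>"
    then obtain c d where cd: "X = cbox c d" using \<D>(3) by blast
    show "AE x in lborel. x \<in> X \<longrightarrow> G x = 0"
      using AE_lborel_cbox_box[of c d] box0[OF \<D>(2)[OF X, unfolded cd]] unfolding cd
      by eventually_elim auto
  qed
  then show ?thesis
    unfolding AE_leb_iff[OF S] \<D>(4)[symmetric] by eventually_elim (auto simp: G_def)
qed

text \<open>The L^2 closure \<open>V\<close> of the test functions is a closed subspace. What
  remains of \<open>f\<close> after projection onto \<open>V\<close> is orthogonal to all test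
  functions, hence vanishes on the interior, and by \<open>null\<close> almost everywhere.\<close>

lemma test_functions_dense:
  fixes f :: "'a::euclidean_space \<Rightarrow> real"
  assumes S: "S \<in> sets borel" "bounded S" and null: "AE x in leb S. x \<in> interior S"
    and f: "f \<in> L2 (leb S)" and e: "e > 0"
  shows "\<exists>\<psi>\<in>test_functions S. l2norm (leb S) (\<lambda>x. f x - \<psi> x) < e"
proof -
  define V where "V = {f \<in> L2 (leb S). \<forall>e>0. \<exists>\<psi>\<in>test_functions S. l2norm (leb S) (\<lambda>x. f x - \<psi> x) < e}"
  have T: "\<psi> \<in> L2 (leb S)" if "\<psi> \<in> test_functions S" for \<psi> by (rule test_functions_L2[OF S(1) that])
  have TV: "\<psi> \<in> V" if "\<psi> \<in> test_functions S" for \<psi>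
    using that T[OF that] by (auto simp: V_def l2norm_def l2inner_def intro!: bexI[of _ \<psi>])
  have "\<exists>u\<in>V. \<forall>w\<in>V. l2inner (leb S) (\<lambda>x. f x - u x) w = 0"
  proof (rule L2_orthogonal_projection[OF finite_measure_leb[OF S] _ _ _ _ f])
    show "V \<subseteq> L2 (leb S)" by (auto simp: V_def)
    show "(\<lambda>x. 0) \<in> V" by (rule TV[OF test_functions_0])
  next
    fix g k c assume gk: "g \<in> V" "k \<in> V"
    have "\<exists>\<psi>\<in>test_functions S. l2norm (leb S) (\<lambda>x. (g x + c *\<^sub>R k x) - \<psi> x) < e" if e: "e > 0" for e
    proof -
      have e': "e / (2 * (\<bar>c\<bar> + 1)) > 0" "e / 2 > 0" using e by auto
      obtain p where p: "p \<in> test_functions S" "l2norm (leb S) (\<lambda>x. g x - p x) < e / 2"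
        using gk(1) e'(2) unfolding V_def by blast
      obtain q where q: "q \<in> test_functions S" "l2norm (leb S) (\<lambda>x. k x - q x) < e / (2 * (\<bar>c\<bar> + 1))"
        using gk(2) e'(1) unfolding V_def by blast
      have "l2norm (leb S) (\<lambda>x. (g x - p x) + c *\<^sub>R (k x - q x)) \<le>
          l2norm (leb S) (\<lambda>x. g x - p x) + l2norm (leb S) (\<lambda>x. c *\<^sub>R (k x - q x))"
        using gk p q T by (intro l2norm_triangle L2_scaleR L2_diff) (auto simp: V_def)
      also have "\<dots> < e / 2 + e / 2"
      proof (rule add_less_le_mono[OF p(2)])
        have "\<bar>c\<bar> * l2norm (leb S) (\<lambda>x. k x - q x) \<le> (\<bar>c\<bar> + 1) * (e / (2 * (\<bar>c\<bar> + 1)))"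
          using q(2) l2norm_nonneg by (intro mult_mono) auto
        also have "\<dots> = e / 2" by (simp add: field_simps)
        finally show "l2norm (leb S) (\<lambda>x. c *\<^sub>R (k x - q x)) \<le> e / 2" unfolding l2norm_scaleR .
      qed
      finally show ?thesis
        by (intro bexI[OF _ test_functions_lincomb[OF p(1) q(1), of c]]) (simp add: algebra_simps)
    qed
    then show "(\<lambda>x. g x + c *\<^sub>R k x) \<in> V" using gk by (auto simp: V_def intro!: L2_add L2_mult_const)
  next
    fix g :: "nat \<Rightarrow> 'a \<Rightarrow> real" and g0 assume g: "\<And>n. g n \<in> V" "g0 \<in> L2 (leb S)" "l2_lim (leb S) g g0"
    have "\<exists>\<psi>\<in>test_functions S. l2norm (leb S) (\<lambda>x. g0 x - \<psi> x) < e" if e: "e > 0" for e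
    proof -
      obtain n where n: "l2norm (leb S) (\<lambda>x. g n x - g0 x) < e / 2"
        using LIMSEQ_D[OF g(3), of "e / 2"] e by (auto simp: l2norm_nonneg)
      obtain p where p: "p \<in> test_functions S" "l2norm (leb S) (\<lambda>x. g n x - p x) < e / 2"
        using g(1)[of n] half_gt_zero[OF e] unfolding V_def by blast
      have gn: "g n \<in> L2 (leb S)" using g(1) by (simp add: V_def)
      show ?thesis
        using l2norm_triangle_diff[OF g(2) gn T[OF p(1)]] n p l2norm_minus_commute[of "leb S" "g n" g0]
        by (intro bexI[OF _ p(1)]) simp
    qed
    then show "g0 \<in> V" using g(2) by (simp add: V_def)
  qed
  then obtain u where u: "u \<in> V" "\<And>w. w \<in> V \<Longrightarrow> l2inner (leb S) (\<lambda>x. f x - u x) w = 0" by blast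
  have uL: "u \<in> L2 (leb S)" using u(1) by (simp add: V_def)
  have "AE x in leb S. x \<in> interior S \<longrightarrow> f x - u x = 0"
    by (rule test_functions_fundamental[OF S(1) L2_diff[OF f uL]]) (use u(2) TV in auto)
  with null have ae: "AE x in leb S. f x = u x" by eventually_elim simp
  obtain p where p: "p \<in> test_functions S" "l2norm (leb S) (\<lambda>x. u x - p x) < e"
    using u(1) e unfolding V_def by blast
  have "l2norm (leb S) (\<lambda>x. f x - p x) = l2norm (leb S) (\<lambda>x. u x - p x)"
  proof (rule l2norm_cong_AE)
    show "AE x in leb S. f x - p x = u x - p x" using ae by eventually_elim simp
  qed (use L2_diff f uL T[OF p(1)] L2_measurable in blast)+
  then show ?thesis using p(2) by (intro bexI[OF _ p(1)]) simp
qed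

lemma test_functions_dense_seq:
  fixes f :: "'a::euclidean_space \<Rightarrow> real"
  assumes "S \<in> sets borel" "bounded S" "AE x in leb S. x \<in> interior S" "f \<in> L2 (leb S)"
  obtains \<psi> where "\<And>n::nat. \<psi> n \<in> test_functions S" "l2_lim (leb S) \<psi> f"
proof -
  have "\<exists>\<psi>\<in>test_functions S. l2norm (leb S) (\<lambda>x. f x - \<psi> x) < 1 / real (Suc n)" for n
    by (rule test_functions_dense[OF assms]) simp
  then obtain \<psi> where \<psi>: "\<And>n. \<psi> n \<in> test_functions S" "\<And>n. l2norm (leb S) (\<lambda>x. f x - \<psi> n x) < 1 / real (Suc n)"
    by metis
  show thesis
  proof (rule that[OF \<psi>(1)])
    show "l2_lim (leb S) \<psi> f"
      by (rule l2norm_tendsto_squeeze[OF LIMSEQ_inverse_real_of_nat])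
        (use \<psi>(2) in \<open>simp add: l2norm_minus_commute[of _ _ f] inverse_eq_divide less_imp_le\<close>)
  qed
qed

section \<open>Calculus of weak gradients\<close>

lemma has_H10_gradient_L2: "has_H10_gradient S u g \<Longrightarrow> u \<in> L2 (leb S)" "has_H10_gradient S u g \<Longrightarrow> g \<in> L2 (leb S)"
  by (simp_all add: has_H10_gradient_def)

lemma has_H10_gradient_approx:
  assumes "has_H10_gradient S u g"
  obtains \<phi> where "\<And>n::nat. \<phi> n \<in> test_functions S"
    "l2_lim (leb S) \<phi> u" "l2_lim (leb S) (\<lambda>n. gradient (\<phi> n)) g"
  using assms unfolding has_H10_gradient_def by blast

lemma has_H10_gradient_test:
  assumes "S \<in> sets borel" "\<phi> \<in> test_functions S" shows "has_H10_gradient S \<phi> (gradient \<phi>)"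
  unfolding has_H10_gradient_def
  using test_functions_L2[OF assms] test_functions_gradient_L2[OF assms] assms(2)
  by (intro conjI exI[of _ "\<lambda>_. \<phi>"]) (auto simp: l2norm_def l2inner_def)

lemma gradient_lincomb:
  assumes "smooth \<phi>" "smooth \<psi>"
  shows "gradient (\<lambda>x. \<phi> x + c * \<psi> x) x = gradient \<phi> x + c *\<^sub>R gradient \<psi> x"
proof -
  have "partial i (\<lambda>x. \<phi> x + c * \<psi> x) x = partial i \<phi> x + c * partial i \<psi> x" for i
    by (rule partial_eqI) (auto intro!: derivative_eq_intros smooth_has_derivative assms)
  then show ?thesis
    by (simp add: gradient_def scaleR_add_left sum.distrib scaleR_sum_right)
qed

lemma has_H10_gradient_lincomb:
  assumes S: "S \<in> sets borel" and "has_H10_gradient S u g" "has_H10_gradient S w k"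
  shows "has_H10_gradient S (\<lambda>x. u x + c * w x) (\<lambda>x. g x + c *\<^sub>R k x)"
proof -
  obtain p where p: "\<And>n::nat. p n \<in> test_functions S"
    "l2_lim (leb S) p u" "l2_lim (leb S) (\<lambda>n. gradient (p n)) g"
    by (rule has_H10_gradient_approx[OF assms(2)], rule that)
  obtain q where q: "\<And>n::nat. q n \<in> test_functions S"
    "l2_lim (leb S) q w" "l2_lim (leb S) (\<lambda>n. gradient (q n)) k"
    by (rule has_H10_gradient_approx[OF assms(3)], rule that)
  note L = has_H10_gradient_L2[OF assms(2)] has_H10_gradient_L2[OF assms(3)]
  note T = test_functions_L2[OF S p(1)] test_functions_L2[OF S q(1)]
    test_functions_gradient_L2[OF S p(1)] test_functions_gradient_L2[OF S q(1)]
  have comb: "(\<lambda>n. a n + \<bar>c\<bar> * b n) \<longlonglongrightarrow> 0" if "a \<longlonglongrightarrow> 0" "b \<longlonglongrightarrow> 0" for a b :: "nat \<Rightarrow> real"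
    using tendsto_add[OF that(1) tendsto_mult_left[OF that(2), of "\<bar>c\<bar>"]] by simp
  show ?thesis unfolding has_H10_gradient_def
  proof (intro conjI exI[of _ "\<lambda>n x. p n x + c * q n x"] allI)
    show "(\<lambda>x. u x + c * w x) \<in> L2 (leb S)" "(\<lambda>x. g x + c *\<^sub>R k x) \<in> L2 (leb S)"
      by (intro L2_add L2_mult_const L2_scaleR L)+
    show "(\<lambda>x. p n x + c * q n x) \<in> test_functions S" for n by (rule test_functions_lincomb[OF p(1) q(1)])
    show "(\<lambda>n. l2norm (leb S) (\<lambda>x. p n x + c * q n x - (u x + c * w x))) \<longlonglongrightarrow> 0"
    proof (rule l2norm_tendsto_squeeze[OF comb[OF p(2) q(2)]])
      show "l2norm (leb S) (\<lambda>x. p n x + c * q n x - (u x + c * w x)) \<le>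
          l2norm (leb S) (\<lambda>x. p n x - u x) + \<bar>c\<bar> * l2norm (leb S) (\<lambda>x. q n x - w x)" for n
      proof -
        have eq: "(\<lambda>x. p n x + c * q n x - (u x + c * w x)) = (\<lambda>x. (p n x - u x) + c *\<^sub>R (q n x - w x))"
          by (simp add: fun_eq_iff algebra_simps)
        show ?thesis unfolding eq l2norm_scaleR[symmetric]
          by (rule l2norm_triangle[OF L2_diff[OF T(1) L(1)] L2_scaleR[OF L2_diff[OF T(2) L(3)]]])
      qed
    qed
    show "(\<lambda>n. l2norm (leb S) (\<lambda>x. gradient (\<lambda>x. p n x + c * q n x) x - (g x + c *\<^sub>R k x))) \<longlonglongrightarrow> 0"
    proof (rule l2norm_tendsto_squeeze[OF comb[OF p(3) q(3)]])
      show "l2norm (leb S) (\<lambda>x. gradient (\<lambda>x. p n x + c * q n x) x - (g x + c *\<^sub>R k x)) \<le>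
          l2norm (leb S) (\<lambda>x. gradient (p n) x - g x) + \<bar>c\<bar> * l2norm (leb S) (\<lambda>x. gradient (q n) x - k x)" for n
      proof -
        have eq: "(\<lambda>x. gradient (\<lambda>x. p n x + c * q n x) x - (g x + c *\<^sub>R k x)) =
            (\<lambda>x. (gradient (p n) x - g x) + c *\<^sub>R (gradient (q n) x - k x))"
          by (simp add: fun_eq_iff gradient_lincomb test_functionsD(1)[OF p(1)] test_functionsD(1)[OF q(1)]
            algebra_simps)
        show ?thesis unfolding eq l2norm_scaleR[symmetric]
          by (rule l2norm_triangle[OF L2_diff[OF T(3) L(2)] L2_scaleR[OF L2_diff[OF T(4) L(4)]]])
      qed
    qed
  qed
qed

lemma has_H10_gradient_0: "S \<in> sets borel \<Longrightarrow> has_H10_gradient S (\<lambda>x. 0) (\<lambda>x. 0)"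
proof -
  assume S: "S \<in> sets borel"
  have "gradient (\<lambda>x::'a. 0) = (\<lambda>x. 0)"
    by (rule ext) (use test_functions_gradient_zero[of "\<lambda>x. 0" "{}"] test_functions_0 in auto)
  then show ?thesis using has_H10_gradient_test[OF S test_functions_0] by simp
qed

lemma has_H10_gradient_diff:
  assumes "S \<in> sets borel" "has_H10_gradient S u g" "has_H10_gradient S w k"
  shows "has_H10_gradient S (\<lambda>x. u x - w x) (\<lambda>x. g x - k x)"
  using has_H10_gradient_lincomb[OF assms, of "-1"] by simp

text \<open>Diagonal choice: for each n one test function within 1/(n+1) of the n-th pair in both
  norms.\<close>

lemma has_H10_gradient_closed:
  assumes S: "S \<in> sets borel" and "\<And>n. has_H10_gradient S (u n) (g n)" and L: "u0 \<in> L2 (leb S)" "g0 \<in> L2 (leb S)"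
    and lim: "l2_lim (leb S) u u0" "l2_lim (leb S) g g0"
  shows "has_H10_gradient S u0 g0"
proof -
  have "\<exists>p\<in>test_functions S. l2norm (leb S) (\<lambda>x. p x - u n x) < 1 / real (Suc n) \<and>
      l2norm (leb S) (\<lambda>x. gradient p x - g n x) < 1 / real (Suc n)" for n
  proof -
    obtain p where p: "\<And>k::nat. p k \<in> test_functions S"
      "(\<lambda>k. l2norm (leb S) (\<lambda>x. p k x - u n x)) \<longlonglongrightarrow> 0" "(\<lambda>k. l2norm (leb S) (\<lambda>x. gradient (p k) x - g n x)) \<longlonglongrightarrow> 0"
      by (rule has_H10_gradient_approx[OF assms(2)[of n]], rule that)
    have e: "1 / real (Suc n) > 0" by simp
    have "eventually (\<lambda>k. l2norm (leb S) (\<lambda>x. p k x - u n x) < 1 / real (Suc n) \<and>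
        l2norm (leb S) (\<lambda>x. gradient (p k) x - g n x) < 1 / real (Suc n)) sequentially"
      using order_tendstoD(2)[OF p(2) e] order_tendstoD(2)[OF p(3) e] by eventually_elim simp
    then obtain k where "l2norm (leb S) (\<lambda>x. p k x - u n x) < 1 / real (Suc n)"
        "l2norm (leb S) (\<lambda>x. gradient (p k) x - g n x) < 1 / real (Suc n)"
      by (metis (no_types, lifting) eventually_sequentially order_refl)
    then show ?thesis by (intro bexI[OF _ p(1)] conjI)
  qed
  then obtain p where p: "\<And>n. p n \<in> test_functions S" "\<And>n. l2norm (leb S) (\<lambda>x. p n x - u n x) < 1 / real (Suc n)"
      "\<And>n. l2norm (leb S) (\<lambda>x. gradient (p n) x - g n x) < 1 / real (Suc n)" by metis
  have z: "(\<lambda>n. inverse (real (Suc n)) + a n) \<longlonglongrightarrow> 0" if "a \<longlonglongrightarrow> 0" for a :: "nat \<Rightarrow> real"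
    using tendsto_add[OF LIMSEQ_inverse_real_of_nat that] by simp
  note uL = has_H10_gradient_L2[OF assms(2)]
  show ?thesis unfolding has_H10_gradient_def
  proof (intro conjI exI[of _ p] allI p L)
    show "l2_lim (leb S) p u0"
    proof (rule l2norm_tendsto_squeeze[OF z[OF lim(1)]])
      show "l2norm (leb S) (\<lambda>x. p n x - u0 x) \<le> inverse (real (Suc n)) + l2norm (leb S) (\<lambda>x. u n x - u0 x)" for n
        using l2norm_triangle_diff[OF test_functions_L2[OF S p(1)] uL(1) L(1), of n n] p(2)[of n]
        by (simp add: inverse_eq_divide)
    qed
    show "l2_lim (leb S) (\<lambda>n. gradient (p n)) g0"
    proof (rule l2norm_tendsto_squeeze[OF z[OF lim(2)]])
      show "l2norm (leb S) (\<lambda>x. gradient (p n) x - g0 x) \<le> inverse (real (Suc n)) + l2norm (leb S) (\<lambda>x. g n x - g0 x)" for n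
        using l2norm_triangle_diff[OF test_functions_gradient_L2[OF S p(1)] uL(2) L(2), of n n] p(3)[of n]
        by (simp add: inverse_eq_divide)
    qed
  qed
qed

text \<open>Closedness of the gradient applied to a constant sequence.\<close>

lemma has_H10_gradient_cong_AE:
  assumes "has_H10_gradient S u g" and S: "S \<in> sets borel"
    and "AE x in leb S. u x = u' x" "u' \<in> borel_measurable (leb S)"
    and "AE x in leb S. g x = g' x" "g' \<in> borel_measurable (leb S)"
  shows "has_H10_gradient S u' g'"
proof -
  note L = has_H10_gradient_L2[OF assms(1)]
  have L': "u' \<in> L2 (leb S)" "g' \<in> L2 (leb S)"
    using L2_cong_AE[OF L(1) assms(3,4)] L2_cong_AE[OF L(2) assms(5,6)] by auto
  have "l2norm (leb S) (\<lambda>x. u x - u' x) = 0" "l2norm (leb S) (\<lambda>x. g x - g' x) = 0"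
    using l2norm_zero_iff[OF L2_diff[OF L(1) L'(1)]] l2norm_zero_iff[OF L2_diff[OF L(2) L'(2)]] assms(3,5) by auto
  then have z: "(\<lambda>n::nat. l2norm (leb S) (\<lambda>x. u x - u' x)) \<longlonglongrightarrow> 0"
    "(\<lambda>n::nat. l2norm (leb S) (\<lambda>x. g x - g' x)) \<longlonglongrightarrow> 0" by simp_all
  show ?thesis
    by (rule has_H10_gradient_closed[where u="\<lambda>_. u" and g="\<lambda>_. g", OF S assms(1) L' z])
qed

lemma l2inner_test_gradient:
  assumes "S \<in> sets borel" "\<phi> \<in> test_functions S" "\<psi> \<in> test_functions S" "i \<in> Basis"
  shows "l2inner (leb S) (\<lambda>x. gradient \<phi> x \<bullet> i) \<psi> = - l2inner (leb S) \<phi> (partial i \<psi>)"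
proof -
  have "l2inner (leb S) (\<lambda>x. gradient \<phi> x \<bullet> i) \<psi> = (\<integral>x. partial i \<phi> x * \<psi> x \<partial>leb S)"
    by (simp add: l2inner_def gradient_inner[OF assms(4)])
  also have "\<dots> = (\<integral>x. partial i \<phi> x * \<psi> x \<partial>lborel)"
    by (rule test_functions_integral_leb[OF assms(1) test_functions_partial[OF assms(2,4)]])
  also have "\<dots> = - (\<integral>x. \<phi> x * partial i \<psi> x \<partial>lborel)"
    by (rule test_function_integration_by_parts[OF assms(2) test_functionsD(1)[OF assms(3)] assms(4)])
  also have "(\<integral>x. \<phi> x * partial i \<psi> x \<partial>lborel) = (\<integral>x. \<phi> x * partial i \<psi> x \<partial>leb S)"
    by (rule test_functions_integral_leb[OF assms(1,2), symmetric])
  finally show ?thesis by (simp add: l2inner_def)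
qed

lemma l2norm_inner_const_le:
  fixes g :: "'a \<Rightarrow> 'b::euclidean_space"
  assumes "g \<in> L2 M" "i \<in> Basis" shows "l2norm M (\<lambda>x. g x \<bullet> i) \<le> l2norm M g"
  by (rule l2norm_mono[OF _ assms(1)]) (use L2_measurable[OF assms(1)] assms(2) Basis_le_norm in auto)

text \<open>Closability of the gradient. On the interior, integration by parts against test
  functions kills the limit; on the rest of \<open>S\<close>, which may have positive measure, all
  approximating gradients vanish, so their limit does too.\<close>

lemma has_H10_gradient_zero_AE:
  assumes S: "S \<in> sets borel" and "has_H10_gradient S (\<lambda>x. 0) d"
  shows "AE x in leb S. d x = 0"
proof -
  obtain p where p: "\<And>n::nat. p n \<in> test_functions S"
    "l2_lim (leb S) p (\<lambda>x. 0)" "l2_lim (leb S) (\<lambda>n. gradient (p n)) d"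
    by (rule has_H10_gradient_approx[OF assms(2)], rule that)
  note dL = has_H10_gradient_L2(2)[OF assms(2)]
  have inner0: "AE x in leb S. x \<in> interior S \<longrightarrow> d x \<bullet> i = 0" if i: "i \<in> Basis" for i
  proof (rule test_functions_fundamental[OF S L2_inner_const[OF dL]])
    fix \<psi> assume \<psi>: "\<psi> \<in> test_functions S"
    note \<psi>L = test_functions_L2[OF S \<psi>] and \<psi>iL = test_functions_L2[OF S test_functions_partial[OF \<psi> i]]
    have "(\<lambda>n. l2inner (leb S) (\<lambda>x. gradient (p n) x \<bullet> i) \<psi>) \<longlonglongrightarrow> l2inner (leb S) (\<lambda>x. d x \<bullet> i) \<psi>"
    proof (rule l2inner_tendsto)
      show "l2_lim (leb S) (\<lambda>n x. gradient (p n) x \<bullet> i) (\<lambda>x. d x \<bullet> i)"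
        by (rule l2norm_tendsto_squeeze[OF p(3)])
          (use l2norm_inner_const_le[OF L2_diff[OF test_functions_gradient_L2[OF S p(1)] dL] i] in
            \<open>simp add: inner_diff_left\<close>)
    qed (use \<psi>L in \<open>auto intro!: L2_inner_const test_functions_gradient_L2[OF S p(1)] dL simp: l2norm_def l2inner_def\<close>)
    moreover have "(\<lambda>n. l2inner (leb S) (p n) (partial i \<psi>)) \<longlonglongrightarrow> l2inner (leb S) (\<lambda>x. 0) (partial i \<psi>)"
      by (rule l2inner_tendsto) (use \<psi>iL p(2) in \<open>auto intro!: test_functions_L2[OF S p(1)] L2_zero simp: l2norm_def l2inner_def\<close>)
    then have "(\<lambda>n. l2inner (leb S) (\<lambda>x. gradient (p n) x \<bullet> i) \<psi>) \<longlonglongrightarrow> 0"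
      unfolding l2inner_test_gradient[OF S p(1) \<psi> i] using tendsto_minus by (force simp: l2inner_def)
    ultimately show "l2inner (leb S) (\<lambda>x. d x \<bullet> i) \<psi> = 0" by (rule LIMSEQ_unique)
  qed
  have "AE x in leb S. \<forall>i\<in>Basis. x \<in> interior S \<longrightarrow> d x \<bullet> i = 0"
    by (rule AE_finite_allI) (use inner0 in auto)
  then have int: "AE x in leb S. x \<in> interior S \<longrightarrow> d x = 0"
    by eventually_elim (auto intro: euclidean_eqI)
  define e where "e = (\<lambda>x. indicator (- interior S) x *\<^sub>R d x)"
  have im: "indicator (- interior S) \<in> borel_measurable (leb S)" by (intro borel_measurable_leb) auto
  have eL: "e \<in> L2 (leb S)" unfolding e_def by (rule L2_bounded_mult[OF dL im, of 1]) (auto simp: indicator_def)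
  have "l2norm (leb S) e \<le> l2norm (leb S) (\<lambda>x. gradient (p n) x - d x)" for n
  proof (rule l2norm_mono[OF L2_measurable[OF eL] L2_diff[OF test_functions_gradient_L2[OF S p(1)] dL]])
    show "norm (e x) \<le> norm (gradient (p n) x - d x)" for x
      using test_functions_gradient_zero[OF p(1), of x n] by (auto simp: e_def indicator_def)
  qed
  then have "l2norm (leb S) e \<le> 0" by (intro LIMSEQ_le_const[OF p(3)]) auto
  then have "AE x in leb S. e x = 0" using l2norm_zero_iff[OF eL] l2norm_nonneg by (metis order_antisym)
  with int show ?thesis by eventually_elim (auto simp: e_def indicator_def split: if_splits)
qed

lemma has_H10_gradient_unique:
  assumes "S \<in> sets borel" "has_H10_gradient S u g" "has_H10_gradient S u g'"
  shows "AE x in leb S. g x = g' x"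
  using has_H10_gradient_zero_AE[OF assms(1), of "\<lambda>x. g x - g' x"] has_H10_gradient_diff[OF assms] by simp

lemma wgrad_has_H10_gradient: "u \<in> H10 S \<Longrightarrow> has_H10_gradient S u (wgrad S u)"
  unfolding H10_def wgrad_def by (rule someI_ex[of "has_H10_gradient S u"]) simp

lemma wgrad_AE: "S \<in> sets borel \<Longrightarrow> has_H10_gradient S u g \<Longrightarrow> AE x in leb S. wgrad S u x = g x"
  by (rule has_H10_gradient_unique[OF _ wgrad_has_H10_gradient]) (auto simp: H10_def)

text \<open>By Fatou's lemma, a weighted $L^2$ bound passes from test functions to their closure even when
  the weight is only integrable.\<close>

lemma weighted_bound_closure:
  fixes V :: "'a::euclidean_space \<Rightarrow> real"
  assumes S: "S \<in> sets borel" "bounded S" and V: "V \<in> borel_measurable (leb S)" "\<And>x. x \<in> S \<Longrightarrow> 0 \<le> V x"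
    and test: "\<And>\<phi>. \<phi> \<in> test_functions S \<Longrightarrow> (\<integral>\<^sup>+x. ennreal (V x * (\<phi> x)\<^sup>2) \<partial>leb S) \<le>
      ennreal (C * l2norm (leb S) \<phi> * l2norm (leb S) (gradient \<phi>))"
    and C: "0 \<le> C" and u: "has_H10_gradient S u g"
  shows "integrable (leb S) (\<lambda>x. V x * (u x)\<^sup>2)"
    "(\<integral>x. V x * (u x)\<^sup>2 \<partial>leb S) \<le> C * l2norm (leb S) u * l2norm (leb S) g"
proof -
  interpret finite_measure "leb S" by (rule finite_measure_leb[OF S])
  obtain p where p: "\<And>n::nat. p n \<in> test_functions S"
    "l2_lim (leb S) p u" "l2_lim (leb S) (\<lambda>n. gradient (p n)) g"
    by (rule has_H10_gradient_approx[OF u], rule that)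
  note L = has_H10_gradient_L2[OF u]
  obtain r where r: "strict_mono r" "AE x in leb S. (\<lambda>n. p (r n) x) \<longlonglongrightarrow> u x"
    by (rule l2_limit_AE_subseq[OF test_functions_L2[OF S(1) p(1)] L(1) p(2)], rule that)
  have [measurable]: "V \<in> borel_measurable (leb S)" "u \<in> borel_measurable (leb S)" "p n \<in> borel_measurable (leb S)" for n
    using V L2_measurable[OF L(1)] L2_measurable[OF test_functions_L2[OF S(1) p(1)]] by auto
  have "(\<lambda>n. C * l2norm (leb S) (p n) * l2norm (leb S) (gradient (p n))) \<longlonglongrightarrow> C * l2norm (leb S) u * l2norm (leb S) g"
    by (intro tendsto_intros l2norm_tendsto test_functions_L2[OF S(1) p(1)] test_functions_gradient_L2[OF S(1) p(1)] L p)
  then have lim: "(\<lambda>n. C * l2norm (leb S) (p (r n)) * l2norm (leb S) (gradient (p (r n)))) \<longlonglongrightarrow> C * l2norm (leb S) u * l2norm (leb S) g"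
    using LIMSEQ_subseq_LIMSEQ[OF _ r(1)] by (fastforce simp: o_def)
  have "(\<integral>\<^sup>+x. ennreal (V x * (u x)\<^sup>2) \<partial>leb S) \<le> (\<integral>\<^sup>+x. liminf (\<lambda>n. ennreal (V x * (p (r n) x)\<^sup>2)) \<partial>leb S)"
  proof (rule nn_integral_mono_AE)
    show "AE x in leb S. ennreal (V x * (u x)\<^sup>2) \<le> liminf (\<lambda>n. ennreal (V x * (p (r n) x)\<^sup>2))"
      using r(2)
    proof eventually_elim
      case (elim x)
      have "(\<lambda>n. ennreal (V x * (p (r n) x)\<^sup>2)) \<longlonglongrightarrow> ennreal (V x * (u x)\<^sup>2)"
        by (intro tendsto_intros elim tendsto_ennrealI)
      then show ?case by (intro eq_refl lim_imp_Liminf[symmetric]) simp_all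
    qed
  qed
  also have "\<dots> \<le> liminf (\<lambda>n. \<integral>\<^sup>+x. ennreal (V x * (p (r n) x)\<^sup>2) \<partial>leb S)"
    by (rule nn_integral_liminf) measurable
  also have "\<dots> \<le> liminf (\<lambda>n. ennreal (C * l2norm (leb S) (p (r n)) * l2norm (leb S) (gradient (p (r n)))))"
    by (intro Liminf_mono always_eventually allI test p)
  also have "\<dots> = ennreal (C * l2norm (leb S) u * l2norm (leb S) g)"
    by (intro lim_imp_Liminf tendsto_ennrealI lim) simp
  finally have le: "(\<integral>\<^sup>+x. ennreal (V x * (u x)\<^sup>2) \<partial>leb S) \<le> ennreal (C * l2norm (leb S) u * l2norm (leb S) g)" .
  have nn: "AE x in leb S. 0 \<le> V x * (u x)\<^sup>2" using V(2) by (intro AE_I2) auto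
  have m: "(\<lambda>x. V x * (u x)\<^sup>2) \<in> borel_measurable (leb S)" by measurable
  show i: "integrable (leb S) (\<lambda>x. V x * (u x)\<^sup>2)"
  proof (rule integrableI_nonneg[OF m nn])
    show "(\<integral>\<^sup>+x. ennreal (V x * (u x)\<^sup>2) \<partial>leb S) < \<infinity>" using le by (rule le_less_trans) simp
  qed
  have "0 \<le> C * l2norm (leb S) u * l2norm (leb S) g" using C by (simp add: l2norm_nonneg)
  then show "(\<integral>x. V x * (u x)\<^sup>2 \<partial>leb S) \<le> C * l2norm (leb S) u * l2norm (leb S) g"
    using le nn_integral_eq_integral[OF i nn] by simp
qed

section \<open>Inequalities and antiderivatives in one variable\<close>

lemma gradient_real: "gradient f x = partial 1 f (x::real)"
  by (simp add: gradient_def)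

lemma test_real_DERIV: "\<phi> \<in> test_functions S \<Longrightarrow> (\<phi> has_real_derivative gradient \<phi> x) (at x)" for x :: real
  unfolding gradient_real by (rule smooth_has_real_derivative[OF test_functionsD(1)])

lemma test_real_continuous:
  fixes T :: "real set"
  assumes "\<phi> \<in> test_functions S" shows "continuous_on T \<phi>" "continuous_on T (gradient \<phi>)"
proof -
  show "continuous_on T \<phi>" by (rule smooth_continuous_on[OF test_functionsD(1)[OF assms]])
  have "smooth (partial 1 \<phi>)" by (rule smooth_partial[OF test_functionsD(1)[OF assms]]) simp
  then show "continuous_on T (gradient \<phi>)" unfolding gradient_real[abs_def] by (rule smooth_continuous_on)
qed

lemma interval_borel: "{\<alpha>..\<beta>::real} \<in> sets borel" "bounded {\<alpha>..\<beta>::real}"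
  by auto

lemma AE_interval_interior: "AE x in leb {\<alpha>..\<beta>::real}. x \<in> interior {\<alpha>..\<beta>}"
proof -
  have "AE x in lborel. x \<notin> {\<alpha>, \<beta>}" by (rule AE_not_in) (auto intro: finite_imp_null_set_lborel)
  then show ?thesis unfolding AE_leb_iff[OF interval_borel(1)] by eventually_elim auto
qed

text \<open>The derivative of f^2 is 2 f f', integrated from a point to the left of the
  support.\<close>

lemma compact_support_sq_bound:
  fixes f f' :: "real \<Rightarrow> real"
  assumes d: "\<And>x. (f has_real_derivative f' x) (at x)" and c: "continuous_on UNIV f'"
    and z: "\<And>x. x \<notin> {A..B} \<Longrightarrow> f x = 0"
  shows "integrable lborel (\<lambda>t. f t * f' t)" "(f x)\<^sup>2 \<le> 2 * (\<integral>t. \<bar>f t * f' t\<bar> \<partial>lborel)"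
proof -
  have cf: "continuous_on UNIV f" by (rule DERIV_continuous_on) (use d in \<open>auto intro: DERIV_subset\<close>)
  have "integrable lborel (\<lambda>t. indicator {A..B} t *\<^sub>R (f t * f' t))"
    by (rule borel_integrable_compact) (auto intro!: continuous_intros continuous_on_subset[OF cf] continuous_on_subset[OF c])
  moreover have "(\<lambda>t. indicator {A..B} t *\<^sub>R (f t * f' t)) = (\<lambda>t. f t * f' t)"
    using z by (auto simp: fun_eq_iff indicator_def)
  ultimately show i: "integrable lborel (\<lambda>t. f t * f' t)" by simp
  \<comment> \<open>Left of the support and left of \<open>x\<close>, wherever \<open>x\<close>
    lies.\<close>
  define A' where "A' = min A x - 1"
  have "(\<integral>t. (2 * (f t * f' t)) * indicator {A'..x} t \<partial>lborel) = (f x)\<^sup>2 - (f A')\<^sup>2"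
  proof (rule integral_FTC_Icc_real)
    show "A' \<le> x" by (simp add: A'_def)
    show "((\<lambda>t. (f t)\<^sup>2) has_real_derivative 2 * (f t * f' t)) (at t)" for t
      by (auto intro!: derivative_eq_intros d)
    show "isCont (\<lambda>t. 2 * (f t * f' t)) t" for t
      using cf c by (auto intro!: continuous_intros simp: continuous_on_eq_continuous_at)
  qed
  moreover have "f A' = 0" by (rule z) (auto simp: A'_def min_def)
  ultimately have "(f x)\<^sup>2 = (\<integral>t. (2 * (f t * f' t)) * indicator {A'..x} t \<partial>lborel)" by simp
  also have "\<dots> \<le> (\<integral>t. 2 * \<bar>f t * f' t\<bar> \<partial>lborel)"
  proof (rule integral_mono)
    show "integrable lborel (\<lambda>t. 2 * (f t * f' t) * indicator {A'..x} t)"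
      using integrable_mult_indicator[of "{A'..x}" lborel "\<lambda>t. 2 * (f t * f' t)"] i by (simp add: mult.commute)
  qed (use i in \<open>auto simp: indicator_def\<close>)
  finally show "(f x)\<^sup>2 \<le> 2 * (\<integral>t. \<bar>f t * f' t\<bar> \<partial>lborel)" by simp
qed

text \<open>Agmon's inequality. A pointwise bound by the two norms is what lets a merely integrable
  weight, here \<lambda>^2, act on H^1_0.\<close>

lemma test_real_sq_bound:
  fixes \<phi> :: "real \<Rightarrow> real"
  assumes "\<phi> \<in> test_functions {\<alpha>..\<beta>}"
  shows "(\<phi> x)\<^sup>2 \<le> 2 * l2norm (leb {\<alpha>..\<beta>}) \<phi> * l2norm (leb {\<alpha>..\<beta>}) (gradient \<phi>)"
proof -
  let ?M = "leb {\<alpha>..\<beta>}"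
  have "(\<phi> x)\<^sup>2 \<le> 2 * (\<integral>t. \<bar>\<phi> t * gradient \<phi> t\<bar> \<partial>lborel)"
    by (rule compact_support_sq_bound(2)[OF test_real_DERIV[OF assms] test_real_continuous(2)[OF assms]])
      (rule test_functions_zero'[OF assms])
  also have "(\<integral>t. \<bar>\<phi> t * gradient \<phi> t\<bar> \<partial>lborel) = (\<integral>t. \<bar>\<phi> t\<bar> * \<bar>gradient \<phi> t\<bar> \<partial>?M)"
    unfolding integral_leb[OF interval_borel(1)]
  proof (rule Bochner_Integration.integral_cong)
    show "\<bar>\<phi> t * gradient \<phi> t\<bar> = indicator {\<alpha>..\<beta>} t *\<^sub>R (\<bar>\<phi> t\<bar> * \<bar>gradient \<phi> t\<bar>)" for t
      using test_functions_zero'[OF assms, of t] by (cases "t \<in> {\<alpha>..\<beta>}") (simp_all add: abs_mult)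
  qed simp
  also have "\<dots> = l2inner ?M (\<lambda>t. \<bar>\<phi> t\<bar>) (\<lambda>t. \<bar>gradient \<phi> t\<bar>)" by (simp add: l2inner_def)
  also have "\<dots> \<le> l2norm ?M (\<lambda>t. \<bar>\<phi> t\<bar>) * l2norm ?M (\<lambda>t. \<bar>gradient \<phi> t\<bar>)"
  proof (rule order_trans[OF abs_ge_self l2inner_Cauchy_Schwarz])
    show "(\<lambda>t. \<bar>\<phi> t\<bar>) \<in> L2 ?M" "(\<lambda>t. \<bar>gradient \<phi> t\<bar>) \<in> L2 ?M"
      using test_functions_L2[OF interval_borel(1) assms] test_functions_gradient_L2[OF interval_borel(1) assms]
      by (auto simp: L2_def)
  qed
  also have "\<dots> = l2norm ?M \<phi> * l2norm ?M (gradient \<phi>)" by (simp add: l2norm_def l2inner_def)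
  finally show ?thesis by simp
qed

lemma weighted_bound_real:
  fixes v :: "real \<Rightarrow> real"
  assumes v: "integrable lborel v" "\<And>x. 0 \<le> v x" and u: "has_H10_gradient {\<alpha>..\<beta>} u g"
  shows "integrable (leb {\<alpha>..\<beta>}) (\<lambda>x. v x * (u x)\<^sup>2)"
    "(\<integral>x. v x * (u x)\<^sup>2 \<partial>leb {\<alpha>..\<beta>}) \<le>
      (2 * (\<integral>x. v x \<partial>lborel)) * l2norm (leb {\<alpha>..\<beta>}) u * l2norm (leb {\<alpha>..\<beta>}) g"
proof -
  let ?M = "leb {\<alpha>..\<beta>}"
  have vm: "v \<in> borel_measurable ?M" by (rule borel_measurable_leb) (use v(1) in \<open>auto dest: borel_measurable_integrable\<close>)
  have t: "(\<integral>\<^sup>+x. ennreal (v x * (\<phi> x)\<^sup>2) \<partial>?M) \<le>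
      ennreal ((2 * (\<integral>x. v x \<partial>lborel)) * l2norm ?M \<phi> * l2norm ?M (gradient \<phi>))"
    if \<phi>: "\<phi> \<in> test_functions {\<alpha>..\<beta>}" for \<phi>
  proof -
    define B where "B = 2 * l2norm ?M \<phi> * l2norm ?M (gradient \<phi>)"
    have B: "0 \<le> B" by (simp add: B_def l2norm_nonneg)
    have "(\<integral>\<^sup>+x. ennreal (v x * (\<phi> x)\<^sup>2) \<partial>?M) \<le> (\<integral>\<^sup>+x. ennreal (v x * B) * indicator {\<alpha>..\<beta>} x \<partial>lborel)"
      unfolding leb_def by (subst nn_integral_restrict_space)
        (auto intro!: nn_integral_mono ennreal_leI mult_left_mono v(2) simp: B_def test_real_sq_bound[OF \<phi>] indicator_def)
    also have "\<dots> \<le> (\<integral>\<^sup>+x. ennreal (v x * B) \<partial>lborel)" by (auto intro!: nn_integral_mono simp: indicator_def)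
    also have "\<dots> = ennreal (\<integral>x. v x * B \<partial>lborel)"
      by (rule nn_integral_eq_integral) (use v B in auto)
    finally show ?thesis by (simp add: B_def mult_ac)
  qed
  have C: "0 \<le> 2 * (\<integral>x. v x \<partial>lborel)" using v(2) by simp
  show "integrable ?M (\<lambda>x. v x * (u x)\<^sup>2)"
    "(\<integral>x. v x * (u x)\<^sup>2 \<partial>?M) \<le> (2 * (\<integral>x. v x \<partial>lborel)) * l2norm ?M u * l2norm ?M g"
    using weighted_bound_closure[OF interval_borel vm v(2) t C u] by auto
qed

lemma l2inner_bounded_mult_tendsto:
  fixes f :: "nat \<Rightarrow> 'a \<Rightarrow> 'b::euclidean_space"
  assumes "\<And>n. f n \<in> L2 M" "f0 \<in> L2 M" "l2_lim M f f0"
    and k: "k \<in> borel_measurable M" "\<And>x. x \<in> space M \<Longrightarrow> \<bar>k x\<bar> \<le> (B::real)" "B \<ge> 0"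
  shows "(\<lambda>n. l2inner M (\<lambda>x. k x *\<^sub>R f n x) (f n)) \<longlonglongrightarrow> l2inner M (\<lambda>x. k x *\<^sub>R f0 x) f0"
proof (rule l2inner_tendsto)
  have "(\<lambda>n. B * l2norm M (\<lambda>x. f n x - f0 x)) \<longlonglongrightarrow> 0" using tendsto_mult_left[OF assms(3), of B] by simp
  then show "l2_lim M (\<lambda>n x. k x *\<^sub>R f n x) (\<lambda>x. k x *\<^sub>R f0 x)"
  proof (rule l2norm_tendsto_squeeze)
    show "l2norm M (\<lambda>x. k x *\<^sub>R f n x - k x *\<^sub>R f0 x) \<le> B * l2norm M (\<lambda>x. f n x - f0 x)" for n
      using l2norm_bounded_mult[OF L2_diff[OF assms(1,2)] k] by (simp add: scaleR_diff_right)
  qed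
qed (use assms L2_bounded_mult[OF _ k(1,2)] in auto)

text \<open>A local uncertainty principle: with $F=-x/(r^2+x^2)$, expand $(u'-Fu)^2\ge 0$ and integrate
  $(Fu^2)'$ away.\<close>

lemma uncertainty_bound:
  fixes u g :: "real \<Rightarrow> real"
  assumes u: "has_H10_gradient {\<alpha>..\<beta>} u g" and r: "r > 0"
  shows "(\<integral>x. (r\<^sup>2 - 2 * x\<^sup>2) / (r\<^sup>2 + x\<^sup>2)\<^sup>2 * (u x)\<^sup>2 \<partial>leb {\<alpha>..\<beta>}) \<le> (l2norm (leb {\<alpha>..\<beta>}) g)\<^sup>2"
proof -
  let ?M = "leb {\<alpha>..\<beta>}"
  define k where "k x = (r\<^sup>2 - 2 * x\<^sup>2) / (r\<^sup>2 + x\<^sup>2)\<^sup>2" for x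
  have pos: "r\<^sup>2 + x\<^sup>2 > 0" for x using r by (simp add: add_pos_nonneg)
  have kc: "continuous_on UNIV k" unfolding k_def using pos by (intro continuous_intros) (auto simp: less_imp_neq[symmetric])
  have km: "k \<in> borel_measurable ?M" by (intro borel_measurable_leb borel_measurable_continuous_onI kc)
  \<comment> \<open>The weight is bounded, so the inequality passes from test functions to their
    closure by L^2 convergence alone.\<close>
  have kb: "\<bar>k x\<bar> \<le> 2 / r\<^sup>2" for x
  proof -
    have "\<bar>r\<^sup>2 - 2 * x\<^sup>2\<bar> \<le> 2 * (r\<^sup>2 + x\<^sup>2)" using r by (simp add: abs_le_iff)
    then have "\<bar>k x\<bar> \<le> 2 * (r\<^sup>2 + x\<^sup>2) / (r\<^sup>2 + x\<^sup>2)\<^sup>2" unfolding k_def abs_divide by (simp add: divide_right_mono)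
    also have "\<dots> = 2 / (r\<^sup>2 + x\<^sup>2)"
    proof -
      have "2 * s / s\<^sup>2 = 2 / s" if "s > 0" for s :: real using that by (simp add: power2_eq_square)
      then show ?thesis using pos by blast
    qed
    also have "\<dots> \<le> 2 / r\<^sup>2" using r by (intro divide_left_mono) (auto intro: mult_pos_pos pos)
    finally show ?thesis .
  qed
  have test: "l2inner ?M (\<lambda>x. k x *\<^sub>R \<phi> x) \<phi> \<le> l2inner ?M (gradient \<phi>) (gradient \<phi>)"
    if \<phi>: "\<phi> \<in> test_functions {\<alpha>..\<beta>}" for \<phi>
  proof (cases "\<alpha> \<le> \<beta>")
    case False
    then have "{\<alpha>..\<beta>} = {}" by simp
    then show ?thesis by (simp add: l2inner_def integral_leb)
  next
    case True
    define F where "F x = - x / (r\<^sup>2 + x\<^sup>2)" for x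
    define F' where "F' x = (x\<^sup>2 - r\<^sup>2) / (r\<^sup>2 + x\<^sup>2)\<^sup>2" for x
    have F': "(F has_real_derivative F' x) (at x)" for x
    proof -
      have "((\<lambda>x. - x / (r\<^sup>2 + x\<^sup>2)) has_real_derivative
          ((- 1) * (r\<^sup>2 + x\<^sup>2) - (- x) * (2 * x)) / ((r\<^sup>2 + x\<^sup>2) * (r\<^sup>2 + x\<^sup>2))) (at x)"
        by (rule DERIV_divide) (use pos[of x] in \<open>auto intro!: derivative_eq_intros\<close>)
      moreover have "(- 1) * (r\<^sup>2 + x\<^sup>2) - (- x) * (2 * x) = x\<^sup>2 - r\<^sup>2" by (simp add: power2_eq_square)
      ultimately show ?thesis unfolding F_def[abs_def] F'_def power2_eq_square[of "r\<^sup>2 + x\<^sup>2"] by (simp only:)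
    qed
    have kF: "k x = - F' x - (F x)\<^sup>2" for x
    proof -
      have "- F' x - (F x)\<^sup>2 = ((r\<^sup>2 - x\<^sup>2) - x\<^sup>2) / (r\<^sup>2 + x\<^sup>2)\<^sup>2"
        unfolding F'_def F_def by (simp add: power_divide diff_divide_distrib)
      then show ?thesis by (simp add: k_def)
    qed
    define D where "D x = F' x * (\<phi> x)\<^sup>2 + 2 * F x * \<phi> x * gradient \<phi> x" for x
    have Fc: "continuous_on UNIV F" by (rule DERIV_continuous_on) (use F' in \<open>auto intro: DERIV_subset\<close>)
    have F'c: "continuous_on UNIV F'"
      unfolding F'_def using pos by (intro continuous_intros) (auto simp: less_imp_neq[symmetric])
    have Dc: "continuous_on UNIV D" unfolding D_def
      by (intro continuous_intros test_real_continuous[OF \<phi>] Fc F'c)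
    have FTC: "(\<integral>x. D x * indicator {\<alpha>..\<beta>} x \<partial>lborel) = F \<beta> * (\<phi> \<beta>)\<^sup>2 - F \<alpha> * (\<phi> \<alpha>)\<^sup>2"
    proof (rule integral_FTC_Icc_real[OF True])
      show "((\<lambda>x. F x * (\<phi> x)\<^sup>2) has_real_derivative D x) (at x)" for x
        unfolding D_def by (auto intro!: derivative_eq_intros F' test_real_DERIV[OF \<phi>])
      show "isCont D x" for x using Dc by (simp add: continuous_on_eq_continuous_at)
    qed
    have "\<phi> \<alpha> = 0" "\<phi> \<beta> = 0" by (rule test_functions_zero[OF \<phi>], simp)+
    with FTC have D0: "(\<integral>x. D x \<partial>?M) = 0" by (simp add: integral_leb mult.commute)
    have ci: "integrable ?M f" if "continuous_on UNIV f" for f :: "real \<Rightarrow> real"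
      unfolding integrable_leb[OF interval_borel(1)]
      by (rule borel_integrable_compact) (auto intro: continuous_on_subset[OF that])
    have "l2inner ?M (\<lambda>x. k x *\<^sub>R \<phi> x) \<phi> + 0 = (\<integral>x. k x *\<^sub>R \<phi> x \<bullet> \<phi> x \<partial>?M) + (\<integral>x. D x \<partial>?M)"
      by (simp add: l2inner_def D0)
    also have "\<dots> = (\<integral>x. k x *\<^sub>R \<phi> x \<bullet> \<phi> x + D x \<partial>?M)"
      by (intro Bochner_Integration.integral_add[symmetric] ci Dc continuous_intros kc test_real_continuous[OF \<phi>])
    also have "\<dots> \<le> (\<integral>x. gradient \<phi> x \<bullet> gradient \<phi> x \<partial>?M)"
    proof (rule integral_mono)
      fix x
      have "0 \<le> (gradient \<phi> x - F x * \<phi> x)\<^sup>2" by simp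
      then show "k x *\<^sub>R \<phi> x \<bullet> \<phi> x + D x \<le> gradient \<phi> x \<bullet> gradient \<phi> x"
        by (simp add: kF D_def power2_eq_square algebra_simps)
    qed (intro ci Dc continuous_intros kc test_real_continuous[OF \<phi>])+
    finally show ?thesis by (simp add: l2inner_def)
  qed
  obtain p where p: "\<And>n::nat. p n \<in> test_functions {\<alpha>..\<beta>}"
    "l2_lim ?M p u" "l2_lim ?M (\<lambda>n. gradient (p n)) g"
    by (rule has_H10_gradient_approx[OF u], rule that)
  note L = has_H10_gradient_L2[OF u]
  have 1: "(\<lambda>n. l2inner ?M (\<lambda>x. k x *\<^sub>R p n x) (p n)) \<longlonglongrightarrow> l2inner ?M (\<lambda>x. k x *\<^sub>R u x) u"
    by (rule l2inner_bounded_mult_tendsto[OF test_functions_L2[OF interval_borel(1) p(1)] L(1) p(2) km kb]) simp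
  have 2: "(\<lambda>n. l2inner ?M (gradient (p n)) (gradient (p n))) \<longlonglongrightarrow> l2inner ?M g g"
    by (intro l2inner_tendsto test_functions_gradient_L2[OF interval_borel(1) p(1)] L p)
  have "l2inner ?M (\<lambda>x. k x *\<^sub>R u x) u \<le> l2inner ?M g g"
    by (rule LIMSEQ_le[OF 1 2]) (use test[OF p(1)] in auto)
  then show ?thesis unfolding l2norm_sq by (simp add: l2inner_def k_def power2_eq_square mult.assoc)
qed

lemma integral_continuous_antiderivative:
  fixes \<psi> :: "real \<Rightarrow> real"
  assumes "continuous_on UNIV \<psi>"
  obtains \<Psi> where "\<And>x. (\<Psi> has_real_derivative \<psi> x) (at x)" "\<Psi> c = 0"
proof (rule that[of "\<lambda>u. LBINT y=c..u. \<psi> y"])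
  fix x
  define l where "l = min c x - 1"
  define m where "m = max c x + 1"
  have "((\<lambda>u. LBINT y=c..u. \<psi> y) has_vector_derivative \<psi> x) (at x within {l..m})"
    by (rule interval_integral_FTC2) (auto simp: l_def m_def intro: continuous_on_subset[OF assms])
  moreover have "at x within {l..m} = at x" by (rule at_within_Icc_at) (auto simp: l_def m_def)
  ultimately show "((\<lambda>u. LBINT y=c..u. \<psi> y) has_real_derivative \<psi> x) (at x)"
    by (simp add: has_real_derivative_iff_has_vector_derivative)
qed simp

text \<open>The antiderivative from the left end is constant on either side of the support of
  \<psi>. The constant on the right is the total integral, so \<open>zero\<close> makes the support
  compact in the open interval.\<close>

lemma test_antiderivative:
  fixes \<psi> :: "real \<Rightarrow> real"
  assumes \<psi>: "\<psi> \<in> test_functions {\<alpha>..\<beta>}" and zero: "(\<integral>x. \<psi> x \<partial>leb {\<alpha>..\<beta>}) = 0"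
  obtains \<Psi> where "\<Psi> \<in> test_functions {\<alpha>..\<beta>}" "gradient \<Psi> = \<psi>"
    "\<And>x. x \<in> {\<alpha>..\<beta>} \<Longrightarrow> \<Psi> x = (\<integral>t. indicator {\<alpha>..x} t * \<psi> t \<partial>leb {\<alpha>..\<beta>})"
proof (cases "\<alpha> < \<beta>")
  case False
  then have "interior {\<alpha>..\<beta>} = {}" by simp
  then have "\<psi> = (\<lambda>x. 0)" using test_functions_zero[OF \<psi>] by auto
  moreover have "gradient (\<lambda>x::real. 0) = (\<lambda>x. 0)"
    by (rule ext) (use test_functions_gradient_zero[of "\<lambda>x. 0" "{}"] test_functions_0 in auto)
  ultimately show thesis using that[OF test_functions_0] by simp
next
  case True
  have c: "continuous_on UNIV \<psi>" by (rule test_real_continuous[OF \<psi>])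
  obtain \<Psi> where \<Psi>: "\<And>x. (\<Psi> has_real_derivative \<psi> x) (at x)" "\<Psi> \<alpha> = 0"
    by (rule integral_continuous_antiderivative[OF c, where c=\<alpha>], rule that)
  have FTC: "\<Psi> x = (\<integral>t. \<psi> t * indicator {\<alpha>..x} t \<partial>lborel)" if "\<alpha> \<le> x" for x
    using c \<Psi>(2)
    by (subst integral_FTC_Icc_real[OF that, of \<Psi>]) (auto simp: continuous_on_eq_continuous_at intro: \<Psi>(1))
  have rep: "\<Psi> x = (\<integral>t. indicator {\<alpha>..x} t * \<psi> t \<partial>leb {\<alpha>..\<beta>})" if "x \<in> {\<alpha>..\<beta>}" for x
  proof -
    have "(\<integral>t. indicator {\<alpha>..x} t * \<psi> t \<partial>leb {\<alpha>..\<beta>}) = (\<integral>t. \<psi> t * indicator {\<alpha>..x} t \<partial>lborel)"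
      unfolding integral_leb[OF interval_borel(1)]
      by (rule Bochner_Integration.integral_cong) (use that in \<open>auto simp: indicator_def\<close>)
    then show ?thesis using FTC[of x] that by simp
  qed
  have \<Psi>\<beta>: "\<Psi> \<beta> = 0"
    using rep[of \<beta>] zero True unfolding integral_leb[OF interval_borel(1)] by (simp add: mult.assoc[symmetric] flip: indicator_inter_arith)
  obtain K where K: "compact K" "K \<subseteq> interior {\<alpha>..\<beta>}" "\<forall>x. x \<notin> K \<longrightarrow> \<psi> x = 0"
    using test_functionsD(2)[OF \<psi>] by blast
  obtain p q where pq: "\<alpha> < p" "p < \<beta>" "\<alpha> < q" "q < \<beta>" "K \<subseteq> {p..q}"
  proof (cases "K = {}")
    case True
    show thesis by (rule that[of "(\<alpha>+\<beta>)/2" "(\<alpha>+\<beta>)/2"]) (use \<open>\<alpha> < \<beta>\<close> True in auto)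
  next
    case False
    obtain l where l: "l \<in> K" "\<forall>x\<in>K. l \<le> x" using compact_attains_inf[OF K(1) False] by blast
    obtain m where m: "m \<in> K" "\<forall>x\<in>K. x \<le> m" using compact_attains_sup[OF K(1) False] by blast
    show thesis by (rule that[of l m]) (use l m K(2) in auto)
  qed
  have lo: "\<Psi> x = 0" if "x < p" for x
  proof -
    have "\<Psi> x = \<Psi> \<alpha>"
    proof (rule DERIV_zero_connected_constant[of "{..<p}" "{}" \<Psi>])
      show "\<forall>x\<in>{..<p} - {}. (\<Psi> has_real_derivative 0) (at x)"
      proof
        fix x assume "x \<in> {..<p} - {}"
        then have "\<psi> x = 0" using K(3) pq(5) by auto
        then show "(\<Psi> has_real_derivative 0) (at x)" using \<Psi>(1)[of x] by simp
      qed
      show "continuous_on {..<p} \<Psi>" by (rule DERIV_continuous_on) (use \<Psi>(1) in \<open>auto intro: DERIV_subset\<close>)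
    qed (use that pq in auto)
    then show ?thesis using \<Psi>(2) by simp
  qed
  have hi: "\<Psi> x = 0" if "q < x" for x
  proof -
    have "\<Psi> x = \<Psi> \<beta>"
    proof (rule DERIV_zero_connected_constant[of "{q<..}" "{}" \<Psi>])
      show "\<forall>x\<in>{q<..} - {}. (\<Psi> has_real_derivative 0) (at x)"
      proof
        fix x assume "x \<in> {q<..} - {}"
        then have "\<psi> x = 0" using K(3) pq(5) by auto
        then show "(\<Psi> has_real_derivative 0) (at x)" using \<Psi>(1)[of x] by simp
      qed
      show "continuous_on {q<..} \<Psi>" by (rule DERIV_continuous_on) (use \<Psi>(1) in \<open>auto intro: DERIV_subset\<close>)
    qed (use that pq in auto)
    then show ?thesis using \<Psi>\<beta> by simp
  qed
  have "gradient \<Psi> = \<psi>" unfolding gradient_real[abs_def] using partial_real[OF \<Psi>(1)] by auto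
  moreover have "\<Psi> \<in> test_functions {\<alpha>..\<beta>}"
    by (rule test_functionsI[of _ "{p..q}"])
      (use pq lo hi smooth_antiderivative[OF test_functionsD(1)[OF \<psi>] \<Psi>(1)] in auto)
  ultimately show thesis using that rep by blast
qed

text \<open>A square integrable \<open>g\<close> of mean zero is approximated by test functions of
  mean zero, whose antiderivatives are again test functions and converge uniformly. This criterion
  is used for \<open>sin\<close> and for fibre integrals, where no approximating sequence is at
  hand.\<close>

lemma has_H10_gradient_antiderivative:
  fixes u g :: "real \<Rightarrow> real"
  assumes ab: "\<alpha> < \<beta>" and g: "g \<in> L2 (leb {\<alpha>..\<beta>})" "(\<integral>x. g x \<partial>leb {\<alpha>..\<beta>}) = 0"
    and u: "\<And>x. x \<in> {\<alpha>..\<beta>} \<Longrightarrow> u x = (\<integral>t. indicator {\<alpha>..x} t * g t \<partial>leb {\<alpha>..\<beta>})"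
  shows "has_H10_gradient {\<alpha>..\<beta>} u g"
proof -
  let ?M = "leb {\<alpha>..\<beta>}"
  interpret finite_measure ?M by (rule finite_measure_leb[OF interval_borel])
  have oL: "(\<lambda>x. 1::real) \<in> L2 ?M" by (simp add: L2_def)
  define K where "K = sqrt (measure ?M (space ?M))"
  have intb: "\<bar>\<integral>t. indicator A t * f t \<partial>?M\<bar> \<le> l2norm ?M f * K" if "f \<in> L2 ?M" "A \<in> sets borel" for f :: "real \<Rightarrow> real" and A
  proof -
    have "\<bar>\<integral>t. indicator A t * f t \<partial>?M\<bar> \<le> (\<integral>t. norm (indicator A t * f t) \<partial>?M)"
      using integral_norm_bound[of ?M "\<lambda>t. indicator A t * f t"] by simp
    also have "\<dots> \<le> (\<integral>t. norm (f t) \<partial>?M)"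
      using L2_norm_integral_le(1)[OF that(1)] by (intro integral_mono_AE') (auto simp: indicator_def)
    finally show ?thesis using L2_norm_integral_le(2)[OF that(1)] by (simp add: K_def)
  qed
  have int1: "\<bar>\<integral>t. f t \<partial>?M\<bar> \<le> l2norm ?M f * K" if "f \<in> L2 ?M" for f :: "real \<Rightarrow> real"
    using intb[OF that, of UNIV] by simp
  \<comment> \<open>If every test function had integral 0, the constant 1 would vanish almost
    everywhere by the fundamental lemma.\<close>
  obtain \<rho>0 where \<rho>0: "\<rho>0 \<in> test_functions {\<alpha>..\<beta>}" "(\<integral>x. \<rho>0 x \<partial>?M) \<noteq> 0"
  proof (rule ccontr)
    assume "\<not> thesis"
    then have "(\<integral>x. \<rho> x \<partial>?M) = 0" if "\<rho> \<in> test_functions {\<alpha>..\<beta>}" for \<rho> using that \<open>\<And>\<rho>0. \<lbrakk>\<rho>0 \<in> test_functions {\<alpha>..\<beta>}; (\<integral>x. \<rho>0 x \<partial>?M) \<noteq> 0\<rbrakk> \<Longrightarrow> thesis\<close> by blast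
    then have "AE x in ?M. x \<in> interior {\<alpha>..\<beta>} \<longrightarrow> (1::real) = 0"
      by (intro test_functions_fundamental[OF interval_borel(1) oL]) (simp add: l2inner_def)
    with AE_interval_interior have "AE x in ?M. False" by eventually_elim auto
    then have "emeasure ?M {\<alpha>..\<beta>} = 0"
      using AE_iff_measurable[OF _ refl, of ?M "\<lambda>_. False"] sets.top[of ?M] by (simp add: atLeastAtMost_def Int_def)
    then have "emeasure lborel {\<alpha>..\<beta>} = 0" by (simp add: leb_def emeasure_restrict_space)
    then show False using ab by simp
  qed
  define \<rho> where "\<rho> x = 0 + (1 / (\<integral>x. \<rho>0 x \<partial>?M)) * \<rho>0 x" for x
  have \<rho>: "\<rho> \<in> test_functions {\<alpha>..\<beta>}" unfolding \<rho>_def by (rule test_functions_lincomb[OF test_functions_0 \<rho>0(1)])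
  have \<rho>1: "(\<integral>x. \<rho> x \<partial>?M) = 1" using \<rho>0(2) by (simp add: \<rho>_def)
  obtain \<psi> where \<psi>: "\<And>n::nat. \<psi> n \<in> test_functions {\<alpha>..\<beta>}" "l2_lim ?M \<psi> g"
    by (rule test_functions_dense_seq[OF interval_borel AE_interval_interior g(1)], rule that)
  define c where "c n = (\<integral>x. \<psi> n x \<partial>?M)" for n
  \<comment> \<open>Subtracting \<open>c n\<close> times a bump of integral 1 restores mean zero;
    the correction tends to 0 because \<open>g\<close> has mean zero.\<close>
  define \<eta> where "\<eta> n x = \<psi> n x + (- c n) * \<rho> x" for n x
  have \<eta>: "\<eta> n \<in> test_functions {\<alpha>..\<beta>}" for n unfolding \<eta>_def by (rule test_functions_lincomb[OF \<psi>(1) \<rho>])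
  note TL = test_functions_L2[OF interval_borel(1)]
  have i: "integrable ?M \<psi>'" if "\<psi>' \<in> test_functions {\<alpha>..\<beta>}" for \<psi>' :: "real \<Rightarrow> real"
    by (rule L2_norm_integral_le(1)[OF TL[OF that]])
  have \<eta>0: "(\<integral>x. \<eta> n x \<partial>?M) = 0" for n
    unfolding \<eta>_def using i[OF \<psi>(1)] i[OF \<rho>] by (simp add: \<rho>1 c_def)
  have cb: "\<bar>c n\<bar> \<le> l2norm ?M (\<lambda>x. \<psi> n x - g x) * K" for n
    using int1[OF L2_diff[OF TL[OF \<psi>(1)] g(1)], of n] i[OF \<psi>(1)] L2_norm_integral_le(1)[OF g(1)] g(2)
    by (simp add: c_def)
  have \<eta>g: "l2_lim ?M \<eta> g"
  proof (rule l2norm_tendsto_squeeze)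
    have "(\<lambda>n. l2norm ?M (\<lambda>x. \<psi> n x - g x) + l2norm ?M (\<lambda>x. \<psi> n x - g x) * K * l2norm ?M \<rho>) \<longlonglongrightarrow> 0 + 0 * K * l2norm ?M \<rho>"
      by (intro tendsto_intros \<psi>)
    then show "(\<lambda>n. l2norm ?M (\<lambda>x. \<psi> n x - g x) + l2norm ?M (\<lambda>x. \<psi> n x - g x) * K * l2norm ?M \<rho>) \<longlonglongrightarrow> 0" by simp
    fix n
    have "(\<lambda>x. \<eta> n x - g x) = (\<lambda>x. (\<psi> n x - g x) + (- c n) *\<^sub>R \<rho> x)" by (auto simp: \<eta>_def)
    then have "l2norm ?M (\<lambda>x. \<eta> n x - g x) \<le> l2norm ?M (\<lambda>x. \<psi> n x - g x) + \<bar>- c n\<bar> * l2norm ?M \<rho>"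
      using l2norm_triangle[OF L2_diff[OF TL[OF \<psi>(1)[of n]] g(1)] L2_scaleR[OF TL[OF \<rho>], of "- c n"]]
      by (simp only: l2norm_scaleR)
    also have "\<dots> \<le> l2norm ?M (\<lambda>x. \<psi> n x - g x) + l2norm ?M (\<lambda>x. \<psi> n x - g x) * K * l2norm ?M \<rho>"
      using cb[of n] by (simp add: mult_right_mono l2norm_nonneg)
    finally show "l2norm ?M (\<lambda>x. \<eta> n x - g x) \<le> l2norm ?M (\<lambda>x. \<psi> n x - g x) + l2norm ?M (\<lambda>x. \<psi> n x - g x) * K * l2norm ?M \<rho>" .
  qed
  have "\<exists>\<Psi>. \<Psi> \<in> test_functions {\<alpha>..\<beta>} \<and> gradient \<Psi> = \<eta> n \<and>
      (\<forall>x\<in>{\<alpha>..\<beta>}. \<Psi> x = (\<integral>t. indicator {\<alpha>..x} t * \<eta> n t \<partial>?M))" for n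
    by (rule test_antiderivative[OF \<eta> \<eta>0, of n]) blast
  then obtain \<Psi> where \<Psi>: "\<And>n. \<Psi> n \<in> test_functions {\<alpha>..\<beta>}" "\<And>n. gradient (\<Psi> n) = \<eta> n"
      "\<And>n x. x \<in> {\<alpha>..\<beta>} \<Longrightarrow> \<Psi> n x = (\<integral>t. indicator {\<alpha>..x} t * \<eta> n t \<partial>?M)" by metis
  have dif: "\<bar>\<Psi> n x - u x\<bar> \<le> l2norm ?M (\<lambda>x. \<eta> n x - g x) * K" if "x \<in> {\<alpha>..\<beta>}" for n x
  proof -
    have ii: "integrable ?M (\<lambda>t. indicator {\<alpha>..x} t * f t)" if "f \<in> L2 ?M" for f :: "real \<Rightarrow> real"
    proof -
      have "indicator {\<alpha>..x} \<in> borel_measurable ?M" by (intro borel_measurable_leb) auto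
      then have "(\<lambda>t. indicator {\<alpha>..x} t *\<^sub>R f t) \<in> L2 ?M"
        by (rule L2_bounded_mult[OF that, of _ 1]) (simp add: indicator_def)
      then show ?thesis using L2_norm_integral_le(1) by fastforce
    qed
    have "\<Psi> n x - u x = (\<integral>t. indicator {\<alpha>..x} t * (\<eta> n t - g t) \<partial>?M)"
      using \<Psi>(3)[OF that] u[OF that] ii[OF TL[OF \<eta>]] ii[OF g(1)] by (simp add: right_diff_distrib)
    then show ?thesis using intb[OF L2_diff[OF TL[OF \<eta>[of n]] g(1)], of "{\<alpha>..x}"] by simp
  qed
  have lim0: "(\<lambda>n. l2norm ?M (\<lambda>x. \<eta> n x - g x) * K) \<longlonglongrightarrow> 0"
    using tendsto_mult_right[OF \<eta>g, of K] by simp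
  have um: "u \<in> borel_measurable ?M"
  proof (rule borel_measurable_LIMSEQ_metric[of \<Psi>])
    show "\<Psi> n \<in> borel_measurable ?M" for n by (rule smooth_measurable_leb[OF test_functionsD(1)[OF \<Psi>(1)]])
    fix x assume "x \<in> space ?M"
    then have "(\<lambda>n. \<Psi> n x - u x) \<longlonglongrightarrow> 0" using dif by (intro LIMSEQ_null_squeeze[OF lim0]) auto
    then show "(\<lambda>n. \<Psi> n x) \<longlonglongrightarrow> u x" by (rule LIM_zero_cancel)
  qed
  have dm: "(\<lambda>x. \<Psi> n x - u x) \<in> borel_measurable ?M" for n
    using um smooth_measurable_leb[OF test_functionsD(1)[OF \<Psi>(1)[of n]], of "{\<alpha>..\<beta>}"] by simp
  have uL: "u \<in> L2 ?M"
  proof -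
    have "(\<lambda>x. \<Psi> 0 x - u x) \<in> L2 ?M"
    proof (rule L2_dominated[OF dm, of "\<lambda>x. (l2norm ?M (\<lambda>x. \<eta> 0 x - g x) * K)\<^sup>2"])
      show "(norm (\<Psi> 0 x - u x))\<^sup>2 \<le> (l2norm ?M (\<lambda>x. \<eta> 0 x - g x) * K)\<^sup>2" if "x \<in> space ?M" for x
        unfolding real_norm_def by (rule power_mono[OF dif]) (use that in auto)
    qed simp
    from L2_diff[OF TL[OF \<Psi>(1)[of 0]] this] show ?thesis by simp
  qed
  have conv: "l2_lim ?M \<Psi> u"
  proof (rule l2norm_tendsto_squeeze)
    show "(\<lambda>n. (l2norm ?M (\<lambda>x. \<eta> n x - g x) * K) * l2norm ?M (\<lambda>x. 1::real)) \<longlonglongrightarrow> 0"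
      using tendsto_mult_right[OF lim0] by simp
    fix n
    have nn: "0 \<le> l2norm ?M (\<lambda>x. \<eta> n x - g x) * K" by (simp add: l2norm_nonneg K_def)
    have "l2norm ?M (\<lambda>x. \<Psi> n x - u x) \<le> l2norm ?M (\<lambda>x. (l2norm ?M (\<lambda>x. \<eta> n x - g x) * K) *\<^sub>R (1::real))"
      by (rule l2norm_mono[OF dm L2_scaleR[OF oL]]) (use dif nn in auto)
    then show "l2norm ?M (\<lambda>x. \<Psi> n x - u x) \<le> (l2norm ?M (\<lambda>x. \<eta> n x - g x) * K) * l2norm ?M (\<lambda>x. 1::real)"
      unfolding l2norm_scaleR using nn by simp
  qed
  show ?thesis unfolding has_H10_gradient_def
    using uL g(1) \<Psi>(1) conv \<eta>g by (intro conjI exI[of _ \<Psi>]) (simp_all add: \<Psi>(2))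
qed

section \<open>Fibre integrals in the plane\<close>

lemma nn_integral_plane:
  fixes f :: "real \<times> real \<Rightarrow> ennreal"
  assumes "f \<in> borel_measurable borel"
  shows "(\<integral>\<^sup>+p. f p \<partial>lborel) = (\<integral>\<^sup>+x. \<integral>\<^sup>+y. f (x, y) \<partial>lborel \<partial>lborel)"
    "(\<integral>\<^sup>+p. f p \<partial>lborel) = (\<integral>\<^sup>+y. \<integral>\<^sup>+x. f (x, y) \<partial>lborel \<partial>lborel)"
proof -
  have m: "f \<in> borel_measurable (lborel \<Otimes>\<^sub>M lborel)" using assms by (simp add: lborel_prod)
  show "(\<integral>\<^sup>+p. f p \<partial>lborel) = (\<integral>\<^sup>+x. \<integral>\<^sup>+y. f (x, y) \<partial>lborel \<partial>lborel)"
    using lborel.nn_integral_fst[OF m] by (simp add: lborel_prod)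
  show "(\<integral>\<^sup>+p. f p \<partial>lborel) = (\<integral>\<^sup>+y. \<integral>\<^sup>+x. f (x, y) \<partial>lborel \<partial>lborel)"
    using lborel_pair.nn_integral_snd[OF m] by (simp add: lborel_prod)
qed

lemma integral_plane:
  fixes f :: "real \<times> real \<Rightarrow> real"
  assumes "integrable lborel f"
  shows "(\<integral>p. f p \<partial>lborel) = (\<integral>x. (\<integral>y. f (x, y) \<partial>lborel) \<partial>lborel)"
    "(\<integral>p. f p \<partial>lborel) = (\<integral>y. (\<integral>x. f (x, y) \<partial>lborel) \<partial>lborel)"
    "integrable lborel (\<lambda>x. \<integral>y. f (x, y) \<partial>lborel)"
    "AE x in lborel. integrable lborel (\<lambda>y. f (x, y))"
proof -
  have i: "integrable (lborel \<Otimes>\<^sub>M lborel) f" using assms by (simp add: lborel_prod)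
  show "(\<integral>p. f p \<partial>lborel) = (\<integral>x. (\<integral>y. f (x, y) \<partial>lborel) \<partial>lborel)"
    using lborel_pair.integral_fst'[OF i] by (simp add: lborel_prod)
  then show "(\<integral>p. f p \<partial>lborel) = (\<integral>y. (\<integral>x. f (x, y) \<partial>lborel) \<partial>lborel)"
    using lborel_pair.Fubini_integral[of "\<lambda>x y. f (x, y)"] i by simp
  show "integrable lborel (\<lambda>x. \<integral>y. f (x, y) \<partial>lborel)" by (rule lborel_pair.integrable_fst'[OF i])
  show "AE x in lborel. integrable lborel (\<lambda>y. f (x, y))" by (rule lborel_pair.AE_integrable_fst'[OF i])
qed

lemma measurable_plane_slice:
  fixes f :: "real \<times> real \<Rightarrow> 'b::{second_countable_topology, real_normed_vector}"
  assumes "f \<in> borel_measurable borel"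
  shows "(\<lambda>y. f (x, y)) \<in> borel_measurable borel" "(\<lambda>x. f (x, y)) \<in> borel_measurable borel"
  by (rule measurable_compose[OF _ assms], rule borel_measurable_continuous_onI, intro continuous_intros)+

lemma measurable_integral_slice:
  fixes f :: "real \<times> real \<Rightarrow> real"
  assumes "f \<in> borel_measurable borel"
  shows "(\<lambda>x. \<integral>y. f (x, y) \<partial>lborel) \<in> borel_measurable borel"
proof -
  have "f \<in> borel_measurable (lborel \<Otimes>\<^sub>M lborel)" using assms by (simp add: lborel_prod)
  then have "(\<lambda>(x, y). f (x, y)) \<in> borel_measurable (lborel \<Otimes>\<^sub>M lborel)" by simp
  then have "(\<lambda>x. \<integral>y. f (x, y) \<partial>lborel) \<in> borel_measurable lborel"
    by (intro lborel.borel_measurable_lebesgue_integral)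
  then show ?thesis by simp
qed

lemma e_Basis: "(1, 0) \<in> (Basis :: (real \<times> real) set)" "(0, 1) \<in> (Basis :: (real \<times> real) set)"
  by (auto simp: Basis_prod_def)

lemma smooth_slice_DERIV:
  fixes \<phi> :: "real \<times> real \<Rightarrow> real"
  assumes "smooth \<phi>"
  shows "((\<lambda>t. \<phi> (t, y)) has_real_derivative partial (1, 0) \<phi> (t, y)) (at t)"
    "((\<lambda>t. \<phi> (x, t)) has_real_derivative partial (0, 1) \<phi> (x, t)) (at t)"
  using smooth_line_derivative[OF assms, of "(0, y)" "(1, 0)" t] smooth_line_derivative[OF assms, of "(x, 0)" "(0, 1)" t]
  by simp_all

lemma smooth_slice_continuous:
  fixes \<phi> :: "real \<times> real \<Rightarrow> real"
  assumes "smooth \<phi>" shows "continuous_on T (\<lambda>t. \<phi> (t, y))" "continuous_on T (\<lambda>t. \<phi> (x, t))"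
  by (rule continuous_on_compose2[OF smooth_continuous_on[OF assms, of UNIV]], intro continuous_intros, simp)+

lemma test_functions_plane_bounded_support:
  fixes \<phi> :: "real \<times> real \<Rightarrow> real"
  assumes "\<phi> \<in> test_functions S"
  obtains R where "R > 0" "\<And>x y. x \<notin> {-R..R} \<or> y \<notin> {-R..R} \<Longrightarrow> \<phi> (x, y) = 0"
proof -
  obtain K where K: "compact K" "\<forall>x. x \<notin> K \<longrightarrow> \<phi> x = 0" using test_functionsD(2)[OF assms] by blast
  obtain R where R: "R > 0" "\<forall>x\<in>K. norm x \<le> R" using compact_imp_bounded[OF K(1)] by (auto simp: bounded_pos)
  show thesis
  proof (rule that[OF R(1)])
    fix x y assume a: "x \<notin> {-R..R} \<or> y \<notin> {-R..R}"
    have "(x, y) \<notin> K"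
    proof
      assume "(x, y) \<in> K"
      then have n: "norm (x, y) \<le> R" using R by blast
      have "\<bar>x\<bar> \<le> norm (x, y)" "\<bar>y\<bar> \<le> norm (x, y)" using norm_fst_le[of x y] norm_snd_le[of y x] by simp_all
      then show False using n a by auto
    qed
    then show "\<phi> (x, y) = 0" using K(2) by blast
  qed
qed

lemma partial_le_gradient:
  fixes \<phi> :: "real \<times> real \<Rightarrow> real"
  assumes "i \<in> Basis" shows "\<bar>partial i \<phi> p\<bar> \<le> norm (gradient \<phi> p)"
  using Basis_le_norm[OF assms, of "gradient \<phi> p"] by (simp add: gradient_inner[OF assms])

text \<open>The one-dimensional bound on each horizontal line, where a test function has compact
  support whatever the shape of \<open>S\<close>: \<phi>(x,y)^2 is at most 2 H(y) for every x, and
  the weight depends on x alone, so the double integral factorises.\<close>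

lemma weighted_bound_plane:
  fixes v :: "real \<Rightarrow> real" and S :: "(real \<times> real) set"
  assumes v: "integrable lborel v" "\<And>x. 0 \<le> v x" and S: "S \<in> sets borel" "bounded S"
    and u: "has_H10_gradient S u g"
  shows "integrable (leb S) (\<lambda>p. v (fst p) * (u p)\<^sup>2)"
    "(\<integral>p. v (fst p) * (u p)\<^sup>2 \<partial>leb S) \<le> (2 * (\<integral>x. v x \<partial>lborel)) * l2norm (leb S) u * l2norm (leb S) g"
proof -
  let ?M = "leb S"
  have vb[measurable]: "v \<in> borel_measurable borel" using v(1) by (auto dest: borel_measurable_integrable)
  have vf[measurable]: "(\<lambda>p::real \<times> real. v (fst p)) \<in> borel_measurable borel"
    by (rule measurable_compose[OF _ vb]) (intro borel_measurable_continuous_onI continuous_intros)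
  have vm: "(\<lambda>p. v (fst p)) \<in> borel_measurable ?M" by (rule borel_measurable_leb[OF vf])
  have t: "(\<integral>\<^sup>+p. ennreal (v (fst p) * (\<phi> p)\<^sup>2) \<partial>?M) \<le>
      ennreal ((2 * (\<integral>x. v x \<partial>lborel)) * l2norm ?M \<phi> * l2norm ?M (gradient \<phi>))"
    if \<phi>: "\<phi> \<in> test_functions S" for \<phi>
  proof -
    note sm = test_functionsD(1)[OF \<phi>]
    have [measurable]: "\<phi> \<in> borel_measurable borel" "partial (1, 0) \<phi> \<in> borel_measurable borel"
      by (intro smooth_measurable sm smooth_partial e_Basis)+
    obtain R where R: "R > 0" "\<And>x y. x \<notin> {-R..R} \<or> y \<notin> {-R..R} \<Longrightarrow> \<phi> (x, y) = 0"
      by (rule test_functions_plane_bounded_support[OF \<phi>], rule that) auto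
    define H where "H y = (\<integral>\<^sup>+t. ennreal \<bar>\<phi> (t, y) * partial (1, 0) \<phi> (t, y)\<bar> \<partial>lborel)" for y
    have sq: "ennreal ((\<phi> (x, y))\<^sup>2) \<le> 2 * H y" for x y
    proof -
      have c: "continuous_on UNIV (\<lambda>t. partial (1, 0) \<phi> (t, y))"
        by (rule smooth_slice_continuous(1)[OF smooth_partial[OF sm e_Basis(1)]])
      have z: "\<phi> (t, y) = 0" if "t \<notin> {-R..R}" for t using R(2) that by blast
      note CB = compact_support_sq_bound[OF smooth_slice_DERIV(1)[OF sm] c z]
      have "ennreal ((\<phi> (x, y))\<^sup>2) \<le> ennreal (2 * (\<integral>t. \<bar>\<phi> (t, y) * partial (1, 0) \<phi> (t, y)\<bar> \<partial>lborel))"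
        by (rule ennreal_leI, rule CB(2))
      also have "\<dots> = 2 * H y"
        unfolding H_def by (subst nn_integral_eq_integral) (use CB(1) in \<open>auto simp: ennreal_mult\<close>)
      finally show ?thesis .
    qed
    have Hm: "H \<in> borel_measurable borel"
    proof -
      have "(\<lambda>p. ennreal \<bar>\<phi> (snd p, fst p) * partial (1, 0) \<phi> (snd p, fst p)\<bar>) \<in> borel_measurable (lborel \<Otimes>\<^sub>M lborel)"
      proof -
        have "(\<lambda>p::real\<times>real. (snd p, fst p)) \<in> borel_measurable borel"
          by (intro borel_measurable_continuous_onI continuous_intros)
        then have "(\<lambda>p. ennreal \<bar>\<phi> (snd p, fst p) * partial (1, 0) \<phi> (snd p, fst p)\<bar>) \<in> borel_measurable borel"
          using measurable_compose[of "\<lambda>p. (snd p, fst p)" borel borel "\<lambda>p. ennreal \<bar>\<phi> p * partial (1, 0) \<phi> p\<bar>"] by simp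
        then show ?thesis by (simp add: lborel_prod)
      qed
      from lborel.borel_measurable_nn_integral_fst[OF this] show ?thesis by (simp add: H_def[abs_def])
    qed
    have pi: "integrable lborel (\<lambda>p. \<phi> p * partial (1, 0) \<phi> p)"
      by (rule test_functions_integrable[OF test_functions_mult[OF \<phi> smooth_partial[OF sm e_Basis(1)]]])
    have HI: "(\<integral>\<^sup>+y. H y \<partial>lborel) = ennreal (\<integral>p. \<bar>\<phi> p * partial (1, 0) \<phi> p\<bar> \<partial>lborel)"
    proof -
      have "(\<integral>\<^sup>+y. H y \<partial>lborel) = (\<integral>\<^sup>+p. ennreal \<bar>\<phi> p * partial (1, 0) \<phi> p\<bar> \<partial>lborel)"
        unfolding H_def by (rule nn_integral_plane(2)[symmetric]) measurable
      also have "\<dots> = ennreal (\<integral>p. \<bar>\<phi> p * partial (1, 0) \<phi> p\<bar> \<partial>lborel)"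
        by (rule nn_integral_eq_integral) (use pi in auto)
      finally show ?thesis .
    qed
    have le: "(\<integral>p. \<bar>\<phi> p * partial (1, 0) \<phi> p\<bar> \<partial>lborel) \<le> l2norm ?M \<phi> * l2norm ?M (gradient \<phi>)"
    proof -
      have "(\<integral>p. \<bar>\<phi> p * partial (1, 0) \<phi> p\<bar> \<partial>lborel) = (\<integral>p. \<bar>\<phi> p\<bar> * \<bar>partial (1, 0) \<phi> p\<bar> \<partial>?M)"
        unfolding integral_leb[OF S(1)]
      proof (rule Bochner_Integration.integral_cong)
        show "\<bar>\<phi> p * partial (1, 0) \<phi> p\<bar> = indicator S p *\<^sub>R (\<bar>\<phi> p\<bar> * \<bar>partial (1, 0) \<phi> p\<bar>)" for p
          using test_functions_zero'[OF \<phi>, of p] by (cases "p \<in> S") (simp_all add: abs_mult)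
      qed simp
      also have "\<dots> = l2inner ?M (\<lambda>p. \<bar>\<phi> p\<bar>) (\<lambda>p. \<bar>partial (1, 0) \<phi> p\<bar>)" by (simp add: l2inner_def)
      also have "\<dots> \<le> l2norm ?M (\<lambda>p. \<bar>\<phi> p\<bar>) * l2norm ?M (\<lambda>p. \<bar>partial (1, 0) \<phi> p\<bar>)"
      proof (rule order_trans[OF abs_ge_self l2inner_Cauchy_Schwarz])
        show "(\<lambda>p. \<bar>\<phi> p\<bar>) \<in> L2 ?M" "(\<lambda>p. \<bar>partial (1, 0) \<phi> p\<bar>) \<in> L2 ?M"
          using test_functions_L2[OF S(1) \<phi>] test_functions_L2[OF S(1) test_functions_partial[OF \<phi> e_Basis(1)]]
          by (auto simp: L2_def)
      qed
      also have "\<dots> \<le> l2norm ?M \<phi> * l2norm ?M (gradient \<phi>)"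
      proof (rule mult_mono)
        show "l2norm ?M (\<lambda>p. \<bar>\<phi> p\<bar>) \<le> l2norm ?M \<phi>" by (simp add: l2norm_def l2inner_def)
        show "l2norm ?M (\<lambda>p. \<bar>partial (1, 0) \<phi> p\<bar>) \<le> l2norm ?M (gradient \<phi>)"
        proof (rule l2norm_mono)
          show "(\<lambda>p. \<bar>partial (1, 0) \<phi> p\<bar>) \<in> borel_measurable ?M" by (intro borel_measurable_leb) measurable
        qed (use test_functions_gradient_L2[OF S(1) \<phi>] partial_le_gradient[OF e_Basis(1)] in auto)
      qed (auto simp: l2norm_nonneg)
      finally show ?thesis .
    qed
    have "(\<integral>\<^sup>+p. ennreal (v (fst p) * (\<phi> p)\<^sup>2) \<partial>?M) \<le> (\<integral>\<^sup>+p. ennreal (v (fst p)) * ennreal ((\<phi> p)\<^sup>2) \<partial>lborel)"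
      unfolding leb_def using S(1) by (subst nn_integral_restrict_space)
        (auto intro!: nn_integral_mono simp: indicator_def ennreal_mult v(2))
    also have "\<dots> = (\<integral>\<^sup>+x. \<integral>\<^sup>+y. ennreal (v x) * ennreal ((\<phi> (x, y))\<^sup>2) \<partial>lborel \<partial>lborel)"
      by (subst nn_integral_plane(1)) auto
    also have "\<dots> \<le> (\<integral>\<^sup>+x. \<integral>\<^sup>+y. ennreal (v x) * (2 * H y) \<partial>lborel \<partial>lborel)"
      by (intro nn_integral_mono mult_left_mono sq) simp
    also have "\<dots> = (\<integral>\<^sup>+x. ennreal (v x) * (2 * (\<integral>\<^sup>+y. H y \<partial>lborel)) \<partial>lborel)"
      using Hm by (simp add: nn_integral_cmult)
    also have "\<dots> = (\<integral>\<^sup>+x. ennreal (v x) \<partial>lborel) * (2 * (\<integral>\<^sup>+y. H y \<partial>lborel))"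
      by (rule nn_integral_multc) simp
    also have "(\<integral>\<^sup>+x. ennreal (v x) \<partial>lborel) = ennreal (\<integral>x. v x \<partial>lborel)"
      by (rule nn_integral_eq_integral) (use v in auto)
    also have "ennreal (\<integral>x. v x \<partial>lborel) * (2 * (\<integral>\<^sup>+y. H y \<partial>lborel)) =
        ennreal ((2 * (\<integral>x. v x \<partial>lborel)) * (\<integral>p. \<bar>\<phi> p * partial (1, 0) \<phi> p\<bar> \<partial>lborel))"
      unfolding HI using v(2) by (simp add: ennreal_mult mult_ac)
    also have "\<dots> \<le> ennreal ((2 * (\<integral>x. v x \<partial>lborel)) * (l2norm ?M \<phi> * l2norm ?M (gradient \<phi>)))"
      using v(2) by (intro ennreal_leI mult_left_mono le) simp
    finally show ?thesis by (simp add: mult.assoc)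
  qed
  have C: "0 \<le> 2 * (\<integral>x. v x \<partial>lborel)" using v(2) by simp
  show "integrable ?M (\<lambda>p. v (fst p) * (u p)\<^sup>2)"
    "(\<integral>p. v (fst p) * (u p)\<^sup>2 \<partial>?M) \<le> (2 * (\<integral>x. v x \<partial>lborel)) * l2norm ?M u * l2norm ?M g"
    using weighted_bound_closure[OF S vm v(2) t C u] by auto
qed

text \<open>Differentiation under the integral sign in integrated form: by Fubini, the primitive of
  the fibre integrals of the x-derivative is the fibre integral of \<phi>, and \<phi> vanishes at
  both ends.\<close>

lemma has_H10_gradient_fibre_integral:
  fixes \<phi> :: "real \<times> real \<Rightarrow> real"
  assumes ab: "\<alpha> < \<beta>" and \<phi>: "\<phi> \<in> test_functions ({\<alpha>..\<beta>} \<times> UNIV)"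
  shows "has_H10_gradient {\<alpha>..\<beta>} (\<lambda>x. \<integral>y. \<phi> (x, y) \<partial>lborel) (\<lambda>x. \<integral>y. partial (1, 0) \<phi> (x, y) \<partial>lborel)"
proof -
  let ?S = "{\<alpha>..\<beta>} \<times> (UNIV :: real set)"
  note sm = test_functionsD(1)[OF \<phi>]
  define \<psi> where "\<psi> = partial (1, 0) \<phi>"
  have \<psi>: "\<psi> \<in> test_functions ?S" unfolding \<psi>_def by (rule test_functions_partial[OF \<phi> e_Basis(1)])
  note sm\<psi> = test_functionsD(1)[OF \<psi>]
  have int: "interior ?S = {\<alpha><..<\<beta>} \<times> UNIV" by (simp add: interior_Times)
  have z: "\<phi> (x, y) = 0" "\<psi> (x, y) = 0" if "x \<notin> {\<alpha><..<\<beta>}" for x y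
    using test_functions_zero[OF \<phi>, of "(x, y)"] test_functions_zero[OF \<psi>, of "(x, y)"] that unfolding int by auto
  have pm[measurable]: "\<psi> \<in> borel_measurable borel" by (rule smooth_measurable[OF sm\<psi>])
  have pi: "integrable lborel \<psi>" by (rule test_functions_integrable[OF \<psi>])
  define G where "G x = (\<integral>y. \<psi> (x, y) \<partial>lborel)" for x
  have Gm[measurable]: "G \<in> borel_measurable borel" unfolding G_def by (rule measurable_integral_slice[OF pm])
  have key: "(\<integral>t. indicator {\<alpha>..x} t * G t \<partial>leb {\<alpha>..\<beta>}) = (\<integral>y. \<phi> (x, y) \<partial>lborel)" if x: "x \<in> {\<alpha>..\<beta>}" for x
  proof -
    have "(\<integral>t. indicator {\<alpha>..x} t * G t \<partial>leb {\<alpha>..\<beta>}) = (\<integral>t. (\<integral>y. indicator ({\<alpha>..x} \<times> UNIV) (t, y) * \<psi> (t, y) \<partial>lborel) \<partial>lborel)"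
      unfolding integral_leb[OF interval_borel(1)] G_def
      by (rule Bochner_Integration.integral_cong) (use x in \<open>auto simp: indicator_def\<close>)
    also have "\<dots> = (\<integral>y. (\<integral>t. indicator ({\<alpha>..x} \<times> UNIV) (t, y) * \<psi> (t, y) \<partial>lborel) \<partial>lborel)"
    proof -
      have "integrable lborel (\<lambda>p. indicator ({\<alpha>..x} \<times> UNIV) p *\<^sub>R \<psi> p)"
        by (rule integrable_mult_indicator[OF _ pi]) (simp add: borel_Times)
      then show ?thesis using integral_plane(1,2)[of "\<lambda>p. indicator ({\<alpha>..x} \<times> UNIV) p * \<psi> p"] by simp
    qed
    also have "\<dots> = (\<integral>y. \<phi> (x, y) \<partial>lborel)"
    proof (rule Bochner_Integration.integral_cong[OF refl])
      fix y
      have "(\<integral>t. indicator ({\<alpha>..x} \<times> UNIV) (t, y) * \<psi> (t, y) \<partial>lborel) = (\<integral>t. \<psi> (t, y) * indicator {\<alpha>..x} t \<partial>lborel)"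
        by (rule Bochner_Integration.integral_cong) (auto simp: indicator_def)
      also have "\<dots> = \<phi> (x, y) - \<phi> (\<alpha>, y)"
      proof (rule integral_FTC_Icc_real)
        show "\<alpha> \<le> x" using x by simp
        show "((\<lambda>t. \<phi> (t, y)) has_real_derivative \<psi> (t, y)) (at t)" for t
          unfolding \<psi>_def by (rule smooth_slice_DERIV(1)[OF sm])
        show "isCont (\<lambda>t. \<psi> (t, y)) t" for t
          using smooth_slice_continuous(1)[OF sm\<psi>, of UNIV y] by (simp add: continuous_on_eq_continuous_at)
      qed
      finally show "(\<integral>t. indicator ({\<alpha>..x} \<times> UNIV) (t, y) * \<psi> (t, y) \<partial>lborel) = \<phi> (x, y)" using z(1)[of \<alpha> y] by simp
    qed
    finally show ?thesis .
  qed
  obtain R where R: "R > 0" "\<And>x y. x \<notin> {-R..R} \<or> y \<notin> {-R..R} \<Longrightarrow> \<psi> (x, y) = 0"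
    by (rule test_functions_plane_bounded_support[OF \<psi>], rule that) auto
  obtain B where B: "\<And>p. \<bar>\<psi> p\<bar> \<le> B" by (rule test_bounded[OF \<psi>], rule that)
  have Gb: "\<bar>G x\<bar> \<le> B * (2 * R)" for x
  proof -
    have "\<bar>G x\<bar> \<le> (\<integral>y. \<bar>\<psi> (x, y)\<bar> \<partial>lborel)" unfolding G_def using integral_norm_bound[of lborel "\<lambda>y. \<psi> (x, y)"] by simp
    also have "\<dots> \<le> (\<integral>y. B * indicator {-R..R} y \<partial>lborel)"
    proof (rule integral_mono_AE')
      have "integrable lborel (indicator {-R..R} :: real \<Rightarrow> real)" by (rule integrable_real_indicator) (simp_all add: emeasure_lborel_Icc_eq)
      then show "integrable lborel (\<lambda>y. B * indicator {-R..R} y)" by simp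
      show "AE y in lborel. \<bar>\<psi> (x, y)\<bar> \<le> B * indicator {-R..R} y"
      proof (rule AE_I2)
        show "\<bar>\<psi> (x, y)\<bar> \<le> B * indicator {-R..R} y" for y
          using B[of "(x, y)"] R(2)[of x y] by (cases "y \<in> {-R..R}") auto
      qed
    qed (use order_trans[OF abs_ge_zero B] in simp)
    also have "\<dots> = B * (2 * R)" using R(1) by simp
    finally show ?thesis .
  qed
  have GL: "G \<in> L2 (leb {\<alpha>..\<beta>})"
  proof (rule L2_dominated)
    interpret finite_measure "leb {\<alpha>..\<beta>}" by (rule finite_measure_leb[OF interval_borel])
    show "integrable (leb {\<alpha>..\<beta>}) (\<lambda>x. (B * (2 * R))\<^sup>2)" by simp
    show "G \<in> borel_measurable (leb {\<alpha>..\<beta>})" by (rule borel_measurable_leb[OF Gm])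
    show "(norm (G x))\<^sup>2 \<le> (B * (2 * R))\<^sup>2" for x unfolding real_norm_def by (rule power_mono[OF Gb abs_ge_zero])
  qed
  have "has_H10_gradient {\<alpha>..\<beta>} (\<lambda>x. \<integral>y. \<phi> (x, y) \<partial>lborel) G"
  proof (rule has_H10_gradient_antiderivative[OF ab GL])
    have "(\<integral>x. G x \<partial>leb {\<alpha>..\<beta>}) = (\<integral>t. indicator {\<alpha>..\<beta>} t * G t \<partial>leb {\<alpha>..\<beta>})"
      unfolding integral_leb[OF interval_borel(1)] by (rule Bochner_Integration.integral_cong) (auto simp: indicator_def)
    also have "\<dots> = (\<integral>y. \<phi> (\<beta>, y) \<partial>lborel)" using ab by (intro key) simp
    finally show "(\<integral>x. G x \<partial>leb {\<alpha>..\<beta>}) = 0" using z(1)[of \<beta>] by simp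
  qed (simp add: key)
  then show ?thesis unfolding G_def[abs_def] \<psi>_def .
qed

text \<open>The inner product of profiles on (0, pi), normalised so that \<open>sin\<close> has norm
  1. By scaling it is the inner product of \<open>ker s\<close> and \<open>ker s'\<close> on every
  fibre of the tube.\<close>

definition J :: "(real \<Rightarrow> real) \<Rightarrow> (real \<Rightarrow> real) \<Rightarrow> real" where
  "J s s' = 2 / pi * (\<integral>t. indicator {0<..<pi} t * (s t * s' t) \<partial>lborel)"

lemma J_integrable:
  assumes "continuous_on UNIV (f :: real \<Rightarrow> real)"
  shows "integrable lborel (\<lambda>t. indicator {0<..<pi} t * f t)"
proof -
  have "integrable lborel (\<lambda>t. indicator {0..pi} t *\<^sub>R f t)"
    by (rule borel_integrable_compact) (auto intro: continuous_on_subset[OF assms])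
  moreover have "(\<lambda>t. indicator {0<..<pi} t * f t) \<in> borel_measurable lborel"
    using borel_measurable_continuous_onI[OF assms] by measurable
  ultimately show ?thesis
    by (rule Bochner_Integration.integrable_bound) (auto simp: indicator_def)
qed

lemma J_FTC:
  assumes "\<And>t. (F has_real_derivative s t * s' t) (at t)" "continuous_on UNIV (\<lambda>t. s t * s' t)"
  shows "J s s' = 2 / pi * (F pi - F 0)"
proof -
  define f where "f t = s t * s' t" for t
  have fm: "f \<in> borel_measurable borel" unfolding f_def by (rule borel_measurable_continuous_onI[OF assms(2)])
  have "AE t in lborel. t \<noteq> 0" "AE t in lborel. t \<noteq> pi" by (rule AE_lborel_singleton)+
  then have "AE t in lborel. indicator {0<..<pi} t * f t = f t * indicator {0..pi} t"
    by eventually_elim (auto simp: indicator_def)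
  then have "(\<integral>t. indicator {0<..<pi} t * f t \<partial>lborel) = (\<integral>t. f t * indicator {0..pi} t \<partial>lborel)"
    using fm by (intro integral_cong_AE) auto
  then have "(\<integral>t. indicator {0<..<pi} t * (s t * s' t) \<partial>lborel) = (\<integral>t. (s t * s' t) * indicator {0..pi} t \<partial>lborel)"
    by (simp add: f_def)
  also have "\<dots> = F pi - F 0"
    by (rule integral_FTC_Icc_real) (use assms in \<open>auto simp: continuous_on_eq_continuous_at\<close>)
  finally show ?thesis by (simp add: J_def)
qed

text \<open>Differentiating the mode $\sqrt{2/L}\,\sin(\pi y/L)$ along the axis gives $-\lambda$ times the same expression with
  \<open>tau\<close> in place of the sine; this is the origin of the constant $\pi^2/3+1/4$.\<close>

definition tau :: "real \<Rightarrow> real" where "tau t = sin t / 2 + t * cos t"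

lemma tau_continuous: "continuous_on A tau"
  unfolding tau_def[abs_def] by (intro continuous_intros) auto

lemma sin_sq_antiderivative: "((\<lambda>t. (t - sin t * cos t) / 2) has_real_derivative sin t * sin t) (at t)"
  and cos_sq_antiderivative: "((\<lambda>t. (t + sin t * cos t) / 2) has_real_derivative cos t * cos t) (at t)"
proof -
  have e: "(1 - (cos t * cos t - sin t * sin t)) / 2 = sin t * sin t" "(1 + (cos t * cos t - sin t * sin t)) / 2 = cos t * cos t"
    using sin_cos_squared_add[of t] by (simp_all add: power2_eq_square field_simps)
  have "((\<lambda>t. (t - sin t * cos t) / 2) has_real_derivative (1 - (cos t * cos t - sin t * sin t)) / 2) (at t)"
    "((\<lambda>t. (t + sin t * cos t) / 2) has_real_derivative (1 + (cos t * cos t - sin t * sin t)) / 2) (at t)"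
    by (auto intro!: derivative_eq_intros)
  then show "((\<lambda>t. (t - sin t * cos t) / 2) has_real_derivative sin t * sin t) (at t)"
    "((\<lambda>t. (t + sin t * cos t) / 2) has_real_derivative cos t * cos t) (at t)" unfolding e .
qed

lemma J_sin_sin: "J sin sin = 1"
  by (subst J_FTC[OF sin_sq_antiderivative]) (auto intro!: continuous_intros)

lemma J_cos_cos: "J cos cos = 1"
  by (subst J_FTC[OF cos_sq_antiderivative]) (auto intro!: continuous_intros)

text \<open>The product is the derivative of t sin(t)^2 / 2, which vanishes at 0 and pi.
  Geometrically, a fibre profile of constant norm is orthogonal to its derivative along the axis;
  hence no first order term arises in \<open>mdx_mdx\<close>.\<close>

lemma J_sin_tau: "J sin tau = 0"
proof -
  have "J sin tau = 2 / pi * (pi * (sin pi)\<^sup>2 / 2 - 0 * (sin 0)\<^sup>2 / 2)"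
  proof (rule J_FTC[where F="\<lambda>t. t * (sin t)\<^sup>2 / 2"])
    show "((\<lambda>t. t * (sin t)\<^sup>2 / 2) has_real_derivative sin t * tau t) (at t)" for t
      by (auto intro!: derivative_eq_intros simp: tau_def power2_eq_square field_simps)
  qed (intro continuous_intros tau_continuous)
  then show ?thesis by simp
qed

lemma J_tau_tau: "J tau tau = pi\<^sup>2 / 3 + 1 / 4"
proof -
  define F where "F t = t ^ 3 / 6 + t / 8 + t\<^sup>2 * (sin t * cos t) / 2 - sin t * cos t / 8" for t :: real
  have "J tau tau = 2 / pi * (F pi - F 0)"
  proof (rule J_FTC)
    fix t :: real
    have "(F has_real_derivative t\<^sup>2 / 2 + 1 / 8 + (2 * t * (sin t * cos t) + t\<^sup>2 * (cos t * cos t - sin t * sin t)) / 2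
        - (cos t * cos t - sin t * sin t) / 8) (at t)"
      unfolding F_def by (auto intro!: derivative_eq_intros simp: field_simps)
    moreover have "t\<^sup>2 / 2 + 1 / 8 + (2 * t * (sin t * cos t) + t\<^sup>2 * (cos t * cos t - sin t * sin t)) / 2
        - (cos t * cos t - sin t * sin t) / 8 = tau t * tau t"
    \<comment> \<open>Once the part without sines and cosines is multiplied by sin^2 + cos^2, the
      identity becomes polynomial in \<open>s\<close> and \<open>c\<close>.\<close>
    proof -
      have "t\<^sup>2 / 2 + 1 / 8 + (2 * t * (s * c) + t\<^sup>2 * (c * c - s * s)) / 2 - (c * c - s * s) / 8
          = (s / 2 + t * c) * (s / 2 + t * c)" if "s * s + c * c = 1" for s c :: real
      proof -
        have "t\<^sup>2 / 2 + 1 / 8 = (t\<^sup>2 / 2 + 1 / 8) * (s * s + c * c)" using that by simp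
        then show ?thesis by (simp add: power2_eq_square field_simps)
      qed
      moreover have "sin t * sin t + cos t * cos t = 1"
        using sin_cos_squared_add[of t] by (simp add: power2_eq_square)
      ultimately show ?thesis unfolding tau_def by blast
    qed
    ultimately show "(F has_real_derivative tau t * tau t) (at t)" by simp
  qed (intro continuous_intros tau_continuous)
  also have "\<dots> = pi\<^sup>2 / 3 + 1 / 4"
    by (simp add: F_def power2_eq_square power3_eq_cube field_simps)
  finally show ?thesis .
qed

section \<open>Modes over a tube\<close>

text \<open>\<open>lam\<close> plays the part of L'/L. Only its primitive is tied to
  \<open>L\<close>, through \<open>logL\<close>, so \<open>L\<close> need not be differentiable
  everywhere and \<open>lam\<close> need not be bounded. For L = \<epsilon> h it does not depend on
  \<epsilon>.\<close>

locale tube =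
  fixes \<alpha> \<beta> :: real and L lam :: "real \<Rightarrow> real"
  assumes ab: "\<alpha> < \<beta>" and Lc: "continuous_on {\<alpha>..\<beta>} L" and Lpos: "\<And>x. x \<in> {\<alpha>..\<beta>} \<Longrightarrow> 0 < L x"
    and lamL: "lam \<in> L2 (leb {\<alpha>..\<beta>})"
    and logL: "\<And>x. x \<in> {\<alpha>..\<beta>} \<Longrightarrow> ln (L x) = ln (L \<alpha>) + (\<integral>t. indicator {\<alpha>..x} t * lam t \<partial>leb {\<alpha>..\<beta>})"
begin

definition S :: "(real \<times> real) set" where
  "S = {p. fst p \<in> {\<alpha>..\<beta>} \<and> 0 < snd p \<and> snd p < L (fst p)}"

text \<open>\<open>L\<close> continued by its end values: continuous and positive on the whole line,
  so that \<open>ker\<close> below is continuous on the whole plane.\<close>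

definition Lb :: "real \<Rightarrow> real" where "Lb x = L (max \<alpha> (min \<beta> x))"

abbreviation "MI \<equiv> leb {\<alpha>..\<beta>}"
abbreviation "MO \<equiv> leb S"
abbreviation "HI \<equiv> has_H10_gradient {\<alpha>..\<beta>}"
abbreviation "HS \<equiv> has_H10_gradient S"

lemma Lb_eq: "x \<in> {\<alpha>..\<beta>} \<Longrightarrow> Lb x = L x"
proof -
  assume "x \<in> {\<alpha>..\<beta>}"
  then have "max \<alpha> (min \<beta> x) = x" by auto
  then show ?thesis by (simp add: Lb_def)
qed

lemma Lb_pos: "0 < Lb x" unfolding Lb_def using ab by (intro Lpos) auto

lemma Lb_continuous: "continuous_on A Lb"
  unfolding Lb_def[abs_def]
  by (rule continuous_on_compose2[OF Lc]) (use ab in \<open>auto intro!: continuous_intros\<close>)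

lemma S_alt: "S = {p. \<alpha> \<le> fst p \<and> fst p \<le> \<beta> \<and> 0 < snd p \<and> snd p < Lb (fst p)}"
  unfolding S_def using Lb_eq by auto

lemma Lbf_continuous: "continuous_on A (\<lambda>p. Lb (fst p))"
  by (rule continuous_on_compose2[OF Lb_continuous[of UNIV]]) (auto intro!: continuous_intros)

lemma S_borel: "S \<in> sets borel"
proof -
  have [measurable]: "(\<lambda>p::real\<times>real. Lb (fst p)) \<in> borel_measurable borel"
    "(fst :: real \<times> real \<Rightarrow> real) \<in> borel_measurable borel" "(snd :: real \<times> real \<Rightarrow> real) \<in> borel_measurable borel"
    by (intro borel_measurable_continuous_onI Lbf_continuous continuous_intros)+
  show ?thesis unfolding S_alt by measurable
qed

lemma L_upper: obtains LM where "LM > 0" "\<And>x. Lb x \<le> LM"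
proof -
  have c: "compact (L ` {\<alpha>..\<beta>})" by (rule compact_continuous_image[OF Lc]) simp
  obtain B where B: "\<forall>y\<in>L ` {\<alpha>..\<beta>}. \<bar>y\<bar> \<le> B"
    using compact_imp_bounded[OF c, unfolded bounded_real] by blast
  have "Lb x \<le> B" for x
  proof -
    have "max \<alpha> (min \<beta> x) \<in> {\<alpha>..\<beta>}" using ab by auto
    then have "\<bar>L (max \<alpha> (min \<beta> x))\<bar> \<le> B" using B by blast
    then show ?thesis unfolding Lb_def by linarith
  qed
  then show thesis using Lb_pos by (intro that[of B]) (auto intro: less_le_trans)
qed

lemma S_bounded: "bounded S"
proof -
  obtain LM where LM: "LM > 0" "\<And>x. Lb x \<le> LM" by (rule L_upper, rule that)
  have "S \<subseteq> {\<alpha>..\<beta>} \<times> {0..LM}"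
  proof
    fix p assume "p \<in> S"
    then show "p \<in> {\<alpha>..\<beta>} \<times> {0..LM}" using LM(2)[of "fst p"] unfolding S_alt by (auto simp: mem_Times_iff)
  qed
  moreover have "bounded ({\<alpha>..\<beta>} \<times> {0..LM})" by (intro bounded_Times) auto
  ultimately show ?thesis by (rule bounded_subset[rotated])
qed

lemma finite_MO: "finite_measure MO" by (rule finite_measure_leb[OF S_borel S_bounded])
lemma finite_MI: "finite_measure MI" by (rule finite_measure_leb[OF interval_borel])

lemma S_fst: "p \<in> S \<Longrightarrow> fst p \<in> {\<alpha>..\<beta>}" by (simp add: S_def)

definition fib :: "(real \<times> real \<Rightarrow> real) \<Rightarrow> real \<Rightarrow> real" where
  "fib F x = (\<integral>y. indicator S (x, y) * F (x, y) \<partial>lborel)"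

lemma fib_outside: "x \<notin> {\<alpha>..\<beta>} \<Longrightarrow> fib F x = 0"
  unfolding fib_def S_def by (subst Bochner_Integration.integral_cong[OF refl, of _ _ "\<lambda>_. 0"]) (auto simp: indicator_def)

lemma fib_measurable: "F \<in> borel_measurable MO \<Longrightarrow> fib F \<in> borel_measurable MI"
  unfolding fib_def leb_measurable_iff[OF S_borel] using measurable_integral_slice
  by (intro borel_measurable_leb) simp

lemma integral_fib:
  assumes "integrable MO F"
  shows "(\<integral>p. F p \<partial>MO) = (\<integral>x. fib F x \<partial>MI)" "integrable MI (fib F)"
    "AE x in MI. integrable lborel (\<lambda>y. indicator S (x, y) * F (x, y))"
proof -
  have i: "integrable lborel (\<lambda>p. indicator S p * F p)" using assms unfolding integrable_leb[OF S_borel] by simp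
  have e: "(\<lambda>x. indicator {\<alpha>..\<beta>} x * fib F x) = fib F" using fib_outside by (auto simp: fun_eq_iff indicator_def)
  show "integrable MI (fib F)"
    unfolding integrable_leb[OF interval_borel(1)] using integral_plane(3)[OF i] e unfolding fib_def[abs_def] by simp
  show "(\<integral>p. F p \<partial>MO) = (\<integral>x. fib F x \<partial>MI)"
    unfolding integral_leb[OF S_borel] integral_leb[OF interval_borel(1)] using integral_plane(1)[OF i] e unfolding fib_def[abs_def] by simp
  show "AE x in MI. integrable lborel (\<lambda>y. indicator S (x, y) * F (x, y))"
    unfolding AE_leb_iff[OF interval_borel(1)] using integral_plane(4)[OF i] by eventually_elim simp
qed

text \<open>The profile \<open>s\<close> on (0, pi) stretched to the fibre of length
  \<open>L\<close>; the square root keeps fibre inner products independent of that length. With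
  \<open>s = sin\<close> it is the normalised first Dirichlet mode of the fibre.\<close>

definition ker :: "(real \<Rightarrow> real) \<Rightarrow> real \<times> real \<Rightarrow> real" where
  "ker s p = sqrt (2 / Lb (fst p)) * s (pi * snd p / Lb (fst p))"

lemma Lb_neq_0: "Lb x \<noteq> 0" using Lb_pos[of x] by simp

lemma ker_continuous:
  assumes "continuous_on UNIV s" shows "continuous_on A (ker s)"
proof -
  have c: "continuous_on A (\<lambda>p. pi * snd p / Lb (fst p))" "continuous_on A (\<lambda>p. sqrt (2 / Lb (fst p)))"
    by (intro continuous_intros Lbf_continuous ballI Lb_neq_0)+
  show ?thesis unfolding ker_def[abs_def]
    by (intro continuous_on_mult c continuous_on_compose2[OF assms c(1)]) simp
qed

lemma ker_measurable: "continuous_on UNIV s \<Longrightarrow> ker s \<in> borel_measurable borel"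
  by (intro borel_measurable_continuous_onI ker_continuous)

lemma S_slice: "x \<in> {\<alpha>..\<beta>} \<Longrightarrow> indicator S (x, Lb x / pi * t) = (indicator {0<..<pi} t :: real)"
proof -
  assume x: "x \<in> {\<alpha>..\<beta>}"
  have c: "0 < Lb x / pi" using Lb_pos[of x] by simp
  have "0 < Lb x / pi * t \<longleftrightarrow> 0 < t" using c by (metis zero_less_mult_pos mult_pos_pos)
  moreover have "Lb x / pi * t < Lb x / pi * pi \<longleftrightarrow> t < pi" using c by (rule mult_less_cancel_left_pos)
  ultimately show ?thesis using x by (simp add: S_alt indicator_def)
qed

lemma ker_slice: "ker s (x, Lb x / pi * t) = sqrt (2 / Lb x) * s t"
  by (simp add: ker_def Lb_neq_0)

lemma slice_ker_ker:
  assumes "x \<in> {\<alpha>..\<beta>}"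
  shows "indicator S (x, 0 + Lb x / pi * t) * (ker s (x, 0 + Lb x / pi * t) * ker s' (x, 0 + Lb x / pi * t))
    = (2 / Lb x) * (indicator {0<..<pi} t * (s t * s' t))"
proof -
  have "sqrt c * s t * (sqrt c * s' t) = c * (s t * s' t)" if "c \<ge> 0" for c
  proof -
    have "sqrt c * s t * (sqrt c * s' t) = (sqrt c * sqrt c) * (s t * s' t)" by (simp only: mult_ac)
    then show ?thesis using that by simp
  qed
  from this[of "2 / Lb x"] show ?thesis
    using Lb_pos[of x] unfolding add_0 S_slice[OF assms] ker_slice by simp
qed

text \<open>The substitution y = L t / pi has Jacobian L / pi, which turns the factor 2 / L of the
  kernels into 2 / pi.\<close>

lemma fib_ker_ker:
  assumes "x \<in> {\<alpha>..\<beta>}"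
  shows "fib (\<lambda>p. ker s p * ker s' p) x = J s s'"
proof -
  have "fib (\<lambda>p. ker s p * ker s' p) x =
      \<bar>Lb x / pi\<bar> *\<^sub>R (\<integral>t. indicator S (x, 0 + Lb x / pi * t) * (ker s (x, 0 + Lb x / pi * t) * ker s' (x, 0 + Lb x / pi * t)) \<partial>lborel)"
    unfolding fib_def using Lb_pos[of x] by (intro lborel_integral_real_affine) simp
  also have "(\<integral>t. indicator S (x, 0 + Lb x / pi * t) * (ker s (x, 0 + Lb x / pi * t) * ker s' (x, 0 + Lb x / pi * t)) \<partial>lborel)
      = (\<integral>t. (2 / Lb x) * (indicator {0<..<pi} t * (s t * s' t)) \<partial>lborel)"
    by (rule Bochner_Integration.integral_cong[OF refl slice_ker_ker[OF assms]])
  also have "\<bar>Lb x / pi\<bar> *\<^sub>R \<dots> = J s s'"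
    using Lb_pos[of x] by (simp add: J_def abs_of_pos)
  finally show ?thesis .
qed

lemma slice_ker_integrable:
  assumes "x \<in> {\<alpha>..\<beta>}" "continuous_on UNIV s" "continuous_on UNIV s'"
  shows "integrable lborel (\<lambda>y. indicator S (x, y) * (ker s (x, y) * ker s' (x, y)))"
proof -
  have "integrable lborel (\<lambda>t. (2 / Lb x) * (indicator {0<..<pi} t * (s t * s' t)))"
    by (intro integrable_mult_right J_integrable continuous_intros assms)
  moreover have "(\<lambda>t. (2 / Lb x) * (indicator {0<..<pi} t * (s t * s' t))) =
      (\<lambda>t. indicator S (x, 0 + Lb x / pi * t) * (ker s (x, 0 + Lb x / pi * t) * ker s' (x, 0 + Lb x / pi * t)))"
    by (rule ext) (rule slice_ker_ker[OF assms(1), symmetric])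
  ultimately show ?thesis
    using Lb_pos[of x] lborel_integrable_real_affine_iff[of "Lb x / pi" "\<lambda>y. indicator S (x, y) * (ker s (x, y) * ker s' (x, y))" 0]
    by simp
qed

lemma fst_measurable_MO: "\<eta> \<in> borel_measurable MI \<Longrightarrow> (\<lambda>p. \<eta> (fst p)) \<in> borel_measurable MO" for \<eta> :: "real \<Rightarrow> real"
proof -
  assume "\<eta> \<in> borel_measurable MI"
  then have "(\<lambda>x. indicator {\<alpha>..\<beta>} x *\<^sub>R \<eta> x) \<in> borel_measurable borel" using leb_measurable_iff[OF interval_borel(1)] by blast
  then have "(\<lambda>p::real\<times>real. indicator {\<alpha>..\<beta>} (fst p) *\<^sub>R \<eta> (fst p)) \<in> borel_measurable borel"
    by (rule measurable_compose[rotated]) (intro borel_measurable_continuous_onI continuous_intros)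
  then have "(\<lambda>p. indicator {\<alpha>..\<beta>} (fst p) *\<^sub>R \<eta> (fst p)) \<in> borel_measurable MO" by (rule borel_measurable_leb)
  then show ?thesis by (rule measurable_cong[THEN iffD1, rotated]) (use S_fst in auto)
qed

text \<open>\<eta> need not be bounded, so integrability over the tube is obtained from Tonelli's
  theorem: the fibre over x contributes \<eta>(x)^2 times \<open>J s s\<close>.\<close>

lemma mult_ker_L2:
  assumes \<eta>: "\<eta> \<in> L2 MI" and s: "continuous_on UNIV s"
  shows "(\<lambda>p. \<eta> (fst p) * ker s p) \<in> L2 MO"
proof -
  define E where "E x = indicator {\<alpha>..\<beta>} x * \<eta> x" for x
  have Em[measurable]: "E \<in> borel_measurable borel"
    using leb_measurable_iff[OF interval_borel(1), of \<eta>] L2_measurable[OF \<eta>] by (simp add: E_def[abs_def])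
  have Ef[measurable]: "(\<lambda>p::real\<times>real. E (fst p)) \<in> borel_measurable borel"
    by (rule measurable_compose[OF _ Em]) (intro borel_measurable_continuous_onI continuous_intros)
  have [measurable]: "ker s \<in> borel_measurable borel" "S \<in> sets borel" by (rule ker_measurable[OF s], rule S_borel)
  have E2: "integrable lborel (\<lambda>x. (E x)\<^sup>2)"
    using L2_integrable_sq[OF \<eta>] unfolding integrable_leb[OF interval_borel(1)]
    by (rule Bochner_Integration.integrable_cong[THEN iffD1, rotated -1]) (auto simp: E_def indicator_def)
  have J0: "0 \<le> J s s" unfolding J_def by (auto intro!: mult_nonneg_nonneg)
  have "(\<integral>\<^sup>+p. ennreal (indicator S p * (E (fst p) * ker s p)\<^sup>2) \<partial>lborel) =
      (\<integral>\<^sup>+x. \<integral>\<^sup>+y. ennreal (indicator S (x, y) * (E x * ker s (x, y))\<^sup>2) \<partial>lborel \<partial>lborel)"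
    by (subst nn_integral_plane(1)) (auto intro!: borel_measurable_times)
  also have "\<dots> = (\<integral>\<^sup>+x. ennreal ((E x)\<^sup>2 * J s s) \<partial>lborel)"
  proof (rule nn_integral_cong)
    fix x
    show "(\<integral>\<^sup>+y. ennreal (indicator S (x, y) * (E x * ker s (x, y))\<^sup>2) \<partial>lborel) = ennreal ((E x)\<^sup>2 * J s s)"
    proof (cases "x \<in> {\<alpha>..\<beta>}")
      case True
      have eq: "indicator S (x, y) * (E x * ker s (x, y))\<^sup>2 = (E x)\<^sup>2 * (indicator S (x, y) * (ker s (x, y) * ker s (x, y)))" for y
        by (simp add: power2_eq_square algebra_simps)
      have "(\<integral>\<^sup>+y. ennreal (indicator S (x, y) * (E x * ker s (x, y))\<^sup>2) \<partial>lborel) =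
          ennreal (\<integral>y. (E x)\<^sup>2 * (indicator S (x, y) * (ker s (x, y) * ker s (x, y))) \<partial>lborel)"
        unfolding eq using slice_ker_integrable[OF True s s] by (intro nn_integral_eq_integral) auto
      then show ?thesis using fib_ker_ker[OF True, of s s] by (simp add: fib_def)
    qed (simp add: E_def)
  qed
  also have "\<dots> = ennreal (\<integral>x. (E x)\<^sup>2 * J s s \<partial>lborel)"
    by (rule nn_integral_eq_integral) (use E2 J0 in auto)
  finally have fin: "(\<integral>\<^sup>+p. ennreal (indicator S p * (E (fst p) * ker s p)\<^sup>2) \<partial>lborel) < \<infinity>" by simp
  have "integrable lborel (\<lambda>p. indicator S p * (E (fst p) * ker s p)\<^sup>2)"
    by (rule integrableI_nonneg) (use fin in auto)
  then have "integrable MO (\<lambda>p. (norm (\<eta> (fst p) * ker s p))\<^sup>2)"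
    unfolding integrable_leb[OF S_borel]
    by (rule Bochner_Integration.integrable_cong[THEN iffD1, rotated -1])
      (auto simp: E_def indicator_def dest: S_fst)
  moreover have "(\<lambda>p. \<eta> (fst p) * ker s p) \<in> borel_measurable MO"
    by (intro borel_measurable_times fst_measurable_MO L2_measurable[OF \<eta>] borel_measurable_leb) measurable
  ultimately show ?thesis by (simp add: L2_def)
qed

text \<open>Adjoint of \<eta> \<mapsto> \<eta> \<open>ker s\<close>, see \<open>pr_adjoint\<close>.
  For \<open>s = sin\<close> it is the coefficient of the orthogonal projection onto the
  modes.\<close>

definition pr :: "(real \<Rightarrow> real) \<Rightarrow> (real \<times> real \<Rightarrow> real) \<Rightarrow> real \<Rightarrow> real" where
  "pr s f x = fib (\<lambda>p. f p * ker s p) x"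

lemma pr_mult_fst: "pr s (\<lambda>p. w (fst p) * f p) x = w x * pr s f x"
proof -
  have "(\<lambda>y. indicator S (x, y) * (w (fst (x, y)) * f (x, y) * ker s (x, y))) =
      (\<lambda>y. w x * (indicator S (x, y) * (f (x, y) * ker s (x, y))))" by (simp add: algebra_simps)
  then show ?thesis unfolding pr_def fib_def by (simp only: integral_mult_right_zero)
qed

lemma pr_ker: "x \<in> {\<alpha>..\<beta>} \<Longrightarrow> pr s (\<lambda>p. \<eta> (fst p) * ker s' p) x = \<eta> x * J s' s"
  unfolding pr_mult_fst by (simp add: pr_def fib_ker_ker)

text \<open>Cauchy-Schwarz on almost every fibre, then integration along the axis.\<close>

lemma pr_L2:
  assumes f: "f \<in> L2 MO" and s: "continuous_on UNIV s"
  shows "pr s f \<in> L2 MI" "l2norm MI (pr s f) \<le> sqrt (J s s) * l2norm MO f"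
proof -
  have J0: "0 \<le> J s s" unfolding J_def by (auto intro!: mult_nonneg_nonneg)
  have i2: "integrable MO (\<lambda>p. (f p)\<^sup>2)" using L2_integrable_sq[OF f] by simp
  have fm: "(\<lambda>p. indicator S p * f p) \<in> borel_measurable borel"
    using leb_measurable_iff[OF S_borel, of f] L2_measurable[OF f] by simp
  have km: "(\<lambda>p. indicator S p * ker s p) \<in> borel_measurable borel"
    using ker_measurable[OF s] S_borel by simp
  have ae: "AE x in MI. (pr s f x)\<^sup>2 \<le> J s s * fib (\<lambda>p. (f p)\<^sup>2) x"
    using integral_fib(3)[OF i2] AE_space
  proof eventually_elim
    case (elim x)
    then have x: "x \<in> {\<alpha>..\<beta>}" by simp
    define A where "A y = indicator S (x, y) * f (x, y)" for y
    define B where "B y = indicator S (x, y) * ker s (x, y)" for y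
    have "(\<lambda>y. (norm (A y))\<^sup>2) = (\<lambda>y. indicator S (x, y) * (f (x, y))\<^sup>2)"
      by (auto simp: fun_eq_iff A_def indicator_def)
    then have A: "A \<in> L2 lborel"
      unfolding L2_def using measurable_plane_slice(1)[OF fm, of x] elim(1) by (simp add: A_def[abs_def])
    have "(\<lambda>y. (norm (B y))\<^sup>2) = (\<lambda>y. indicator S (x, y) * (ker s (x, y) * ker s (x, y)))"
      by (auto simp: fun_eq_iff B_def indicator_def power2_eq_square)
    then have B: "B \<in> L2 lborel"
      unfolding L2_def using measurable_plane_slice(1)[OF km, of x] slice_ker_integrable[OF x s s]
      by (simp add: B_def[abs_def])
    have 1: "l2inner lborel A B = pr s f x"
      unfolding l2inner_def pr_def fib_def
      by (rule Bochner_Integration.integral_cong) (auto simp: A_def B_def indicator_def)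
    have 2: "l2inner lborel B B = J s s"
      unfolding l2inner_def fib_ker_ker[OF x, symmetric] fib_def
      by (rule Bochner_Integration.integral_cong) (auto simp: B_def indicator_def)
    have 3: "l2inner lborel A A = fib (\<lambda>p. (f p)\<^sup>2) x"
      unfolding l2inner_def fib_def
      by (rule Bochner_Integration.integral_cong) (auto simp: A_def indicator_def power2_eq_square)
    have "\<bar>pr s f x\<bar>\<^sup>2 \<le> (l2norm lborel A * l2norm lborel B)\<^sup>2"
      using l2inner_Cauchy_Schwarz[OF A B] unfolding 1 by (intro power_mono) auto
    then show ?case by (simp add: power_mult_distrib l2norm_sq 2 3 mult.commute)
  qed
  have pm: "pr s f \<in> borel_measurable MI"
    unfolding pr_def by (intro fib_measurable borel_measurable_times L2_measurable[OF f] borel_measurable_leb ker_measurable s)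
  have ri: "integrable MI (\<lambda>x. J s s * fib (\<lambda>p. (f p)\<^sup>2) x)" using integral_fib(2)[OF i2] by simp
  have pi: "integrable MI (\<lambda>x. (pr s f x)\<^sup>2)"
    by (rule Bochner_Integration.integrable_bound[OF ri]) (use pm ae in auto)
  then show "pr s f \<in> L2 MI" using pm by (simp add: L2_def)
  have "(l2norm MI (pr s f))\<^sup>2 \<le> (\<integral>x. J s s * fib (\<lambda>p. (f p)\<^sup>2) x \<partial>MI)"
    unfolding l2norm_sq l2inner_def using integral_mono_AE[OF pi ri ae] by (simp add: power2_eq_square)
  also have "\<dots> = J s s * (l2norm MO f)\<^sup>2"
    unfolding l2norm_sq l2inner_def using integral_fib(1)[OF i2] by (simp add: power2_eq_square)
  finally have "(l2norm MI (pr s f))\<^sup>2 \<le> (sqrt (J s s) * l2norm MO f)\<^sup>2"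
    using J0 by (simp add: power_mult_distrib)
  then show "l2norm MI (pr s f) \<le> sqrt (J s s) * l2norm MO f"
    by (rule power2_le_imp_le) (simp add: J0 l2norm_nonneg)
qed

lemma pr_adjoint:
  assumes "f \<in> L2 MO" "\<eta> \<in> L2 MI" "continuous_on UNIV s"
  shows "l2inner MO (\<lambda>p. \<eta> (fst p) * ker s p) f = l2inner MI \<eta> (pr s f)"
proof -
  have "integrable MO (\<lambda>p. (\<eta> (fst p) * ker s p) * f p)"
    by (rule L2_mult_integrable[OF mult_ker_L2[OF assms(2,3)] assms(1)])
  then have "l2inner MO (\<lambda>p. \<eta> (fst p) * ker s p) f = (\<integral>x. fib (\<lambda>p. (\<eta> (fst p) * ker s p) * f p) x \<partial>MI)"
    unfolding l2inner_def using integral_fib(1) by simp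
  also have "\<dots> = (\<integral>x. pr s (\<lambda>p. \<eta> (fst p) * f p) x \<partial>MI)"
    unfolding pr_def by (simp add: mult_ac)
  finally show ?thesis by (simp add: pr_mult_fst l2inner_def)
qed

lemma mode_inner:
  assumes "\<xi> \<in> L2 MI" "\<eta> \<in> L2 MI" "continuous_on UNIV s" "continuous_on UNIV s'"
  shows "l2inner MO (\<lambda>p. \<xi> (fst p) * ker s p) (\<lambda>p. \<eta> (fst p) * ker s' p) = J s' s * l2inner MI \<xi> \<eta>"
proof -
  have "l2inner MO (\<lambda>p. \<xi> (fst p) * ker s p) (\<lambda>p. \<eta> (fst p) * ker s' p) = l2inner MI \<xi> (pr s (\<lambda>p. \<eta> (fst p) * ker s' p))"
    by (rule pr_adjoint[OF mult_ker_L2[OF assms(2,4)] assms(1,3)])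
  also have "\<dots> = (\<integral>x. J s' s * (\<xi> x * \<eta> x) \<partial>MI)"
    unfolding l2inner_def by (rule Bochner_Integration.integral_cong) (simp_all add: pr_ker)
  finally show ?thesis by (simp add: l2inner_def)
qed

lemma mode_norm:
  assumes "\<xi> \<in> L2 MI" "continuous_on UNIV s"
  shows "l2norm MO (\<lambda>p. \<xi> (fst p) * ker s p) = sqrt (J s s) * l2norm MI \<xi>"
  unfolding l2norm_def mode_inner[OF assms(1,1,2,2)] by (simp add: real_sqrt_mult)

text \<open>Only almost everywhere: on a null set of fibres the functions may fail to be integrable,
  and there the integral is 0 by convention.\<close>

lemma pr_lincomb_AE:
  assumes "f \<in> L2 MO" "g \<in> L2 MO" "continuous_on UNIV s"
  shows "AE x in MI. pr s (\<lambda>p. f p + c * g p) x = pr s f x + c * pr s g x"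
proof -
  have k: "ker s \<in> L2 MO" using mult_ker_L2[of "\<lambda>_. 1", OF _ assms(3)] finite_MI
    by (simp add: L2_def finite_measure.integrable_const)
  show ?thesis
    using integral_fib(3)[OF L2_mult_integrable[OF assms(1) k]] integral_fib(3)[OF L2_mult_integrable[OF assms(2) k]]
  proof eventually_elim
    case (elim x)
    have "pr s (\<lambda>p. f p + c * g p) x = (\<integral>y. indicator S (x, y) * (f (x, y) * ker s (x, y)) + c * (indicator S (x, y) * (g (x, y) * ker s (x, y))) \<partial>lborel)"
      unfolding pr_def fib_def by (simp add: algebra_simps)
    also have "\<dots> = pr s f x + c * pr s g x"
      unfolding pr_def fib_def using elim by simp
    finally show ?case .
  qed
qed

lemma pr_tendsto:
  assumes "\<And>n. f n \<in> L2 MO" "f0 \<in> L2 MO" "continuous_on UNIV s" "l2_lim MO f f0"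
  shows "l2_lim MI (\<lambda>n x. pr s (f n) x) (\<lambda>x. pr s f0 x)"
proof (rule l2norm_tendsto_squeeze)
  show "(\<lambda>n. sqrt (J s s) * l2norm MO (\<lambda>p. f n p - f0 p)) \<longlonglongrightarrow> 0"
    using tendsto_mult_left[OF assms(4)] by simp
  fix n
  have "l2norm MI (\<lambda>x. pr s (f n) x - pr s f0 x) = l2norm MI (pr s (\<lambda>p. f n p - f0 p))"
  proof (rule l2norm_cong_AE)
    show "AE x in MI. pr s (f n) x - pr s f0 x = pr s (\<lambda>p. f n p - f0 p) x"
      using pr_lincomb_AE[OF assms(1)[of n] assms(2,3), of "-1"] by eventually_elim simp
  qed (use L2_measurable pr_L2(1) assms L2_diff in blast)+
  also have "\<dots> \<le> sqrt (J s s) * l2norm MO (\<lambda>p. f n p - f0 p)" by (rule pr_L2(2)[OF L2_diff[OF assms(1,2)] assms(3)])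
  finally show "l2norm MI (\<lambda>x. pr s (f n) x - pr s f0 x) \<le> sqrt (J s s) * l2norm MO (\<lambda>p. f n p - f0 p)" .
qed

end

lemma gradient_plane: "gradient f p = (partial (1, 0) f p, partial (0, 1) f (p :: real \<times> real))"
proof -
  have "gradient f p \<bullet> (1, 0) = partial (1, 0) f p" "gradient f p \<bullet> (0, 1) = partial (0, 1) f p"
    by (intro gradient_inner e_Basis)+
  then show ?thesis by (cases "gradient f p") simp
qed

lemma l2norm_Pair_le:
  assumes "f \<in> L2 M" "g \<in> L2 M" shows "l2norm M (\<lambda>x. (f x, g x)) \<le> l2norm M f + l2norm M g"
proof (rule power2_le_imp_le)
  show "(l2norm M (\<lambda>x. (f x, g x)))\<^sup>2 \<le> (l2norm M f + l2norm M g)\<^sup>2"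
    unfolding l2norm_Pair_sq[OF assms] by (simp add: power2_sum l2norm_nonneg)
qed (simp add: l2norm_nonneg)

lemma l2norm_Pair_ge:
  assumes "f \<in> L2 M" "g \<in> L2 M" shows "l2norm M f \<le> l2norm M (\<lambda>x. (f x, g x))" "l2norm M g \<le> l2norm M (\<lambda>x. (f x, g x))"
  by (rule power2_le_imp_le, simp add: l2norm_Pair_sq[OF assms], simp add: l2norm_nonneg)+

lemma l2norm_Pair_tendsto:
  assumes "\<And>n. f n \<in> L2 M" "\<And>n. g n \<in> L2 M" "f0 \<in> L2 M" "g0 \<in> L2 M"
    and "l2_lim M f f0" "l2_lim M g g0"
  shows "l2_lim M (\<lambda>n x. (f n x, g n x)) (\<lambda>x. (f0 x, g0 x))"
proof (rule l2norm_tendsto_squeeze)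
  show "(\<lambda>n. l2norm M (\<lambda>x. f n x - f0 x) + l2norm M (\<lambda>x. g n x - g0 x)) \<longlonglongrightarrow> 0"
    using tendsto_add[OF assms(5,6)] by simp
  show "l2norm M (\<lambda>x. (f n x, g n x) - (f0 x, g0 x)) \<le> l2norm M (\<lambda>x. f n x - f0 x) + l2norm M (\<lambda>x. g n x - g0 x)" for n
    using l2norm_Pair_le[OF L2_diff[OF assms(1,3)] L2_diff[OF assms(2,4)]] by simp
qed

lemma l2norm_add_tendsto:
  fixes f g :: "nat \<Rightarrow> 'a \<Rightarrow> 'b::euclidean_space"
  assumes "\<And>n. f n \<in> L2 M" "\<And>n. g n \<in> L2 M" "f0 \<in> L2 M" "g0 \<in> L2 M"
    and "l2_lim M f f0" "l2_lim M g g0"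
  shows "(\<lambda>n. l2norm M (\<lambda>x. (f n x + g n x) - (f0 x + g0 x))) \<longlonglongrightarrow> 0"
proof (rule l2norm_tendsto_squeeze)
  show "(\<lambda>n. l2norm M (\<lambda>x. f n x - f0 x) + l2norm M (\<lambda>x. g n x - g0 x)) \<longlonglongrightarrow> 0"
    using tendsto_add[OF assms(5,6)] by simp
  show "l2norm M (\<lambda>x. (f n x + g n x) - (f0 x + g0 x)) \<le> l2norm M (\<lambda>x. f n x - f0 x) + l2norm M (\<lambda>x. g n x - g0 x)" for n
    using l2norm_triangle[OF L2_diff[OF assms(1,3)] L2_diff[OF assms(2,4)]] by (simp add: algebra_simps)
qed

text \<open>Against a fixed square integrable factor, bounded pointwise convergence of the
  multipliers is enough. This is how the smoothed kernels reach their limits.\<close>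

lemma l2_dominated_mult_tendsto:
  fixes f :: "'a \<Rightarrow> real" and b :: "nat \<Rightarrow> 'a \<Rightarrow> real"
  assumes f: "f \<in> L2 M" and b: "\<And>n. b n \<in> borel_measurable M" "b0 \<in> borel_measurable M"
    and bd: "\<And>n x. x \<in> space M \<Longrightarrow> \<bar>b n x\<bar> \<le> B" and lim: "\<And>x. x \<in> space M \<Longrightarrow> (\<lambda>n. b n x) \<longlonglongrightarrow> b0 x"
  shows "l2_lim M (\<lambda>n x. f x * b n x) (\<lambda>x. f x * b0 x)" "(\<lambda>x. f x * b0 x) \<in> L2 M" "(\<lambda>x. f x * b n x) \<in> L2 M"
proof -
  have [measurable]: "f \<in> borel_measurable M" "b0 \<in> borel_measurable M" "\<And>n. b n \<in> borel_measurable M"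
    using L2_measurable[OF f] b by auto
  have b0: "\<bar>b0 x\<bar> \<le> B" if "x \<in> space M" for x
    using tendsto_upperbound[OF tendsto_rabs[OF lim[OF that]], of B] bd[OF that] by auto
  have "(\<lambda>n. \<integral>x. (f x * b n x - f x * b0 x)\<^sup>2 \<partial>M) \<longlonglongrightarrow> (\<integral>x. 0 \<partial>M)"
  proof (rule integral_dominated_convergence[where w="\<lambda>x. (2 * B)\<^sup>2 * (f x)\<^sup>2"])
    show "integrable M (\<lambda>x. (2 * B)\<^sup>2 * (f x)\<^sup>2)" using L2_integrable_sq[OF f] by simp
    show "AE x in M. (\<lambda>n. (f x * b n x - f x * b0 x)\<^sup>2) \<longlonglongrightarrow> 0"
    proof (rule AE_I2)
      fix x assume "x \<in> space M"
      then have "(\<lambda>n. (f x * b n x - f x * b0 x)\<^sup>2) \<longlonglongrightarrow> (f x * b0 x - f x * b0 x)\<^sup>2" by (intro tendsto_intros lim)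
      then show "(\<lambda>n. (f x * b n x - f x * b0 x)\<^sup>2) \<longlonglongrightarrow> 0" by simp
    qed
    show "AE x in M. norm ((f x * b n x - f x * b0 x)\<^sup>2) \<le> (2 * B)\<^sup>2 * (f x)\<^sup>2" for n
    proof (rule AE_I2)
      fix x assume x: "x \<in> space M"
      have "\<bar>b n x - b0 x\<bar> \<le> 2 * B" using bd[OF x, of n] b0[OF x] by linarith
      then have "\<bar>b n x - b0 x\<bar>\<^sup>2 \<le> (2 * B)\<^sup>2" by (rule power_mono) simp
      then have "(f x)\<^sup>2 * \<bar>b n x - b0 x\<bar>\<^sup>2 \<le> (f x)\<^sup>2 * (2 * B)\<^sup>2" by (rule mult_left_mono) simp
      moreover have "(f x * b n x - f x * b0 x)\<^sup>2 = (f x)\<^sup>2 * \<bar>b n x - b0 x\<bar>\<^sup>2"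
        by (simp add: power_mult_distrib flip: right_diff_distrib)
      ultimately show "norm ((f x * b n x - f x * b0 x)\<^sup>2) \<le> (2 * B)\<^sup>2 * (f x)\<^sup>2" by (simp add: mult.commute)
    qed
  qed measurable
  then have "(\<lambda>n. sqrt (\<integral>x. (f x * b n x - f x * b0 x)\<^sup>2 \<partial>M)) \<longlonglongrightarrow> sqrt 0" by (intro tendsto_intros) simp
  then show "l2_lim M (\<lambda>n x. f x * b n x) (\<lambda>x. f x * b0 x)"
    by (simp add: l2norm_def l2inner_def power2_eq_square)
  show "(\<lambda>x. f x * b0 x) \<in> L2 M" using L2_bounded_mult[OF f b(2) b0] by (simp add: mult.commute)
  show "(\<lambda>x. f x * b n x) \<in> L2 M" using L2_bounded_mult[OF f b(1) bd] by (simp add: mult.commute)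
qed

text \<open>As $h'$ is merely square integrable, modes are smoothed by replacing $\ln L$ with a smooth \<open>l\<close>; then $L'$ enters
  only through the derivative of \<open>l\<close>, which converges to $\lambda$ in $L^2$.\<close>

definition wave :: "(real \<Rightarrow> real) \<Rightarrow> (real \<Rightarrow> real) \<Rightarrow> real \<times> real \<Rightarrow> real" where
  "wave l f p = sqrt 2 * exp (- l (fst p) / 2) * f (pi * snd p * exp (- l (fst p)))"

text \<open>Generator of dilations: minus the derivative of exp(-l/2) s(t exp(-l)) with respect to l
  at l = 0. For \<open>sin\<close> it is \<open>tau\<close>.\<close>

definition dil :: "(real \<Rightarrow> real) \<Rightarrow> real \<Rightarrow> real" where
  "dil s t = s t / 2 + t * partial 1 s t"

lemma smooth_wave:
  assumes "smooth l" "smooth f" shows "smooth (wave l f)"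
proof -
  have c: "smooth (\<lambda>p::real\<times>real. c * l (fst p))" for c by (intro smooth_cmult smooth_compose[OF assms(1)] smooth_fst)
  have "smooth (\<lambda>p::real\<times>real. sqrt 2 * exp ((- 1 / 2) * l (fst p)) * f (pi * snd p * exp ((- 1) * l (fst p))))"
    by (intro smooth_mult smooth_const smooth_compose[OF assms(2)] smooth_compose[OF smooth_exp] c smooth_snd)
  moreover have "wave l f = (\<lambda>p. sqrt 2 * exp ((- 1 / 2) * l (fst p)) * f (pi * snd p * exp ((- 1) * l (fst p))))"
    by (rule ext) (simp add: wave_def)
  ultimately show ?thesis by simp
qed

lemma wave_partial:
  assumes l: "smooth l" "\<And>x. (l has_real_derivative g x) (at x)" and s: "smooth s"
  shows "partial (1, 0) (wave l s) p = - (g (fst p) * wave l (dil s) p)"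
    "partial (0, 1) (wave l s) p = pi * exp (- l (fst p)) * wave l (partial 1 s) p"
proof -
  obtain x y where p: "p = (x, y)" by (cases p)
  have ds: "(s has_real_derivative partial 1 s t) (at t)" for t by (rule smooth_has_real_derivative[OF s])
  define E where "E = exp (- l x)"
  define H where "H = exp (- l x / 2)"
  have d1: "((\<lambda>x. s (pi * y * exp (- l x))) has_real_derivative partial 1 s (pi * y * E) * (pi * y * (E * - g x))) (at x)"
    unfolding E_def by (rule DERIV_chain2[OF ds]) (auto intro!: derivative_eq_intros l(2))
  have d2: "((\<lambda>x. exp (- l x / 2)) has_real_derivative H * (- g x / 2)) (at x)"
    unfolding H_def by (auto intro!: derivative_eq_intros l(2))
  have "((\<lambda>t. wave l s (t, y)) has_real_derivative
      sqrt 2 * (H * (- g x / 2)) * s (pi * y * E) + sqrt 2 * H * (partial 1 s (pi * y * E) * (pi * y * (E * - g x)))) (at x)"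
    unfolding wave_def fst_conv snd_conv
    by (rule derivative_eq_intros d1 d2 refl | simp add: E_def H_def)+
  then have "partial (1, 0) (wave l s) (x, y) = sqrt 2 * (H * (- g x / 2)) * s (pi * y * E) + sqrt 2 * H * (partial 1 s (pi * y * E) * (pi * y * (E * - g x)))"
    by (rule DERIV_unique[OF smooth_slice_DERIV(1)[OF smooth_wave[OF l(1) s]]])
  also have "\<dots> = - (g x * wave l (dil s) (x, y))"
    unfolding wave_def dil_def fst_conv snd_conv E_def[symmetric] H_def[symmetric] by (simp add: algebra_simps)
  finally show "partial (1, 0) (wave l s) p = - (g (fst p) * wave l (dil s) p)" by (simp add: p)
  have "((\<lambda>t. wave l s (x, t)) has_real_derivative sqrt 2 * H * (partial 1 s (pi * y * E) * (pi * E))) (at y)"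
    unfolding wave_def fst_conv snd_conv E_def[symmetric] H_def[symmetric]
    by (rule DERIV_cmult, rule DERIV_chain2[OF ds]) (auto intro!: derivative_eq_intros)
  then have "partial (0, 1) (wave l s) (x, y) = sqrt 2 * H * (partial 1 s (pi * y * E) * (pi * E))"
    by (rule DERIV_unique[OF smooth_slice_DERIV(2)[OF smooth_wave[OF l(1) s]]])
  also have "\<dots> = pi * E * wave l (partial 1 s) (x, y)"
    unfolding wave_def fst_conv snd_conv E_def[symmetric] H_def[symmetric] by (simp add: algebra_simps)
  finally show "partial (0, 1) (wave l s) p = pi * exp (- l (fst p)) * wave l (partial 1 s) p" by (simp add: p E_def)
qed

lemma smooth_dil: "smooth s \<Longrightarrow> smooth (dil s)"
proof -
  assume s: "smooth s"
  have "smooth (\<lambda>t. (1/2) * s t + t * partial 1 s t)"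
    by (intro smooth_add smooth_mult smooth_cmult smooth_ident s smooth_partial) simp
  then show ?thesis by (simp add: dil_def[abs_def])
qed

lemma dil_sin: "dil sin = tau"
proof -
  have "partial 1 sin = (cos :: real \<Rightarrow> real)" by (rule ext) (rule partial_real[OF DERIV_sin])
  then show ?thesis by (simp add: fun_eq_iff dil_def tau_def)
qed

lemma smooth_partial_real: "smooth s \<Longrightarrow> smooth (partial 1 s)" for s :: "real \<Rightarrow> real"
  by (rule smooth_partial) simp_all

context tube begin

text \<open>A function of x alone is a constant profile in disguise: multiply and divide by sqrt(L /
  2) and use the norm formula for \<open>ker\<close>. The second claim provides one constant for all
  \<eta>, so that it can be applied along a sequence.\<close>

lemma fst_L2:
  fixes \<eta> :: "real \<Rightarrow> real"
  assumes "\<eta> \<in> L2 MI"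
  shows "(\<lambda>p. \<eta> (fst p)) \<in> L2 MO"
    "\<exists>K\<ge>0. \<forall>\<eta>::real \<Rightarrow> real\<in>L2 MI. l2norm MO (\<lambda>p. \<eta> (fst p)) \<le> K * l2norm MI \<eta>"
proof -
  obtain LM where LM: "LM > 0" "\<And>x. Lb x \<le> LM" by (rule L_upper, rule that)
  have m: "(\<lambda>x. sqrt (Lb x / 2)) \<in> borel_measurable MI"
    by (intro borel_measurable_leb borel_measurable_continuous_onI continuous_on_real_sqrt continuous_on_divide
        Lb_continuous continuous_on_const) simp
  have b: "\<bar>sqrt (Lb x / 2)\<bar> \<le> sqrt (LM / 2)" for x using LM(2)[of x] Lb_pos[of x] by simp
  have e: "\<eta> (fst p) = sqrt (Lb (fst p) / 2) * \<eta> (fst p) * ker (\<lambda>_. 1) p" for p and \<eta> :: "real \<Rightarrow> real"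
  proof -
    have "sqrt (Lb (fst p) / 2) * sqrt (2 / Lb (fst p)) = 1"
      unfolding real_sqrt_mult[symmetric] by (simp add: Lb_neq_0)
    then show ?thesis by (simp add: ker_def mult.commute mult.left_commute)
  qed
  have w: "(\<lambda>x. sqrt (Lb x / 2) * \<eta> x) \<in> L2 MI" if "\<eta> \<in> L2 MI" for \<eta>
    using L2_bounded_mult[OF that m b] by simp
  show "(\<lambda>p. \<eta> (fst p)) \<in> L2 MO"
    using mult_ker_L2[OF w[OF assms], of "\<lambda>_. 1"] by (subst e) simp
  have "l2norm MO (\<lambda>p. \<eta> (fst p)) \<le> sqrt (J (\<lambda>_. 1) (\<lambda>_. 1)) * sqrt (LM / 2) * l2norm MI \<eta>" if "\<eta> \<in> L2 MI" for \<eta> :: "real \<Rightarrow> real"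
  proof -
    have "l2norm MO (\<lambda>p. \<eta> (fst p)) = sqrt (J (\<lambda>_. 1) (\<lambda>_. 1)) * l2norm MI (\<lambda>x. sqrt (Lb x / 2) * \<eta> x)"
      by (subst e, rule mode_norm[OF w[OF that]]) simp
    also have "\<dots> \<le> sqrt (J (\<lambda>_. 1) (\<lambda>_. 1)) * (sqrt (LM / 2) * l2norm MI \<eta>)"
      using l2norm_bounded_mult[OF that m b] LM(1) by (intro mult_left_mono) (auto simp: J_def)
    finally show ?thesis by simp
  qed
  then show "\<exists>K\<ge>0. \<forall>\<eta>::real \<Rightarrow> real\<in>L2 MI. l2norm MO (\<lambda>p. \<eta> (fst p)) \<le> K * l2norm MI \<eta>"
    using LM(1) by (intro exI[of _ "sqrt (J (\<lambda>_. 1) (\<lambda>_. 1)) * sqrt (LM / 2)"]) (auto simp: J_def)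
qed

lemma fst_tendsto:
  fixes f0 :: "real \<Rightarrow> real"
  assumes "\<And>n. f n \<in> L2 MI" "f0 \<in> L2 MI" "l2_lim MI f f0"
  shows "l2_lim MO (\<lambda>n p. f n (fst p)) (\<lambda>p. f0 (fst p))"
proof -
  obtain K where K: "\<And>\<eta>::real \<Rightarrow> real. \<eta> \<in> L2 MI \<Longrightarrow> l2norm MO (\<lambda>p. \<eta> (fst p)) \<le> K * l2norm MI \<eta>" using fst_L2(2)[OF assms(2)] by blast
  show ?thesis
  proof (rule l2norm_tendsto_squeeze)
    show "(\<lambda>n. K * l2norm MI (\<lambda>x. f n x - f0 x)) \<longlonglongrightarrow> 0" using tendsto_mult_left[OF assms(3)] by simp
    show "l2norm MO (\<lambda>p. f n (fst p) - f0 (fst p)) \<le> K * l2norm MI (\<lambda>x. f n x - f0 x)" for n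
      by (rule K[OF L2_diff[OF assms(1,2)]])
  qed
qed

text \<open>The device of \<open>fst_L2\<close> in the other direction: integrating over a fibre is
  pairing with the constant profile.\<close>

lemma fib_eq_pr: "x \<in> {\<alpha>..\<beta>} \<Longrightarrow> fib F x = sqrt (Lb x / 2) * pr (\<lambda>_. 1) F x"
proof -
  have e: "sqrt (Lb x / 2) * sqrt (2 / Lb x) = 1" unfolding real_sqrt_mult[symmetric] by (simp add: Lb_neq_0)
  have "sqrt (Lb x / 2) * pr (\<lambda>_. 1) F x = (\<integral>y. sqrt (Lb x / 2) * (indicator S (x, y) * (F (x, y) * ker (\<lambda>_. 1) (x, y))) \<partial>lborel)"
    by (simp add: pr_def fib_def)
  also have "\<dots> = (\<integral>y. (sqrt (Lb x / 2) * sqrt (2 / Lb x)) * (indicator S (x, y) * F (x, y)) \<partial>lborel)"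
    by (rule Bochner_Integration.integral_cong) (auto simp: ker_def)
  finally show ?thesis unfolding e by (simp add: fib_def)
qed

lemma fib_tendsto:
  assumes "\<And>n. f n \<in> L2 MO" "f0 \<in> L2 MO" "l2_lim MO f f0"
  shows "l2_lim MI (\<lambda>n x. fib (f n) x) (\<lambda>x. fib f0 x)" "fib f0 \<in> L2 MI"
proof -
  obtain LM where LM: "LM > 0" "\<And>x. Lb x \<le> LM" by (rule L_upper, rule that)
  have m: "(\<lambda>x. sqrt (Lb x / 2)) \<in> borel_measurable MI"
    by (intro borel_measurable_leb borel_measurable_continuous_onI continuous_on_real_sqrt continuous_on_divide
        Lb_continuous continuous_on_const) simp
  have b: "\<bar>sqrt (Lb x / 2)\<bar> \<le> sqrt (LM / 2)" for x using LM(2)[of x] Lb_pos[of x] by simp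
  have c1: "continuous_on UNIV (\<lambda>_::real. 1::real)" by simp
  note P = pr_L2(1)[OF _ c1]
  have "(\<lambda>x. sqrt (Lb x / 2) * pr (\<lambda>_. 1) f0 x) \<in> L2 MI" using L2_bounded_mult[OF P[OF assms(2)] m b] by simp
  then show "fib f0 \<in> L2 MI"
    by (rule L2_cong_AE) (use fib_eq_pr fib_measurable[OF L2_measurable[OF assms(2)]] in auto)
  show "l2_lim MI (\<lambda>n x. fib (f n) x) (\<lambda>x. fib f0 x)"
  proof (rule l2norm_tendsto_squeeze)
    show "(\<lambda>n. sqrt (LM / 2) * l2norm MI (\<lambda>x. pr (\<lambda>_. 1) (f n) x - pr (\<lambda>_. 1) f0 x)) \<longlonglongrightarrow> 0"
      using tendsto_mult_left[OF pr_tendsto[OF assms(1,2) c1 assms(3)]] by simp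
    fix n
    have d: "(\<lambda>x. pr (\<lambda>_. 1) (f n) x - pr (\<lambda>_. 1) f0 x) \<in> L2 MI" by (intro L2_diff P assms)
    have "l2norm MI (\<lambda>x. fib (f n) x - fib f0 x) = l2norm MI (\<lambda>x. sqrt (Lb x / 2) *\<^sub>R (pr (\<lambda>_. 1) (f n) x - pr (\<lambda>_. 1) f0 x))"
      unfolding l2norm_def l2inner_def
      by (intro arg_cong[of _ _ sqrt] Bochner_Integration.integral_cong) (simp_all add: fib_eq_pr algebra_simps)
    also have "\<dots> \<le> sqrt (LM / 2) * l2norm MI (\<lambda>x. pr (\<lambda>_. 1) (f n) x - pr (\<lambda>_. 1) f0 x)"
      by (rule l2norm_bounded_mult[OF d m b]) (use LM(1) in simp)
    finally show "l2norm MI (\<lambda>x. fib (f n) x - fib f0 x) \<le> sqrt (LM / 2) * l2norm MI (\<lambda>x. pr (\<lambda>_. 1) (f n) x - pr (\<lambda>_. 1) f0 x)" .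
  qed
qed

text \<open>Approximate \<open>lam\<close> in L^2 by test functions and integrate. By Cauchy-Schwarz
  the logarithms then converge uniformly, with error at most a constant times the L^2 error.\<close>

lemma log_approximation:
  obtains g l :: "nat \<Rightarrow> real \<Rightarrow> real" and \<eta> :: "nat \<Rightarrow> real"
  where "\<And>n. g n \<in> test_functions {\<alpha>..\<beta>}" "l2_lim MI g lam"
    "\<And>n x. (l n has_real_derivative g n x) (at x)" "\<And>n. smooth (l n)"
    "\<eta> \<longlonglongrightarrow> 0" "\<And>n x. x \<in> {\<alpha>..\<beta>} \<Longrightarrow> \<bar>l n x - ln (L x)\<bar> \<le> \<eta> n"
proof -
  interpret finite_measure MI by (rule finite_MI)
  obtain g where g: "\<And>n::nat. g n \<in> test_functions {\<alpha>..\<beta>}" "l2_lim MI g lam"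
    by (rule test_functions_dense_seq[OF interval_borel AE_interval_interior lamL], rule that)
  have "\<exists>\<Psi>. (\<forall>x. (\<Psi> has_real_derivative g n x) (at x)) \<and> \<Psi> \<alpha> = 0" for n
    by (rule integral_continuous_antiderivative[OF test_real_continuous(1)[OF g(1)[of n]], where c=\<alpha>]) blast
  then obtain \<Psi> where \<Psi>: "\<And>n x. (\<Psi> n has_real_derivative g n x) (at x)" "\<And>n. \<Psi> n \<alpha> = 0" by metis
  define l where "l n x = ln (L \<alpha>) + \<Psi> n x" for n x
  have dl: "(l n has_real_derivative g n x) (at x)" for n x
    unfolding l_def by (auto intro!: derivative_eq_intros \<Psi>(1))
  define K where "K = sqrt (measure MI (space MI))"
  have bd: "\<bar>l n x - ln (L x)\<bar> \<le> l2norm MI (\<lambda>x. g n x - lam x) * K" if x: "x \<in> {\<alpha>..\<beta>}" for n x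
  proof -
    have im: "indicator {\<alpha>..x} \<in> borel_measurable MI" by (intro borel_measurable_leb) auto
    have ii: "integrable MI (\<lambda>t. indicator {\<alpha>..x} t * f t)" if "f \<in> L2 MI" for f :: "real \<Rightarrow> real"
    proof -
      have "(\<lambda>t. indicator {\<alpha>..x} t *\<^sub>R f t) \<in> L2 MI"
        by (rule L2_bounded_mult[OF that im, of 1]) (simp add: indicator_def)
      then show ?thesis using L2_norm_integral_le(1) by fastforce
    qed
    note gL = test_functions_L2[OF interval_borel(1) g(1)[of n]]
    have "(\<integral>t. indicator {\<alpha>..x} t * g n t \<partial>MI) = (\<integral>t. g n t * indicator {\<alpha>..x} t \<partial>lborel)"
      unfolding integral_leb[OF interval_borel(1)]
      by (rule Bochner_Integration.integral_cong) (use x in \<open>auto simp: indicator_def\<close>)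
    also have "\<dots> = \<Psi> n x - \<Psi> n \<alpha>"
      using x test_real_continuous(1)[OF g(1)[of n], of UNIV]
      by (intro integral_FTC_Icc_real) (auto simp: continuous_on_eq_continuous_at intro: \<Psi>(1))
    finally have "l n x = ln (L \<alpha>) + (\<integral>t. indicator {\<alpha>..x} t * g n t \<partial>MI)" by (simp add: l_def \<Psi>(2))
    then have "l n x - ln (L x) = (\<integral>t. indicator {\<alpha>..x} t * (g n t - lam t) \<partial>MI)"
      using logL[OF x] ii[OF gL] ii[OF lamL] by (simp add: right_diff_distrib)
    then have "\<bar>l n x - ln (L x)\<bar> \<le> (\<integral>t. norm (indicator {\<alpha>..x} t * (g n t - lam t)) \<partial>MI)"
      using integral_norm_bound[of MI "\<lambda>t. indicator {\<alpha>..x} t * (g n t - lam t)"] by simp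
    also have "\<dots> \<le> (\<integral>t. norm (g n t - lam t) \<partial>MI)"
      using L2_norm_integral_le(1)[OF L2_diff[OF gL lamL]] by (intro integral_mono_AE') (auto simp: indicator_def)
    also have "\<dots> \<le> l2norm MI (\<lambda>x. g n x - lam x) * K"
      unfolding K_def by (rule L2_norm_integral_le(2)[OF L2_diff[OF gL lamL]])
    finally show ?thesis .
  qed
  show thesis
  proof (rule that[OF g dl])
    show "smooth (l n)" for n by (rule smooth_antiderivative[OF test_functionsD(1)[OF g(1)] dl])
    show "(\<lambda>n. l2norm MI (\<lambda>x. g n x - lam x) * K) \<longlonglongrightarrow> 0" using tendsto_mult_right[OF g(2), of K] by simp
  qed (rule bd)
qed

lemma wave_ker:
  assumes "p \<in> S" "\<And>x. x \<in> {\<alpha>..\<beta>} \<Longrightarrow> l x = ln (L x)"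
  shows "wave l f p = ker f p" "exp (- l (fst p)) = 1 / Lb (fst p)"
proof -
  have x: "fst p \<in> {\<alpha>..\<beta>}" by (rule S_fst[OF assms(1)])
  have l: "l (fst p) = ln (Lb (fst p))" using assms(2)[OF x] Lb_eq[OF x] by simp
  show e: "exp (- l (fst p)) = 1 / Lb (fst p)" unfolding l by (simp add: exp_minus Lb_pos inverse_eq_divide)
  have "exp (- l (fst p) / 2) = sqrt (exp (- l (fst p)))"
    by (rule real_sqrt_unique[symmetric]) (simp_all flip: exp_double)
  then show "wave l f p = ker f p" unfolding wave_def e ker_def by (simp add: real_sqrt_divide)
qed

text \<open>Uniform convergence of \<open>l n\<close> to ln L gives pointwise convergence of the
  waves and also confines the arguments of \<open>f\<close> to one compact interval, whence the
  bounds uniform in n.\<close>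

lemma wave_tendsto:
  assumes f: "continuous_on UNIV f" and l: "\<And>n. smooth (l n)"
    and \<eta>: "\<eta> \<longlonglongrightarrow> 0" "\<And>n x. x \<in> {\<alpha>..\<beta>} \<Longrightarrow> \<bar>l n x - ln (L x)\<bar> \<le> \<eta> n"
  shows "\<And>p. p \<in> S \<Longrightarrow> (\<lambda>n. wave (l n) f p) \<longlonglongrightarrow> ker f p"
    "\<And>p. p \<in> S \<Longrightarrow> (\<lambda>n. exp (- l n (fst p))) \<longlonglongrightarrow> 1 / Lb (fst p)"
    "\<exists>B. \<forall>n. \<forall>p\<in>S. \<bar>wave (l n) f p\<bar> \<le> B" "\<exists>B. \<forall>n. \<forall>p\<in>S. \<bar>exp (- l n (fst p))\<bar> \<le> B"
proof -
  have lt: "(\<lambda>n. l n x) \<longlonglongrightarrow> ln (L x)" if "x \<in> {\<alpha>..\<beta>}" for x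
    by (rule LIM_zero_cancel, rule LIMSEQ_null_squeeze[OF \<eta>(1) \<eta>(2)[OF that]])
  show "(\<lambda>n. wave (l n) f p) \<longlonglongrightarrow> ker f p" if "p \<in> S" for p
  proof -
    have "(\<lambda>n. wave (l n) f p) \<longlonglongrightarrow> wave (\<lambda>x. ln (L x)) f p"
      unfolding wave_def using f
      by (intro tendsto_intros lt S_fst[OF that] isCont_tendsto_compose[of _ f]) (auto simp: continuous_on_eq_continuous_at)
    then show ?thesis using wave_ker(1)[OF that] by simp
  qed
  show "(\<lambda>n. exp (- l n (fst p))) \<longlonglongrightarrow> 1 / Lb (fst p)" if "p \<in> S" for p
    unfolding wave_ker(2)[OF that, of "\<lambda>x. ln (L x)", OF refl, symmetric] by (intro tendsto_intros lt S_fst[OF that])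
  obtain E where E: "\<And>n. \<eta> n \<le> E"
  proof -
    have "Bseq \<eta>" by (rule convergent_imp_Bseq) (use \<eta>(1) in \<open>auto simp: convergent_def\<close>)
    then obtain K where "\<And>n. norm (\<eta> n) \<le> K" unfolding Bseq_def by blast
    then show thesis by (intro that[of K]) (auto intro: order_trans[OF abs_ge_self])
  qed
  have c1: "compact ((\<lambda>x. ln (L x)) ` {\<alpha>..\<beta>})"
    by (rule compact_continuous_image) (auto intro!: continuous_intros Lc dest: Lpos less_imp_neq)
  then obtain D where D: "\<forall>y\<in>(\<lambda>x. ln (L x)) ` {\<alpha>..\<beta>}. \<bar>y\<bar> \<le> D"
    using compact_imp_bounded[OF c1, unfolded bounded_real] by blast
  have lb: "\<bar>l n x\<bar> \<le> D + E" if "x \<in> {\<alpha>..\<beta>}" for n x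
  proof -
    have "\<bar>ln (L x)\<bar> \<le> D" using D that by blast
    then show ?thesis using \<eta>(2)[OF that, of n] E[of n] by linarith
  qed
  have eb: "exp (- l n x) \<le> exp (D + E)" "exp (- l n x / 2) \<le> exp (D + E)" if "x \<in> {\<alpha>..\<beta>}" for n x
    using lb[OF that, of n] by auto
  then show "\<exists>B. \<forall>n. \<forall>p\<in>S. \<bar>exp (- l n (fst p))\<bar> \<le> B" using S_fst by (intro exI[of _ "exp (D + E)"]) auto
  obtain LM where LM: "LM > 0" "\<And>x. Lb x \<le> LM" by (rule L_upper, rule that)
  define R where "R = pi * LM * exp (D + E)"
  have c2: "compact (f ` {-R..R})" by (rule compact_continuous_image[OF continuous_on_subset[OF f]]) auto
  then obtain F where F: "\<forall>y\<in>f ` {-R..R}. \<bar>y\<bar> \<le> F"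
    using compact_imp_bounded[OF c2, unfolded bounded_real] by blast
  have "\<bar>wave (l n) f p\<bar> \<le> sqrt 2 * exp (D + E) * F" if p: "p \<in> S" for n p
  proof -
    have x: "fst p \<in> {\<alpha>..\<beta>}" by (rule S_fst[OF p])
    have y: "0 < snd p" "snd p \<le> LM" using p LM(2)[of "fst p"] by (auto simp: S_alt)
    have "pi * snd p * exp (- l n (fst p)) \<le> R"
      unfolding R_def using y eb(1)[OF x, of n] LM(1) by (intro mult_mono) auto
    moreover have "0 \<le> pi * snd p * exp (- l n (fst p))" using y by simp
    ultimately have "pi * snd p * exp (- l n (fst p)) \<in> {-R..R}" by auto
    then have "\<bar>f (pi * snd p * exp (- l n (fst p)))\<bar> \<le> F" using F by blast
    then show ?thesis unfolding wave_def abs_mult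
      using eb(2)[OF x, of n] by (intro mult_mono) auto
  qed
  then show "\<exists>B. \<forall>n. \<forall>p\<in>S. \<bar>wave (l n) f p\<bar> \<le> B" by blast
qed

end

lemma has_H10_gradient_closed_plane:
  fixes u :: "nat \<Rightarrow> real \<times> real \<Rightarrow> real"
  assumes S: "S \<in> sets borel" and p: "\<And>n. has_H10_gradient S (u n) (\<lambda>x. (g n x, k n x))"
    and L: "u0 \<in> L2 (leb S)" "g0 \<in> L2 (leb S)" "k0 \<in> L2 (leb S)"
    and lim: "l2_lim (leb S) u u0"
      "l2_lim (leb S) g g0" "l2_lim (leb S) k k0"
  shows "has_H10_gradient S u0 (\<lambda>x. (g0 x, k0 x))"
proof (rule has_H10_gradient_closed[OF S p L(1) _ lim(1)])
  show "(\<lambda>x. (g0 x, k0 x)) \<in> L2 (leb S)" using L by (simp add: L2_Pair)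
  have "g n \<in> L2 (leb S)" "k n \<in> L2 (leb S)" for n
    using has_H10_gradient_L2(2)[OF p[of n]] by (simp_all add: L2_Pair)
  then show "l2_lim (leb S) (\<lambda>n x. (g n x, k n x)) (\<lambda>x. (g0 x, k0 x))"
    by (intro l2norm_Pair_tendsto L lim)
qed

lemma J_eq_l2:
  assumes "continuous_on UNIV s" shows "J s s = 2 / pi * (l2norm (leb {0..pi}) s)\<^sup>2"
proof -
  have "AE t in lborel. t \<noteq> 0" "AE t in lborel. t \<noteq> pi" by (rule AE_lborel_singleton)+
  then have ae: "AE t in lborel. indicator {0<..<pi} t * (s t * s t) = indicator {0..pi} t * (s t * s t)"
    by eventually_elim (auto simp: indicator_def)
  have [measurable]: "s \<in> borel_measurable borel" by (rule borel_measurable_continuous_onI[OF assms])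
  have "(\<integral>t. indicator {0<..<pi} t * (s t * s t) \<partial>lborel) = (\<integral>t. indicator {0..pi} t * (s t * s t) \<partial>lborel)"
    by (rule integral_cong_AE[OF _ _ ae]) measurable
  then show ?thesis unfolding J_def l2norm_sq l2inner_def integral_leb[OF interval_borel(1)] by simp
qed

lemma sin_H10: "has_H10_gradient {0..pi} sin cos"
proof (rule has_H10_gradient_antiderivative)
  have rep: "(\<integral>t. indicator {0..x} t * cos t \<partial>leb {0..pi}) = sin x" if "x \<in> {0..pi}" for x
  proof -
    have "(\<integral>t. indicator {0..x} t * cos t \<partial>leb {0..pi}) = (\<integral>t. cos t * indicator {0..x} t \<partial>lborel)"
      unfolding integral_leb[OF interval_borel(1)]
      by (rule Bochner_Integration.integral_cong) (use that in \<open>auto simp: indicator_def\<close>)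
    also have "\<dots> = sin x - sin 0"
      by (rule integral_FTC_Icc_real) (use that in \<open>auto intro!: derivative_eq_intros\<close>)
    finally show ?thesis by simp
  qed
  show "sin x = (\<integral>t. indicator {0..x} t * cos t \<partial>leb {0..pi})" if "x \<in> {0..pi}" for x using rep[OF that] by simp
  have "(\<integral>t. cos t \<partial>leb {0..pi}) = (\<integral>t. indicator {0..pi} t * cos t \<partial>leb {0..pi})"
    unfolding integral_leb[OF interval_borel(1)] by (rule Bochner_Integration.integral_cong) (auto simp: indicator_def)
  also have "\<dots> = 0" using rep[of pi] by simp
  finally show "(\<integral>t. cos t \<partial>leb {0..pi}) = 0" .
  have "integrable (leb {0..pi}) (\<lambda>t. (norm (cos t))\<^sup>2)"
    unfolding integrable_leb[OF interval_borel(1)] by (rule borel_integrable_compact) (auto intro!: continuous_intros)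
  moreover have "cos \<in> borel_measurable (leb {0..pi})"
    by (intro borel_measurable_leb borel_measurable_continuous_onI continuous_intros)
  ultimately show "cos \<in> L2 (leb {0..pi})" by (simp add: L2_def)
qed simp

context tube begin

section \<open>Multiplication by \<lambda> and convergence of smoothed modes\<close>

lemma interior_S: "{p. \<alpha> < fst p \<and> fst p < \<beta> \<and> 0 < snd p \<and> snd p < Lb (fst p)} \<subseteq> interior S"
proof (rule interior_maximal)
  show "open {p. \<alpha> < fst p \<and> fst p < \<beta> \<and> 0 < snd p \<and> snd p < Lb (fst p)}"
    by (intro open_Collect_conj open_Collect_less continuous_intros Lbf_continuous)
qed (auto simp: S_alt)

definition lamsq :: "real \<Rightarrow> real" where "lamsq x = indicator {\<alpha>..\<beta>} x * (lam x)\<^sup>2"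

lemma lam_sq: "integrable lborel lamsq" "0 \<le> lamsq x" "(\<integral>x. lamsq x \<partial>lborel) = (l2norm MI lam)\<^sup>2"
  using L2_integrable_sq[OF lamL]
  by (simp_all add: lamsq_def[abs_def] l2norm_sq l2inner_def integral_leb integrable_leb power2_eq_square[of "lam _"])

text \<open>\<open>weighted_bound_real\<close> with weight \<lambda>^2. That the bound is a product
  of the two norms is what produces the square roots of small lengths in \<open>DD\<close>.\<close>

lemma lam_mult_L2:
  assumes u: "HI u g"
  shows "(\<lambda>x. u x * lam x) \<in> L2 MI"
    "(l2norm MI (\<lambda>x. u x * lam x))\<^sup>2 \<le> 2 * (l2norm MI lam)\<^sup>2 * l2norm MI u * l2norm MI g"
proof -
  note W = weighted_bound_real[OF lam_sq(1,2) u]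
  have eq: "lamsq x * (u x)\<^sup>2 = (u x * lam x)\<^sup>2" if "x \<in> {\<alpha>..\<beta>}" for x using that by (simp add: lamsq_def power_mult_distrib)
  have "integrable MI (\<lambda>x. (u x * lam x)\<^sup>2)"
    using W(1) by (rule Bochner_Integration.integrable_cong[THEN iffD1, rotated -1]) (auto simp: eq)
  then show "(\<lambda>x. u x * lam x) \<in> L2 MI"
    using L2_measurable[OF lamL] L2_measurable[OF has_H10_gradient_L2(1)[OF u]] by (simp add: L2_def)
  have "(l2norm MI (\<lambda>x. u x * lam x))\<^sup>2 = (\<integral>x. lamsq x * (u x)\<^sup>2 \<partial>MI)"
    unfolding l2norm_sq l2inner_def
    by (rule Bochner_Integration.integral_cong) (simp_all only: space_leb inner_real_def eq, simp_all only: power2_eq_square)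
  then show "(l2norm MI (\<lambda>x. u x * lam x))\<^sup>2 \<le> 2 * (l2norm MI lam)\<^sup>2 * l2norm MI u * l2norm MI g" using W(2) by (simp add: lam_sq(3))
qed

lemma lam_mult_L2_plane:
  assumes u: "HS u g"
  shows "(\<lambda>p. lam (fst p) * u p) \<in> L2 MO"
    "(l2norm MO (\<lambda>p. lam (fst p) * u p))\<^sup>2 \<le> 2 * (l2norm MI lam)\<^sup>2 * l2norm MO u * l2norm MO g"
proof -
  note W = weighted_bound_plane[OF lam_sq(1,2) S_borel S_bounded u]
  have eq: "lamsq (fst p) * (u p)\<^sup>2 = (lam (fst p) * u p)\<^sup>2" if "p \<in> S" for p using S_fst[OF that] by (simp add: lamsq_def power_mult_distrib)
  have "integrable MO (\<lambda>p. (lam (fst p) * u p)\<^sup>2)"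
    using W(1) by (rule Bochner_Integration.integrable_cong[THEN iffD1, rotated -1]) (auto simp: eq)
  then show "(\<lambda>p. lam (fst p) * u p) \<in> L2 MO"
    using fst_measurable_MO[OF L2_measurable[OF lamL]] L2_measurable[OF has_H10_gradient_L2(1)[OF u]] by (simp add: L2_def)
  have "(l2norm MO (\<lambda>p. lam (fst p) * u p))\<^sup>2 = (\<integral>p. lamsq (fst p) * (u p)\<^sup>2 \<partial>MO)"
    unfolding l2norm_sq l2inner_def
    by (rule Bochner_Integration.integral_cong) (simp_all only: space_leb inner_real_def eq, simp_all only: power2_eq_square)
  then show "(l2norm MO (\<lambda>p. lam (fst p) * u p))\<^sup>2 \<le> 2 * (l2norm MI lam)\<^sup>2 * l2norm MO u * l2norm MO g" using W(2) by (simp add: lam_sq(3))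
qed

lemma null_of_sq_bound:
  assumes "\<And>n. (a n)\<^sup>2 \<le> C * x n * y n" "x \<longlonglongrightarrow> 0" "y \<longlonglongrightarrow> 0"
  shows "a \<longlonglongrightarrow> (0::real)"
proof -
  have "(\<lambda>n. C * x n * y n) \<longlonglongrightarrow> C * 0 * 0"
    by (rule tendsto_mult[OF tendsto_mult[OF tendsto_const assms(2)] assms(3)])
  then have "(\<lambda>n. sqrt (C * x n * y n)) \<longlonglongrightarrow> sqrt (C * 0 * 0)" by (rule tendsto_real_sqrt)
  then have "(\<lambda>n. sqrt (C * x n * y n)) \<longlonglongrightarrow> 0" by simp
  then show ?thesis by (rule LIMSEQ_null_squeeze) (use assms(1) in \<open>simp add: real_le_rsqrt\<close>)
qed

lemma const_L2: "(\<lambda>_. c::real) \<in> L2 MO"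
  using finite_MO by (simp add: L2_def finite_measure.integrable_const)

lemma invL_bounded_measurable:
  "(\<lambda>x. pi / Lb x) \<in> borel_measurable MI" "\<exists>B\<ge>0. \<forall>x. \<bar>pi / Lb x\<bar> \<le> B"
proof -
  show "(\<lambda>x. pi / Lb x) \<in> borel_measurable MI"
    by (intro borel_measurable_leb borel_measurable_continuous_onI continuous_on_divide Lb_continuous continuous_on_const) (simp add: Lb_neq_0)
  have c: "compact (Lb ` {\<alpha>..\<beta>})" by (rule compact_continuous_image[OF Lb_continuous]) simp
  obtain y where y: "y \<in> Lb ` {\<alpha>..\<beta>}" "\<forall>z\<in>Lb ` {\<alpha>..\<beta>}. y \<le> z"
    using compact_attains_inf[OF c] ab by auto
  have y0: "y > 0" using y(1) Lb_pos by auto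
  have "y \<le> Lb x" for x
  proof -
    have "max \<alpha> (min \<beta> x) \<in> {\<alpha>..\<beta>}" using ab by auto
    then have "y \<le> Lb (max \<alpha> (min \<beta> x))" using y(2) by blast
    then show ?thesis using Lb_eq[OF \<open>max \<alpha> (min \<beta> x) \<in> {\<alpha>..\<beta>}\<close>] by (simp add: Lb_def[of x])
  qed
  then have "\<bar>pi / Lb x\<bar> \<le> pi / y" for x using Lb_pos[of x] y0 by (simp add: abs_of_pos divide_left_mono)
  then show "\<exists>B\<ge>0. \<forall>x. \<bar>pi / Lb x\<bar> \<le> B" using y0 by (intro exI[of _ "pi / y"]) simp
qed

lemma invL_mult_L2: "\<xi> \<in> L2 MI \<Longrightarrow> (\<lambda>x. pi / Lb x * \<xi> x) \<in> L2 MI"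
proof -
  assume x: "\<xi> \<in> L2 MI"
  obtain B where "\<forall>x. \<bar>pi / Lb x\<bar> \<le> B" using invL_bounded_measurable(2) by blast
  then show ?thesis using L2_bounded_mult[OF x invL_bounded_measurable(1), of B] by simp
qed

text \<open>Stated for bounded measurable \<open>\<theta>\<close>, \<open>\<theta>x\<close>,
  \<open>\<theta>y\<close> in the places of a factor and its partial derivatives, so that it serves
  both a test function on the tube and a function of x alone. The limits are those of the product
  rule with \<lambda> in place of the derivative of \<open>l n\<close>.\<close>

lemma wave_gradient_tendsto:
  fixes \<theta> \<theta>x \<theta>y :: "real \<times> real \<Rightarrow> real"
  assumes m: "\<theta> \<in> borel_measurable MO" "\<theta>x \<in> borel_measurable MO" "\<theta>y \<in> borel_measurable MO"
    and bd: "\<And>p. p \<in> S \<Longrightarrow> \<bar>\<theta> p\<bar> \<le> C" "\<And>p. p \<in> S \<Longrightarrow> \<bar>\<theta>x p\<bar> \<le> C" "\<And>p. p \<in> S \<Longrightarrow> \<bar>\<theta>y p\<bar> \<le> C"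
    and s: "smooth s"
    and g: "\<And>n. g n \<in> test_functions {\<alpha>..\<beta>}" "l2_lim MI g lam"
    and l: "\<And>n. smooth (l n)" and \<eta>: "\<eta> \<longlonglongrightarrow> 0" "\<And>n x. x \<in> {\<alpha>..\<beta>} \<Longrightarrow> \<bar>l n x - ln (L x)\<bar> \<le> \<eta> n"
  defines "U n \<equiv> \<lambda>p. \<theta> p * wave (l n) s p"
    and "X n \<equiv> \<lambda>p. \<theta>x p * wave (l n) s p + (- 1) * (g n (fst p) * (\<theta> p * wave (l n) (dil s) p))"
    and "Y n \<equiv> \<lambda>p. \<theta>y p * wave (l n) s p + pi * (exp (- l n (fst p)) * (\<theta> p * wave (l n) (partial 1 s) p))"
    and "U0 \<equiv> \<lambda>p. \<theta> p * ker s p"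
    and "X0 \<equiv> \<lambda>p. \<theta>x p * ker s p + (- 1) * (lam (fst p) * (\<theta> p * ker (dil s) p))"
    and "Y0 \<equiv> \<lambda>p. \<theta>y p * ker s p + pi * (1 / Lb (fst p) * (\<theta> p * ker (partial 1 s) p))"
  shows "l2_lim MO U U0" "l2_lim MO X X0"
    "l2_lim MO Y Y0"
    "\<And>n. U n \<in> L2 MO" "\<And>n. X n \<in> L2 MO" "\<And>n. Y n \<in> L2 MO" "U0 \<in> L2 MO" "X0 \<in> L2 MO" "Y0 \<in> L2 MO"
proof -
  note cs = smooth_continuous_on[OF s, of UNIV] smooth_continuous_on[OF smooth_dil[OF s], of UNIV]
    smooth_continuous_on[OF smooth_partial_real[OF s], of UNIV]
  have wm: "wave (l n) f \<in> borel_measurable MO" if "smooth f" for n f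
    by (rule smooth_measurable_leb[OF smooth_wave[OF l that]])
  have km: "ker f \<in> borel_measurable MO" if "continuous_on UNIV f" for f
    by (rule borel_measurable_leb[OF ker_measurable[OF that]])
  note WT = wave_tendsto[OF _ l \<eta>]
  have main: "l2_lim MO (\<lambda>n p. \<psi> p * (\<rho> p * wave (l n) f p)) (\<lambda>p. \<psi> p * (\<rho> p * ker f p))"
      "\<And>n. (\<lambda>p. \<psi> p * (\<rho> p * wave (l n) f p)) \<in> L2 MO" "(\<lambda>p. \<psi> p * (\<rho> p * ker f p)) \<in> L2 MO"
    if f: "smooth f" "continuous_on UNIV f" and \<psi>: "\<psi> \<in> L2 MO" and \<rho>: "\<rho> \<in> borel_measurable MO" "\<And>p. p \<in> S \<Longrightarrow> \<bar>\<rho> p\<bar> \<le> C"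
    for f \<psi> \<rho>
  proof -
    obtain B where B: "\<forall>n. \<forall>p\<in>S. \<bar>wave (l n) f p\<bar> \<le> B" using WT(3)[OF f(2)] by blast
    have b1: "(\<lambda>p. \<rho> p * wave (l n) f p) \<in> borel_measurable MO" for n using \<rho>(1) wm[OF f(1)] by simp
    have b2: "(\<lambda>p. \<rho> p * ker f p) \<in> borel_measurable MO" using \<rho>(1) km[OF f(2)] by simp
    have b3: "\<bar>\<rho> p * wave (l n) f p\<bar> \<le> C * B" if "p \<in> space MO" for n p
      using that B \<rho>(2)[of p] unfolding abs_mult by (intro mult_mono) (auto intro: order_trans[OF abs_ge_zero])
    have b4: "(\<lambda>n. \<rho> p * wave (l n) f p) \<longlonglongrightarrow> \<rho> p * ker f p" if "p \<in> space MO" for p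
      using that by (intro tendsto_mult tendsto_const WT(1)[OF f(2)]) simp_all
    note D = l2_dominated_mult_tendsto[where b="\<lambda>n p. \<rho> p * wave (l n) f p" and ?b0.0="\<lambda>p. \<rho> p * ker f p", OF \<psi> b1 b2 b3 b4]
    show "l2_lim MO (\<lambda>n p. \<psi> p * (\<rho> p * wave (l n) f p)) (\<lambda>p. \<psi> p * (\<rho> p * ker f p))"
      "\<And>n. (\<lambda>p. \<psi> p * (\<rho> p * wave (l n) f p)) \<in> L2 MO" "(\<lambda>p. \<psi> p * (\<rho> p * ker f p)) \<in> L2 MO"
      using D by simp_all
  qed
  note A = main[OF s cs(1) const_L2[of 1] m(1) bd(1)] and Ax = main[OF s cs(1) const_L2[of 1] m(2) bd(2)]
    and Ay = main[OF s cs(1) const_L2[of 1] m(3) bd(3)]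
  note G = main[OF smooth_dil[OF s] cs(2) fst_L2(1)[OF lamL] m(1) bd(1)]
  have gL: "g n \<in> L2 MI" for n by (rule test_functions_L2[OF interval_borel(1) g(1)])
  have ft: "l2_lim MO (\<lambda>n p. g n (fst p)) (\<lambda>p. lam (fst p))"
    by (rule fst_tendsto[OF gL lamL g(2)])
  let ?d = "\<lambda>n p. \<theta> p * wave (l n) (dil s) p"
  let ?e = "\<lambda>p. \<theta> p * ker (dil s) p"
  obtain B where B: "\<forall>n. \<forall>p\<in>S. \<bar>wave (l n) (dil s) p\<bar> \<le> B" using WT(3)[OF cs(2)] by blast
  have rm: "(\<lambda>p. ?d n p) \<in> borel_measurable MO" for n using m(1) wm[OF smooth_dil[OF s]] by simp
  have rb: "\<bar>?d n p\<bar> \<le> \<bar>C * B\<bar>" if "p \<in> space MO" for n p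
  proof -
    have "\<bar>\<theta> p\<bar> * \<bar>wave (l n) (dil s) p\<bar> \<le> C * B"
      using that B bd(1)[of p] by (intro mult_mono) (auto intro: order_trans[OF abs_ge_zero])
    then show ?thesis unfolding abs_mult[of "\<theta> p"] by linarith
  qed
  have gL2: "(\<lambda>p. g n (fst p) * ?d n p) \<in> L2 MO" for n
    using L2_bounded_mult[OF fst_L2(1)[OF gL] rm rb] by (simp add: mult.commute)
  \<comment> \<open>\<open>g n\<close> converges only in L^2 and the waves only boundedly and
    pointwise, so the two factors are replaced one after the other.\<close>
  have Gt: "l2_lim MO (\<lambda>n p. g n (fst p) * ?d n p) (\<lambda>p. lam (fst p) * ?e p)"
  proof (rule l2norm_tendsto_squeeze)
    show "(\<lambda>n. \<bar>C * B\<bar> * l2norm MO (\<lambda>p. g n (fst p) - lam (fst p)) +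
        l2norm MO (\<lambda>p. lam (fst p) * ?d n p - lam (fst p) * ?e p)) \<longlonglongrightarrow> 0"
      using tendsto_add[OF tendsto_mult_left[OF ft] G(1)] by simp
    fix n
    have "l2norm MO (\<lambda>p. g n (fst p) * ?d n p - lam (fst p) * ?e p) \<le>
        l2norm MO (\<lambda>p. g n (fst p) * ?d n p - lam (fst p) * ?d n p) +
        l2norm MO (\<lambda>p. lam (fst p) * ?d n p - lam (fst p) * ?e p)"
      by (rule l2norm_triangle_diff[OF gL2 G(2) G(3)])
    moreover have "l2norm MO (\<lambda>p. g n (fst p) * ?d n p - lam (fst p) * ?d n p)
        \<le> \<bar>C * B\<bar> * l2norm MO (\<lambda>p. g n (fst p) - lam (fst p))"
      using l2norm_bounded_mult[OF L2_diff[OF fst_L2(1)[OF gL] fst_L2(1)[OF lamL]] rm rb, of n n]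
      by (simp add: algebra_simps)
    ultimately show "l2norm MO (\<lambda>p. g n (fst p) * ?d n p - lam (fst p) * ?e p) \<le>
        \<bar>C * B\<bar> * l2norm MO (\<lambda>p. g n (fst p) - lam (fst p)) +
        l2norm MO (\<lambda>p. lam (fst p) * ?d n p - lam (fst p) * ?e p)" by linarith
  qed
  obtain B1 where B1: "\<forall>n. \<forall>p\<in>S. \<bar>wave (l n) (partial 1 s) p\<bar> \<le> B1" using WT(3)[OF cs(3)] by blast
  obtain B2 where B2: "\<forall>n. \<forall>p\<in>S. \<bar>exp (- l n (fst p))\<bar> \<le> B2" using WT(4)[OF cs(3)] by blast
  have em: "(\<lambda>p. exp (- l n (fst p))) \<in> borel_measurable MO" for n
  proof -
    have "smooth (\<lambda>p::real\<times>real. exp ((- 1) * l n (fst p)))"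
      by (intro smooth_compose[OF smooth_exp] smooth_cmult smooth_compose[OF l] smooth_fst)
    from smooth_measurable_leb[OF this] show ?thesis by simp
  qed
  have im: "(\<lambda>p. 1 / Lb (fst p)) \<in> borel_measurable MO"
    by (intro borel_measurable_leb borel_measurable_continuous_onI continuous_on_divide Lbf_continuous continuous_on_const)
      (simp add: Lb_neq_0)
  have y1: "(\<lambda>p. exp (- l n (fst p)) * (\<theta> p * wave (l n) (partial 1 s) p)) \<in> borel_measurable MO" for n
    using em m(1) wm[OF smooth_partial_real[OF s]] by simp
  have y2: "(\<lambda>p. 1 / Lb (fst p) * (\<theta> p * ker (partial 1 s) p)) \<in> borel_measurable MO"
    by (intro borel_measurable_times im m(1) km[OF cs(3)])
  have y3: "\<bar>exp (- l n (fst p)) * (\<theta> p * wave (l n) (partial 1 s) p)\<bar> \<le> B2 * (C * B1)" if "p \<in> space MO" for n p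
    using that B1 B2 bd(1)[of p] order_trans[OF abs_ge_zero B2[rule_format, of p n]] unfolding abs_mult
    by (intro mult_mono) (auto intro: order_trans[OF abs_ge_zero])
  have y4: "(\<lambda>n. exp (- l n (fst p)) * (\<theta> p * wave (l n) (partial 1 s) p)) \<longlonglongrightarrow> 1 / Lb (fst p) * (\<theta> p * ker (partial 1 s) p)"
    if "p \<in> space MO" for p
    by (intro tendsto_mult tendsto_const WT(1,2)[OF cs(3)]) (use that in simp_all)
  note D = l2_dominated_mult_tendsto[where b="\<lambda>n p. exp (- l n (fst p)) * (\<theta> p * wave (l n) (partial 1 s) p)"
      and ?b0.0="\<lambda>p. 1 / Lb (fst p) * (\<theta> p * ker (partial 1 s) p)", OF const_L2[of pi] y1 y2 y3 y4]
  show "l2_lim MO U U0" "\<And>n. U n \<in> L2 MO" "U0 \<in> L2 MO"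
    unfolding U_def U0_def using A by simp_all
  have mG: "l2_lim MO (\<lambda>n p. (- 1) * (g n (fst p) * (\<theta> p * wave (l n) (dil s) p))) (\<lambda>p. (- 1) * (lam (fst p) * (\<theta> p * ker (dil s) p)))"
    using Gt by (subst l2norm_minus_commute) simp
  show "l2_lim MO X X0"
    unfolding X_def X0_def using Ax
    by (intro l2norm_add_tendsto mG L2_mult_const[OF gL2] L2_mult_const[OF G(3)]) simp_all
  show "\<And>n. X n \<in> L2 MO" "X0 \<in> L2 MO"
    unfolding X_def X0_def using Ax by (intro L2_add L2_mult_const[OF gL2] L2_mult_const[OF G(3)]; simp)+
  show "l2_lim MO Y Y0"
    unfolding Y_def Y0_def using Ay by (intro l2norm_add_tendsto D) simp_all
  show "\<And>n. Y n \<in> L2 MO" "Y0 \<in> L2 MO"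
    unfolding Y_def Y0_def using Ay by (intro L2_add D; simp)+
qed

lemma partial_mult_wave:
  assumes "smooth \<theta>" "smooth l" "\<And>x. (l has_real_derivative g x) (at x)" "smooth s"
  shows "partial (1, 0) (\<lambda>p. \<theta> p * wave l s p) p
      = partial (1, 0) \<theta> p * wave l s p + (- 1) * (g (fst p) * (\<theta> p * wave l (dil s) p))"
    "partial (0, 1) (\<lambda>p. \<theta> p * wave l s p) p
      = partial (0, 1) \<theta> p * wave l s p + pi * (exp (- l (fst p)) * (\<theta> p * wave l (partial 1 s) p))"
proof -
  note d = smooth_differentiable[OF assms(1)] smooth_differentiable[OF smooth_wave[OF assms(2,4)]]
  show "partial (1, 0) (\<lambda>p. \<theta> p * wave l s p) p
      = partial (1, 0) \<theta> p * wave l s p + (- 1) * (g (fst p) * (\<theta> p * wave l (dil s) p))"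
    unfolding partial_mult[OF d] wave_partial[OF assms(2,3,4)] by (simp add: algebra_simps)
  show "partial (0, 1) (\<lambda>p. \<theta> p * wave l s p) p
      = partial (0, 1) \<theta> p * wave l s p + pi * (exp (- l (fst p)) * (\<theta> p * wave l (partial 1 s) p))"
    unfolding partial_mult[OF d] wave_partial[OF assms(2,3,4)] by (simp add: algebra_simps)
qed

text \<open>With a smoothed sine the fibre integrand is a test function, so the integral may be
  differentiated under the integral sign; the smoothing is then removed. The term with
  \<open>tau\<close> is the derivative of the kernel.\<close>

lemma fibre_component_test:
  assumes u: "u \<in> test_functions S"
  shows "HI (pr sin u) (\<lambda>x. pr sin (partial (1, 0) u) x - lam x * pr tau u x)"
proof -
  obtain g l \<eta> where gl: "\<And>n::nat. g n \<in> test_functions {\<alpha>..\<beta>}" "l2_lim MI g lam"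
    "\<And>n x. (l n has_real_derivative g n x) (at x)" "\<And>n. smooth (l n)"
    "\<eta> \<longlonglongrightarrow> 0" "\<And>n x. x \<in> {\<alpha>..\<beta>} \<Longrightarrow> \<bar>l n x - ln (L x)\<bar> \<le> \<eta> n"
    by (rule log_approximation, rule that)
  note su = test_functionsD(1)[OF u]
  have ux: "partial (1, 0) u \<in> test_functions S" "partial (0, 1) u \<in> test_functions S"
    by (intro test_functions_partial u e_Basis)+
  obtain B1 where B1: "\<And>p. \<bar>u p\<bar> \<le> B1" by (rule test_bounded[OF u], rule that)
  obtain B2 where B2: "\<And>p. \<bar>partial (1, 0) u p\<bar> \<le> B2" by (rule test_bounded[OF ux(1)], rule that)
  obtain B3 where B3: "\<And>p. \<bar>partial (0, 1) u p\<bar> \<le> B3" by (rule test_bounded[OF ux(2)], rule that)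
  define B where "B = max B1 (max B2 B3)"
  have b: "\<bar>u p\<bar> \<le> B" "\<bar>partial (1, 0) u p\<bar> \<le> B" "\<bar>partial (0, 1) u p\<bar> \<le> B" for p
    using B1[of p] B2[of p] B3[of p] by (auto simp: B_def)
  note m = smooth_measurable_leb[OF su] smooth_measurable_leb[OF test_functionsD(1)[OF ux(1)]] smooth_measurable_leb[OF test_functionsD(1)[OF ux(2)]]
  note W = wave_gradient_tendsto[OF m b smooth_sin gl(1,2,4,5,6), unfolded dil_sin]
  define F where "F n p = u p * wave (l n) sin p" for n p
  have F: "F n \<in> test_functions S" for n
    unfolding F_def by (rule test_functions_mult[OF u smooth_wave[OF gl(4) smooth_sin]])
  have F': "F n \<in> test_functions ({\<alpha>..\<beta>} \<times> UNIV)" for n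
  proof -
    have "interior S \<subseteq> interior ({\<alpha>..\<beta>} \<times> UNIV)" by (rule interior_mono) (auto dest: S_fst)
    then show ?thesis using F[of n] unfolding test_functions_def by blast
  qed
  have Fx: "partial (1, 0) (F n) p = partial (1, 0) u p * wave (l n) sin p + (- 1) * (g n (fst p) * (u p * wave (l n) tau p))" for n p
    unfolding F_def[abs_def] partial_mult_wave(1)[OF su gl(4,3) smooth_sin] dil_sin ..
  have e: "(\<integral>y. \<phi> (x, y) \<partial>lborel) = fib \<phi> x" if "\<phi> \<in> test_functions S" for \<phi> x
    unfolding fib_def using test_functions_zero'[OF that]
    by (intro Bochner_Integration.integral_cong) (auto simp: indicator_def)
  have "HI (fib (F n)) (fib (partial (1, 0) (F n)))" for n
    using has_H10_gradient_fibre_integral[OF ab F'[of n]]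
    unfolding e[OF F] e[OF test_functions_partial[OF F e_Basis(1)]] .
  then have P: "HI (fib (F n)) (fib (\<lambda>p. partial (1, 0) u p * wave (l n) sin p + (- 1) * (g n (fst p) * (u p * wave (l n) tau p))))" for n
    unfolding Fx[abs_def] .
  have H: "HI (fib (\<lambda>p. u p * ker sin p))
     (fib (\<lambda>p. partial (1, 0) u p * ker sin p + (- 1) * (lam (fst p) * (u p * ker tau p))))"
    by (rule has_H10_gradient_closed[OF interval_borel(1) P[unfolded F_def[abs_def]]
        fib_tendsto(2)[OF W(4,7,1)] fib_tendsto(2)[OF W(5,8,2)] fib_tendsto(1)[OF W(4,7,1)] fib_tendsto(1)[OF W(5,8,2)]])
  note uL = test_functions_L2[OF S_borel u] and uxL = test_functions_L2[OF S_borel ux(1)]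
  have lu: "(\<lambda>p. lam (fst p) * u p) \<in> L2 MO" by (rule lam_mult_L2_plane(1)[OF has_H10_gradient_test[OF S_borel u]])
  note cs = smooth_continuous_on[OF smooth_sin, of UNIV]
  have kL: "ker tau \<in> L2 MO" "ker sin \<in> L2 MO"
    using mult_ker_L2[of "\<lambda>_. 1" tau, OF _ tau_continuous] mult_ker_L2[of "\<lambda>_. 1" sin, OF _ cs] finite_MI
    by (simp_all add: L2_def finite_measure.integrable_const)
  show ?thesis
  proof (rule has_H10_gradient_cong_AE[OF H interval_borel(1)])
    show "AE x in MI. fib (\<lambda>p. u p * ker sin p) x = pr sin u x" by (simp add: pr_def)
    show "pr sin u \<in> borel_measurable MI" by (rule L2_measurable[OF pr_L2(1)[OF uL cs]])
    show "(\<lambda>x. pr sin (partial (1, 0) u) x - lam x * pr tau u x) \<in> borel_measurable MI"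
      using L2_measurable[OF pr_L2(1)[OF uxL cs]] L2_measurable[OF pr_L2(1)[OF uL tau_continuous]] L2_measurable[OF lamL] by simp
    show "AE x in MI. fib (\<lambda>p. partial (1, 0) u p * ker sin p + (- 1) * (lam (fst p) * (u p * ker tau p))) x
        = pr sin (partial (1, 0) u) x - lam x * pr tau u x"
      using integral_fib(3)[OF L2_mult_integrable[OF uxL kL(2)]] integral_fib(3)[OF L2_mult_integrable[OF lu kL(1)]]
    proof eventually_elim
      case (elim x)
      have "fib (\<lambda>p. partial (1, 0) u p * ker sin p + (- 1) * (lam (fst p) * (u p * ker tau p))) x =
          (\<integral>y. indicator S (x, y) * (partial (1, 0) u (x, y) * ker sin (x, y)) - indicator S (x, y) * (lam (fst (x, y)) * u (x, y) * ker tau (x, y)) \<partial>lborel)"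
        unfolding fib_def by (rule Bochner_Integration.integral_cong) (simp_all add: algebra_simps)
      also have "\<dots> = pr sin (partial (1, 0) u) x - pr tau (\<lambda>p. lam (fst p) * u p) x"
        unfolding pr_def fib_def by (rule Bochner_Integration.integral_diff) (use elim in simp_all)
      finally show ?case unfolding pr_mult_fst .
    qed
  qed
qed

text \<open>The term with \<lambda> survives the limit because \<open>lam_mult_L2_plane\<close>
  controls it by the H^1 norm. For a function orthogonal to the modes the coefficient is 0, and the
  vanishing of its derivative is the identity behind \<open>cross_bound\<close>.\<close>

theorem fibre_component_H10:
  assumes u: "HS u g"
  shows "HI (pr sin u) (\<lambda>x. pr sin (\<lambda>p. fst (g p)) x - lam x * pr tau u x)"
proof -
  obtain p where p: "\<And>n::nat. p n \<in> test_functions S"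
    "l2_lim MO p u" "l2_lim MO (\<lambda>n. gradient (p n)) g"
    by (rule has_H10_gradient_approx[OF u], rule that)
  note cs = smooth_continuous_on[OF smooth_sin, of UNIV]
  note pL = test_functions_L2[OF S_borel p(1)]
  note pxL = test_functions_L2[OF S_borel test_functions_partial[OF p(1) e_Basis(1)]]
  note uL = has_H10_gradient_L2(1)[OF u]
  have "(\<lambda>p. (fst (g p), snd (g p))) \<in> L2 MO" using has_H10_gradient_L2(2)[OF u] by simp
  then have gL: "(\<lambda>p. fst (g p)) \<in> L2 MO" by (simp only: L2_Pair)
  have xt: "l2_lim MO (\<lambda>n x. partial (1, 0) (p n) x) (\<lambda>x. fst (g x))"
  proof (rule l2norm_tendsto_squeeze[OF p(3)])
    fix n
    have d: "(\<lambda>x. gradient (p n) x - g x) \<in> L2 MO"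
      by (intro L2_diff test_functions_gradient_L2[OF S_borel p(1)] has_H10_gradient_L2(2)[OF u])
    show "l2norm MO (\<lambda>x. partial (1, 0) (p n) x - fst (g x)) \<le> l2norm MO (\<lambda>x. gradient (p n) x - g x)"
    proof (rule l2norm_mono[OF L2_measurable[OF L2_diff[OF pxL gL]] d])
      show "norm (partial (1, 0) (p n) x - fst (g x)) \<le> norm (gradient (p n) x - g x)" for x
      proof -
        have "norm (fst D) \<le> norm D" for D :: "real \<times> real" using norm_fst_le[of "fst D" "snd D"] by simp
        from this[of "gradient (p n) x - g x"] show ?thesis by (simp add: gradient_plane)
      qed
    qed
  qed
  have dH: "HS (\<lambda>x. p n x - u x) (\<lambda>x. gradient (p n) x - g x)" for n
    by (rule has_H10_gradient_diff[OF S_borel has_H10_gradient_test[OF S_borel p(1)] u])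
  have lp: "(\<lambda>q. lam (fst q) * p n q) \<in> L2 MO" for n by (rule lam_mult_L2_plane(1)[OF has_H10_gradient_test[OF S_borel p(1)]])
  have lu: "(\<lambda>q. lam (fst q) * u q) \<in> L2 MO" by (rule lam_mult_L2_plane(1)[OF u])
  have "(\<lambda>n. l2norm MO (\<lambda>q. lam (fst q) * (p n q - u q))) \<longlonglongrightarrow> 0"
    by (rule null_of_sq_bound[OF lam_mult_L2_plane(2)[OF dH] p(2,3)])
  then have lt: "l2_lim MO (\<lambda>n q. lam (fst q) * p n q) (\<lambda>q. lam (fst q) * u q)"
    by (simp add: right_diff_distrib)
  have Dl: "(\<lambda>x. - (lam x * pr tau (p n) x)) \<in> L2 MI" "(\<lambda>x. lam x * pr tau (p n) x) \<in> L2 MI" for n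
    using pr_L2(1)[OF lp tau_continuous, unfolded pr_mult_fst[abs_def]] L2_mult_const[OF pr_L2(1)[OF lp tau_continuous, unfolded pr_mult_fst[abs_def]], of "-1"] by simp_all
  have Dl0: "(\<lambda>x. lam x * pr tau u x) \<in> L2 MI" "(\<lambda>x. - (lam x * pr tau u x)) \<in> L2 MI"
    using pr_L2(1)[OF lu tau_continuous, unfolded pr_mult_fst[abs_def]] L2_mult_const[OF pr_L2(1)[OF lu tau_continuous, unfolded pr_mult_fst[abs_def]], of "-1"] by simp_all
  have Dt: "l2_lim MI (\<lambda>n x. lam x * pr tau (p n) x) (\<lambda>x. lam x * pr tau u x)"
    using pr_tendsto[OF lp lu tau_continuous lt, unfolded pr_mult_fst] .
  have Dt': "l2_lim MI (\<lambda>n x. - (lam x * pr tau (p n) x)) (\<lambda>x. - (lam x * pr tau u x))"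
    using Dt by (subst l2norm_minus_commute) simp
  show ?thesis
  proof (rule has_H10_gradient_closed[OF interval_borel(1) fibre_component_test[OF p(1)]])
    show "pr sin u \<in> L2 MI" by (rule pr_L2(1)[OF uL cs])
    show "(\<lambda>x. pr sin (\<lambda>p. fst (g p)) x - lam x * pr tau u x) \<in> L2 MI"
      by (intro L2_diff pr_L2(1)[OF gL cs] Dl0)
    show "l2_lim MI (\<lambda>n x. pr sin (p n) x) (\<lambda>x. pr sin u x)" by (rule pr_tendsto[OF pL uL cs p(2)])
    have "(\<lambda>n. l2norm MI (\<lambda>x. (pr sin (partial (1, 0) (p n)) x + - (lam x * pr tau (p n) x)) - (pr sin (\<lambda>p. fst (g p)) x + - (lam x * pr tau u x)))) \<longlonglongrightarrow> 0"
      by (rule l2norm_add_tendsto[OF pr_L2(1)[OF pxL cs] Dl(1) pr_L2(1)[OF gL cs] Dl0(2) pr_tendsto[OF pxL gL cs xt] Dt'])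
    then show "l2_lim MI (\<lambda>n x. pr sin (partial (1, 0) (p n)) x - lam x * pr tau (p n) x) (\<lambda>x. pr sin (\<lambda>p. fst (g p)) x - lam x * pr tau u x)"
      by simp
  qed
qed

end

lemma test_functions_interval_support:
  fixes \<phi> :: "real \<Rightarrow> real"
  assumes "\<alpha> < \<beta>" "\<phi> \<in> test_functions {\<alpha>..\<beta>}"
  obtains p q where "\<alpha> < p" "q < \<beta>" "\<And>x. x \<notin> {p..q} \<Longrightarrow> \<phi> x = 0"
proof -
  obtain K where K: "compact K" "K \<subseteq> interior {\<alpha>..\<beta>}" "\<forall>x. x \<notin> K \<longrightarrow> \<phi> x = 0"
    using test_functionsD(2)[OF assms(2)] by blast
  show thesis
  proof (cases "K = {}")
    case True
    then show thesis using K(3) assms(1) by (intro that[of "(\<alpha>+\<beta>)/2" "(\<alpha>+\<beta>)/2"]) auto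
  next
    case False
    obtain l where l: "l \<in> K" "\<forall>x\<in>K. l \<le> x" using compact_attains_inf[OF K(1) False] by blast
    obtain m where m: "m \<in> K" "\<forall>x\<in>K. x \<le> m" using compact_attains_sup[OF K(1) False] by blast
    show thesis
    proof (rule that)
      show "\<alpha> < l" "m < \<beta>" using l m K(2) by auto
      show "\<phi> x = 0" if "x \<notin> {l..m}" for x using that l m K(3) by (metis atLeastAtMost_iff)
    qed
  qed
qed

lemma partial_fst_compose:
  assumes "smooth f"
  shows "partial (1, 0) (\<lambda>p::real\<times>real. f (fst p)) p = gradient f (fst p)"
    "partial (0, 1) (\<lambda>p::real\<times>real. f (fst p)) p = 0"
proof -
  have d: "(fst has_derivative fst) (at p)" for p :: "real \<times> real" by (rule bounded_linear_imp_has_derivative[OF bounded_linear_fst])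
  have f: "partial i fst p = fst i" for i p :: "real \<times> real" by (rule partial_eqI[OF d])
  have df: "fst differentiable (at p)" for p :: "real \<times> real" by (rule differentiableI[OF d])
  note C = partial_compose[OF smooth_differentiable[OF assms] df]
  show "partial (1, 0) (\<lambda>p::real\<times>real. f (fst p)) p = gradient f (fst p)"
    "partial (0, 1) (\<lambda>p::real\<times>real. f (fst p)) p = 0"
    unfolding C f gradient_real by simp_all
qed

context tube begin

text \<open>The profile has compact support in (0, pi) because only then is a smoothed mode
  eventually a test function of the tube. The sine and general \<xi> follow by two further
  limits.\<close>

lemma mode_test:
  assumes \<xi>: "\<xi> \<in> test_functions {\<alpha>..\<beta>}" and s: "s \<in> test_functions {0..pi}"
  shows "HS (\<lambda>p. \<xi> (fst p) * ker s p)
    (\<lambda>p. (gradient \<xi> (fst p) * ker s p + (- 1) * (lam (fst p) * (\<xi> (fst p) * ker (dil s) p)),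
       0 * ker s p + pi * (1 / Lb (fst p) * (\<xi> (fst p) * ker (partial 1 s) p))))"
proof -
  obtain g l \<eta> where gl: "\<And>n::nat. g n \<in> test_functions {\<alpha>..\<beta>}" "l2_lim MI g lam"
    "\<And>n x. (l n has_real_derivative g n x) (at x)" "\<And>n. smooth (l n)"
    "\<eta> \<longlonglongrightarrow> 0" "\<And>n x. x \<in> {\<alpha>..\<beta>} \<Longrightarrow> \<bar>l n x - ln (L x)\<bar> \<le> \<eta> n"
    by (rule log_approximation, rule that)
  note ss = test_functionsD(1)[OF s] and sx = test_functionsD(1)[OF \<xi>]
  define \<theta> where "\<theta> p = \<xi> (fst p)" for p :: "real \<times> real"
  have s\<theta>: "smooth \<theta>" unfolding \<theta>_def by (rule smooth_compose[OF sx smooth_fst])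
  have \<theta>x: "partial (1, 0) \<theta> p = gradient \<xi> (fst p)" "partial (0, 1) \<theta> p = 0" for p
    unfolding \<theta>_def by (rule partial_fst_compose[OF sx])+
  have gx: "gradient \<xi> \<in> test_functions {\<alpha>..\<beta>}"
    using test_functions_partial[OF \<xi>, of 1] by (simp add: gradient_real[abs_def])
  obtain B1 where B1: "\<And>p. \<bar>\<xi> p\<bar> \<le> B1" by (rule test_bounded[OF \<xi>], rule that)
  obtain B2 where B2: "\<And>p. \<bar>gradient \<xi> p\<bar> \<le> B2" by (rule test_bounded[OF gx], rule that)
  have b: "\<bar>\<theta> p\<bar> \<le> max B1 B2" "\<bar>gradient \<xi> (fst p)\<bar> \<le> max B1 B2" "\<bar>0\<bar> \<le> max B1 B2" for p
    using B1[of "fst p"] B2[of "fst p"] by (auto simp: \<theta>_def)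
  have m: "\<theta> \<in> borel_measurable MO" "(\<lambda>p. gradient \<xi> (fst p)) \<in> borel_measurable MO" "(\<lambda>p. 0) \<in> borel_measurable MO"
    by (rule smooth_measurable_leb[OF s\<theta>], rule smooth_measurable_leb[OF smooth_compose[OF test_functionsD(1)[OF gx] smooth_fst]], simp)
  note W = wave_gradient_tendsto[OF m b ss gl(1,2,4,5,6), unfolded \<theta>_def]
  obtain p1 q1 where pq1: "\<alpha> < p1" "q1 < \<beta>" "\<And>x. x \<notin> {p1..q1} \<Longrightarrow> \<xi> x = 0"
    by (rule test_functions_interval_support[OF ab \<xi>], rule that)
  obtain p q where pq: "0 < p" "q < pi" "\<And>x. x \<notin> {p..q} \<Longrightarrow> s x = 0"
    by (rule test_functions_interval_support[OF pi_gt_zero s], rule that)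
  define F where "F n = (\<lambda>p. \<theta> p * wave (l n) s p)" for n
  \<comment> \<open>The support of the smoothed mode reaches at most the height q exp(\<eta> n) L /
    pi, as exp(l n) <= L exp(\<eta> n). It stays below L once q exp(\<eta> n) < pi.\<close>
  have "(\<lambda>n. q * exp (\<eta> n)) \<longlonglongrightarrow> q * exp 0" by (intro tendsto_intros gl)
  then have "\<forall>\<^sub>F n in sequentially. q * exp (\<eta> n) < pi" by (rule order_tendstoD(2)) (use pq in simp)
  then obtain N where N: "\<And>n. n \<ge> N \<Longrightarrow> q * exp (\<eta> n) < pi" unfolding eventually_sequentially by blast
  have F: "F n \<in> test_functions S" if n: "n \<ge> N" for n
  proof (rule test_functionsI)
    define \<Psi> where "\<Psi> z = (fst z, snd z / pi * exp (l n (fst z)))" for z :: "real \<times> real"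
    show "smooth (F n)" unfolding F_def by (intro smooth_mult s\<theta> smooth_wave gl ss)
    have "continuous_on UNIV (\<lambda>z::real\<times>real. l n (fst z))"
      by (rule continuous_on_compose2[OF smooth_continuous_on[OF gl(4)[of n], of UNIV]]) (auto intro!: continuous_intros)
    then have "continuous_on UNIV \<Psi>" unfolding \<Psi>_def by (intro continuous_intros) auto
    then show "compact (\<Psi> ` ({p1..q1} \<times> {p..q}))"
      by (intro compact_continuous_image compact_Times) (auto intro: continuous_on_subset)
    show "\<Psi> ` ({p1..q1} \<times> {p..q}) \<subseteq> interior S"
    proof (rule order_trans[OF _ interior_S], rule subsetI)
      fix w assume "w \<in> \<Psi> ` ({p1..q1} \<times> {p..q})"
      then obtain x t where w: "w = (x, t / pi * exp (l n x))" and xt: "p1 \<le> x" "x \<le> q1" "p \<le> t" "t \<le> q"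
        by (auto simp: \<Psi>_def)
      have x: "x \<in> {\<alpha>..\<beta>}" using xt pq1 by simp
      have "l n x \<le> ln (L x) + \<eta> n" using gl(6)[OF x, of n] by linarith
      then have "exp (l n x) \<le> L x * exp (\<eta> n)" using Lpos[OF x] by (simp add: exp_add[symmetric] flip: exp_ln_iff) (metis exp_add exp_le_cancel_iff exp_ln)
      then have "t / pi * exp (l n x) \<le> q / pi * (L x * exp (\<eta> n))"
        using xt pq by (intro mult_mono divide_right_mono) (auto intro: order_trans less_imp_le)
      also have "\<dots> = (q * exp (\<eta> n)) / pi * L x" by simp
      also have "\<dots> < 1 * L x" using N[OF n] Lpos[OF x] by (intro mult_strict_right_mono) simp_all
      finally have "t / pi * exp (l n x) < Lb x" using Lb_eq[OF x] by simp
      moreover have "0 < t / pi * exp (l n x)" using xt pq by simp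
      ultimately show "w \<in> {p. \<alpha> < fst p \<and> fst p < \<beta> \<and> 0 < snd p \<and> snd p < Lb (fst p)}"
        using xt pq1 w by simp
    qed
    fix w assume w: "w \<notin> \<Psi> ` ({p1..q1} \<times> {p..q})"
    obtain x y where xy: "w = (x, y)" by (cases w)
    have "(x, y) = \<Psi> (x, pi * y * exp (- l n x))" by (simp add: \<Psi>_def exp_minus)
    then have "x \<notin> {p1..q1} \<or> pi * y * exp (- l n x) \<notin> {p..q}" using w xy by blast
    then show "F n w = 0" using pq1(3)[of x] pq(3)[of "pi * y * exp (- l n x)"] xy by (auto simp: F_def \<theta>_def wave_def)
  qed
  have G: "gradient (F n) = (\<lambda>p. (gradient \<xi> (fst p) * wave (l n) s p + (- 1) * (g n (fst p) * (\<xi> (fst p) * wave (l n) (dil s) p)),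
       0 * wave (l n) s p + pi * (exp (- l n (fst p)) * (\<xi> (fst p) * wave (l n) (partial 1 s) p))))" for n
    unfolding F_def gradient_plane[abs_def] partial_mult_wave[OF s\<theta> gl(4,3) ss] \<theta>x unfolding \<theta>_def ..
  have H: "HS (\<lambda>p. \<xi> (fst p) * wave (l (n + N)) s p)
     (\<lambda>p. (gradient \<xi> (fst p) * wave (l (n + N)) s p + (- 1) * (g (n + N) (fst p) * (\<xi> (fst p) * wave (l (n + N)) (dil s) p)),
       0 * wave (l (n + N)) s p + pi * (exp (- l (n + N) (fst p)) * (\<xi> (fst p) * wave (l (n + N)) (partial 1 s) p))))" for n
    using has_H10_gradient_test[OF S_borel F[of "n + N"]] unfolding G unfolding F_def \<theta>_def by simp
  show ?thesis
    by (rule has_H10_gradient_closed_plane[OF S_borel H W(7,8,9)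
        W(1)[THEN LIMSEQ_ignore_initial_segment] W(2)[THEN LIMSEQ_ignore_initial_segment] W(3)[THEN LIMSEQ_ignore_initial_segment]])
qed

lemma ker_tendsto:
  assumes \<xi>: "\<xi> \<in> L2 MI" and c: "\<And>n. continuous_on UNIV (\<sigma> n)" "continuous_on UNIV \<sigma>0"
    and lim: "l2_lim (leb {0..pi}) \<sigma> (\<lambda>t. \<sigma>0 t)"
  shows "l2_lim MO (\<lambda>n p. \<xi> (fst p) * ker (\<sigma> n) p) (\<lambda>p. \<xi> (fst p) * ker \<sigma>0 p)"
proof -
  have "l2norm MO (\<lambda>p. \<xi> (fst p) * ker (\<sigma> n) p - \<xi> (fst p) * ker \<sigma>0 p) =
      sqrt (2 / pi) * l2norm (leb {0..pi}) (\<lambda>t. \<sigma> n t - \<sigma>0 t) * l2norm MI \<xi>" for n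
  proof -
    have cd: "continuous_on UNIV (\<lambda>t. \<sigma> n t - \<sigma>0 t)" by (intro continuous_intros c)
    have "(\<lambda>p. \<xi> (fst p) * ker (\<sigma> n) p - \<xi> (fst p) * ker \<sigma>0 p) = (\<lambda>p. \<xi> (fst p) * ker (\<lambda>t. \<sigma> n t - \<sigma>0 t) p)"
      by (simp add: ker_def algebra_simps)
    then show ?thesis
      unfolding mode_norm[OF \<xi> cd, unfolded J_eq_l2[OF cd]] real_sqrt_mult by (simp add: mode_norm[OF \<xi> cd] J_eq_l2[OF cd] real_sqrt_mult real_sqrt_divide l2norm_nonneg)
  qed
  moreover have "(\<lambda>n. sqrt (2 / pi) * l2norm (leb {0..pi}) (\<lambda>t. \<sigma> n t - \<sigma>0 t) * l2norm MI \<xi>) \<longlonglongrightarrow> sqrt (2 / pi) * 0 * l2norm MI \<xi>"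
    by (intro tendsto_mult tendsto_const lim)
  ultimately show ?thesis by simp
qed

text \<open>\<open>sin\<close> lies in H^1_0 of (0, pi), so compactly supported profiles approximate
  it together with its derivative; \<open>dil\<close> of them converges to \<open>tau\<close>
  because t is bounded on that interval.\<close>

lemma mode_H10_test:
  assumes \<xi>: "\<xi> \<in> test_functions {\<alpha>..\<beta>}"
  shows "HS (\<lambda>p. \<xi> (fst p) * ker sin p)
    (\<lambda>p. (gradient \<xi> (fst p) * ker sin p - \<xi> (fst p) * lam (fst p) * ker tau p,
       pi / Lb (fst p) * \<xi> (fst p) * ker cos p))"
proof -
  obtain s where s: "\<And>n::nat. s n \<in> test_functions {0..pi}"
    "l2_lim (leb {0..pi}) s sin" "l2_lim (leb {0..pi}) (\<lambda>n. gradient (s n)) cos"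
    by (rule has_H10_gradient_approx[OF sin_H10], rule that)
  note ss = test_functionsD(1)[OF s(1)]
  have gp: "gradient (s n) = partial 1 (s n)" for n by (simp add: gradient_real[abs_def])
  note c = smooth_continuous_on[OF ss, of UNIV] smooth_continuous_on[OF smooth_dil[OF ss], of UNIV]
    smooth_continuous_on[OF smooth_partial_real[OF ss], of UNIV]
  have cc: "continuous_on UNIV (sin :: real \<Rightarrow> real)" "continuous_on UNIV (cos :: real \<Rightarrow> real)" by (intro continuous_intros)+
  note \<xi>L = test_functions_L2[OF interval_borel(1) \<xi>]
  have \<xi>'L: "gradient \<xi> \<in> L2 MI" by (rule test_functions_gradient_L2[OF interval_borel(1) \<xi>])
  have \<xi>lL: "(\<lambda>x. \<xi> x * lam x) \<in> L2 MI" by (rule lam_mult_L2(1)[OF has_H10_gradient_test[OF interval_borel(1) \<xi>]])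
  note yL = invL_mult_L2[OF \<xi>L]
  have cL: "f \<in> L2 (leb {0..pi})" if "continuous_on UNIV f" for f :: "real \<Rightarrow> real"
  proof -
    have "integrable (leb {0..pi}) (\<lambda>t. (norm (f t))\<^sup>2)"
      unfolding integrable_leb[OF interval_borel(1)]
      by (rule borel_integrable_compact) (auto intro!: continuous_intros continuous_on_subset[OF that])
    then show ?thesis using borel_measurable_leb[OF borel_measurable_continuous_onI[OF that]] by (simp add: L2_def)
  qed
  have dl: "l2_lim (leb {0..pi}) (\<lambda>n t. dil (s n) t) tau"
  proof (rule l2norm_tendsto_squeeze)
    show "(\<lambda>n. (1 / 2) * l2norm (leb {0..pi}) (\<lambda>t. s n t - sin t) + pi * l2norm (leb {0..pi}) (\<lambda>t. gradient (s n) t - cos t)) \<longlonglongrightarrow> 0"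
      using tendsto_add[OF tendsto_mult_left[OF s(2), of "1/2"] tendsto_mult_left[OF s(3), of pi]] by simp
    fix n
    have d1: "(\<lambda>t. s n t - sin t) \<in> L2 (leb {0..pi})" by (intro cL continuous_intros c(1))
    have d2: "(\<lambda>t. gradient (s n) t - cos t) \<in> L2 (leb {0..pi})" unfolding gp by (intro cL continuous_intros c(3))
    have im: "(\<lambda>t::real. t) \<in> borel_measurable (leb {0..pi})" by (intro borel_measurable_leb) simp
    have ib: "\<bar>t\<bar> \<le> pi" if "t \<in> space (leb {0..pi})" for t using that by simp
    have e: "(\<lambda>t. dil (s n) t - tau t) = (\<lambda>t. (1 / 2) *\<^sub>R (s n t - sin t) + t *\<^sub>R (gradient (s n) t - cos t))"
      by (simp add: fun_eq_iff dil_def tau_def gp algebra_simps)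
    show "l2norm (leb {0..pi}) (\<lambda>t. dil (s n) t - tau t) \<le> (1 / 2) * l2norm (leb {0..pi}) (\<lambda>t. s n t - sin t) + pi * l2norm (leb {0..pi}) (\<lambda>t. gradient (s n) t - cos t)"
      unfolding e using l2norm_triangle[OF L2_scaleR[OF d1, of "1/2"] L2_bounded_mult[OF d2 im ib]]
        l2norm_bounded_mult[OF d2 im ib pi_ge_zero] l2norm_scaleR[of "leb {0..pi}" "1/2" "\<lambda>t. s n t - sin t"]
      by linarith
  qed
  have H: "HS (\<lambda>p. \<xi> (fst p) * ker (s n) p)
     (\<lambda>p. (gradient \<xi> (fst p) * ker (s n) p + - (\<xi> (fst p) * lam (fst p) * ker (dil (s n)) p),
       pi / Lb (fst p) * \<xi> (fst p) * ker (partial 1 (s n)) p))" for n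
    using mode_test[OF \<xi> s(1)] by (simp add: mult_ac)
  note K1 = ker_tendsto[OF \<xi>L c(1) cc(1) s(2)] and K2 = ker_tendsto[OF \<xi>'L c(1) cc(1) s(2)]
    and K3 = ker_tendsto[OF \<xi>lL c(2) tau_continuous dl] and K4 = ker_tendsto[OF yL c(3) cc(2) s(3)[unfolded gp]]
  have K3': "l2_lim MO (\<lambda>n p. - (\<xi> (fst p) * lam (fst p) * ker (dil (s n)) p)) (\<lambda>p. - (\<xi> (fst p) * lam (fst p) * ker tau p))"
    using K3 by (subst l2norm_minus_commute) simp
  note M1 = mult_ker_L2[OF \<xi>L cc(1)] and M2 = mult_ker_L2[OF \<xi>'L] and M3 = mult_ker_L2[OF \<xi>lL]
    and M4 = mult_ker_L2[OF yL cc(2)]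
  have M3': "(\<lambda>p. - (\<xi> (fst p) * lam (fst p) * ker f p)) \<in> L2 MO" if "continuous_on UNIV f" for f
    using L2_mult_const[OF M3[OF that], of "-1"] by simp
  have "HS (\<lambda>p. \<xi> (fst p) * ker sin p)
    (\<lambda>p. (gradient \<xi> (fst p) * ker sin p + - (\<xi> (fst p) * lam (fst p) * ker tau p),
       pi / Lb (fst p) * \<xi> (fst p) * ker cos p))"
    by (rule has_H10_gradient_closed_plane[OF S_borel H M1 L2_add[OF M2[OF cc(1)] M3'[OF tau_continuous]] M4 K1
        l2norm_add_tendsto[OF M2[OF c(1)] M3'[OF c(2)] M2[OF cc(1)] M3'[OF tau_continuous] K2 K3'] K4])
  then show ?thesis by simp
qed

text \<open>The last limit, in \<xi>: the product with \<lambda> converges by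
  \<open>lam_mult_L2\<close>, the y-derivative by boundedness of pi / L.\<close>

theorem mode_H10:
  assumes \<xi>: "HI \<xi> \<xi>'"
  shows "HS (\<lambda>p. \<xi> (fst p) * ker sin p)
    (\<lambda>p. (\<xi>' (fst p) * ker sin p - \<xi> (fst p) * lam (fst p) * ker tau p,
       pi / Lb (fst p) * \<xi> (fst p) * ker cos p))"
proof -
  obtain p where p: "\<And>n::nat. p n \<in> test_functions {\<alpha>..\<beta>}"
    "l2_lim MI p \<xi>" "l2_lim MI (\<lambda>n. gradient (p n)) \<xi>'"
    by (rule has_H10_gradient_approx[OF \<xi>], rule that)
  note L = has_H10_gradient_L2[OF \<xi>]
  note pH = has_H10_gradient_test[OF interval_borel(1) p(1)]
  note pL = has_H10_gradient_L2[OF pH]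
  note dH = has_H10_gradient_diff[OF interval_borel(1) pH \<xi>]
  note lp = lam_mult_L2(1)[OF pH] and lx = lam_mult_L2(1)[OF \<xi>]
  have cc: "continuous_on UNIV (sin :: real \<Rightarrow> real)" "continuous_on UNIV (cos :: real \<Rightarrow> real)" by (intro continuous_intros)+
  have "(\<lambda>n. l2norm MI (\<lambda>x. (p n x - \<xi> x) * lam x)) \<longlonglongrightarrow> 0"
    by (rule null_of_sq_bound[OF lam_mult_L2(2)[OF dH] p(2,3)])
  then have lt: "l2_lim MI (\<lambda>n x. p n x * lam x) (\<lambda>x. \<xi> x * lam x)" by (simp add: left_diff_distrib)
  obtain B where B: "B \<ge> 0" "\<forall>x. \<bar>pi / Lb x\<bar> \<le> B" using invL_bounded_measurable(2) by blast
  have yt: "l2_lim MI (\<lambda>n x. pi / Lb x * p n x) (\<lambda>x. pi / Lb x * \<xi> x)"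
  proof (rule l2norm_tendsto_squeeze)
    show "(\<lambda>n. B * l2norm MI (\<lambda>x. p n x - \<xi> x)) \<longlonglongrightarrow> 0" using tendsto_mult_left[OF p(2), of B] by simp
    show "l2norm MI (\<lambda>x. pi / Lb x * p n x - pi / Lb x * \<xi> x) \<le> B * l2norm MI (\<lambda>x. p n x - \<xi> x)" for n
      using l2norm_bounded_mult[OF L2_diff[OF pL(1) L(1)] invL_bounded_measurable(1) B(2)[rule_format] B(1), of n]
      by (simp add: right_diff_distrib)
  qed
  have mt: "l2_lim MO (\<lambda>n q. f n (fst q) * ker s q) (\<lambda>q. f0 (fst q) * ker s q)"
    if "\<And>n. f n \<in> L2 MI" "f0 \<in> L2 MI" "l2_lim MI f f0" "continuous_on UNIV s"
    for f :: "nat \<Rightarrow> real \<Rightarrow> real" and f0 s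
  proof -
    have "l2norm MO (\<lambda>q. f n (fst q) * ker s q - f0 (fst q) * ker s q) = sqrt (J s s) * l2norm MI (\<lambda>x. f n x - f0 x)" for n
      using mode_norm[OF L2_diff[OF that(1,2)] that(4), of n] by (simp add: left_diff_distrib)
    then show ?thesis using tendsto_mult_left[OF that(3), of "sqrt (J s s)"] by simp
  qed
  have K3: "l2_lim MO (\<lambda>n q. - (p n (fst q) * lam (fst q) * ker tau q)) (\<lambda>q. - (\<xi> (fst q) * lam (fst q) * ker tau q))"
    using mt[OF lp lx lt tau_continuous] by (subst l2norm_minus_commute) simp
  have M3: "(\<lambda>q. - (f (fst q) * lam (fst q) * ker tau q)) \<in> L2 MO" if "(\<lambda>x. f x * lam x) \<in> L2 MI" for f
    using L2_mult_const[OF mult_ker_L2[OF that tau_continuous], of "-1"] by simp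
  have H: "HS (\<lambda>q. p n (fst q) * ker sin q)
    (\<lambda>q. (gradient (p n) (fst q) * ker sin q + - (p n (fst q) * lam (fst q) * ker tau q),
       pi / Lb (fst q) * p n (fst q) * ker cos q))" for n
    using mode_H10_test[OF p(1)] by simp
  have "HS (\<lambda>q. \<xi> (fst q) * ker sin q)
    (\<lambda>q. (\<xi>' (fst q) * ker sin q + - (\<xi> (fst q) * lam (fst q) * ker tau q),
       pi / Lb (fst q) * \<xi> (fst q) * ker cos q))"
    by (rule has_H10_gradient_closed_plane[OF S_borel H mult_ker_L2[OF L(1) cc(1)]
        L2_add[OF mult_ker_L2[OF L(2) cc(1)] M3[OF lx]] mult_ker_L2[OF invL_mult_L2[OF L(1)] cc(2)]
        mt[OF pL(1) L(1) p(2) cc(1)]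
        l2norm_add_tendsto[OF mult_ker_L2[OF pL(2) cc(1)] M3[OF lp] mult_ker_L2[OF L(2) cc(1)] M3[OF lx] mt[OF pL(2) L(2) p(3) cc(1)] K3]
        mt[OF invL_mult_L2[OF pL(1)] invL_mult_L2[OF L(1)] yt cc(2)]])
  then show ?thesis by simp
qed

end

text \<open>With
  $U=\varphi-c\sin$, $c=\frac2\pi\int\varphi\sin$, $F=\int_0^{\cdot}U\sin$, $G=F/\sin$ and $k=\cot$ one has
  $U'^2-2U^2=(kU^2-2UG+kG^2)'+(U'-kU+G)^2+(U-kG)^2+2k^2G^2$, and the boundary terms vanish.\<close>

lemma dirichlet_gap:
  fixes \<phi> \<phi>' :: "real \<Rightarrow> real"
  assumes d: "\<And>t. (\<phi> has_real_derivative \<phi>' t) (at t)" and c': "continuous_on UNIV \<phi>'"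
    and pq: "0 < p" "p < pi" "0 < q" "q < pi" "\<And>t. t \<notin> {p..q} \<Longrightarrow> \<phi> t = 0"
  shows "2 * (\<integral>t. (\<phi> t)\<^sup>2 * indicator {0..pi} t \<partial>lborel) - 2 / pi * (\<integral>t. (\<phi> t * sin t) * indicator {0..pi} t \<partial>lborel)\<^sup>2
    \<le> (\<integral>t. (\<phi>' t)\<^sup>2 * indicator {0..pi} t \<partial>lborel)"
proof -
  let ?I = "\<lambda>f :: real \<Rightarrow> real. \<integral>t. f t * indicator {0..pi} t \<partial>lborel"
  define A where "A = ?I (\<lambda>t. \<phi> t * sin t)"
  \<comment> \<open>The Fourier sine coefficient of \<phi>, so that \<open>U\<close> is orthogonal
    to \<open>sin\<close> and \<open>F\<close> vanishes at both ends.\<close>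
  define c where "c = 2 / pi * A"
  define U where "U t = \<phi> t - c * sin t" for t
  define U' where "U' t = \<phi>' t - c * cos t" for t
  have dU: "(U has_real_derivative U' t) (at t)" for t
    unfolding U_def U'_def by (auto intro!: derivative_eq_intros d)
  have cphi: "continuous_on UNIV \<phi>" by (rule DERIV_continuous_on) (use d in \<open>auto intro: DERIV_subset\<close>)
  have cU: "continuous_on UNIV U" "continuous_on UNIV U'" unfolding U_def U'_def by (intro continuous_intros cphi c')+
  have FTC: "?I f = H pi - H 0"
    if "\<And>t. (H has_real_derivative f t) (at t)" "continuous_on UNIV f" for f H :: "real \<Rightarrow> real"
    by (rule integral_FTC_Icc_real) (use that in \<open>auto simp: continuous_on_eq_continuous_at\<close>)
  have int: "integrable lborel (\<lambda>t. f t * indicator {0..pi} t)" if "continuous_on UNIV f" for f :: "real \<Rightarrow> real"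
    using borel_integrable_compact[of "{0..pi}" f] continuous_on_subset[OF that] by (simp add: mult.commute)
  define m where "m t = (t - sin t * cos t) / 2" for t :: real
  have dm: "(m has_real_derivative sin t * sin t) (at t)" for t
    unfolding m_def by (rule sin_sq_antiderivative)
  have ss: "?I (\<lambda>t. sin t * sin t) = pi / 2"
    using FTC[of m, OF dm] by (simp add: m_def continuous_intros)
  have cc: "?I (\<lambda>t. cos t * cos t) = pi / 2"
    by (subst FTC[OF cos_sq_antiderivative]) (auto intro!: continuous_intros)
  have z: "\<phi> 0 = 0" "\<phi> pi = 0" using pq by auto
  have dc: "?I (\<lambda>t. \<phi>' t * cos t) = A"
  proof -
    have "?I (\<lambda>t. \<phi>' t * cos t - \<phi> t * sin t) = \<phi> pi * cos pi - \<phi> 0 * cos 0"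
      by (rule FTC[where H="\<lambda>t. \<phi> t * cos t"]) (auto intro!: derivative_eq_intros continuous_intros d cphi c')
    moreover have "?I (\<lambda>t. \<phi>' t * cos t - \<phi> t * sin t) =
        ?I (\<lambda>t. \<phi>' t * cos t) - A"
      unfolding A_def left_diff_distrib by (rule Bochner_Integration.integral_diff) (intro int continuous_intros cphi c')+
    ultimately show ?thesis using z by simp
  qed
  obtain F where F: "\<And>t. (F has_real_derivative U t * sin t) (at t)" "F 0 = 0"
    by (rule integral_continuous_antiderivative[where c=0 and \<psi>="\<lambda>t. U t * sin t"], intro continuous_intros cU, rule that)
  have Fpi: "F pi = 0"
  proof -
    have "F pi - F 0 = ?I (\<lambda>t. U t * sin t)"
      by (rule FTC[symmetric]) (auto intro!: F(1) continuous_intros cU)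
    also have "\<dots> = (\<integral>t. (\<phi> t * sin t) * indicator {0..pi} t - c * ((sin t * sin t) * indicator {0..pi} t) \<partial>lborel)"
      by (rule Bochner_Integration.integral_cong) (simp_all add: U_def algebra_simps)
    also have "\<dots> = A - c * ?I (\<lambda>t. sin t * sin t)"
      unfolding A_def by (subst Bochner_Integration.integral_diff) (intro int continuous_intros cphi integrable_mult_right | simp)+
    also have "\<dots> = 0" unfolding ss by (simp add: c_def)
    finally show ?thesis using F(2) by simp
  qed
  have zlow: "\<phi> t = 0" if "t < p" for t using pq(5)[of t] that by auto
  have zhigh: "\<phi> t = 0" if "q < t" for t using pq(5)[of t] that by auto
  \<comment> \<open>Near the ends \<phi> vanishes, so \<open>U\<close> is -c sin and
    \<open>F\<close> is explicit there; this controls the quotients by \<open>sin\<close>, which are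
    singular at 0 and pi.\<close>
  have Flow: "F t = - (c * m t)" if t: "0 \<le> t" "t < p" for t
  proof -
    have "F t + c * m t = F 0 + c * m 0"
    proof (rule DERIV_isconst3[of "-1" p t 0 "\<lambda>t. F t + c * m t"])
      fix x assume x: "x \<in> {-1<..<p}"
      have "((\<lambda>t. F t + c * m t) has_real_derivative U x * sin x + c * (sin x * sin x)) (at x)"
        by (auto intro!: derivative_eq_intros F(1) dm)
      moreover have "U x * sin x + c * (sin x * sin x) = 0" using zlow[of x] x by (simp add: U_def algebra_simps)
      ultimately show "((\<lambda>t. F t + c * m t) has_real_derivative 0) (at x)" by simp
    qed (use t pq in auto)
    then show ?thesis using F(2) by (simp add: m_def)
  qed
  have Fhigh: "F t = c * m (pi - t)" if t: "q < t" "t \<le> pi" for t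
  proof -
    have "F t - c * m (pi - t) = F pi - c * m (pi - pi)"
    proof (rule DERIV_isconst3[of q 4 t pi "\<lambda>t. F t - c * m (pi - t)"])
      fix x assume x: "x \<in> {q<..<4}"
      have "((\<lambda>t. m (pi - t)) has_real_derivative (sin (pi - x) * sin (pi - x)) * (- 1)) (at x)"
        by (rule DERIV_chain2[OF dm]) (auto intro!: derivative_eq_intros)
      then have "((\<lambda>t. F t - c * m (pi - t)) has_real_derivative U x * sin x - c * ((sin (pi - x) * sin (pi - x)) * (- 1))) (at x)"
        by (intro DERIV_diff F(1) DERIV_cmult)
      moreover have "U x * sin x - c * ((sin (pi - x) * sin (pi - x)) * (- 1)) = 0"
        using zhigh[of x] x by (simp add: U_def algebra_simps)
      ultimately show "((\<lambda>t. F t - c * m (pi - t)) has_real_derivative 0) (at x)" by simp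
    qed (use t pq pi_less_4 in auto)
    then show ?thesis using Fpi by (simp add: m_def)
  qed
  define k where "k t = cos t / sin t" for t :: real
  define G where "G t = F t / sin t" for t
  define P where "P t = k t * (U t)\<^sup>2 - 2 * U t * G t + k t * (G t)\<^sup>2" for t
  \<comment> \<open>Up to the factor c^2, the boundary quantity \<open>P\<close> near 0; near pi it
    reappears, reflected, with the opposite sign.\<close>
  define \<rho> where "\<rho> t = cos t * sin t - 2 * m t + cos t * (m t)\<^sup>2 / (sin t) ^ 3" for t
  obtain H where H: "\<And>t. (H has_real_derivative (U' t)\<^sup>2 - 2 * (U t)\<^sup>2) (at t)" "H 0 = 0"
    by (rule integral_continuous_antiderivative[where c=0 and \<psi>="\<lambda>t. (U' t)\<^sup>2 - 2 * (U t)\<^sup>2"], intro continuous_intros cU, rule that)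
  have mono: "\<exists>y. ((\<lambda>t. H t - P t) has_real_derivative y) (at t) \<and> 0 \<le> y" if t: "0 < t" "t < pi" for t
  proof -
    have s: "sin t \<noteq> 0" using sin_gt_zero[OF t] by simp
    have dk: "(k has_real_derivative - 1 - (k t)\<^sup>2) (at t)"
    proof -
      have "(k has_real_derivative (- sin t * sin t - cos t * cos t) / (sin t * sin t)) (at t)"
        unfolding k_def by (rule DERIV_divide[OF DERIV_cos DERIV_sin s])
      moreover have "(- sin t * sin t - cos t * cos t) / (sin t * sin t) = - 1 - (k t)\<^sup>2"
        using s by (simp add: k_def diff_divide_distrib power2_eq_square)
      ultimately show ?thesis by simp
    qed
    have dG: "(G has_real_derivative U t - k t * G t) (at t)"
    proof -
      have "(G has_real_derivative (U t * sin t * sin t - F t * cos t) / (sin t * sin t)) (at t)"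
        unfolding G_def by (rule DERIV_divide[OF F(1) DERIV_sin s])
      moreover have "(U t * sin t * sin t - F t * cos t) / (sin t * sin t) = U t - k t * G t"
        using s by (simp add: k_def G_def diff_divide_distrib)
      ultimately show ?thesis by simp
    qed
    define K where "K = k t"
    define g where "g = G t"
    define u where "u = U t"
    define u' where "u' = U' t"
    have "((\<lambda>t. H t - P t) has_real_derivative (u'\<^sup>2 - 2 * u\<^sup>2) -
        ((- 1 - K\<^sup>2) * u\<^sup>2 + K * (2 * u * u') - (2 * u' * g + 2 * u * (u - K * g)) +
         ((- 1 - K\<^sup>2) * g\<^sup>2 + K * (2 * g * (u - K * g))))) (at t)"
      unfolding P_def K_def g_def u_def u'_def
      by (rule derivative_eq_intros H(1) dk dG dU refl | simp)+
    moreover have "(u'\<^sup>2 - 2 * u\<^sup>2) -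
        ((- 1 - K\<^sup>2) * u\<^sup>2 + K * (2 * u * u') - (2 * u' * g + 2 * u * (u - K * g)) +
         ((- 1 - K\<^sup>2) * g\<^sup>2 + K * (2 * g * (u - K * g)))) = (u' - K * u + g)\<^sup>2 + (u - K * g)\<^sup>2 + 2 * (K * g)\<^sup>2"
      by (simp add: power2_eq_square algebra_simps)
    moreover have "0 \<le> (u' - K * u + g)\<^sup>2 + (u - K * g)\<^sup>2 + 2 * (K * g)\<^sup>2" by simp
    ultimately show ?thesis by metis
  qed
  have Plow: "P t = c\<^sup>2 * \<rho> t" if t: "0 < t" "t < p" for t
  proof -
    have s: "sin t \<noteq> 0" using sin_gt_zero[of t] t pq by simp
    show ?thesis using s t Flow[of t] zlow[of t]
      by (simp add: P_def k_def G_def U_def \<rho>_def power2_eq_square power3_eq_cube field_simps)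
  qed
  have Phigh: "P (pi - t) = - (c\<^sup>2 * \<rho> t)" if t: "0 < t" "t < pi - q" for t
  proof -
    have s: "sin t \<noteq> 0" using sin_gt_zero[of t] t pq by simp
    have "q < pi - t" "pi - t \<le> pi" using t by auto
    then show ?thesis using s t Fhigh[of "pi - t"] zhigh[of "pi - t"]
      by (simp add: P_def k_def G_def U_def \<rho>_def power2_eq_square power3_eq_cube field_simps)
  qed
  \<comment> \<open>\<open>m t\<close> is of order t^3, so even the quotient of its square by sin^3
    tends to 0.\<close>
  have \<rho>0: "(\<rho> \<longlongrightarrow> 0) (at_right 0)"
    unfolding \<rho>_def m_def by real_asymp
  have ev: "\<forall>\<^sub>F t in at_right 0. 2 * (c\<^sup>2 * \<rho> t) + (H (pi - t) - H t) \<ge> 0"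
  proof -
    define e where "e = min p (min (pi - q) (pi / 2))"
    have e: "e > 0" using pq by (simp add: e_def)
    have "2 * (c\<^sup>2 * \<rho> t) + (H (pi - t) - H t) \<ge> 0" if t: "0 < t" "t < e" for t
    proof -
      have "H t - P t \<le> H (pi - t) - P (pi - t)"
        by (rule DERIV_nonneg_imp_nondecreasing) (use t mono in \<open>auto simp: e_def\<close>)
      moreover have "P t = c\<^sup>2 * \<rho> t" "P (pi - t) = - (c\<^sup>2 * \<rho> t)"
        using Plow[of t] Phigh[of t] t by (simp_all add: e_def)
      ultimately show ?thesis by linarith
    qed
    then show ?thesis using e by (auto simp: eventually_at_right_field)
  qed
  have Hc: "(H \<longlongrightarrow> H a) (at a)" for a using DERIV_isCont[OF H(1)] by (simp add: isCont_def)
  have "((\<lambda>t. 2 * (c\<^sup>2 * \<rho> t) + (H (pi - t) - H t)) \<longlongrightarrow> 2 * (c\<^sup>2 * 0) + (H (pi - 0) - H 0)) (at_right 0)"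
  proof (intro tendsto_intros \<rho>0)
    show "((\<lambda>t. H (pi - t)) \<longlongrightarrow> H (pi - 0)) (at_right 0)"
      by (rule isCont_tendsto_compose[OF DERIV_isCont[OF H(1)]]) (intro tendsto_intros)
    show "(H \<longlongrightarrow> H 0) (at_right 0)" by (rule tendsto_within_subset[OF Hc]) simp
  qed
  then have "0 \<le> 2 * (c\<^sup>2 * 0) + (H (pi - 0) - H 0)"
    by (rule tendsto_lowerbound[OF _ ev]) simp
  \<comment> \<open>This says that the integral of U'^2 - 2 U^2 is nonnegative; the rest expands
    \<open>U\<close> in terms of \<phi>.\<close>
  then have "0 \<le> H pi - H 0" by simp
  also have "\<dots> = ?I (\<lambda>t. (U' t)\<^sup>2 - 2 * (U t)\<^sup>2)"
    by (rule FTC[symmetric]) (auto intro!: H(1) continuous_intros cU)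
  also have "\<dots> = (\<integral>t. (\<phi>' t)\<^sup>2 * indicator {0..pi} t - 2 * c * ((\<phi>' t * cos t) * indicator {0..pi} t)
      + c\<^sup>2 * ((cos t * cos t) * indicator {0..pi} t) - 2 * ((\<phi> t)\<^sup>2 * indicator {0..pi} t)
      + 4 * c * ((\<phi> t * sin t) * indicator {0..pi} t) - 2 * c\<^sup>2 * ((sin t * sin t) * indicator {0..pi} t) \<partial>lborel)"
    by (rule Bochner_Integration.integral_cong) (simp_all add: U_def U'_def power2_eq_square algebra_simps)
  also have "\<dots> = ?I (\<lambda>t. (\<phi>' t)\<^sup>2) - 2 * c * A + c\<^sup>2 * (pi / 2)
      - 2 * ?I (\<lambda>t. (\<phi> t)\<^sup>2) + 4 * c * A - 2 * c\<^sup>2 * (pi / 2)"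
  proof -
    have i: "integrable lborel (\<lambda>t. (\<phi>' t)\<^sup>2 * indicator {0..pi} t)" "integrable lborel (\<lambda>t. (\<phi>' t * cos t) * indicator {0..pi} t)"
      "integrable lborel (\<lambda>t. (cos t * cos t) * indicator {0..pi} t)" "integrable lborel (\<lambda>t. (\<phi> t)\<^sup>2 * indicator {0..pi} t)"
      "integrable lborel (\<lambda>t. (\<phi> t * sin t) * indicator {0..pi} t)" "integrable lborel (\<lambda>t. (sin t * sin t) * indicator {0..pi} t)"
      by (intro int continuous_intros cphi c')+
    have lin: "(\<integral>t. f1 t - a2 * f2 t + a3 * f3 t - a4 * f4 t + a5 * f5 t - a6 * f6 t \<partial>lborel) =
        (\<integral>t. f1 t \<partial>lborel) - a2 * (\<integral>t. f2 t \<partial>lborel) + a3 * (\<integral>t. f3 t \<partial>lborel) - a4 * (\<integral>t. f4 t \<partial>lborel)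
        + a5 * (\<integral>t. f5 t \<partial>lborel) - a6 * (\<integral>t. f6 t \<partial>lborel)"
      if "integrable lborel f1" "integrable lborel f2" "integrable lborel f3" "integrable lborel f4" "integrable lborel f5" "integrable lborel f6"
      for f1 f2 f3 f4 f5 f6 :: "real \<Rightarrow> real" and a2 a3 a4 a5 a6 :: real
      using that by simp
    show ?thesis by (subst lin[OF i]) (simp only: ss cc dc A_def[symmetric])
  qed
  also have "\<dots> = ?I (\<lambda>t. (\<phi>' t)\<^sup>2) - 2 * ?I (\<lambda>t. (\<phi> t)\<^sup>2) + 2 / pi * A\<^sup>2"
    by (simp add: c_def power2_eq_square field_simps)
  finally show ?thesis unfolding A_def by simp
qed

context tube begin

section \<open>The transverse spectral gap on the tube\<close>

lemma fib_scaled: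
  assumes x: "x \<in> {\<alpha>..\<beta>}" and F: "F \<in> borel_measurable borel"
  shows "fib F x = Lb x / pi * (\<integral>t. F (x, Lb x / pi * t) * indicator {0..pi} t \<partial>lborel)"
proof -
  have m: "(\<lambda>t. F (x, Lb x / pi * t)) \<in> borel_measurable borel"
    by (rule measurable_compose[OF _ F]) (intro borel_measurable_continuous_onI continuous_intros)
  have "fib F x = \<bar>Lb x / pi\<bar> *\<^sub>R (\<integral>t. indicator S (x, 0 + Lb x / pi * t) * F (x, 0 + Lb x / pi * t) \<partial>lborel)"
    unfolding fib_def using Lb_pos[of x] by (intro lborel_integral_real_affine) simp
  also have "\<dots> = Lb x / pi * (\<integral>t. indicator {0<..<pi} t * F (x, Lb x / pi * t) \<partial>lborel)"
    using Lb_pos[of x] by (simp only: add_0 S_slice[OF x]) simp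
  also have "(\<integral>t. indicator {0<..<pi} t * F (x, Lb x / pi * t) \<partial>lborel) = (\<integral>t. F (x, Lb x / pi * t) * indicator {0..pi} t \<partial>lborel)"
  proof (rule integral_cong_AE)
    have "AE t in lborel. t \<noteq> 0" "AE t in lborel. t \<noteq> pi" by (rule AE_lborel_singleton)+
    then show "AE t in lborel. indicator {0<..<pi} t * F (x, Lb x / pi * t) = F (x, Lb x / pi * t) * indicator {0..pi} t"
      by eventually_elim (auto simp: indicator_def)
  qed (use m in auto)
  finally show ?thesis .
qed

text \<open>\<open>dirichlet_gap\<close> rescaled by \<kappa> = L / pi. In units of the first
  eigenvalue the complement of the first mode gets the factor 2, where the second eigenvalue would
  give 4; any factor above 1 leaves a gap after the spectral shift.\<close>

lemma fibre_gap_slice: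
  assumes u: "u \<in> test_functions S" and x: "x \<in> {\<alpha>..\<beta>}"
  shows "2 * ((pi / Lb x)\<^sup>2 * fib (\<lambda>p. (u p)\<^sup>2) x) - (pi / Lb x * pr sin u x)\<^sup>2 \<le> fib (\<lambda>p. (partial (0, 1) u p)\<^sup>2) x"
proof -
  define \<kappa> where "\<kappa> = Lb x / pi"
  have k: "\<kappa> > 0" using Lb_pos[of x] by (simp add: \<kappa>_def)
  note su = test_functionsD(1)[OF u]
  have sy: "smooth (partial (0, 1) u)" by (rule smooth_partial[OF su e_Basis(2)])
  define \<psi> where "\<psi> t = u (x, \<kappa> * t)" for t
  define \<psi>' where "\<psi>' t = partial (0, 1) u (x, \<kappa> * t) * \<kappa>" for t
  obtain K where K: "compact K" "K \<subseteq> interior S" "\<forall>p. p \<notin> K \<longrightarrow> u p = 0"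
    using test_functionsD(2)[OF u] by blast
  \<comment> \<open>The rescaled slice of the support: a compact subset of (0, pi), as
    \<open>dirichlet_gap\<close> requires.\<close>
  define T where "T = (\<lambda>p. snd p / \<kappa>) ` (K \<inter> {x} \<times> UNIV)"
  have "compact (K \<inter> {x} \<times> UNIV)" by (intro compact_Int_closed K(1) closed_Times) auto
  then have T: "compact T" unfolding T_def using k by (intro compact_continuous_image continuous_intros) auto
  have Tsub: "0 < t \<and> t < pi" if "t \<in> T" for t
  proof -
    obtain y where y: "(x, y) \<in> K" "t = y / \<kappa>" using \<open>t \<in> T\<close> by (auto simp: T_def)
    then have "(x, y) \<in> S" using K(2) interior_subset by blast
    then have "0 < y" "y < Lb x" by (auto simp: S_alt)
    moreover have "Lb x = pi * \<kappa>" by (simp add: \<kappa>_def)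
    ultimately show ?thesis using k y(2) by (simp add: pos_divide_less_eq)
  qed
  have Tz: "\<psi> t = 0" if "t \<notin> T" for t
  proof -
    have "(x, \<kappa> * t) \<notin> K"
    proof
      assume "(x, \<kappa> * t) \<in> K"
      then have "snd (x, \<kappa> * t) / \<kappa> \<in> T" unfolding T_def by blast
      then show False using that k by simp
    qed
    then show ?thesis using K(3) by (simp add: \<psi>_def)
  qed
  obtain p q where pq: "0 < p" "p < pi" "0 < q" "q < pi" "\<And>t. t \<notin> {p..q} \<Longrightarrow> \<psi> t = 0"
  proof (cases "T = {}")
    case True
    show thesis by (rule that[of 1 1]) (use True Tz pi_gt3 in auto)
  next
    case False
    obtain l where l: "l \<in> T" "\<forall>x\<in>T. l \<le> x" using compact_attains_inf[OF T False] by blast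
    obtain m where m: "m \<in> T" "\<forall>x\<in>T. x \<le> m" using compact_attains_sup[OF T False] by blast
    show thesis
    proof (rule that)
      show "0 < l" "l < pi" "0 < m" "m < pi" using Tsub l m by auto
      show "\<psi> t = 0" if "t \<notin> {l..m}" for t using that l m Tz by (metis atLeastAtMost_iff)
    qed
  qed
  have d: "(\<psi> has_real_derivative \<psi>' t) (at t)" for t
    unfolding \<psi>_def \<psi>'_def by (rule DERIV_chain2[OF smooth_slice_DERIV(2)[OF su]]) (auto intro!: derivative_eq_intros)
  have c: "continuous_on UNIV \<psi>'"
    unfolding \<psi>'_def
    by (intro continuous_intros continuous_on_compose2[OF smooth_slice_continuous(2)[OF sy, of UNIV]]) auto
  define A2 where "A2 = (\<integral>t. (\<psi> t)\<^sup>2 * indicator {0..pi} t \<partial>lborel)"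
  define As where "As = (\<integral>t. (\<psi> t * sin t) * indicator {0..pi} t \<partial>lborel)"
  define Ad where "Ad = (\<integral>t. (\<psi>' t)\<^sup>2 * indicator {0..pi} t \<partial>lborel)"
  have gap: "2 * A2 - 2 / pi * As\<^sup>2 \<le> Ad" unfolding A2_def As_def Ad_def by (rule dirichlet_gap[OF d c pq])
  have m: "u \<in> borel_measurable borel" "partial (0, 1) u \<in> borel_measurable borel" by (intro smooth_measurable su sy)+
  have f1: "fib (\<lambda>p. (u p)\<^sup>2) x = \<kappa> * A2"
    by (subst fib_scaled[OF x]) (use m in \<open>simp_all add: A2_def \<kappa>_def \<psi>_def\<close>)
  have f2: "fib (\<lambda>p. (partial (0, 1) u p)\<^sup>2) x = Ad / \<kappa>"
  proof -
    have "Ad = (\<integral>t. \<kappa>\<^sup>2 * ((partial (0, 1) u (x, \<kappa> * t))\<^sup>2 * indicator {0..pi} t) \<partial>lborel)"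
      unfolding Ad_def \<psi>'_def by (rule Bochner_Integration.integral_cong) (simp_all add: power_mult_distrib)
    then have "Ad = \<kappa>\<^sup>2 * (\<integral>t. (partial (0, 1) u (x, \<kappa> * t))\<^sup>2 * indicator {0..pi} t \<partial>lborel)" by simp
    moreover have "fib (\<lambda>p. (partial (0, 1) u p)\<^sup>2) x = \<kappa> * (\<integral>t. (partial (0, 1) u (x, \<kappa> * t))\<^sup>2 * indicator {0..pi} t \<partial>lborel)"
      by (subst fib_scaled[OF x]) (use m in \<open>simp_all add: \<kappa>_def\<close>)
    ultimately show ?thesis using k by (simp add: power2_eq_square)
  qed
  have f3: "pr sin u x = \<kappa> * (sqrt (2 / Lb x) * As)"
  proof -
    have "pr sin u x = \<kappa> * (\<integral>t. (u (x, \<kappa> * t) * ker sin (x, \<kappa> * t)) * indicator {0..pi} t \<partial>lborel)"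
      unfolding pr_def \<kappa>_def
      by (rule fib_scaled[OF x]) (intro borel_measurable_times m ker_measurable continuous_intros)
    also have "(\<integral>t. (u (x, \<kappa> * t) * ker sin (x, \<kappa> * t)) * indicator {0..pi} t \<partial>lborel) = (\<integral>t. sqrt (2 / Lb x) * ((\<psi> t * sin t) * indicator {0..pi} t) \<partial>lborel)"
      unfolding \<kappa>_def ker_slice \<psi>_def by (rule Bochner_Integration.integral_cong[OF refl]) (simp only: mult_ac)
    finally show ?thesis by (simp add: As_def)
  qed
  have e: "pi / Lb x = 1 / \<kappa>" by (simp add: \<kappa>_def)
  have "(pi / Lb x * pr sin u x)\<^sup>2 = 2 / pi * As\<^sup>2 / \<kappa>"
  proof -
    have "(pi / Lb x * pr sin u x)\<^sup>2 = (2 / Lb x) * As\<^sup>2"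
      unfolding e f3 using k Lb_pos[of x] by (simp add: power_mult_distrib)
    then show ?thesis by (simp add: \<kappa>_def)
  qed
  moreover have "(pi / Lb x)\<^sup>2 * fib (\<lambda>p. (u p)\<^sup>2) x = A2 / \<kappa>"
    unfolding e f1 using k by (simp add: power2_eq_square)
  moreover have "(2 * A2 - 2 / pi * As\<^sup>2) / \<kappa> \<le> Ad / \<kappa>" using gap k by (simp add: divide_right_mono)
  ultimately show ?thesis unfolding f2 by (simp add: diff_divide_distrib)
qed

lemma invL_plane:
  assumes "f \<in> L2 MO" shows "(\<lambda>p. pi / Lb (fst p) * f p) \<in> L2 MO"
    "\<exists>B\<ge>0. \<forall>f::real \<times> real \<Rightarrow> real\<in>L2 MO. l2norm MO (\<lambda>p. pi / Lb (fst p) * f p) \<le> B * l2norm MO f"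
proof -
  obtain B where B: "B \<ge> 0" "\<forall>x. \<bar>pi / Lb x\<bar> \<le> B" using invL_bounded_measurable(2) by blast
  have m: "(\<lambda>p. pi / Lb (fst p)) \<in> borel_measurable MO" by (rule fst_measurable_MO[OF invL_bounded_measurable(1)])
  show "(\<lambda>p. pi / Lb (fst p) * f p) \<in> L2 MO" using L2_bounded_mult[OF assms m B(2)[rule_format]] by simp
  show "\<exists>B\<ge>0. \<forall>f::real \<times> real \<Rightarrow> real\<in>L2 MO. l2norm MO (\<lambda>p. pi / Lb (fst p) * f p) \<le> B * l2norm MO f"
  proof (intro exI[of _ B] conjI B(1) ballI)
    fix f :: "real \<times> real \<Rightarrow> real" assume "f \<in> L2 MO"
    from l2norm_bounded_mult[OF this m B(2)[rule_format] B(1)]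
    show "l2norm MO (\<lambda>p. pi / Lb (fst p) * f p) \<le> B * l2norm MO f" by (simp only: real_scaleR_def)
  qed
qed

lemma fibre_gap_test:
  assumes u: "u \<in> test_functions S"
  shows "2 * (l2norm MO (\<lambda>p. pi / Lb (fst p) * u p))\<^sup>2 - (l2norm MI (\<lambda>x. pi / Lb x * pr sin u x))\<^sup>2
    \<le> (l2norm MO (partial (0, 1) u))\<^sup>2"
proof -
  have cs: "continuous_on UNIV (sin :: real \<Rightarrow> real)" by (intro continuous_intros)
  note uL = test_functions_L2[OF S_borel u]
  note uyL = test_functions_L2[OF S_borel test_functions_partial[OF u e_Basis(2)]]
  note prL = invL_mult_L2[OF pr_L2(1)[OF uL cs]]
  have i1: "integrable MO (\<lambda>p. (pi / Lb (fst p) * u p)\<^sup>2)" using L2_integrable_sq[OF invL_plane(1)[OF uL]] unfolding real_norm_def power2_abs .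
  have i2: "integrable MO (\<lambda>p. (partial (0, 1) u p)\<^sup>2)" using L2_integrable_sq[OF uyL] unfolding real_norm_def power2_abs .
  have i3: "integrable MI (\<lambda>x. (pi / Lb x * pr sin u x)\<^sup>2)" using L2_integrable_sq[OF prL] unfolding real_norm_def power2_abs .
  have f1: "fib (\<lambda>p. (pi / Lb (fst p) * u p)\<^sup>2) x = (pi / Lb x)\<^sup>2 * fib (\<lambda>p. (u p)\<^sup>2) x" for x
  proof -
    have "fib (\<lambda>p. (pi / Lb (fst p) * u p)\<^sup>2) x = (\<integral>y. (pi / Lb x)\<^sup>2 * (indicator S (x, y) * (u (x, y))\<^sup>2) \<partial>lborel)"
      unfolding fib_def by (rule Bochner_Integration.integral_cong) (simp_all add: power_mult_distrib power_divide)
    then show ?thesis by (simp add: fib_def)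
  qed
  have n: "(l2norm M f)\<^sup>2 = (\<integral>x. (f x)\<^sup>2 \<partial>M)" for f :: "'b \<Rightarrow> real" and M
    unfolding l2norm_sq l2inner_def by (simp add: power2_eq_square)
  have "(\<integral>x. 2 * fib (\<lambda>p. (pi / Lb (fst p) * u p)\<^sup>2) x - (pi / Lb x * pr sin u x)\<^sup>2 \<partial>MI) \<le> (\<integral>x. fib (\<lambda>p. (partial (0, 1) u p)\<^sup>2) x \<partial>MI)"
  proof (rule integral_mono)
    show "integrable MI (\<lambda>x. 2 * fib (\<lambda>p. (pi / Lb (fst p) * u p)\<^sup>2) x - (pi / Lb x * pr sin u x)\<^sup>2)"
      using integral_fib(2)[OF i1] i3 by simp
    show "integrable MI (fib (\<lambda>p. (partial (0, 1) u p)\<^sup>2))" by (rule integral_fib(2)[OF i2])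
    show "2 * fib (\<lambda>p. (pi / Lb (fst p) * u p)\<^sup>2) x - (pi / Lb x * pr sin u x)\<^sup>2 \<le> fib (\<lambda>p. (partial (0, 1) u p)\<^sup>2) x"
      if "x \<in> space MI" for x
      using fibre_gap_slice[OF u, of x] that unfolding f1 by simp
  qed
  then show ?thesis
    unfolding n integral_fib(1)[OF i1] integral_fib(1)[OF i2] using integral_fib(2)[OF i1] i3 by simp
qed

text \<open>The factors pi / L stay inside the norms because L varies along the axis. Equality holds
  on modes, a fact on which \<open>transverse_cross_zero\<close> relies.\<close>

theorem fibre_gap:
  assumes u: "HS u g"
  shows "2 * (l2norm MO (\<lambda>p. pi / Lb (fst p) * u p))\<^sup>2 - (l2norm MI (\<lambda>x. pi / Lb x * pr sin u x))\<^sup>2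
    \<le> (l2norm MO (\<lambda>p. snd (g p)))\<^sup>2"
proof -
  obtain p where p: "\<And>n::nat. p n \<in> test_functions S"
    "l2_lim MO p u" "l2_lim MO (\<lambda>n. gradient (p n)) g"
    by (rule has_H10_gradient_approx[OF u], rule that)
  have cs: "continuous_on UNIV (sin :: real \<Rightarrow> real)" by (intro continuous_intros)
  note pL = test_functions_L2[OF S_borel p(1)]
  note pyL = test_functions_L2[OF S_borel test_functions_partial[OF p(1) e_Basis(2)]]
  note uL = has_H10_gradient_L2(1)[OF u]
  have "(\<lambda>p. (fst (g p), snd (g p))) \<in> L2 MO" using has_H10_gradient_L2(2)[OF u] by simp
  then have gL: "(\<lambda>p. snd (g p)) \<in> L2 MO" by (simp only: L2_Pair)
  have yt: "l2_lim MO (\<lambda>n x. partial (0, 1) (p n) x) (\<lambda>x. snd (g x))"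
  proof (rule l2norm_tendsto_squeeze[OF p(3)])
    fix n
    have d: "(\<lambda>x. gradient (p n) x - g x) \<in> L2 MO"
      by (intro L2_diff test_functions_gradient_L2[OF S_borel p(1)] has_H10_gradient_L2(2)[OF u])
    show "l2norm MO (\<lambda>x. partial (0, 1) (p n) x - snd (g x)) \<le> l2norm MO (\<lambda>x. gradient (p n) x - g x)"
    proof (rule l2norm_mono[OF L2_measurable[OF L2_diff[OF pyL gL]] d])
      show "norm (partial (0, 1) (p n) x - snd (g x)) \<le> norm (gradient (p n) x - g x)" for x
      proof -
        have "norm (snd D) \<le> norm D" for D :: "real \<times> real" using norm_snd_le[of "snd D" "fst D"] by simp
        from this[of "gradient (p n) x - g x"] show ?thesis by (simp add: gradient_plane)
      qed
    qed
  qed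
  obtain B where B: "B \<ge> 0" "\<forall>f::real \<times> real \<Rightarrow> real\<in>L2 MO. l2norm MO (\<lambda>p. pi / Lb (fst p) * f p) \<le> B * l2norm MO f"
    using invL_plane(2)[OF uL] by blast
  have t1: "l2_lim MO (\<lambda>n q. pi / Lb (fst q) * p n q) (\<lambda>q. pi / Lb (fst q) * u q)"
  proof (rule l2norm_tendsto_squeeze)
    show "(\<lambda>n. B * l2norm MO (\<lambda>x. p n x - u x)) \<longlonglongrightarrow> 0" using tendsto_mult_left[OF p(2), of B] by simp
    show "l2norm MO (\<lambda>q. pi / Lb (fst q) * p n q - pi / Lb (fst q) * u q) \<le> B * l2norm MO (\<lambda>x. p n x - u x)" for n
      using B(2)[rule_format, OF L2_diff[OF pL uL], of n] by (simp add: right_diff_distrib)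
  qed
  obtain B' where B': "B' \<ge> 0" "\<forall>x. \<bar>pi / Lb x\<bar> \<le> B'" using invL_bounded_measurable(2) by blast
  have t2: "l2_lim MI (\<lambda>n x. pi / Lb x * pr sin (p n) x) (\<lambda>x. pi / Lb x * pr sin u x)"
  proof (rule l2norm_tendsto_squeeze)
    show "(\<lambda>n. B' * l2norm MI (\<lambda>x. pr sin (p n) x - pr sin u x)) \<longlonglongrightarrow> 0"
      using tendsto_mult_left[OF pr_tendsto[OF pL uL cs p(2)], of B'] by simp
    show "l2norm MI (\<lambda>x. pi / Lb x * pr sin (p n) x - pi / Lb x * pr sin u x) \<le> B' * l2norm MI (\<lambda>x. pr sin (p n) x - pr sin u x)" for n
      using l2norm_bounded_mult[OF L2_diff[OF pr_L2(1)[OF pL cs] pr_L2(1)[OF uL cs]] invL_bounded_measurable(1) B'(2)[rule_format] B'(1), of n]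
      by (simp add: right_diff_distrib)
  qed
  have l1: "(\<lambda>n. 2 * (l2norm MO (\<lambda>q. pi / Lb (fst q) * p n q))\<^sup>2 - (l2norm MI (\<lambda>x. pi / Lb x * pr sin (p n) x))\<^sup>2)
      \<longlonglongrightarrow> 2 * (l2norm MO (\<lambda>q. pi / Lb (fst q) * u q))\<^sup>2 - (l2norm MI (\<lambda>x. pi / Lb x * pr sin u x))\<^sup>2"
    by (intro tendsto_diff tendsto_mult tendsto_const tendsto_power
        l2norm_tendsto[OF invL_plane(1)[OF pL] invL_plane(1)[OF uL] t1]
        l2norm_tendsto[OF invL_mult_L2[OF pr_L2(1)[OF pL cs]] invL_mult_L2[OF pr_L2(1)[OF uL cs]] t2])
  have l2: "(\<lambda>n. (l2norm MO (partial (0, 1) (p n)))\<^sup>2) \<longlonglongrightarrow> (l2norm MO (\<lambda>q. snd (g q)))\<^sup>2"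
    by (intro tendsto_power l2norm_tendsto[OF pyL gL yt])
  show ?thesis by (rule LIMSEQ_le[OF l1 l2]) (use fibre_gap_test[OF p(1)] in auto)
qed

end

section \<open>The resolvent in a narrow tube\<close>

text \<open>All that the estimate needs from the profile: a bound on the width, and |\<xi>|^2 <= R^2
  q already for the form without its nonnegative \<lambda>^2 term. \<open>R\<close> is thus the
  length over which functions of low energy may spread.\<close>

locale narrow_tube = tube +
  fixes Lmax R :: real
  assumes Lmax: "0 < Lmax" "\<And>x. x \<in> {\<alpha>..\<beta>} \<Longrightarrow> L x \<le> Lmax" and R: "0 < R"
    and coer: "\<And>\<xi> \<xi>'. has_H10_gradient {\<alpha>..\<beta>} \<xi> \<xi>' \<Longrightarrow> (l2norm MI \<xi>)\<^sup>2 \<le>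
      R\<^sup>2 * ((l2norm MI \<xi>')\<^sup>2 + (l2norm MI (\<lambda>x. pi / Lb x * \<xi> x))\<^sup>2 - (pi / Lmax)\<^sup>2 * (l2norm MI \<xi>)\<^sup>2)"
begin

definition mu :: real where "mu = (pi / Lmax)\<^sup>2"

text \<open>The form of Q: \<open>J tau tau\<close> is pi^2/3 + 1/4 and \<open>mu\<close> is the
  subtracted threshold. Weak gradients are arguments, here and in \<open>Af\<close>, so no
  representative has to be chosen during the estimates.\<close>

definition Qf where "Qf \<xi> \<xi>' \<eta> \<eta>' = l2inner MI \<xi>' \<eta>' + l2inner MI (\<lambda>x. pi / Lb x * \<xi> x) (\<lambda>x. pi / Lb x * \<eta> x)
  - mu * l2inner MI \<xi> \<eta> + J tau tau * l2inner MI (\<lambda>x. \<xi> x * lam x) (\<lambda>x. \<eta> x * lam x)"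

definition Af :: "(real \<times> real \<Rightarrow> real) \<Rightarrow> (real \<times> real \<Rightarrow> real \<times> real) \<Rightarrow> (real \<times> real \<Rightarrow> real) \<Rightarrow> (real \<times> real \<Rightarrow> real \<times> real) \<Rightarrow> real"
  where "Af u g w k = l2inner MO g k - mu * l2inner MO u w"


definition md :: "(real \<Rightarrow> real) \<Rightarrow> real \<times> real \<Rightarrow> real" where "md \<xi> p = \<xi> (fst p) * ker sin p"

definition mdx :: "(real \<Rightarrow> real) \<Rightarrow> (real \<Rightarrow> real) \<Rightarrow> real \<times> real \<Rightarrow> real" where
  "mdx \<xi> \<xi>' p = \<xi>' (fst p) * ker sin p - \<xi> (fst p) * lam (fst p) * ker tau p"

definition mdy :: "(real \<Rightarrow> real) \<Rightarrow> real \<times> real \<Rightarrow> real" where "mdy \<xi> p = pi / Lb (fst p) * \<xi> (fst p) * ker cos p"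

abbreviation mdg where "mdg \<xi> \<xi>' \<equiv> \<lambda>p. (mdx \<xi> \<xi>' p, mdy \<xi> p)"

lemma mu_pos: "mu > 0" using Lmax by (simp add: mu_def)

lemma csin: "continuous_on UNIV (sin :: real \<Rightarrow> real)" and ccos: "continuous_on UNIV (cos :: real \<Rightarrow> real)"
  by (intro continuous_intros)+

lemma Jtt_pos: "J tau tau > 0" by (simp add: J_tau_tau add_pos_pos)

lemma md_H: "HI \<xi> \<xi>' \<Longrightarrow> HS (md \<xi>) (mdg \<xi> \<xi>')"
  unfolding md_def[abs_def] mdx_def mdy_def by (rule mode_H10)

lemma md_L2: "\<xi> \<in> L2 MI \<Longrightarrow> md \<xi> \<in> L2 MO" unfolding md_def[abs_def] by (rule mult_ker_L2[OF _ csin])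
lemma mdy_L2: "\<xi> \<in> L2 MI \<Longrightarrow> mdy \<xi> \<in> L2 MO"
  unfolding mdy_def[abs_def] by (rule mult_ker_L2[OF invL_mult_L2 ccos])

lemma HS_fst_snd:
  assumes "HS u g" shows "u \<in> L2 MO" "(\<lambda>p. fst (g p)) \<in> L2 MO" "(\<lambda>p. snd (g p)) \<in> L2 MO"
proof -
  show "u \<in> L2 MO" by (rule has_H10_gradient_L2(1)[OF assms])
  have "(\<lambda>p. (fst (g p), snd (g p))) \<in> L2 MO" using has_H10_gradient_L2(2)[OF assms] by simp
  then show "(\<lambda>p. fst (g p)) \<in> L2 MO" "(\<lambda>p. snd (g p)) \<in> L2 MO" by (simp_all only: L2_Pair)
qed

lemma inner_split:
  assumes "HS u g" "HS w k"
  shows "l2inner MO g k = l2inner MO (\<lambda>p. fst (g p)) (\<lambda>p. fst (k p)) + l2inner MO (\<lambda>p. snd (g p)) (\<lambda>p. snd (k p))"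
  using l2inner_Pair[OF HS_fst_snd(2,3)[OF assms(1)] HS_fst_snd(2,3)[OF assms(2)]] by simp

text \<open>The mixed terms carry \<open>J sin tau\<close>, which is 0, so only the two squares
  survive; \<open>J tau tau\<close> becomes the constant of the potential v.\<close>

lemma mdx_mdx:
  assumes "HI \<xi> \<xi>'" "HI \<eta> \<eta>'"
  shows "l2inner MO (mdx \<xi> \<xi>') (mdx \<eta> \<eta>') = l2inner MI \<xi>' \<eta>' + J tau tau * l2inner MI (\<lambda>x. \<xi> x * lam x) (\<lambda>x. \<eta> x * lam x)"
proof -
  note L = has_H10_gradient_L2(2)[OF assms(1)] lam_mult_L2(1)[OF assms(1)] has_H10_gradient_L2(2)[OF assms(2)] lam_mult_L2(1)[OF assms(2)]
  note K = mult_ker_L2[OF L(1) csin] mult_ker_L2[OF L(2) tau_continuous] mult_ker_L2[OF L(3) csin] mult_ker_L2[OF L(4) tau_continuous]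
  have Jts: "J tau sin = 0" using J_sin_tau by (simp add: J_def mult.commute)
  show ?thesis
    unfolding mdx_def[abs_def]
    by (simp add: l2inner_diff_left l2inner_diff_right K L2_diff mode_inner[OF L(1) L(3) csin csin]
      mode_inner[OF L(1) L(4) csin tau_continuous] mode_inner[OF L(2) L(3) tau_continuous csin]
      mode_inner[OF L(2) L(4) tau_continuous tau_continuous] J_sin_sin J_sin_tau Jts)
qed

text \<open>Restricted to modes the shifted Dirichlet form is exactly the form of Q, so the error
  comes only from the coupling to the complement and from the complement itself.\<close>

lemma Af_mode:
  assumes "HI \<xi> \<xi>'" "HI \<eta> \<eta>'"
  shows "Af (md \<xi>) (mdg \<xi> \<xi>') (md \<eta>) (mdg \<eta> \<eta>') = Qf \<xi> \<xi>' \<eta> \<eta>'"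
proof -
  note L = has_H10_gradient_L2(1)[OF assms(1)] has_H10_gradient_L2(1)[OF assms(2)]
  have "l2inner MO (mdy \<xi>) (mdy \<eta>) = l2inner MI (\<lambda>x. pi / Lb x * \<xi> x) (\<lambda>x. pi / Lb x * \<eta> x)"
    unfolding mdy_def[abs_def] using mode_inner[OF invL_mult_L2[OF L(1)] invL_mult_L2[OF L(2)] ccos ccos]
    by (simp add: J_cos_cos)
  moreover have "l2inner MO (md \<xi>) (md \<eta>) = l2inner MI \<xi> \<eta>"
    unfolding md_def[abs_def] using mode_inner[OF L csin csin] by (simp add: J_sin_sin)
  ultimately show ?thesis
    unfolding Af_def Qf_def using inner_split[OF md_H[OF assms(1)] md_H[OF assms(2)]] mdx_mdx[OF assms] by simp
qed

definition orth :: "(real \<times> real \<Rightarrow> real) \<Rightarrow> bool" where "orth V \<longleftrightarrow> (AE x in MI. pr sin V x = 0)"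

lemma orth_inner:
  assumes "orth V" "V \<in> L2 MO" "\<xi> \<in> L2 MI" shows "l2inner MO (md \<xi>) V = 0"
proof -
  have "l2inner MO (md \<xi>) V = l2inner MI \<xi> (pr sin V)" unfolding md_def[abs_def] by (rule pr_adjoint[OF assms(2,3) csin])
  also have "\<dots> = l2inner MI \<xi> (\<lambda>x. 0)"
    using assms(1) unfolding orth_def
    by (intro l2inner_cong_AE) (auto intro!: L2_measurable[OF assms(3)] L2_measurable[OF pr_L2(1)[OF assms(2) csin]])
  finally show ?thesis by (simp add: l2inner_def)
qed

lemma mu_invL: "x \<in> {\<alpha>..\<beta>} \<Longrightarrow> mu \<le> (pi / Lb x)\<^sup>2"
  unfolding mu_def using Lmax Lb_eq[of x] Lb_pos[of x] by (intro power_mono divide_left_mono) auto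

lemma mu_norm_plane: "V \<in> L2 MO \<Longrightarrow> mu * (l2norm MO V)\<^sup>2 \<le> (l2norm MO (\<lambda>p. pi / Lb (fst p) * V p))\<^sup>2"
proof -
  assume V: "V \<in> L2 MO"
  have "l2norm MO (\<lambda>p. sqrt mu *\<^sub>R V p) \<le> l2norm MO (\<lambda>p. pi / Lb (fst p) * V p)"
  proof (rule l2norm_mono[OF L2_measurable[OF L2_scaleR[OF V]] invL_plane(1)[OF V]])
    fix p assume "p \<in> space MO"
    then have "mu \<le> (pi / Lb (fst p))\<^sup>2" using mu_invL S_fst by simp
    then have "sqrt mu \<le> pi / Lb (fst p)" using Lb_pos[of "fst p"] by (simp add: real_le_lsqrt)
    then show "norm (sqrt mu *\<^sub>R V p) \<le> norm (pi / Lb (fst p) * V p)"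
      using mu_pos Lb_pos[of "fst p"] by (simp add: abs_mult mult_right_mono del: times_divide_eq_left)
  qed
  then have "sqrt mu * l2norm MO V \<le> l2norm MO (\<lambda>p. pi / Lb (fst p) * V p)"
    unfolding l2norm_scaleR using mu_pos by (simp only: abs_of_pos real_sqrt_gt_zero)
  then have "(sqrt mu * l2norm MO V)\<^sup>2 \<le> (l2norm MO (\<lambda>p. pi / Lb (fst p) * V p))\<^sup>2"
    by (rule power_mono) (use mu_pos in \<open>simp add: l2norm_nonneg\<close>)
  then show ?thesis using mu_pos by (simp add: power_mult_distrib)
qed

lemma mu_norm_line: "\<xi> \<in> L2 MI \<Longrightarrow> mu * (l2norm MI \<xi>)\<^sup>2 \<le> (l2norm MI (\<lambda>x. pi / Lb x * \<xi> x))\<^sup>2"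
proof -
  assume V: "\<xi> \<in> L2 MI"
  have "l2norm MI (\<lambda>p. sqrt mu *\<^sub>R \<xi> p) \<le> l2norm MI (\<lambda>p. pi / Lb p * \<xi> p)"
  proof (rule l2norm_mono[OF L2_measurable[OF L2_scaleR[OF V]] invL_mult_L2[OF V]])
    fix p assume "p \<in> space MI"
    then have "mu \<le> (pi / Lb p)\<^sup>2" using mu_invL by simp
    then have "sqrt mu \<le> pi / Lb p" using Lb_pos[of p] by (simp add: real_le_lsqrt)
    then show "norm (sqrt mu *\<^sub>R \<xi> p) \<le> norm (pi / Lb p * \<xi> p)"
      using mu_pos Lb_pos[of p] by (simp add: abs_mult mult_right_mono del: times_divide_eq_left)
  qed
  then have "sqrt mu * l2norm MI \<xi> \<le> l2norm MI (\<lambda>x. pi / Lb x * \<xi> x)"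
    unfolding l2norm_scaleR using mu_pos by (simp only: abs_of_pos real_sqrt_gt_zero)
  then have "(sqrt mu * l2norm MI \<xi>)\<^sup>2 \<le> (l2norm MI (\<lambda>x. pi / Lb x * \<xi> x))\<^sup>2"
    by (rule power_mono) (use mu_pos in \<open>simp add: l2norm_nonneg\<close>)
  then show ?thesis using mu_pos by (simp add: power_mult_distrib)
qed

lemma Qf_eq: "Qf \<xi> \<xi>' \<xi> \<xi>' = (l2norm MI \<xi>')\<^sup>2 + (l2norm MI (\<lambda>x. pi / Lb x * \<xi> x))\<^sup>2 - mu * (l2norm MI \<xi>)\<^sup>2
    + J tau tau * (l2norm MI (\<lambda>x. \<xi> x * lam x))\<^sup>2"
  unfolding Qf_def l2norm_sq ..

lemma Qf_bounds:
  assumes "HI \<xi> \<xi>'"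
  shows "0 \<le> Qf \<xi> \<xi>' \<xi> \<xi>'" "l2norm MI \<xi>' \<le> sqrt (Qf \<xi> \<xi>' \<xi> \<xi>')" "l2norm MI \<xi> \<le> R * sqrt (Qf \<xi> \<xi>' \<xi> \<xi>')"
proof -
  have m: "mu * (l2norm MI \<xi>)\<^sup>2 \<le> (l2norm MI (\<lambda>x. pi / Lb x * \<xi> x))\<^sup>2"
    by (rule mu_norm_line[OF has_H10_gradient_L2(1)[OF assms]])
  have j: "0 \<le> J tau tau * (l2norm MI (\<lambda>x. \<xi> x * lam x))\<^sup>2" using Jtt_pos by simp
  show q: "0 \<le> Qf \<xi> \<xi>' \<xi> \<xi>'" unfolding Qf_eq using m j zero_le_power2[of "l2norm MI \<xi>'"] by linarith
  show "l2norm MI \<xi>' \<le> sqrt (Qf \<xi> \<xi>' \<xi> \<xi>')"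
    by (rule real_le_rsqrt) (use m j in \<open>unfold Qf_eq, linarith\<close>)
  have "(l2norm MI \<xi>)\<^sup>2 \<le> R\<^sup>2 * Qf \<xi> \<xi>' \<xi> \<xi>'"
    by (rule order_trans[OF coer[OF assms]], rule mult_left_mono) (use j in \<open>simp_all add: Qf_eq mu_def\<close>)
  then have "l2norm MI \<xi> \<le> sqrt (R\<^sup>2 * Qf \<xi> \<xi>' \<xi> \<xi>')" by (rule real_le_rsqrt)
  then show "l2norm MI \<xi> \<le> R * sqrt (Qf \<xi> \<xi>' \<xi> \<xi>')" using R by (simp add: real_sqrt_mult)
qed

text \<open>For V orthogonal to the modes \<open>fibre_gap\<close> gives |V_y|^2 >= 2 mu |V|^2;
  subtracting the shift still leaves mu |V|^2, with mu = (pi / Lmax)^2.\<close>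

lemma Af_orth_bounds:
  assumes V: "HS V k" "orth V"
  shows "0 \<le> Af V k V k" "l2norm MO (\<lambda>p. fst (k p)) \<le> sqrt (Af V k V k)" "l2norm MO V \<le> Lmax / pi * sqrt (Af V k V k)"
    "l2norm MO k \<le> sqrt 2 * sqrt (Af V k V k)"
proof -
  note L = HS_fst_snd[OF V(1)]
  have "l2norm MI (\<lambda>x. pi / Lb x * pr sin V x) = l2norm MI (\<lambda>x. 0::real)"
    using V(2) unfolding orth_def
    by (intro l2norm_cong_AE L2_measurable[OF invL_mult_L2[OF pr_L2(1)[OF L(1) csin]]]) auto
  then have "(l2norm MI (\<lambda>x. pi / Lb x * pr sin V x))\<^sup>2 = 0" by (simp add: l2norm_def l2inner_def)
  then have y: "2 * (mu * (l2norm MO V)\<^sup>2) \<le> (l2norm MO (\<lambda>p. snd (k p)))\<^sup>2"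
    using fibre_gap[OF V(1)] mu_norm_plane[OF L(1)] by linarith
  have e: "Af V k V k = (l2norm MO (\<lambda>p. fst (k p)))\<^sup>2 + (l2norm MO (\<lambda>p. snd (k p)))\<^sup>2 - mu * (l2norm MO V)\<^sup>2"
    unfolding Af_def inner_split[OF V(1) V(1)] l2norm_sq ..
  have k: "(l2norm MO k)\<^sup>2 = (l2norm MO (\<lambda>p. fst (k p)))\<^sup>2 + (l2norm MO (\<lambda>p. snd (k p)))\<^sup>2"
    unfolding l2norm_sq by (rule inner_split[OF V(1) V(1)])
  have mn: "0 \<le> mu * (l2norm MO V)\<^sup>2" using mu_pos by simp
  have fn: "0 \<le> (l2norm MO (\<lambda>p. fst (k p)))\<^sup>2" by simp
  show "0 \<le> Af V k V k" using e y mn fn by linarith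
  show "l2norm MO (\<lambda>p. fst (k p)) \<le> sqrt (Af V k V k)" by (rule real_le_rsqrt) (use e y mn in linarith)
  have a: "mu * (l2norm MO V)\<^sup>2 \<le> Af V k V k" using e y fn by linarith
  have "(l2norm MO V)\<^sup>2 \<le> (Lmax / pi)\<^sup>2 * Af V k V k"
  proof -
    have "(Lmax / pi)\<^sup>2 * (mu * (l2norm MO V)\<^sup>2) \<le> (Lmax / pi)\<^sup>2 * Af V k V k" by (rule mult_left_mono[OF a]) simp
    moreover have "(Lmax / pi)\<^sup>2 * mu = 1" using Lmax by (simp add: mu_def power_divide)
    ultimately show ?thesis by (simp add: mult.assoc[symmetric])
  qed
  then have "l2norm MO V \<le> sqrt ((Lmax / pi)\<^sup>2 * Af V k V k)" by (rule real_le_rsqrt)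
  also have "\<dots> = Lmax / pi * sqrt (Af V k V k)" unfolding real_sqrt_mult using Lmax by simp
  finally show "l2norm MO V \<le> Lmax / pi * sqrt (Af V k V k)" .
  have "l2norm MO k \<le> sqrt (2 * Af V k V k)" by (rule real_le_rsqrt) (use e k a in linarith)
  then show "l2norm MO k \<le> sqrt 2 * sqrt (Af V k V k)" by (simp add: real_sqrt_mult)
qed

text \<open>The mixed term in the transverse direction vanishes because, by \<open>fibre_gap\<close>, the transverse form is
  nonnegative and vanishes on the modes.\<close>

lemma transverse_cross_zero:
  assumes \<xi>: "HI \<xi> \<xi>'" and V: "HS V k" "orth V"
  shows "l2inner MO (mdy \<xi>) (\<lambda>p. snd (k p)) = 0"
proof -
  note L = HS_fst_snd[OF V(1)]
  note xL = has_H10_gradient_L2(1)[OF \<xi>]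
  define X where "X = l2inner MO (\<lambda>p. snd (k p)) (mdy \<xi>)"
  define c where "c = (l2norm MI (\<lambda>x. pi / Lb x * \<xi> x))\<^sup>2"
  \<comment> \<open>In \<open>fibre_gap\<close> for V + t \<open>md \<xi>\<close> the terms in t^2
    cancel, c - 2 c + c = 0. A nonnegative affine function of t remains, so its slope, a multiple of
    X, vanishes.\<close>
  have kk: "0 \<le> ((l2norm MO (\<lambda>p. snd (k p)))\<^sup>2 - 2 * (l2norm MO (\<lambda>p. pi / Lb (fst p) * V p))\<^sup>2) + 2 * t * X + t\<^sup>2 * 0" for t
  proof -
    have H: "HS (\<lambda>p. V p + t * md \<xi> p) (\<lambda>p. k p + t *\<^sub>R (mdx \<xi> \<xi>' p, mdy \<xi> p))"
      by (rule has_H10_gradient_lincomb[OF S_borel V(1) md_H[OF \<xi>]])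
    have n1: "(l2norm MO (\<lambda>p. snd (k p + t *\<^sub>R (mdx \<xi> \<xi>' p, mdy \<xi> p))))\<^sup>2 = (l2norm MO (\<lambda>p. snd (k p)))\<^sup>2 + 2 * t * X + t\<^sup>2 * c"
    proof -
      have "l2inner MO (mdy \<xi>) (mdy \<xi>) = c"
        unfolding mdy_def[abs_def] c_def l2norm_sq using mode_inner[OF invL_mult_L2[OF xL] invL_mult_L2[OF xL] ccos ccos] by (simp add: J_cos_cos)
      then show ?thesis
        unfolding l2norm_sq using l2inner_add_square[OF L(3) mdy_L2[OF xL], of t] by (simp add: X_def)
    qed
    have n2: "(l2norm MO (\<lambda>p. pi / Lb (fst p) * (V p + t * md \<xi> p)))\<^sup>2 = (l2norm MO (\<lambda>p. pi / Lb (fst p) * V p))\<^sup>2 + t\<^sup>2 * c"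
    proof -
      \<comment> \<open>The weight (pi / L)^2 depends on x alone, so it can be moved into the
        coefficient, and V is orthogonal to the resulting mode as well.\<close>
      have iL: "(\<lambda>x. pi / Lb x * (pi / Lb x * \<xi> x)) \<in> L2 MI" by (rule invL_mult_L2[OF invL_mult_L2[OF xL]])
      have "l2inner MO (\<lambda>p. pi / Lb (fst p) * V p) (\<lambda>p. pi / Lb (fst p) * md \<xi> p) = l2inner MO (md (\<lambda>x. pi / Lb x * (pi / Lb x * \<xi> x))) V"
        unfolding l2inner_def md_def by (rule Bochner_Integration.integral_cong) (simp_all add: mult_ac)
      also have "\<dots> = 0" by (rule orth_inner[OF V(2) L(1) iL])
      finally have o: "l2inner MO (\<lambda>p. pi / Lb (fst p) * V p) (\<lambda>p. pi / Lb (fst p) * md \<xi> p) = 0" .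
      have "l2inner MO (\<lambda>p. pi / Lb (fst p) * md \<xi> p) (\<lambda>p. pi / Lb (fst p) * md \<xi> p) = c"
      proof -
        have "(\<lambda>p. pi / Lb (fst p) * md \<xi> p) = (\<lambda>p. (pi / Lb (fst p) * \<xi> (fst p)) * ker sin p)" by (simp add: md_def fun_eq_iff)
        then show ?thesis unfolding c_def l2norm_sq using mode_inner[OF invL_mult_L2[OF xL] invL_mult_L2[OF xL] csin csin] by (simp add: J_sin_sin)
      qed
      moreover have "(\<lambda>p. pi / Lb (fst p) * (V p + t * md \<xi> p)) = (\<lambda>p. pi / Lb (fst p) * V p + t *\<^sub>R (pi / Lb (fst p) * md \<xi> p))"
        by (simp add: fun_eq_iff algebra_simps add_divide_distrib)
      ultimately show ?thesis
        unfolding l2norm_sq using l2inner_add_square[OF invL_plane(1)[OF L(1)] invL_plane(1)[OF md_L2[OF xL]], of t] o by simp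
    qed
    have n3: "(l2norm MI (\<lambda>x. pi / Lb x * pr sin (\<lambda>p. V p + t * md \<xi> p) x))\<^sup>2 = t\<^sup>2 * c"
    proof -
      have Lc: "(\<lambda>p. V p + t * md \<xi> p) \<in> L2 MO" by (intro L2_add L2_mult_const L md_L2 xL)
      have "AE x in MI. pi / Lb x * pr sin (\<lambda>p. V p + t * md \<xi> p) x = t *\<^sub>R (pi / Lb x * \<xi> x)"
        using pr_lincomb_AE[OF L(1) md_L2[OF xL] csin, of t] V(2)[unfolded orth_def] AE_space
      proof eventually_elim
        case (elim x)
        then have "pr sin (md \<xi>) x = \<xi> x" unfolding md_def[abs_def] using pr_ker[of x sin \<xi> sin] by (simp add: J_sin_sin)
        then show ?case using elim by simp
      qed
      then have "l2norm MI (\<lambda>x. pi / Lb x * pr sin (\<lambda>p. V p + t * md \<xi> p) x) = l2norm MI (\<lambda>x. t *\<^sub>R (pi / Lb x * \<xi> x))"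
        by (rule l2norm_cong_AE) (intro L2_measurable[OF invL_mult_L2[OF pr_L2(1)[OF Lc csin]]] L2_measurable[OF L2_scaleR[OF invL_mult_L2[OF xL]]])+
      then show ?thesis by (simp only: l2norm_scaleR power_mult_distrib power2_abs c_def)
    qed
    show ?thesis using fibre_gap[OF H] unfolding n1 n2 n3 by simp
  qed
  have "\<bar>X\<bar> \<le> sqrt ((l2norm MO (\<lambda>p. snd (k p)))\<^sup>2 - 2 * (l2norm MO (\<lambda>p. pi / Lb (fst p) * V p))\<^sup>2) * sqrt 0"
    by (rule quadratic_nonneg_discr[OF kk]) (use kk[of 0] in simp_all)
  then show ?thesis by (simp add: X_def l2inner_commute)
qed

text \<open>Bound for the coupling relative to the two form norms. The summand with
  \<open>Lmax\<close> comes from \<lambda> V and the one with \<open>R\<close> from \<lambda> \<xi>,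
  each a square root because the weighted inequality bounds a square.\<close>

definition DD :: real where "DD = sqrt (J tau tau) * (l2norm MI lam * (2 * sqrt (Lmax / pi)) + l2norm MI lam * sqrt (2 * R))"

text \<open>The y-parts do not couple. In the x-part \<xi>' meets the sine coefficient of V_x, and
  V_x is bounded by the form norm but not small; orthogonality replaces this coefficient by
  \<lambda> times the \<open>tau\<close> coefficient of V, and V itself is small.\<close>

lemma cross_bound:
  assumes \<xi>: "HI \<xi> \<xi>'" and V: "HS V k" "orth V"
  shows "\<bar>Af (md \<xi>) (mdg \<xi> \<xi>') V k\<bar> \<le> DD * sqrt (Qf \<xi> \<xi>' \<xi> \<xi>') * sqrt (Af V k V k)"
proof -
  note L = HS_fst_snd[OF V(1)]
  note xL = has_H10_gradient_L2[OF \<xi>]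
  note lV = lam_mult_L2_plane[OF V(1)]
  note lx = lam_mult_L2[OF \<xi>]
  have "Af (md \<xi>) (mdg \<xi> \<xi>') V k = l2inner MO (mdx \<xi> \<xi>') (\<lambda>p. fst (k p))"
    unfolding Af_def using inner_split[OF md_H[OF \<xi>] V(1)] transverse_cross_zero[OF \<xi> V] orth_inner[OF V(2) L(1) xL(1)] by simp
  also have "\<dots> = l2inner MO (\<lambda>p. \<xi>' (fst p) * ker sin p) (\<lambda>p. fst (k p)) - l2inner MO (\<lambda>p. \<xi> (fst p) * lam (fst p) * ker tau p) (\<lambda>p. fst (k p))"
    unfolding mdx_def[abs_def] by (intro l2inner_diff_left mult_ker_L2 xL lx csin tau_continuous L)
  also have "l2inner MO (\<lambda>p. \<xi>' (fst p) * ker sin p) (\<lambda>p. fst (k p)) = l2inner MI \<xi>' (pr sin (\<lambda>p. fst (k p)))"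
    by (rule pr_adjoint[OF L(2) xL(2) csin])
  also have "\<dots> = l2inner MI \<xi>' (pr tau (\<lambda>p. lam (fst p) * V p))"
  \<comment> \<open>The sine coefficient of V is 0 almost everywhere, hence so is its weak
    derivative, which \<open>fibre_component_H10\<close> computes.\<close>
  proof (rule l2inner_cong_AE)
    have "HI (\<lambda>x. 0) (\<lambda>x. pr sin (\<lambda>p. fst (k p)) x - lam x * pr tau V x)"
      by (rule has_H10_gradient_cong_AE[OF fibre_component_H10[OF V(1)] interval_borel(1) V(2)[unfolded orth_def]])
        (use L2_measurable[OF has_H10_gradient_L2(2)[OF fibre_component_H10[OF V(1)]]] in auto)
    from has_H10_gradient_zero_AE[OF interval_borel(1) this]
    show "AE x in MI. pr sin (\<lambda>p. fst (k p)) x = pr tau (\<lambda>p. lam (fst p) * V p) x"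
      unfolding pr_mult_fst by eventually_elim simp
  qed (use xL(2) pr_L2(1)[OF L(2) csin] pr_L2(1)[OF lV(1) tau_continuous] L2_measurable in auto)
  also have "\<dots> = l2inner MO (\<lambda>p. \<xi>' (fst p) * ker tau p) (\<lambda>p. lam (fst p) * V p)"
    by (rule pr_adjoint[OF lV(1) xL(2) tau_continuous, symmetric])
  finally have e: "Af (md \<xi>) (mdg \<xi> \<xi>') V k =
      l2inner MO (\<lambda>p. \<xi>' (fst p) * ker tau p) (\<lambda>p. lam (fst p) * V p) - l2inner MO (\<lambda>p. \<xi> (fst p) * lam (fst p) * ker tau p) (\<lambda>p. fst (k p))" .
  define q where "q = sqrt (Qf \<xi> \<xi>' \<xi> \<xi>')"
  define a where "a = sqrt (Af V k V k)"
  define La where "La = l2norm MI lam"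
  define j where "j = sqrt (J tau tau)"
  have nn: "0 \<le> q" "0 \<le> a" "0 \<le> La" "0 \<le> j"
    using Qf_bounds(1)[OF \<xi>] Af_orth_bounds(1)[OF V] l2norm_nonneg Jtt_pos by (simp_all add: q_def a_def La_def j_def)
  have b1: "l2norm MO (\<lambda>p. lam (fst p) * V p) \<le> La * (2 * sqrt (Lmax / pi)) * a"
  proof (rule power2_le_imp_le)
    have "(l2norm MO (\<lambda>p. lam (fst p) * V p))\<^sup>2 \<le> 2 * La\<^sup>2 * l2norm MO V * l2norm MO k" using lV(2) by (simp add: La_def)
    also have "\<dots> \<le> 2 * La\<^sup>2 * (Lmax / pi * a) * (sqrt 2 * a)"
      using Af_orth_bounds(3,4)[OF V] nn Lmax by (intro mult_mono mult_left_mono) (simp_all add: a_def l2norm_nonneg)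
    \<comment> \<open>sqrt 2 is rounded up to 2 so that the bound becomes a perfect square.\<close>
    also have "\<dots> \<le> 2 * La\<^sup>2 * (Lmax / pi * a) * (2 * a)"
      using nn Lmax real_sqrt_le_mono[of 2 4] by (intro mult_left_mono mult_right_mono) simp_all
    also have "\<dots> = (La * (2 * sqrt (Lmax / pi)) * a)\<^sup>2"
      using Lmax by (simp add: power_mult_distrib power2_eq_square[of a])
    finally show "(l2norm MO (\<lambda>p. lam (fst p) * V p))\<^sup>2 \<le> (La * (2 * sqrt (Lmax / pi)) * a)\<^sup>2" .
  qed (use nn Lmax in simp)
  have b2: "l2norm MI (\<lambda>x. \<xi> x * lam x) \<le> La * sqrt (2 * R) * q"
  proof (rule power2_le_imp_le)
    have "(l2norm MI (\<lambda>x. \<xi> x * lam x))\<^sup>2 \<le> 2 * La\<^sup>2 * l2norm MI \<xi> * l2norm MI \<xi>'" using lx(2) by (simp add: La_def)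
    also have "\<dots> \<le> 2 * La\<^sup>2 * (R * q) * q"
      using Qf_bounds(2,3)[OF \<xi>] nn R by (intro mult_mono mult_left_mono) (simp_all add: q_def l2norm_nonneg)
    also have "\<dots> = (La * sqrt (2 * R) * q)\<^sup>2"
      using R by (simp add: power_mult_distrib power2_eq_square[of q])
    finally show "(l2norm MI (\<lambda>x. \<xi> x * lam x))\<^sup>2 \<le> (La * sqrt (2 * R) * q)\<^sup>2" .
  qed (use nn R in simp)
  have t1: "\<bar>l2inner MO (\<lambda>p. \<xi>' (fst p) * ker tau p) (\<lambda>p. lam (fst p) * V p)\<bar> \<le> j * q * (La * (2 * sqrt (Lmax / pi)) * a)"
  proof -
    have "\<bar>l2inner MO (\<lambda>p. \<xi>' (fst p) * ker tau p) (\<lambda>p. lam (fst p) * V p)\<bar> \<le> (j * l2norm MI \<xi>') * l2norm MO (\<lambda>p. lam (fst p) * V p)"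
      using l2inner_Cauchy_Schwarz[OF mult_ker_L2[OF xL(2) tau_continuous] lV(1)] unfolding mode_norm[OF xL(2) tau_continuous] j_def .
    also have "\<dots> \<le> (j * q) * (La * (2 * sqrt (Lmax / pi)) * a)"
      using Qf_bounds(2)[OF \<xi>] b1 nn by (intro mult_mono mult_left_mono) (simp_all add: q_def l2norm_nonneg)
    finally show ?thesis .
  qed
  have t2: "\<bar>l2inner MO (\<lambda>p. \<xi> (fst p) * lam (fst p) * ker tau p) (\<lambda>p. fst (k p))\<bar> \<le> j * (La * sqrt (2 * R) * q) * a"
  proof -
    have "\<bar>l2inner MO (\<lambda>p. \<xi> (fst p) * lam (fst p) * ker tau p) (\<lambda>p. fst (k p))\<bar> \<le> (j * l2norm MI (\<lambda>x. \<xi> x * lam x)) * l2norm MO (\<lambda>p. fst (k p))"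
      using l2inner_Cauchy_Schwarz[OF mult_ker_L2[OF lx(1) tau_continuous] L(2)] unfolding mode_norm[OF lx(1) tau_continuous] j_def .
    also have "\<dots> \<le> (j * (La * sqrt (2 * R) * q)) * a"
      using Af_orth_bounds(2)[OF V] b2 nn R by (intro mult_mono mult_left_mono) (simp_all add: a_def l2norm_nonneg)
    finally show ?thesis .
  qed
  have "\<bar>Af (md \<xi>) (mdg \<xi> \<xi>') V k\<bar> \<le> j * q * (La * (2 * sqrt (Lmax / pi)) * a) + j * (La * sqrt (2 * R) * q) * a"
    unfolding e using t1 t2 abs_triangle_ineq4 by (meson add_mono order_trans)
  also have "\<dots> = DD * q * a" by (simp add: DD_def j_def La_def algebra_simps)
  finally show ?thesis by (simp add: q_def a_def)
qed

text \<open>The coefficient \<open>pr sin u\<close> lies in H^1_0 of the interval by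
  \<open>fibre_component_H10\<close>, and its mode lies in H^1_0 of the tube by
  \<open>mode_H10\<close>; both facts are needed to split the form.\<close>

lemma decomposition:
  assumes u: "HS u g"
  obtains \<xi> \<xi>' V k where "\<xi> = pr sin u" "HI \<xi> \<xi>'" "HS V k" "orth V" "\<And>p. V p = u p - md \<xi> p"
    "\<And>p. k p = g p - (mdx \<xi> \<xi>' p, mdy \<xi> p)"
proof -
  define \<xi> where "\<xi> = pr sin u"
  define \<xi>' where "\<xi>' x = pr sin (\<lambda>p. fst (g p)) x - lam x * pr tau u x" for x
  have \<xi>: "HI \<xi> \<xi>'" unfolding \<xi>_def \<xi>'_def by (rule fibre_component_H10[OF u])
  note xL = has_H10_gradient_L2(1)[OF \<xi>]
  have o: "orth (\<lambda>p. u p - md \<xi> p)"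
    unfolding orth_def using pr_lincomb_AE[OF HS_fst_snd(1)[OF u] md_L2[OF xL] csin, of "-1"] AE_space
  proof eventually_elim
    case (elim x)
    then have "pr sin (md \<xi>) x = \<xi> x" unfolding md_def[abs_def] using pr_ker[of x sin \<xi> sin] by (simp add: J_sin_sin)
    then show ?case using elim by (simp add: \<xi>_def)
  qed
  show thesis
    by (rule that[OF \<xi>_def \<xi> has_H10_gradient_diff[OF S_borel u md_H[OF \<xi>]] o]) simp_all
qed

end

text \<open>A function and its weak gradient are treated as one L^2 function with values in
  \<open>real \<times> 'a\<close>. Such pairs form a closed subspace on which the form is bounded
  and coercive, so \<open>closed_subspace_representation\<close> applies.\<close>

lemma H10_form_solve:
  fixes a :: "('a::euclidean_space \<Rightarrow> real) \<Rightarrow> ('a \<Rightarrow> 'a) \<Rightarrow> ('a \<Rightarrow> real) \<Rightarrow> ('a \<Rightarrow> 'a) \<Rightarrow> real"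
    and S :: "'a set" and N :: "('a \<Rightarrow> real) \<Rightarrow> real" and N' :: "('a \<Rightarrow> 'a) \<Rightarrow> real"
  defines "H \<equiv> has_H10_gradient S" and "N \<equiv> l2norm (leb S)" and "N' \<equiv> l2norm (leb S)"
  assumes S: "S \<in> sets borel" "bounded S"
    and lin: "\<And>u g w k v l c. H u g \<Longrightarrow> H w k \<Longrightarrow> H v l \<Longrightarrow>
      a (\<lambda>x. u x + c * w x) (\<lambda>x. g x + c *\<^sub>R k x) v l = a u g v l + c * a w k v l"
    and sym: "\<And>u g w k. H u g \<Longrightarrow> H w k \<Longrightarrow> a u g w k = a w k u g"
    and bd: "0 \<le> C" "\<And>u g w k. H u g \<Longrightarrow> H w k \<Longrightarrow> \<bar>a u g w k\<bar> \<le> C * (N u + N' g) * (N w + N' k)"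
    and co: "0 < \<kappa>" "\<And>u g. H u g \<Longrightarrow> \<kappa> * ((N u)\<^sup>2 + (N' g)\<^sup>2) \<le> a u g u g"
    and f: "f \<in> L2 (leb S)"
  shows "\<exists>u g. H u g \<and> (\<forall>w k. H w k \<longrightarrow> a u g w k = l2inner (leb S) f w)"
proof -
  define V where "V = {F :: 'a \<Rightarrow> real \<times> 'a. H (\<lambda>x. fst (F x)) (\<lambda>x. snd (F x))}"
  define B where "B F G = a (\<lambda>x. fst (F x)) (\<lambda>x. snd (F x)) (\<lambda>x. fst (G x)) (\<lambda>x. snd (G x))" for F G :: "'a \<Rightarrow> real \<times> 'a"
  let ?M = "leb S"
  have comp: "(\<lambda>x. fst (F x)) \<in> L2 ?M \<and> (\<lambda>x. snd (F x)) \<in> L2 ?M" if "F \<in> L2 ?M" for F :: "'a \<Rightarrow> real \<times> 'a"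
  proof -
    have "(\<lambda>x. (fst (F x), snd (F x))) \<in> L2 ?M" using that by simp
    then show ?thesis by (simp only: L2_Pair)
  qed
  have VL: "F \<in> L2 ?M" if "F \<in> V" for F
  proof -
    have "(\<lambda>x. (fst (F x), snd (F x))) \<in> L2 ?M"
      using that has_H10_gradient_L2[of S] unfolding L2_Pair V_def H_def by blast
    then show ?thesis by simp
  qed
  have nle: "N (\<lambda>x. fst (F x)) \<le> l2norm ?M F" "N' (\<lambda>x. snd (F x)) \<le> l2norm ?M F" if "F \<in> L2 ?M" for F :: "'a \<Rightarrow> real \<times> 'a"
    unfolding N_def N'_def using l2norm_Pair_ge[of "\<lambda>x. fst (F x)" ?M "\<lambda>x. snd (F x)"] comp[OF that] by simp_all
  have nsq: "(l2norm ?M F)\<^sup>2 = (N (\<lambda>x. fst (F x)))\<^sup>2 + (N' (\<lambda>x. snd (F x)))\<^sup>2" if "F \<in> L2 ?M" for F :: "'a \<Rightarrow> real \<times> 'a"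
    unfolding N_def N'_def using l2norm_Pair_sq[of "\<lambda>x. fst (F x)" ?M "\<lambda>x. snd (F x)"] comp[OF that] by simp
  have linV: "(\<lambda>x. F x + c *\<^sub>R G x) \<in> V" if "F \<in> V" "G \<in> V" for F G c
    using has_H10_gradient_lincomb[OF S(1), of "\<lambda>x. fst (F x)" "\<lambda>x. snd (F x)" "\<lambda>x. fst (G x)" "\<lambda>x. snd (G x)" c] that
    unfolding V_def H_def by simp
  have "\<exists>U\<in>V. \<forall>W\<in>V. B U W = l2inner ?M f (\<lambda>x. fst (W x))"
  proof (rule closed_subspace_representation[where \<kappa>=\<kappa> and C="4 * C" and K="l2norm ?M f", OF finite_measure_leb[OF S]])
    show "V \<subseteq> L2 ?M" using VL by blast
    show "(\<lambda>x. 0) \<in> V" using has_H10_gradient_0[OF S(1)] by (simp add: V_def H_def)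
    show "(\<lambda>x. F x + c *\<^sub>R G x) \<in> V" if "F \<in> V" "G \<in> V" for F G c by (rule linV[OF that])
  next
    fix F :: "nat \<Rightarrow> 'a \<Rightarrow> real \<times> 'a" and F0
    assume F: "\<And>n. F n \<in> V" "F0 \<in> L2 ?M" "l2_lim ?M F F0"
    have d: "(\<lambda>x. F n x - F0 x) \<in> L2 ?M" for n by (rule L2_diff[OF VL[OF F(1)] F(2)])
    have Hn: "has_H10_gradient S (\<lambda>x. fst (F n x)) (\<lambda>x. snd (F n x))" for n using F(1)[of n] by (simp add: V_def H_def)
    have "has_H10_gradient S (\<lambda>x. fst (F0 x)) (\<lambda>x. snd (F0 x))"
    proof (rule has_H10_gradient_closed[OF S(1) Hn])
      show "l2_lim ?M (\<lambda>n x. fst (F n x)) (\<lambda>x. fst (F0 x))"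
        by (rule l2norm_tendsto_squeeze[OF F(3)]) (use nle(1)[OF d] in \<open>simp add: N_def\<close>)
      show "l2_lim ?M (\<lambda>n x. snd (F n x)) (\<lambda>x. snd (F0 x))"
        by (rule l2norm_tendsto_squeeze[OF F(3)]) (use nle(2)[OF d] in \<open>simp add: N'_def\<close>)
    qed (use comp[OF F(2)] in auto)
    then show "F0 \<in> V" by (simp add: V_def H_def)
  next
    fix F G K c assume "F \<in> V" "G \<in> V" "K \<in> V"
    then show "B (\<lambda>x. F x + c *\<^sub>R G x) K = B F K + c * B G K"
      using lin[of "\<lambda>x. fst (F x)" "\<lambda>x. snd (F x)" "\<lambda>x. fst (G x)" "\<lambda>x. snd (G x)" "\<lambda>x. fst (K x)" "\<lambda>x. snd (K x)" c]
      by (simp add: B_def V_def)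
  next
    fix F G assume FG: "F \<in> V" "G \<in> V"
    then show "B F G = B G F" unfolding B_def by (intro sym) (simp_all add: V_def)
    have "\<bar>B F G\<bar> \<le> C * (N (\<lambda>x. fst (F x)) + N' (\<lambda>x. snd (F x))) * (N (\<lambda>x. fst (G x)) + N' (\<lambda>x. snd (G x)))"
      unfolding B_def using FG by (intro bd) (simp_all add: V_def)
    also have "\<dots> \<le> C * (l2norm ?M F + l2norm ?M F) * (l2norm ?M G + l2norm ?M G)"
      by (intro mult_mono mult_left_mono add_mono nle VL FG bd) (simp_all add: bd l2norm_nonneg N_def N'_def add_nonneg_nonneg)
    finally show "\<bar>B F G\<bar> \<le> 4 * C * l2norm ?M F * l2norm ?M G" by (simp add: algebra_simps)
  next
    fix F assume F: "F \<in> V"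
    show "\<kappa> * (l2norm ?M F)\<^sup>2 \<le> B F F" unfolding nsq[OF VL[OF F]] B_def using F by (intro co) (simp add: V_def)
    have "\<bar>l2inner ?M f (\<lambda>x. fst (F x))\<bar> \<le> l2norm ?M f * N (\<lambda>x. fst (F x))"
      unfolding N_def by (rule l2inner_Cauchy_Schwarz[OF f]) (use comp[OF VL[OF F]] in simp)
    also have "\<dots> \<le> l2norm ?M f * l2norm ?M F" by (intro mult_left_mono nle VL F l2norm_nonneg)
    finally show "\<bar>l2inner ?M f (\<lambda>x. fst (F x))\<bar> \<le> l2norm ?M f * l2norm ?M F" .
  next
    fix F G c assume FG: "F \<in> V" "G \<in> V"
    have c: "(\<lambda>x. fst (F x)) \<in> L2 ?M" "(\<lambda>x. c * fst (G x)) \<in> L2 ?M"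
      using comp[OF VL[OF FG(1)]] comp[OF VL[OF FG(2)]] by (auto intro: L2_mult_const)
    show "l2inner ?M f (\<lambda>x. fst (F x + c *\<^sub>R G x)) = l2inner ?M f (\<lambda>x. fst (F x)) + c * l2inner ?M f (\<lambda>x. fst (G x))"
      using l2inner_add_right[OF c f] l2inner_scaleR_right[of ?M f c "\<lambda>x. fst (G x)"] by simp
  qed (rule co(1))
  then obtain U where U: "U \<in> V" "\<And>W. W \<in> V \<Longrightarrow> B U W = l2inner ?M f (\<lambda>x. fst (W x))" by blast
  show ?thesis
  proof (intro exI conjI allI impI)
    show "H (\<lambda>x. fst (U x)) (\<lambda>x. snd (U x))" using U(1) by (simp add: V_def)
    fix w k assume "H w k"
    then have "(\<lambda>x. (w x, k x)) \<in> V" by (simp add: V_def)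
    from U(2)[OF this] show "a (\<lambda>x. fst (U x)) (\<lambda>x. snd (U x)) w k = l2inner ?M f w" by (simp add: B_def)
  qed
qed

text \<open>In \<open>resolvent_estimate\<close>, x, y and z are form norms: of the mode part, of
  the orthogonal part, and of the difference between the mode part and the solution for Q. Each
  hypothesis yields a linear bound after division; inserting that of x into that of y and absorbing
  D^2 y <= y / 2 gives y <= 2 (E + D R), and z <= D y. The weights E and R convert form norms into
  L^2 norms.\<close>

lemma error_arithmetic:
  fixes x y z D E R :: real
  assumes nn: "0 \<le> x" "0 \<le> y" "0 \<le> z" "0 \<le> D" "0 \<le> E" "0 \<le> R" and D: "D \<le> 1 / 2"
    and h: "z\<^sup>2 \<le> D * z * y" "x\<^sup>2 \<le> R * x + D * x * y" "y\<^sup>2 \<le> E * y + D * x * y"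
  shows "E * y + R * z \<le> 2 * (E + D * R)\<^sup>2"
proof -
  have c: "s \<le> t" if "s\<^sup>2 \<le> s * t" "0 \<le> s" "0 \<le> t" for s t :: real
  proof (cases "s = 0")
    case False
    then show ?thesis using that by (simp add: power2_eq_square mult_le_cancel_left)
  qed (use that in simp)
  have z: "z \<le> D * y" by (rule c) (use h(1) nn in \<open>simp_all add: mult_ac\<close>)
  have x: "x \<le> R + D * y" by (rule c) (use h(2) nn in \<open>simp_all add: algebra_simps\<close>)
  have "y \<le> E + D * x" by (rule c) (use h(3) nn in \<open>simp_all add: algebra_simps\<close>)
  also have "\<dots> \<le> E + D * (R + D * y)" by (intro add_left_mono mult_left_mono x nn)
  also have "\<dots> = E + D * R + D * D * y" by (simp add: algebra_simps)
  also have "\<dots> \<le> E + D * R + 1 / 2 * 1 * y"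
    using D nn by (intro add_left_mono mult_right_mono mult_mono) auto
  finally have y: "y \<le> 2 * (E + D * R)" by simp
  have "E * y + R * z \<le> E * y + R * (D * y)" by (intro add_left_mono mult_left_mono z nn)
  also have "\<dots> = (E + D * R) * y" by (simp add: algebra_simps)
  also have "\<dots> \<le> (E + D * R) * (2 * (E + D * R))" by (intro mult_left_mono y) (simp add: nn)
  finally show ?thesis by (simp add: power2_eq_square algebra_simps)
qed

section \<open>Solvability of both equations and comparison of their solutions\<close>

context narrow_tube begin

lemma Af_lin:
  assumes "HS u g" "HS w k" "HS v l"
  shows "Af (\<lambda>x. u x + c * w x) (\<lambda>x. g x + c *\<^sub>R k x) v l = Af u g v l + c * Af w k v l"
proof -
  note L = has_H10_gradient_L2[OF assms(1)] has_H10_gradient_L2[OF assms(2)] has_H10_gradient_L2[OF assms(3)]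
  have "l2inner MO (\<lambda>x. g x + c *\<^sub>R k x) l = l2inner MO g l + c * l2inner MO k l"
    using l2inner_add_left[OF L(2) L2_scaleR[OF L(4)] L(6)] by (simp add: l2inner_scaleR_left)
  moreover have "l2inner MO (\<lambda>x. u x + c * w x) v = l2inner MO u v + c * l2inner MO w v"
    using l2inner_add_left[OF L(1) L2_scaleR[OF L(3)] L(5), of c] l2inner_scaleR_left[of MO c w v] by simp
  ultimately show ?thesis by (simp add: Af_def algebra_simps)
qed

lemma Af_sym: "Af u g w k = Af w k u g"
  by (simp add: Af_def l2inner_commute)

lemma Qf_sym: "Qf \<xi> \<xi>' \<eta> \<eta>' = Qf \<eta> \<eta>' \<xi> \<xi>'"
  unfolding Qf_def by (simp only: l2inner_commute[of MI \<xi>'] l2inner_commute[of MI \<xi>] l2inner_commute[of MI "\<lambda>x. pi / Lb x * \<xi> x"] l2inner_commute[of MI "\<lambda>x. \<xi> x * lam x"])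

lemma HI_md_lin: "md (\<lambda>x. \<xi> x + c * \<eta> x) p = md \<xi> p + c * md \<eta> p"
  by (simp add: md_def algebra_simps)

text \<open>Inherited from \<open>Af\<close> through the identity \<open>Af_mode\<close>.\<close>

lemma Qf_lin:
  assumes "HI \<xi> \<xi>'" "HI \<eta> \<eta>'" "HI \<zeta> \<zeta>'"
  shows "Qf (\<lambda>x. \<xi> x + c * \<eta> x) (\<lambda>x. \<xi>' x + c *\<^sub>R \<eta>' x) \<zeta> \<zeta>' = Qf \<xi> \<xi>' \<zeta> \<zeta>' + c * Qf \<eta> \<eta>' \<zeta> \<zeta>'"
proof -
  have H: "HI (\<lambda>x. \<xi> x + c * \<eta> x) (\<lambda>x. \<xi>' x + c *\<^sub>R \<eta>' x)" by (rule has_H10_gradient_lincomb[OF interval_borel(1) assms(1,2)])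
  have e: "md (\<lambda>x. \<xi> x + c * \<eta> x) = (\<lambda>p. md \<xi> p + c * md \<eta> p)"
    "(\<lambda>p. (mdx (\<lambda>x. \<xi> x + c * \<eta> x) (\<lambda>x. \<xi>' x + c *\<^sub>R \<eta>' x) p, mdy (\<lambda>x. \<xi> x + c * \<eta> x) p)) =
      (\<lambda>p. (mdx \<xi> \<xi>' p, mdy \<xi> p) + c *\<^sub>R (mdx \<eta> \<eta>' p, mdy \<eta> p))"
    by (simp_all add: fun_eq_iff HI_md_lin mdx_def mdy_def algebra_simps add_divide_distrib)
  show ?thesis
    unfolding Af_mode[OF H assms(3), symmetric] Af_mode[OF assms(1,3), symmetric] Af_mode[OF assms(2,3), symmetric] e
    by (rule Af_lin) (intro md_H assms)+
qed

lemma Af_decomposed: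
  assumes \<xi>: "HI \<xi> \<xi>'" and V: "HS V k" and w: "HS w l" and e: "\<And>p. V p = u p - md \<xi> p" "\<And>p. k p = g p - (mdx \<xi> \<xi>' p, mdy \<xi> p)"
  shows "Af u g w l = Af (md \<xi>) (mdg \<xi> \<xi>') w l + Af V k w l"
proof -
  have "u = (\<lambda>p. md \<xi> p + 1 * V p)" "g = (\<lambda>p. (mdx \<xi> \<xi>' p, mdy \<xi> p) + 1 *\<^sub>R k p)" using e by (auto simp: fun_eq_iff)
  then show ?thesis using Af_lin[OF md_H[OF \<xi>] V w, of 1] by simp
qed

lemma DD_nonneg: "0 \<le> DD"
  unfolding DD_def using Jtt_pos l2norm_nonneg R Lmax by (intro mult_nonneg_nonneg add_nonneg_nonneg) auto

lemma md_norm: "\<xi> \<in> L2 MI \<Longrightarrow> l2norm MO (md \<xi>) = l2norm MI \<xi>"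
  unfolding md_def[abs_def] using mode_norm[OF _ csin] by (simp add: J_sin_sin)

text \<open>A coupling constant of at most 1/2 costs at most half of the diagonal part of the form,
  by the inequality between geometric and arithmetic means.\<close>

lemma Af_coercive:
  assumes D: "DD \<le> 1 / 2" and u: "HS u g"
  shows "(l2norm MO u)\<^sup>2 \<le> 4 * (R\<^sup>2 + (Lmax / pi)\<^sup>2) * Af u g u g" "0 \<le> Af u g u g"
proof -
  obtain \<xi> \<xi>' V k where d: "\<xi> = pr sin u" "HI \<xi> \<xi>'" "HS V k" "orth V" "\<And>p. V p = u p - md \<xi> p"
    "\<And>p. k p = g p - (mdx \<xi> \<xi>' p, mdy \<xi> p)" by (rule decomposition[OF u], rule that)
  let ?m = "\<lambda>p. (mdx \<xi> \<xi>' p, mdy \<xi> p)"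
  define q where "q = Qf \<xi> \<xi>' \<xi> \<xi>'"
  define a where "a = Af V k V k"
  define B where "B = Af (md \<xi>) ?m V k"
  have nn: "0 \<le> q" "0 \<le> a" unfolding q_def a_def by (rule Qf_bounds(1)[OF d(2)], rule Af_orth_bounds(1)[OF d(3,4)])
  have e: "Af u g u g = q + 2 * B + a"
  proof -
    note X = Af_decomposed[OF d(2,3) _ d(5,6)]
    have "Af u g u g = Af (md \<xi>) ?m u g + Af V k u g" by (rule X[OF u])
    also have "Af (md \<xi>) ?m u g = Af u g (md \<xi>) ?m" by (rule Af_sym)
    also have "\<dots> = q + Af V k (md \<xi>) ?m" using X[OF md_H[OF d(2)]] Af_mode[OF d(2,2)] by (simp add: q_def)
    also have "Af V k (md \<xi>) ?m = B" unfolding B_def by (rule Af_sym)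
    also have "Af V k u g = Af u g V k" by (rule Af_sym)
    also have "\<dots> = B + a" using X[OF d(3)] by (simp add: B_def a_def)
    finally show ?thesis by simp
  qed
  have Bb: "2 * \<bar>B\<bar> \<le> (q + a) / 2"
  proof -
    have "\<bar>B\<bar> \<le> DD * sqrt q * sqrt a" unfolding B_def q_def a_def by (rule cross_bound[OF d(2,3,4)])
    also have "\<dots> \<le> 1 / 2 * sqrt q * sqrt a" using D nn by (intro mult_right_mono) auto
    finally show ?thesis using arith_geo_mean_sqrt[OF nn] by (simp add: real_sqrt_mult)
  qed
  then have low: "(q + a) / 2 \<le> Af u g u g" unfolding e using abs_ge_minus_self[of B] by argo
  then show "0 \<le> Af u g u g" using nn by simp
  have xL: "\<xi> \<in> L2 MI" by (rule has_H10_gradient_L2(1)[OF d(2)])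
  have "l2norm MO u \<le> l2norm MO (md \<xi>) + l2norm MO V"
    using l2norm_triangle[OF md_L2[OF xL] has_H10_gradient_L2(1)[OF d(3)]] d(5) by simp
  also have "\<dots> \<le> R * sqrt q + Lmax / pi * sqrt a"
    unfolding md_norm[OF xL] q_def a_def by (intro add_mono Qf_bounds d Af_orth_bounds)
  finally have "(l2norm MO u)\<^sup>2 \<le> (R * sqrt q + Lmax / pi * sqrt a)\<^sup>2" by (rule power_mono) (rule l2norm_nonneg)
  also have "\<dots> \<le> 2 * (R * sqrt q)\<^sup>2 + 2 * (Lmax / pi * sqrt a)\<^sup>2"
    using norm_add_sq_le[of "R * sqrt q" "Lmax / pi * sqrt a"] unfolding real_norm_def power2_abs .
  also have "\<dots> = 2 * (R\<^sup>2 * q + (Lmax / pi)\<^sup>2 * a)" using nn by (simp only: power_mult_distrib real_sqrt_pow2 distrib_left)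
  also have "\<dots> \<le> 2 * ((R\<^sup>2 + (Lmax / pi)\<^sup>2) * (q + a))" using nn by (simp add: distrib_left distrib_right mult_nonneg_nonneg add_nonneg_nonneg)
  also have "\<dots> = 4 * (R\<^sup>2 + (Lmax / pi)\<^sup>2) * ((q + a) / 2)" by simp
  also have "\<dots> \<le> 4 * (R\<^sup>2 + (Lmax / pi)\<^sup>2) * Af u g u g" by (intro mult_left_mono low) simp
  finally show "(l2norm MO u)\<^sup>2 \<le> 4 * (R\<^sup>2 + (Lmax / pi)\<^sup>2) * Af u g u g" .
qed

lemma Af_solve:
  assumes D: "DD \<le> 1 / 2" and f: "f \<in> L2 MO"
  shows "\<exists>u g. HS u g \<and> (\<forall>w k. HS w k \<longrightarrow> Af u g w k = l2inner MO f w)"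
proof -
  define K where "K = 4 * (R\<^sup>2 + (Lmax / pi)\<^sup>2)"
  have K: "0 \<le> K" by (simp add: K_def)
  show ?thesis
  \<comment> \<open>The coercivity constant combines |u|^2 <= K Af with |g|^2 = Af + mu |u|^2, where
    Af is the form at \<open>u\<close>.\<close>
  proof (rule H10_form_solve[OF S_borel S_bounded Af_lin Af_sym _ _ _ _ f, where C="1 + mu" and \<kappa>="1 / (1 + (1 + mu) * K)"])
    show "0 \<le> 1 + mu" "0 < 1 / (1 + (1 + mu) * K)" using mu_pos K by (simp_all add: add_pos_nonneg)
    fix u g assume u: "HS u g"
    {
      fix w k assume w: "HS w k"
      note L = has_H10_gradient_L2[OF u] has_H10_gradient_L2[OF w]
      have "\<bar>Af u g w k\<bar> \<le> \<bar>l2inner MO g k\<bar> + mu * \<bar>l2inner MO u w\<bar>"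
        unfolding Af_def using abs_triangle_ineq4[of "l2inner MO g k" "mu * l2inner MO u w"] mu_pos by (simp add: abs_mult)
      also have "\<dots> \<le> l2norm MO g * l2norm MO k + mu * (l2norm MO u * l2norm MO w)"
        using mu_pos by (intro add_mono mult_left_mono l2inner_Cauchy_Schwarz L) simp
      also have "\<dots> \<le> (l2norm MO u + l2norm MO g) * (l2norm MO w + l2norm MO k) + mu * ((l2norm MO u + l2norm MO g) * (l2norm MO w + l2norm MO k))"
        using mu_pos by (intro add_mono mult_left_mono mult_mono) (simp_all add: l2norm_nonneg add_nonneg_nonneg)
      finally show "\<bar>Af u g w k\<bar> \<le> (1 + mu) * (l2norm MO u + l2norm MO g) * (l2norm MO w + l2norm MO k)"
        by (simp add: algebra_simps)
    }
    have a: "(l2norm MO u)\<^sup>2 \<le> K * Af u g u g" "0 \<le> Af u g u g" using Af_coercive[OF D u] by (simp_all add: K_def)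
    have "(l2norm MO g)\<^sup>2 = Af u g u g + mu * (l2norm MO u)\<^sup>2" by (simp add: Af_def l2norm_sq)
    then have "(l2norm MO u)\<^sup>2 + (l2norm MO g)\<^sup>2 = Af u g u g + (1 + mu) * (l2norm MO u)\<^sup>2" by (simp add: algebra_simps)
    also have "\<dots> \<le> Af u g u g + (1 + mu) * (K * Af u g u g)" using mu_pos by (intro add_left_mono mult_left_mono a) simp
    also have "\<dots> = (1 + (1 + mu) * K) * Af u g u g" by (simp add: algebra_simps)
    finally have le: "(l2norm MO u)\<^sup>2 + (l2norm MO g)\<^sup>2 \<le> (1 + (1 + mu) * K) * Af u g u g" .
    have p: "0 < 1 + (1 + mu) * K" using mu_pos K by (simp add: add_pos_nonneg)
    show "1 / (1 + (1 + mu) * K) * ((l2norm MO u)\<^sup>2 + (l2norm MO g)\<^sup>2) \<le> Af u g u g"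
      using le p by (simp add: pos_divide_le_eq mult.commute)
  qed
qed

text \<open>No smallness of the coupling enters here: \<open>Qf\<close> bounds the gradient directly
  and the function through \<open>coer\<close>. Boundedness of the \<lambda> term is again the
  weighted inequality.\<close>

lemma Qf_solve:
  assumes f: "f \<in> L2 MI"
  shows "\<exists>\<xi> \<xi>'. HI \<xi> \<xi>' \<and> (\<forall>\<eta> \<eta>'. HI \<eta> \<eta>' \<longrightarrow> Qf \<xi> \<xi>' \<eta> \<eta>' = l2inner MI f \<eta>)"
proof -
  obtain B where B: "B \<ge> 0" "\<forall>x. \<bar>pi / Lb x\<bar> \<le> B" using invL_bounded_measurable(2) by blast
  define La where "La = l2norm MI lam"
  define C where "C = 1 + B\<^sup>2 + mu + J tau tau * (2 * La\<^sup>2)"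
  show ?thesis
  proof (rule H10_form_solve[OF interval_borel Qf_lin Qf_sym _ _ _ _ f, where C=C and \<kappa>="1 / (1 + R\<^sup>2)"])
    show "0 \<le> C" using mu_pos Jtt_pos by (simp add: C_def add_nonneg_nonneg)
    show "0 < 1 / (1 + R\<^sup>2)" by (simp add: add_pos_nonneg)
    fix u g assume u: "HI u g"
    {
      fix w k assume w: "HI w k"
      note L = has_H10_gradient_L2[OF u] has_H10_gradient_L2[OF w]
      define X where "X = l2norm MI u + l2norm MI g"
      define Y where "Y = l2norm MI w + l2norm MI k"
      have nn: "0 \<le> X" "0 \<le> Y" "0 \<le> La" by (simp_all add: X_def Y_def La_def l2norm_nonneg add_nonneg_nonneg)
      have 1: "\<bar>l2inner MI g k\<bar> \<le> X * Y"
        by (rule order_trans[OF l2inner_Cauchy_Schwarz[OF L(2,4)]], rule mult_mono) (simp_all add: X_def Y_def l2norm_nonneg add_nonneg_nonneg)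
      have bl: "l2norm MI (\<lambda>x. pi / Lb x * v x) \<le> B * l2norm MI v" if "v \<in> L2 MI" for v :: "real \<Rightarrow> real"
        using l2norm_bounded_mult[OF that invL_bounded_measurable(1) B(2)[rule_format] B(1)] by (simp only: real_scaleR_def)
      have 2: "\<bar>l2inner MI (\<lambda>x. pi / Lb x * u x) (\<lambda>x. pi / Lb x * w x)\<bar> \<le> B\<^sup>2 * (X * Y)"
      proof -
        have "\<bar>l2inner MI (\<lambda>x. pi / Lb x * u x) (\<lambda>x. pi / Lb x * w x)\<bar> \<le> (B * X) * (B * Y)"
          by (rule order_trans[OF l2inner_Cauchy_Schwarz[OF invL_mult_L2[OF L(1)] invL_mult_L2[OF L(3)]]], rule mult_mono)
            (use bl[OF L(1)] bl[OF L(3)] B(1) nn in \<open>auto intro!: order_trans[OF bl] mult_left_mono mult_nonneg_nonneg L simp: X_def Y_def l2norm_nonneg simp del: times_divide_eq_left\<close>)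
        then show ?thesis by (simp add: power2_eq_square mult_ac)
      qed
      have 3: "mu * \<bar>l2inner MI u w\<bar> \<le> mu * (X * Y)"
        using mu_pos by (intro mult_left_mono order_trans[OF l2inner_Cauchy_Schwarz[OF L(1,3)]] mult_mono) (simp_all add: X_def Y_def l2norm_nonneg add_nonneg_nonneg)
      have ll: "l2norm MI (\<lambda>x. v x * lam x) \<le> sqrt 2 * La * (l2norm MI v + l2norm MI v')" if "HI v v'" for v v'
      proof (rule power2_le_imp_le)
        have "(l2norm MI (\<lambda>x. v x * lam x))\<^sup>2 \<le> 2 * La\<^sup>2 * (l2norm MI v * l2norm MI v')" using lam_mult_L2(2)[OF that] by (simp add: La_def mult.assoc)
        also have "\<dots> \<le> 2 * La\<^sup>2 * ((l2norm MI v + l2norm MI v') * (l2norm MI v + l2norm MI v'))"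
          by (intro mult_left_mono mult_mono) (simp_all add: l2norm_nonneg add_nonneg_nonneg)
        finally show "(l2norm MI (\<lambda>x. v x * lam x))\<^sup>2 \<le> (sqrt 2 * La * (l2norm MI v + l2norm MI v'))\<^sup>2"
          by (simp add: power_mult_distrib power2_eq_square[of "_ + _"])
      qed (use nn in \<open>simp add: l2norm_nonneg add_nonneg_nonneg\<close>)
      have 4: "\<bar>l2inner MI (\<lambda>x. u x * lam x) (\<lambda>x. w x * lam x)\<bar> \<le> 2 * La\<^sup>2 * (X * Y)"
      proof -
        have "\<bar>l2inner MI (\<lambda>x. u x * lam x) (\<lambda>x. w x * lam x)\<bar> \<le> (sqrt 2 * La * X) * (sqrt 2 * La * Y)"
          by (rule order_trans[OF l2inner_Cauchy_Schwarz[OF lam_mult_L2(1)[OF u] lam_mult_L2(1)[OF w]]], rule mult_mono)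
            (use ll[OF u] ll[OF w] nn in \<open>simp_all add: X_def Y_def l2norm_nonneg\<close>)
        also have "\<dots> = (sqrt 2 * sqrt 2) * (La * La) * (X * Y)" by (simp only: mult_ac)
        finally show ?thesis by (simp add: power2_eq_square)
      qed
      then have 4: "J tau tau * \<bar>l2inner MI (\<lambda>x. u x * lam x) (\<lambda>x. w x * lam x)\<bar> \<le> J tau tau * (2 * La\<^sup>2 * (X * Y))"
        using Jtt_pos by (intro mult_left_mono) simp_all
      have "\<bar>a + b - c + d\<bar> \<le> \<bar>a\<bar> + \<bar>b\<bar> + \<bar>c\<bar> + \<bar>d\<bar>" for a b c d :: real by linarith
      then have "\<bar>Qf u g w k\<bar> \<le> \<bar>l2inner MI g k\<bar> + \<bar>l2inner MI (\<lambda>x. pi / Lb x * u x) (\<lambda>x. pi / Lb x * w x)\<bar>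
          + \<bar>mu * l2inner MI u w\<bar> + \<bar>J tau tau * l2inner MI (\<lambda>x. u x * lam x) (\<lambda>x. w x * lam x)\<bar>"
        unfolding Qf_def by blast
      also have "\<dots> = \<bar>l2inner MI g k\<bar> + \<bar>l2inner MI (\<lambda>x. pi / Lb x * u x) (\<lambda>x. pi / Lb x * w x)\<bar>
          + mu * \<bar>l2inner MI u w\<bar> + J tau tau * \<bar>l2inner MI (\<lambda>x. u x * lam x) (\<lambda>x. w x * lam x)\<bar>"
        using mu_pos Jtt_pos by (simp only: abs_mult abs_of_pos)
      also have "\<dots> \<le> X * Y + B\<^sup>2 * (X * Y) + mu * (X * Y) + J tau tau * (2 * La\<^sup>2 * (X * Y))"
        by (intro add_mono 1 2 3 4)
      finally show "\<bar>Qf u g w k\<bar> \<le> C * (l2norm MI u + l2norm MI g) * (l2norm MI w + l2norm MI k)"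
        unfolding C_def X_def[symmetric] Y_def[symmetric] by (simp add: algebra_simps)
    }
    note b = Qf_bounds[OF u]
    have "(l2norm MI u)\<^sup>2 \<le> (R * sqrt (Qf u g u g))\<^sup>2" "(l2norm MI g)\<^sup>2 \<le> (sqrt (Qf u g u g))\<^sup>2"
      using power_mono[OF b(2) l2norm_nonneg, of 2] power_mono[OF b(3) l2norm_nonneg, of 2] by simp_all
    then have le: "(l2norm MI u)\<^sup>2 + (l2norm MI g)\<^sup>2 \<le> (1 + R\<^sup>2) * Qf u g u g"
      using b(1) by (simp add: power_mult_distrib algebra_simps)
    have p: "0 < 1 + R\<^sup>2" by (simp add: add_pos_nonneg)
    show "1 / (1 + R\<^sup>2) * ((l2norm MI u)\<^sup>2 + (l2norm MI g)\<^sup>2) \<le> Qf u g u g"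
      using le p by (simp add: pos_divide_le_eq mult.commute)
  qed
qed

lemma Af_solution_bound:
  assumes D: "DD \<le> 1 / 2" and f: "f \<in> L2 MO" and u: "HS u g" and eq: "Af u g u g = l2inner MO f u"
  shows "l2norm MO u \<le> 4 * (R\<^sup>2 + (Lmax / pi)\<^sup>2) * l2norm MO f"
proof (cases "l2norm MO u = 0")
  case True then show ?thesis by (simp add: l2norm_nonneg)
next
  case False
  then have p: "0 < l2norm MO u" using l2norm_nonneg[of MO u] by simp
  have "l2norm MO u * l2norm MO u \<le> 4 * (R\<^sup>2 + (Lmax / pi)\<^sup>2) * Af u g u g" using Af_coercive(1)[OF D u] by (simp add: power2_eq_square)
  also have "\<dots> \<le> 4 * (R\<^sup>2 + (Lmax / pi)\<^sup>2) * (l2norm MO f * l2norm MO u)"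
    unfolding eq using l2inner_Cauchy_Schwarz[OF f has_H10_gradient_L2(1)[OF u]] by (intro mult_left_mono) auto
  finally have "l2norm MO u * l2norm MO u \<le> (4 * (R\<^sup>2 + (Lmax / pi)\<^sup>2) * l2norm MO f) * l2norm MO u" by (simp add: mult.assoc)
  then show ?thesis by (rule mult_right_le_imp_le[OF _ p])
qed

lemma Qf_solution_bound:
  assumes f: "f \<in> L2 MI" and u: "HI \<xi> \<xi>'" and eq: "Qf \<xi> \<xi>' \<xi> \<xi>' = l2inner MI f \<xi>"
  shows "l2norm MI \<xi> \<le> R\<^sup>2 * l2norm MI f"
proof (cases "l2norm MI \<xi> = 0")
  case True then show ?thesis by (simp add: l2norm_nonneg)
next
  case False
  then have p: "0 < l2norm MI \<xi>" using l2norm_nonneg[of MI \<xi>] by simp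
  have "(l2norm MI \<xi>)\<^sup>2 \<le> (R * sqrt (Qf \<xi> \<xi>' \<xi> \<xi>'))\<^sup>2" by (rule power_mono[OF Qf_bounds(3)[OF u] l2norm_nonneg])
  then have "l2norm MI \<xi> * l2norm MI \<xi> \<le> R\<^sup>2 * Qf \<xi> \<xi>' \<xi> \<xi>'" using Qf_bounds(1)[OF u] by (simp add: power_mult_distrib power2_eq_square[of "l2norm MI \<xi>"])
  also have "\<dots> \<le> R\<^sup>2 * (l2norm MI f * l2norm MI \<xi>)"
    unfolding eq using l2inner_Cauchy_Schwarz[OF f has_H10_gradient_L2(1)[OF u]] by (intro mult_left_mono) auto
  finally have "l2norm MI \<xi> * l2norm MI \<xi> \<le> (R\<^sup>2 * l2norm MI f) * l2norm MI \<xi>" by (simp add: mult.assoc)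
  then show ?thesis by (rule mult_right_le_imp_le[OF _ p])
qed

text \<open>Testing the equation of \<open>u\<close> with modes and subtracting that of \<xi>0,
  which has the same source, leaves only the coupling to V as right-hand side for the difference
  \<open>dL\<close>. Testing with \<open>dL\<close>, with the mode part and with V yields the three
  inequalities of \<open>error_arithmetic\<close>.\<close>

theorem resolvent_estimate:
  assumes D: "DD \<le> 1 / 2" and f: "f \<in> L2 MO" "l2norm MO f \<le> 1"
    and u: "HS u g" "\<And>w k. HS w k \<Longrightarrow> Af u g w k = l2inner MO f w"
    and \<xi>0: "HI \<xi>0 \<xi>0'" "\<And>\<eta> \<eta>'. HI \<eta> \<eta>' \<Longrightarrow> Qf \<xi>0 \<xi>0' \<eta> \<eta>' = l2inner MI (pr sin f) \<eta>"
  shows "l2norm MO (\<lambda>p. u p - md \<xi>0 p) \<le> 2 * (Lmax / pi + DD * R)\<^sup>2"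
proof -
  obtain \<xi> \<xi>' V k where d: "\<xi> = pr sin u" "HI \<xi> \<xi>'" "HS V k" "orth V" "\<And>p. V p = u p - md \<xi> p"
    "\<And>p. k p = g p - (mdx \<xi> \<xi>' p, mdy \<xi> p)" by (rule decomposition[OF u(1)], rule that)
  note X = Af_decomposed[OF d(2,3) _ d(5,6)]
  define B where "B \<eta> \<eta>' = Af (md \<eta>) (mdg \<eta> \<eta>') V k" for \<eta> \<eta>'
  have Bb: "\<bar>B \<eta> \<eta>'\<bar> \<le> DD * sqrt (Qf \<eta> \<eta>' \<eta> \<eta>') * sqrt (Af V k V k)" if "HI \<eta> \<eta>'" for \<eta> \<eta>'
    unfolding B_def by (rule cross_bound[OF that d(3,4)])
  have eq: "Qf \<xi> \<xi>' \<eta> \<eta>' + B \<eta> \<eta>' = l2inner MI (pr sin f) \<eta>" if \<eta>: "HI \<eta> \<eta>'" for \<eta> \<eta>'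
  proof -
    have "Af u g (md \<eta>) (mdg \<eta> \<eta>') = l2inner MO f (md \<eta>)" by (rule u(2)[OF md_H[OF \<eta>]])
    also have "\<dots> = l2inner MI (pr sin f) \<eta>"
      unfolding l2inner_commute[of MO f] l2inner_commute[of MI "pr sin f"] md_def[abs_def]
      by (rule pr_adjoint[OF f(1) has_H10_gradient_L2(1)[OF \<eta>] csin])
    finally show ?thesis
      using X[OF md_H[OF \<eta>]] Af_mode[OF d(2) \<eta>] Af_sym[of V k "md \<eta>" "\<lambda>p. (mdx \<eta> \<eta>' p, mdy \<eta> p)"] by (simp add: B_def)
  qed
  define dL where "dL x = \<xi> x + (- 1) * \<xi>0 x" for x
  define dL' where "dL' x = \<xi>' x + (- 1) *\<^sub>R \<xi>0' x" for x
  have dL: "HI dL dL'" unfolding dL_def dL'_def by (rule has_H10_gradient_lincomb[OF interval_borel(1) d(2) \<xi>0(1)])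
  define x where "x = sqrt (Qf \<xi> \<xi>' \<xi> \<xi>')"
  define y where "y = sqrt (Af V k V k)"
  define z where "z = sqrt (Qf dL dL' dL dL')"
  define E where "E = Lmax / pi"
  have nn: "0 \<le> x" "0 \<le> y" "0 \<le> z" "0 \<le> E"
    using Qf_bounds(1)[OF d(2)] Qf_bounds(1)[OF dL] Af_orth_bounds(1)[OF d(3,4)] Lmax by (simp_all add: x_def y_def z_def E_def)
  have sq: "x\<^sup>2 = Qf \<xi> \<xi>' \<xi> \<xi>'" "y\<^sup>2 = Af V k V k" "z\<^sup>2 = Qf dL dL' dL dL'"
    using Qf_bounds(1)[OF d(2)] Qf_bounds(1)[OF dL] Af_orth_bounds(1)[OF d(3,4)] by (simp_all add: x_def y_def z_def)
  have pfL: "pr sin f \<in> L2 MI" "l2norm MI (pr sin f) \<le> 1" using pr_L2[OF f(1) csin] f(2) by (simp_all add: J_sin_sin)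
  have h1: "z\<^sup>2 \<le> DD * z * y"
  proof -
    have "Qf dL dL' dL dL' = Qf \<xi> \<xi>' dL dL' + (- 1) * Qf \<xi>0 \<xi>0' dL dL'"
      using Qf_lin[OF d(2) \<xi>0(1) dL, of "- 1"] by (simp add: dL_def[abs_def] dL'_def[abs_def])
    also have "\<dots> = - B dL dL'" using eq[OF dL] \<xi>0(2)[OF dL] by simp
    finally show ?thesis using Bb[OF dL] unfolding sq by (simp add: z_def y_def)
  qed
  have h2: "x\<^sup>2 \<le> R * x + DD * x * y"
  proof -
    have "l2inner MI (pr sin f) \<xi> \<le> l2norm MI (pr sin f) * l2norm MI \<xi>"
      using l2inner_Cauchy_Schwarz[OF pfL(1) has_H10_gradient_L2(1)[OF d(2)]] by simp
    also have "\<dots> \<le> 1 * (R * x)" using pfL(2) Qf_bounds(3)[OF d(2)] by (intro mult_mono) (simp_all add: x_def l2norm_nonneg)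
    finally show ?thesis using eq[OF d(2)] Bb[OF d(2)] unfolding sq by (simp add: x_def y_def)
  qed
  have VL: "V \<in> L2 MO" by (rule has_H10_gradient_L2(1)[OF d(3)])
  have h3: "y\<^sup>2 \<le> E * y + DD * x * y"
  proof -
    have "B \<xi> \<xi>' + Af V k V k = l2inner MO f V" using X[OF d(3)] u(2)[OF d(3)] by (simp add: B_def)
    moreover have "l2inner MO f V \<le> l2norm MO f * l2norm MO V" using l2inner_Cauchy_Schwarz[OF f(1) VL] by simp
    moreover have "l2norm MO f * l2norm MO V \<le> 1 * (E * y)"
      using f(2) Af_orth_bounds(3)[OF d(3,4)] by (intro mult_mono) (simp_all add: E_def y_def l2norm_nonneg)
    ultimately show ?thesis using Bb[OF d(2)] unfolding sq by (simp add: x_def y_def)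
  qed
  have dlL: "dL \<in> L2 MI" by (rule has_H10_gradient_L2(1)[OF dL])
  have "(\<lambda>p. u p - md \<xi>0 p) = (\<lambda>p. V p + md dL p)" unfolding dL_def[abs_def] HI_md_lin d(5) by simp
  then have "l2norm MO (\<lambda>p. u p - md \<xi>0 p) \<le> l2norm MO V + l2norm MI dL"
    using l2norm_triangle[OF VL md_L2[OF dlL]] by (simp add: md_norm[OF dlL])
  also have "\<dots> \<le> E * y + R * z"
    using Af_orth_bounds(3)[OF d(3,4)] Qf_bounds(3)[OF dL] by (intro add_mono) (simp_all add: E_def y_def z_def)
  also have "\<dots> \<le> 2 * (E + DD * R)\<^sup>2" by (rule error_arithmetic[OF nn(1-3) DD_nonneg nn(4) less_imp_le[OF R] D h1 h2 h3])
  finally show ?thesis by (simp add: E_def)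
qed

end

section \<open>From forms to operators\<close>

lemma boundedly_invertibleI:
  assumes ex: "\<And>f. f \<in> L2 M \<Longrightarrow> \<exists>u. (u, f) \<in> A"
    and bd: "\<And>u f. (u, f) \<in> A \<Longrightarrow> u \<in> L2 M \<and> l2norm M u \<le> C * l2norm M f"
    and un: "\<And>u u' f. (u, f) \<in> A \<Longrightarrow> (u', f) \<in> A \<Longrightarrow> AE x in M. u x = u' x" and C: "0 \<le> C"
  shows "boundedly_invertible M A"
  unfolding boundedly_invertible_def
proof (intro conjI ballI allI impI)
  show "\<exists>u. (u, f) \<in> A" if "f \<in> L2 M" for f by (rule ex[OF that])
  show "AE x in M. u x = u' x" if "(u, f) \<in> A \<and> (u', f) \<in> A" for u u' f using un that by blast
  have "l2_opnorm M (inv_op A) \<le> ereal C"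
    unfolding l2_opnorm_def
  proof (rule SUP_least)
    fix f :: "'a \<Rightarrow> real" assume f: "f \<in> {f \<in> L2 M. l2norm M f \<le> 1}"
    then have "(inv_op A f, f) \<in> A" unfolding inv_op_def using f by (intro someI_ex[OF ex]) simp
    from bd[OF this] f C show "(if inv_op A f \<in> L2 M then ereal (l2norm M (inv_op A f)) else \<infinity>) \<le> ereal C"
      using mult_left_mono[of "l2norm M f" 1 C] by simp
  qed
  then show "l2_opnorm M (inv_op A) < \<infinity>" using order_le_less_trans by fastforce
qed

lemma boundedly_invertible_inv_op: "boundedly_invertible M A \<Longrightarrow> f \<in> L2 M \<Longrightarrow> (inv_op A f, f) \<in> A"
  unfolding inv_op_def boundedly_invertible_def by (elim conjE, drule (1) bspec, erule someI_ex)

context narrow_tube begin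

text \<open>Replaces the chosen gradients \<open>wgrad\<close> by arbitrary weak gradients, which
  differ from them only on null sets, so that the form estimates apply to the operator.\<close>

lemma minus_scalar_dirichlet_iff:
  "(u, f) \<in> minus_scalar (dirichlet_laplacian S) mu \<longleftrightarrow>
    f \<in> L2 MO \<and> (\<exists>g. HS u g \<and> (\<forall>w k. HS w k \<longrightarrow> Af u g w k = l2inner MO f w))" (is "_ \<longleftrightarrow> ?R")
proof -
  have form: "(\<integral>p. wgrad S u p \<bullet> wgrad S w p \<partial>MO) = l2inner MO g k" if "HS u g" "HS w k" for u g w k
  proof -
    have "HS u (wgrad S u)" "HS w (wgrad S w)" using that by (auto intro!: wgrad_has_H10_gradient simp: H10_def)
    note L = this[THEN has_H10_gradient_L2(2)] that[THEN has_H10_gradient_L2(2)]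
    show ?thesis
      unfolding l2inner_def[symmetric]
      by (rule l2inner_cong_AE[OF wgrad_AE[OF S_borel that(1)] wgrad_AE[OF S_borel that(2)]])
        (intro L2_measurable L)+
  qed
  have lin: "l2inner MO (\<lambda>p. f p + c * u p) w = l2inner MO f w + c * l2inner MO u w"
    if "f \<in> L2 MO" "u \<in> L2 MO" "w \<in> L2 MO" for f u w c
    using l2inner_add_left[OF that(1) L2_mult_const[OF that(2)] that(3), of c] l2inner_scaleR_left[of MO c u w] by simp
  show ?thesis
  proof
    assume "(u, f) \<in> minus_scalar (dirichlet_laplacian S) mu"
    then obtain F where F: "f = (\<lambda>p. F p - mu * u p)" "u \<in> H10 S" "F \<in> L2 MO"
      "\<And>w. w \<in> H10 S \<Longrightarrow> (\<integral>p. wgrad S u p \<bullet> wgrad S w p \<partial>MO) = l2inner MO F w"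
      unfolding minus_scalar_def dirichlet_laplacian_def form_operator_def by auto
    have u: "HS u (wgrad S u)" by (rule wgrad_has_H10_gradient[OF F(2)])
    note uL = has_H10_gradient_L2(1)[OF u]
    have fe: "f = (\<lambda>p. F p + (- mu) * u p)" using F(1) by simp
    show ?R
    proof (intro conjI exI[of _ "wgrad S u"] allI impI u)
      show "f \<in> L2 MO" unfolding F(1) by (intro L2_diff L2_mult_const F uL)
      fix w k assume w: "HS w k"
      have "l2inner MO (wgrad S u) k = l2inner MO F w" using form[OF u w] F(4)[of w] w by (auto simp: H10_def)
      then show "Af u (wgrad S u) w k = l2inner MO f w"
        unfolding Af_def fe lin[OF F(3) uL has_H10_gradient_L2(1)[OF w]] by simp
    qed
  next
    assume ?R
    then obtain g where g: "f \<in> L2 MO" "HS u g" "\<And>w k. HS w k \<Longrightarrow> Af u g w k = l2inner MO f w" by blast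
    note uL = has_H10_gradient_L2(1)[OF g(2)]
    define F where "F p = f p + mu * u p" for p
    have "(u, F) \<in> dirichlet_laplacian S"
      unfolding dirichlet_laplacian_def form_operator_def
    proof (intro CollectI case_prodI conjI ballI)
      show "u \<in> H10 S" using g(2) by (auto simp: H10_def)
      show "F \<in> L2 MO" unfolding F_def by (intro L2_add L2_mult_const g uL)
      fix w assume "w \<in> H10 S"
      then have w: "HS w (wgrad S w)" by (rule wgrad_has_H10_gradient)
      show "(\<integral>p. wgrad S u p \<bullet> wgrad S w p \<partial>MO) = l2inner MO F w"
        unfolding form[OF g(2) w] F_def lin[OF g(1) uL has_H10_gradient_L2(1)[OF w]] using g(3)[OF w] by (simp add: Af_def)
    qed
    moreover have "f = (\<lambda>p. F p - mu * u p)" by (simp add: F_def)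
    ultimately show "(u, f) \<in> minus_scalar (dirichlet_laplacian S) mu" unfolding minus_scalar_def by blast
  qed
qed

text \<open>The single integral over the potential splits into the terms of \<open>Qf\<close>. The
  splitting is legitimate because \<xi> lam and \<eta> lam are square integrable, although the
  square of lam is merely integrable.\<close>

lemma schroedinger_iff:
  assumes W: "\<And>x. x \<in> {\<alpha>..\<beta>} \<Longrightarrow> W x = (pi / L x)\<^sup>2 - mu + J tau tau * (lam x)\<^sup>2"
  shows "(\<xi>, f) \<in> schroedinger {\<alpha>..\<beta>} W \<longleftrightarrow>
    f \<in> L2 MI \<and> (\<exists>\<xi>'. HI \<xi> \<xi>' \<and> (\<forall>\<eta> \<eta>'. HI \<eta> \<eta>' \<longrightarrow> Qf \<xi> \<xi>' \<eta> \<eta>' = l2inner MI f \<eta>))" (is "_ \<longleftrightarrow> ?R")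
proof -
  have form: "(\<integral>x. (wgrad {\<alpha>..\<beta>} \<xi> x * wgrad {\<alpha>..\<beta>} \<eta> x + W x * (\<xi> x * \<eta> x)) \<partial>MI) = Qf \<xi> \<xi>' \<eta> \<eta>'"
    if H: "HI \<xi> \<xi>'" "HI \<eta> \<eta>'" for \<xi> \<xi>' \<eta> \<eta>'
  proof -
    let ?g = "wgrad {\<alpha>..\<beta>} \<xi>" and ?k = "wgrad {\<alpha>..\<beta>} \<eta>"
    have "HI \<xi> ?g" "HI \<eta> ?k" using H by (auto intro!: wgrad_has_H10_gradient simp: H10_def)
    note L' = this[THEN has_H10_gradient_L2(2)] H[THEN has_H10_gradient_L2(2)]
    note L0 = H[THEN has_H10_gradient_L2(1)]
    note i = L2_mult_integrable[OF L'(1,2)] L2_mult_integrable[OF L0]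
      L2_mult_integrable[OF invL_mult_L2[OF L0(1)] invL_mult_L2[OF L0(2)]]
      L2_mult_integrable[OF lam_mult_L2(1)[OF H(1)] lam_mult_L2(1)[OF H(2)]]
    have "(\<integral>x. (?g x * ?k x + W x * (\<xi> x * \<eta> x)) \<partial>MI) =
      (\<integral>x. (?g x * ?k x + (pi / Lb x * \<xi> x) * (pi / Lb x * \<eta> x) - mu * (\<xi> x * \<eta> x)
         + J tau tau * ((\<xi> x * lam x) * (\<eta> x * lam x))) \<partial>MI)"
    proof (rule Bochner_Integration.integral_cong)
      fix x assume "x \<in> space MI"
      then have x: "x \<in> {\<alpha>..\<beta>}" by simp
      show "?g x * ?k x + W x * (\<xi> x * \<eta> x) = ?g x * ?k x + (pi / Lb x * \<xi> x) * (pi / Lb x * \<eta> x) - mu * (\<xi> x * \<eta> x)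
         + J tau tau * ((\<xi> x * lam x) * (\<eta> x * lam x))"
        unfolding W[OF x] Lb_eq[OF x] by (simp add: power2_eq_square algebra_simps)
    qed simp
    also have "\<dots> = l2inner MI ?g ?k + l2inner MI (\<lambda>x. pi / Lb x * \<xi> x) (\<lambda>x. pi / Lb x * \<eta> x)
      - mu * l2inner MI \<xi> \<eta> + J tau tau * l2inner MI (\<lambda>x. \<xi> x * lam x) (\<lambda>x. \<eta> x * lam x)"
      unfolding l2inner_def inner_real_def
      using i by (simp only: Bochner_Integration.integral_add Bochner_Integration.integral_diff integral_mult_right_zero
        Bochner_Integration.integrable_add Bochner_Integration.integrable_diff integrable_mult_right)
    also have "l2inner MI ?g ?k = l2inner MI \<xi>' \<eta>'"
      by (rule l2inner_cong_AE[OF wgrad_AE[OF interval_borel(1) H(1)] wgrad_AE[OF interval_borel(1) H(2)]])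
        (intro L2_measurable L')+
    finally show ?thesis by (simp add: Qf_def)
  qed
  show ?thesis
  proof
    assume "(\<xi>, f) \<in> schroedinger {\<alpha>..\<beta>} W"
    then have x: "HI \<xi> (wgrad {\<alpha>..\<beta>} \<xi>)" "f \<in> L2 MI"
      and eq: "\<And>\<eta>. \<eta> \<in> H10 {\<alpha>..\<beta>} \<Longrightarrow> (\<integral>x. (wgrad {\<alpha>..\<beta>} \<xi> x * wgrad {\<alpha>..\<beta>} \<eta> x + W x * (\<xi> x * \<eta> x)) \<partial>MI) = l2inner MI f \<eta>"
      unfolding schroedinger_def form_operator_def by (auto intro: wgrad_has_H10_gradient)
    have "Qf \<xi> (wgrad {\<alpha>..\<beta>} \<xi>) \<eta> \<eta>' = l2inner MI f \<eta>" if "HI \<eta> \<eta>'" for \<eta> \<eta>'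
      using eq[of \<eta>] form[OF x(1) that] that by (auto simp: H10_def)
    then show ?R using x by blast
  next
    assume ?R
    then obtain \<xi>' where x: "f \<in> L2 MI" "HI \<xi> \<xi>'" "\<And>\<eta> \<eta>'. HI \<eta> \<eta>' \<Longrightarrow> Qf \<xi> \<xi>' \<eta> \<eta>' = l2inner MI f \<eta>" by blast
    show "(\<xi>, f) \<in> schroedinger {\<alpha>..\<beta>} W"
      unfolding schroedinger_def form_operator_def
    proof (intro CollectI case_prodI conjI ballI)
      show "\<xi> \<in> H10 {\<alpha>..\<beta>}" using x(2) by (auto simp: H10_def)
      fix \<eta> assume "\<eta> \<in> H10 {\<alpha>..\<beta>}"
      then have "HI \<eta> (wgrad {\<alpha>..\<beta>} \<eta>)" by (rule wgrad_has_H10_gradient)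
      from form[OF x(2) this] x(3)[OF this]
      show "(\<integral>x. (wgrad {\<alpha>..\<beta>} \<xi> x * wgrad {\<alpha>..\<beta>} \<eta> x + W x * (\<xi> x * \<eta> x)) \<partial>MI) = l2inner MI f \<eta>" by simp
    qed (rule x(1))
  qed
qed

lemma dirichlet_boundedly_invertible:
  assumes D: "DD \<le> 1 / 2"
  shows "boundedly_invertible MO (minus_scalar (dirichlet_laplacian S) mu)" (is "boundedly_invertible MO ?A")
proof (rule boundedly_invertibleI)
  show "\<exists>u. (u, f) \<in> ?A" if f: "f \<in> L2 MO" for f using Af_solve[OF D f] f unfolding minus_scalar_dirichlet_iff by blast
  show "0 \<le> 4 * (R\<^sup>2 + (Lmax / pi)\<^sup>2)" by simp
  fix u f assume "(u, f) \<in> ?A"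
  then obtain g where g: "f \<in> L2 MO" "HS u g" "\<And>w k. HS w k \<Longrightarrow> Af u g w k = l2inner MO f w"
    unfolding minus_scalar_dirichlet_iff by blast
  show "u \<in> L2 MO \<and> l2norm MO u \<le> 4 * (R\<^sup>2 + (Lmax / pi)\<^sup>2) * l2norm MO f"
    using has_H10_gradient_L2(1)[OF g(2)] Af_solution_bound[OF D g(1,2) g(3)[OF g(2)]] by blast
  fix u' assume "(u', f) \<in> ?A"
  then obtain g' where g': "HS u' g'" "\<And>w k. HS w k \<Longrightarrow> Af u' g' w k = l2inner MO f w"
    unfolding minus_scalar_dirichlet_iff by blast
  have d: "HS (\<lambda>p. u p + (- 1) * u' p) (\<lambda>p. g p + (- 1) *\<^sub>R g' p)"
    by (rule has_H10_gradient_lincomb[OF S_borel g(2) g'(1)])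
  have "Af (\<lambda>p. u p + (- 1) * u' p) (\<lambda>p. g p + (- 1) *\<^sub>R g' p) (\<lambda>p. u p + (- 1) * u' p) (\<lambda>p. g p + (- 1) *\<^sub>R g' p) = 0"
    using Af_lin[OF g(2) g'(1) d, of "- 1"] g(3)[OF d] g'(2)[OF d] by simp
  with Af_coercive(1)[OF D d] have "l2norm MO (\<lambda>p. u p + (- 1) * u' p) = 0" by simp
  then have "AE p in MO. u p + (- 1) * u' p = 0" unfolding l2norm_zero_iff[OF has_H10_gradient_L2(1)[OF d]] .
  then show "AE p in MO. u p = u' p" by eventually_elim simp
qed

lemma schroedinger_boundedly_invertible:
  assumes W: "\<And>x. x \<in> {\<alpha>..\<beta>} \<Longrightarrow> W x = (pi / L x)\<^sup>2 - mu + J tau tau * (lam x)\<^sup>2"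
  shows "boundedly_invertible MI (schroedinger {\<alpha>..\<beta>} W)" (is "boundedly_invertible MI ?A")
proof (rule boundedly_invertibleI)
  have iff: "(\<xi>, f) \<in> ?A \<longleftrightarrow>
    f \<in> L2 MI \<and> (\<exists>\<xi>'. HI \<xi> \<xi>' \<and> (\<forall>\<eta> \<eta>'. HI \<eta> \<eta>' \<longrightarrow> Qf \<xi> \<xi>' \<eta> \<eta>' = l2inner MI f \<eta>))" for \<xi> f
    by (rule schroedinger_iff) (rule W)
  show "\<exists>u. (u, f) \<in> ?A" if f: "f \<in> L2 MI" for f using Qf_solve[OF f] f unfolding iff by blast
  show "0 \<le> R\<^sup>2" by simp
  fix u f assume "(u, f) \<in> ?A"
  then obtain g where g: "f \<in> L2 MI" "HI u g" "\<And>w k. HI w k \<Longrightarrow> Qf u g w k = l2inner MI f w"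
    unfolding iff by blast
  show "u \<in> L2 MI \<and> l2norm MI u \<le> R\<^sup>2 * l2norm MI f"
    using has_H10_gradient_L2(1)[OF g(2)] Qf_solution_bound[OF g(1,2) g(3)[OF g(2)]] by blast
  fix u' assume "(u', f) \<in> ?A"
  then obtain g' where g': "HI u' g'" "\<And>w k. HI w k \<Longrightarrow> Qf u' g' w k = l2inner MI f w"
    unfolding iff by blast
  have d: "HI (\<lambda>p. u p + (- 1) * u' p) (\<lambda>p. g p + (- 1) *\<^sub>R g' p)"
    by (rule has_H10_gradient_lincomb[OF interval_borel(1) g(2) g'(1)])
  have "Qf (\<lambda>p. u p + (- 1) * u' p) (\<lambda>p. g p + (- 1) *\<^sub>R g' p) (\<lambda>p. u p + (- 1) * u' p) (\<lambda>p. g p + (- 1) *\<^sub>R g' p) = 0"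
    using Qf_lin[OF g(2) g'(1) d, of "- 1"] g(3)[OF d] g'(2)[OF d] by simp
  with Qf_bounds(3)[OF d] have "l2norm MI (\<lambda>p. u p + (- 1) * u' p) = 0"
    using l2norm_nonneg[of MI "\<lambda>p. u p + (- 1) * u' p"] by simp
  then have "AE p in MI. u p + (- 1) * u' p = 0" unfolding l2norm_zero_iff[OF has_H10_gradient_L2(1)[OF d]] .
  then show "AE p in MI. u p = u' p" by eventually_elim simp
qed

text \<open>\<open>proj\<close> picks some element of the mode space; since modes are isometric,
  every admissible choice has the coefficient \<open>pr sin f\<close> almost everywhere.
  \<open>mo\<close> stands for \<open>mode h \<epsilon>\<close>, which has to agree with
  \<open>md\<close> only on the tube.\<close>

lemma proj_mode:
  assumes f: "f \<in> L2 MO" and mo: "\<And>\<eta> p. p \<in> S \<Longrightarrow> mo \<eta> p = md \<eta> p"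
  obtains \<eta> where "proj MO (mo ` L2 MI) f = mo \<eta>" "\<eta> \<in> L2 MI" "AE x in MI. \<eta> x = pr sin f x"
proof -
  let ?P = "\<lambda>g. g \<in> mo ` L2 MI \<and> (\<forall>k\<in>mo ` L2 MI. l2inner MO (\<lambda>p. f p - g p) k = 0)"
  have prL: "pr sin f \<in> L2 MI" by (rule pr_L2(1)[OF f csin])
  have inn: "l2inner MO (\<lambda>p. f p - mo \<eta> p) (mo \<zeta>) = l2inner MI (pr sin f) \<zeta> - l2inner MI \<eta> \<zeta>"
    if "\<eta> \<in> L2 MI" "\<zeta> \<in> L2 MI" for \<eta> \<zeta>
  proof -
    have "l2inner MO (\<lambda>p. f p - mo \<eta> p) (mo \<zeta>) = l2inner MO (\<lambda>p. f p - md \<eta> p) (md \<zeta>)"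
      unfolding l2inner_def by (rule Bochner_Integration.integral_cong) (simp_all add: mo)
    also have "\<dots> = l2inner MO f (md \<zeta>) - l2inner MO (md \<eta>) (md \<zeta>)" by (rule l2inner_diff_left[OF f md_L2[OF that(1)] md_L2[OF that(2)]])
    also have "l2inner MO f (md \<zeta>) = l2inner MI (pr sin f) \<zeta>"
      unfolding l2inner_commute[of MO f] l2inner_commute[of MI "pr sin f"] md_def[abs_def]
      by (rule pr_adjoint[OF f that(2) csin])
    also have "l2inner MO (md \<eta>) (md \<zeta>) = l2inner MI \<eta> \<zeta>"
      unfolding md_def[abs_def] using mode_inner[OF that csin csin] by (simp add: J_sin_sin)
    finally show ?thesis .
  qed
  have "?P (mo (pr sin f))" using inn prL by auto
  then have "?P (proj MO (mo ` L2 MI) f)" unfolding proj_def by (rule someI[of ?P])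
  then obtain \<eta> where \<eta>: "proj MO (mo ` L2 MI) f = mo \<eta>" "\<eta> \<in> L2 MI"
    and o': "\<forall>k\<in>mo ` L2 MI. l2inner MO (\<lambda>p. f p - proj MO (mo ` L2 MI) f p) k = 0" by blast
  have o: "l2inner MO (\<lambda>p. f p - mo \<eta> p) (mo \<zeta>) = 0" if "\<zeta> \<in> L2 MI" for \<zeta>
    using o' that unfolding \<eta>(1) by blast
  have dl: "(\<lambda>x. pr sin f x - \<eta> x) \<in> L2 MI" by (rule L2_diff[OF prL \<eta>(2)])
  have "l2inner MI (\<lambda>x. pr sin f x - \<eta> x) (\<lambda>x. pr sin f x - \<eta> x) = 0"
    using l2inner_diff_left[OF prL \<eta>(2) dl] o[OF dl] inn[OF \<eta>(2) dl] by simp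
  then have "l2norm MI (\<lambda>x. pr sin f x - \<eta> x) = 0" by (simp add: l2norm_def)
  then have "AE x in MI. pr sin f x - \<eta> x = 0" unfolding l2norm_zero_iff[OF dl] .
  then have "AE x in MI. \<eta> x = pr sin f x" by eventually_elim simp
  with \<eta> show thesis by (rule that)
qed

lemma mode_cong_AE:
  assumes "\<eta> \<in> L2 MI" "\<zeta> \<in> L2 MI" "AE p in MO. md \<eta> p = md \<zeta> p"
  shows "AE x in MI. \<eta> x = \<zeta> x"
proof -
  have dl: "(\<lambda>x. \<eta> x - \<zeta> x) \<in> L2 MI" by (rule L2_diff[OF assms(1,2)])
  have "AE p in MO. md (\<lambda>x. \<eta> x - \<zeta> x) p = 0" using assms(3) by eventually_elim (simp add: md_def algebra_simps)
  then have "l2norm MO (md (\<lambda>x. \<eta> x - \<zeta> x)) = 0" unfolding l2norm_zero_iff[OF md_L2[OF dl]] .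
  then have "AE x in MI. \<eta> x - \<zeta> x = 0" unfolding md_norm[OF dl] l2norm_zero_iff[OF dl] .
  then show ?thesis by eventually_elim simp
qed

text \<open>The projection, the coefficient of its value and the two inverses are all chosen by
  \<open>SOME\<close>. The coefficient is determined almost everywhere, and
  \<open>resolvent_estimate\<close> holds for any solutions of the two equations, so the choices do
  not affect the bound.\<close>

theorem operator_estimate:
  assumes D: "DD \<le> 1 / 2" and mo: "\<And>\<eta> p. p \<in> S \<Longrightarrow> mo \<eta> p = md \<eta> p"
    and W: "\<And>x. x \<in> {\<alpha>..\<beta>} \<Longrightarrow> W x = (pi / L x)\<^sup>2 - mu + J tau tau * (lam x)\<^sup>2"
  defines "A \<equiv> minus_scalar (dirichlet_laplacian S) mu" and "Q \<equiv> schroedinger {\<alpha>..\<beta>} W"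
  shows "l2_opnorm MO (\<lambda>f p. inv_op A f p - direct_sum MO (mo ` L2 MI)
      (\<lambda>g. mo (inv_op Q (SOME \<eta>. \<eta> \<in> L2 MI \<and> (AE p in MO. g p = mo \<eta> p)))) (\<lambda>_ _. 0) f p)
    \<le> ereal (2 * (Lmax / pi + DD * R)\<^sup>2)" (is "l2_opnorm MO ?T \<le> _")
  unfolding l2_opnorm_def
proof (rule SUP_least)
  have iff: "(\<xi>, f) \<in> schroedinger {\<alpha>..\<beta>} W \<longleftrightarrow>
    f \<in> L2 MI \<and> (\<exists>\<xi>'. HI \<xi> \<xi>' \<and> (\<forall>\<eta> \<eta>'. HI \<eta> \<eta>' \<longrightarrow> Qf \<xi> \<xi>' \<eta> \<eta>' = l2inner MI f \<eta>))" for \<xi> f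
    by (rule schroedinger_iff) (rule W)
  fix f :: "real \<times> real \<Rightarrow> real" assume "f \<in> {f \<in> L2 MO. l2norm MO f \<le> 1}"
  then have f: "f \<in> L2 MO" "l2norm MO f \<le> 1" by auto
  obtain \<eta> where \<eta>: "proj MO (mo ` L2 MI) f = mo \<eta>" "\<eta> \<in> L2 MI" "AE x in MI. \<eta> x = pr sin f x"
    by (rule proj_mode[of f mo, OF f(1) mo])
  \<comment> \<open>The coefficient selected by \<open>on_modes\<close>; it need not be \<eta>
    itself, but both equal \<open>pr sin f\<close> almost everywhere.\<close>
  define \<zeta> where "\<zeta> = (SOME \<zeta>. \<zeta> \<in> L2 MI \<and> (AE p in MO. mo \<eta> p = mo \<zeta> p))"
  have "\<zeta> \<in> L2 MI \<and> (AE p in MO. mo \<eta> p = mo \<zeta> p)"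
    unfolding \<zeta>_def by (rule someI[of _ \<eta>]) (simp add: \<eta>)
  then have \<zeta>: "\<zeta> \<in> L2 MI" and ae: "AE p in MO. mo \<eta> p = mo \<zeta> p" by auto
  have "AE p in MO. md \<eta> p = md \<zeta> p" using ae AE_space by eventually_elim (simp add: mo)
  from mode_cong_AE[OF \<eta>(2) \<zeta> this] have ae: "AE x in MI. \<zeta> x = pr sin f x" using \<eta>(3) by eventually_elim simp
  define u where "u = inv_op A f"
  define \<xi> where "\<xi> = inv_op Q \<zeta>"
  have "(u, f) \<in> A"
    unfolding u_def A_def by (rule boundedly_invertible_inv_op[OF dirichlet_boundedly_invertible[OF D] f(1)])
  then obtain g where u: "HS u g" "\<And>w k. HS w k \<Longrightarrow> Af u g w k = l2inner MO f w"
    unfolding A_def minus_scalar_dirichlet_iff by blast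
  have "(\<xi>, \<zeta>) \<in> Q"
    unfolding \<xi>_def Q_def by (rule boundedly_invertible_inv_op[OF schroedinger_boundedly_invertible \<zeta>]) (rule W)
  then obtain \<xi>' where \<xi>: "HI \<xi> \<xi>'" "\<And>\<eta> \<eta>'. HI \<eta> \<eta>' \<Longrightarrow> Qf \<xi> \<xi>' \<eta> \<eta>' = l2inner MI \<zeta> \<eta>"
    unfolding Q_def iff by blast
  have q: "Qf \<xi> \<xi>' \<theta> \<theta>' = l2inner MI (pr sin f) \<theta>" if t: "HI \<theta> \<theta>'" for \<theta> \<theta>'
    unfolding \<xi>(2)[OF t]
    by (rule l2inner_cong_AE[OF ae]) (use \<zeta> pr_L2(1)[OF f(1) csin] has_H10_gradient_L2(1)[OF t] in \<open>auto intro: L2_measurable\<close>)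
  have eq: "?T f = (\<lambda>p. u p - mo \<xi> p)"
    unfolding direct_sum_def \<eta>(1) \<xi>_def u_def \<zeta>_def by simp
  note uL = has_H10_gradient_L2(1)[OF u(1)] and mL = md_L2[OF has_H10_gradient_L2(1)[OF \<xi>(1)]]
  have L: "(\<lambda>p. u p - md \<xi> p) \<in> L2 MO" by (rule L2_diff[OF uL mL])
  have m: "(\<lambda>p. u p - mo \<xi> p) \<in> borel_measurable MO"
    by (rule measurable_cong[THEN iffD1, OF _ L2_measurable[OF L]]) (simp add: mo)
  have ae': "AE p in MO. u p - md \<xi> p = u p - mo \<xi> p" using AE_space by eventually_elim (simp add: mo)
  have "l2norm MO (\<lambda>p. u p - mo \<xi> p) = l2norm MO (\<lambda>p. u p - md \<xi> p)"
    by (rule l2norm_cong_AE[symmetric, OF ae' L2_measurable[OF L] m])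
  also have "\<dots> \<le> 2 * (Lmax / pi + DD * R)\<^sup>2" by (rule resolvent_estimate[OF D f u \<xi>(1) q])
  finally show "(if ?T f \<in> L2 MO then ereal (l2norm MO (?T f)) else \<infinity>) \<le> ereal (2 * (Lmax / pi + DD * R)\<^sup>2)"
    unfolding eq using L2_cong_AE[OF L ae' m] by simp
qed

end

section \<open>Profiles with a single maximum\<close>

lemma one_sided_expansion:
  fixes k :: "real \<Rightarrow> real"
  assumes c: "0 < c" and m: "0 \<le> m" and O: "(\<lambda>x. k x - (M - c * x powr m)) \<in> O[at_right 0](\<lambda>x. x powr (m + 1))"
  shows "\<exists>\<delta>>0. \<forall>x\<in>{0<..<\<delta>}. c / 2 * x powr m \<le> M - k x"
proof -
  obtain C where C: "C > 0" "eventually (\<lambda>x. norm (k x - (M - c * x powr m)) \<le> C * norm (x powr (m + 1))) (at_right 0)"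
    using O by (rule landau_o.bigE)
  obtain d where d: "d > 0" "\<And>x. 0 < x \<Longrightarrow> x < d \<Longrightarrow> norm (k x - (M - c * x powr m)) \<le> C * norm (x powr (m + 1))"
    using C(2) unfolding eventually_at_right_field by auto
  show ?thesis
  \<comment> \<open>For x < c / (2 C) the remainder C x^(m+1) is at most half of the leading term c
    x^m.\<close>
  proof (intro exI[of _ "min d (c / (2 * C))"] conjI ballI)
    show "0 < min d (c / (2 * C))" using d(1) c C(1) by simp
    fix x assume "x \<in> {0<..<min d (c / (2 * C))}"
    then have x: "0 < x" "x < d" "x * C < c / 2" using C(1) by (auto simp: field_simps)
    have "k x - (M - c * x powr m) \<le> (x * C) * x powr m"
      using d(2)[OF x(1,2)] x(1) by (simp add: powr_add mult_ac)
    also have "\<dots> \<le> c / 2 * x powr m" using x(3) by (intro mult_right_mono) auto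
    finally show "c / 2 * x powr m \<le> M - k x" by (simp add: field_simps)
  qed
qed

text \<open>For |x| <= r/2 the weight of \<open>uncertainty_bound\<close> is at least its value 8 /
  (25 r^2) at |x| = r/2. Elsewhere it is at least -1 / (2 r^2), so half of \<theta> / r^2 is left
  from P, and 1/2 exceeds 8/25.\<close>

lemma quartic_weight_bounds:
  fixes r x \<theta> P :: real
  assumes r: "0 < r" and \<theta>: "0 \<le> \<theta>" "0 \<le> P" and P: "r / 2 \<le> \<bar>x\<bar> \<Longrightarrow> \<theta> / r\<^sup>2 \<le> P"
  shows "8 * \<theta> / (25 * r\<^sup>2) \<le> \<theta> * ((r\<^sup>2 - 2 * x\<^sup>2) / (r\<^sup>2 + x\<^sup>2)\<^sup>2) + P"
proof (cases "r / 2 \<le> \<bar>x\<bar>")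
  case True
  have p: "0 < (r\<^sup>2 + x\<^sup>2)\<^sup>2" using r by (simp add: add_pos_nonneg)
  have "- 1 * (r\<^sup>2 + x\<^sup>2)\<^sup>2 \<le> 2 * r\<^sup>2 * (r\<^sup>2 - 2 * x\<^sup>2)"
  proof -
    have "0 \<le> (x\<^sup>2 - r\<^sup>2)\<^sup>2 + 2 * (r\<^sup>2)\<^sup>2" by simp
    then show ?thesis by (simp add: power2_eq_square algebra_simps)
  qed
  moreover have "(r\<^sup>2 - 2 * x\<^sup>2) / Y + 1 / (2 * r\<^sup>2) = (Y + 2 * r\<^sup>2 * (r\<^sup>2 - 2 * x\<^sup>2)) / (2 * r\<^sup>2 * Y)" if "Y > 0" for Y
    using r that by (simp add: field_simps)
  ultimately have "0 \<le> (r\<^sup>2 - 2 * x\<^sup>2) / (r\<^sup>2 + x\<^sup>2)\<^sup>2 + 1 / (2 * r\<^sup>2)"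
    using p by simp
  then have "- 1 / (2 * r\<^sup>2) \<le> (r\<^sup>2 - 2 * x\<^sup>2) / (r\<^sup>2 + x\<^sup>2)\<^sup>2" by simp
  then have "\<theta> * (- 1 / (2 * r\<^sup>2)) \<le> \<theta> * ((r\<^sup>2 - 2 * x\<^sup>2) / (r\<^sup>2 + x\<^sup>2)\<^sup>2)" by (rule mult_left_mono[OF _ \<theta>(1)])
  moreover have "8 * \<theta> / (25 * r\<^sup>2) \<le> \<theta> * (- 1 / (2 * r\<^sup>2)) + \<theta> / r\<^sup>2" using r \<theta>(1) by (simp add: field_simps)
  ultimately show ?thesis using P[OF True] by linarith
next
  case False
  then have "\<bar>x\<bar>\<^sup>2 \<le> (r / 2)\<^sup>2" by (intro power_mono) auto
  then have x: "x\<^sup>2 \<le> r\<^sup>2 / 4" by (simp add: power_divide)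
  have p: "0 < (r\<^sup>2 + x\<^sup>2)\<^sup>2" using r by (simp add: add_pos_nonneg)
  have "(r\<^sup>2 + x\<^sup>2)\<^sup>2 \<le> (r\<^sup>2 + r\<^sup>2 / 4)\<^sup>2" using x by (intro power_mono) auto
  then have "8 * (r\<^sup>2 + x\<^sup>2)\<^sup>2 \<le> 25 * r\<^sup>2 * (r\<^sup>2 / 2)" by (simp add: power2_eq_square field_simps)
  also have "\<dots> \<le> 25 * r\<^sup>2 * (r\<^sup>2 - 2 * x\<^sup>2)" using x by (intro mult_left_mono) auto
  finally have "8 / (25 * r\<^sup>2) \<le> (r\<^sup>2 - 2 * x\<^sup>2) / (r\<^sup>2 + x\<^sup>2)\<^sup>2"
    using p r by (simp add: divide_le_eq le_divide_eq mult_ac)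
  from mult_left_mono[OF this \<theta>(1)] show ?thesis using \<theta>(2) by (simp add: mult.commute)
qed

locale waist =
  fixes a b M m cp cm :: real and h h' :: "real \<Rightarrow> real"
  assumes ab: "a > 0" "b > 0" and hc: "continuous_on {-a..b} h"
    and hpos: "\<And>x. x \<in> {-a..b} \<Longrightarrow> h x > 0"
    and hmax: "\<And>x. x \<in> {-a..b} \<Longrightarrow> x \<noteq> 0 \<Longrightarrow> h x < h 0"
    and hd: "\<And>x. x \<in> {-a..b} - {0} \<Longrightarrow> (h has_real_derivative h' x) (at x within {-a..b})"
    and hc': "continuous_on ({-a..b} - {0}) h'"
    and par: "M > 0" "cp > 0" "cm > 0" "m \<ge> 1"
    and right: "(\<lambda>x. h x - (M - cp * x powr m)) \<in> O[at_right 0](\<lambda>x. x powr (m + 1))"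
    and left: "(\<lambda>x. h x - (M - cm * \<bar>x\<bar> powr m)) \<in> O[at_left 0](\<lambda>x. \<bar>x\<bar> powr (m + 1))"
    and form_domain: "\<And>\<epsilon> \<eta>. \<epsilon> > 0 \<Longrightarrow> \<eta> \<in> H10 {-a..b} \<Longrightarrow>
           integrable (leb {-a..b}) (\<lambda>x. W_pot h h' M \<epsilon> x * (\<eta> x)\<^sup>2)"
begin

text \<open>The constant of the expansion is its limit from the right, which continuity identifies
  with the value at 0.\<close>

lemma h_0: "h 0 = M"
proof -
  have "(\<lambda>x. x powr (m + 1)) \<in> o[at_right 0](\<lambda>_. 1 :: real)"
    by (rule smalloI_tendsto) (use par(4) in real_asymp, simp)
  with right have "(\<lambda>x. h x - (M - cp * x powr m)) \<in> o[at_right 0](\<lambda>_. 1)" by (rule landau_o.big_small_trans)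
  then have "((\<lambda>x. h x - (M - cp * x powr m)) \<longlongrightarrow> 0) (at_right 0)" by (auto dest: smalloD_tendsto)
  moreover have "((\<lambda>x. M - cp * x powr m) \<longlongrightarrow> M) (at_right 0)" using par(4) by real_asymp
  ultimately have "((\<lambda>x. (h x - (M - cp * x powr m)) + (M - cp * x powr m)) \<longlongrightarrow> 0 + M) (at_right 0)" by (rule tendsto_add)
  then have 1: "(h \<longlongrightarrow> M) (at_right 0)" by simp
  have "(h \<longlongrightarrow> h 0) (at 0 within {-a..b})" using hc ab by (auto simp: continuous_on_def)
  then have "(h \<longlongrightarrow> h 0) (at 0)" using at_within_interior[of 0 "{-a..b}"] ab by simp
  then have "(h \<longlongrightarrow> h 0) (at_right 0)" by (rule tendsto_within_subset) simp
  from tendsto_unique[OF _ this 1] show ?thesis by simp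
qed

lemma h_le: "x \<in> {-a..b} \<Longrightarrow> h x \<le> M"
  using hmax[of x] h_0 by (cases "x = 0") auto

text \<open>Near 0 the two expansions leave half of their leading coefficients; away from 0 strict
  maximality and compactness give a positive gap, which is compared with an upper bound for |x|^m on
  the interval.\<close>

lemma gap_lower_bound: "\<exists>c>0. \<forall>x\<in>{-a..b}. c * \<bar>x\<bar> powr m \<le> M - h x"
proof -
  obtain d1 where d1: "d1 > 0" "\<And>x. x \<in> {0<..<d1} \<Longrightarrow> cp / 2 * x powr m \<le> M - h x"
    using one_sided_expansion[OF par(2) _ right] par(4) by auto
  have "(\<lambda>x. h (- x) - (M - cm * x powr m)) \<in> O[at_right 0](\<lambda>x. x powr (m + 1))"
  proof (rule landau_o.bigE[OF left])
    fix C assume C: "C > 0" "eventually (\<lambda>x. norm (h x - (M - cm * \<bar>x\<bar> powr m)) \<le> C * norm (\<bar>x\<bar> powr (m + 1))) (at_left 0)"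
    then have "eventually (\<lambda>x. norm (h (- x) - (M - cm * \<bar>x\<bar> powr m)) \<le> C * norm (\<bar>x\<bar> powr (m + 1))) (at_right 0)"
      unfolding at_left_minus[of 0] eventually_filtermap by simp
    moreover have "eventually (\<lambda>x::real. 0 < x) (at_right 0)" by (rule eventually_at_right_less)
    ultimately have "eventually (\<lambda>x. norm (h (- x) - (M - cm * x powr m)) \<le> C * norm (x powr (m + 1))) (at_right 0)"
      by eventually_elim simp
    then show ?thesis by (rule landau_o.bigI[OF C(1)])
  qed
  then obtain d2 where d2: "d2 > 0" "\<And>x. x \<in> {0<..<d2} \<Longrightarrow> cm / 2 * x powr m \<le> M - h (- x)"
    using one_sided_expansion[OF par(3), of m "\<lambda>x. h (- x)" M] par(4) by auto
  define d where "d = min d1 d2"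
  have d: "d > 0" using d1(1) d2(1) by (simp add: d_def)
  define K where "K = {-a..b} - {-d<..<d}"
  have K: "compact K" unfolding K_def by (intro compact_diff) auto
  have "continuous_on K (\<lambda>x. M - h x)" unfolding K_def by (intro continuous_intros continuous_on_subset[OF hc]) auto
  obtain c0 where c0: "c0 > 0" "\<And>x. x \<in> K \<Longrightarrow> c0 \<le> M - h x"
  proof (cases "K = {}")
    case False
    obtain y where y: "y \<in> K" "\<forall>x\<in>K. M - h y \<le> M - h x"
      using continuous_attains_inf[OF K False \<open>continuous_on K _\<close>] by blast
    have "h y < M" using y(1) d hmax[of y] h_0 by (auto simp: K_def)
    with y(2) show thesis by (intro that[of "M - h y"]) auto
  qed (rule that[of 1], auto)
  define B where "B = (a + b) powr m"
  have B: "B > 0" using ab by (simp add: B_def)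
  define c where "c = min (min (cp / 2) (cm / 2)) (c0 / B)"
  have "c \<le> c0 / B" and c12: "c \<le> min (cp / 2) (cm / 2)" unfolding c_def by (rule min.cobounded2, rule min.cobounded1)
  then have "c * B \<le> c0" using B by (simp add: pos_le_divide_eq)
  moreover have "c > 0" using par c0(1) B by (simp add: c_def)
  ultimately have c: "c > 0" "c \<le> cp / 2" "c \<le> cm / 2" "c * B \<le> c0"
    using order_trans[OF c12 min.cobounded1] order_trans[OF c12 min.cobounded2] by blast+
  have "c * \<bar>x\<bar> powr m \<le> M - h x" if x: "x \<in> {-a..b}" for x
  proof -
    consider "x = 0" | "x \<in> K" | "x \<in> {0<..<d1}" | "- x \<in> {0<..<d2}" using x by (force simp: K_def d_def)
    then show ?thesis
    proof cases
      case 1 then show ?thesis using h_0 by simp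
    next
      case 2
      have "c * \<bar>x\<bar> powr m \<le> c * B" unfolding B_def using x ab c(1) par(4) by (intro mult_left_mono powr_mono2) auto
      then show ?thesis using c(4) c0(2)[OF 2] by linarith
    next
      case 3
      have "c * \<bar>x\<bar> powr m \<le> cp / 2 * x powr m" using c(2) 3 by (simp add: mult_right_mono)
      then show ?thesis using d1(2)[OF 3] by linarith
    next
      case 4
      have "c * \<bar>x\<bar> powr m \<le> cm / 2 * (- x) powr m" using c(3) 4 by (simp add: mult_right_mono)
      then show ?thesis using d2(2)[OF 4] by simp
    qed
  qed
  then show ?thesis using c(1) by blast
qed

text \<open>1/y^2 - 1/M^2 = (M - y) (M + y) / (M^2 y^2), and for y <= M the factor of M - y is at
  least 1 / M^3.\<close>

lemma potential_lower_bound: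
  obtains \<kappa> where "\<kappa> > 0" "\<And>x. x \<in> {-a..b} \<Longrightarrow> \<kappa> * \<bar>x\<bar> powr m \<le> 1 / (h x)\<^sup>2 - 1 / M\<^sup>2"
proof -
  obtain c where c: "c > 0" "\<And>x. x \<in> {-a..b} \<Longrightarrow> c * \<bar>x\<bar> powr m \<le> M - h x" using gap_lower_bound by blast
  show thesis
  proof (rule that[of "c / M ^ 3"])
    fix x assume x: "x \<in> {-a..b}"
    define y where "y = h x"
    have y: "0 < y" "y \<le> M" using hpos[OF x] h_le[OF x] by (auto simp: y_def)
    have "c / M ^ 3 * \<bar>x\<bar> powr m \<le> (M - y) / M ^ 3" using divide_right_mono[OF c(2)[OF x], of "M ^ 3"] par(1) by (simp add: y_def)
    also have "\<dots> \<le> 1 / y\<^sup>2 - 1 / M\<^sup>2"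
    proof -
      have "y\<^sup>2 \<le> M\<^sup>2" using y by (intro power_mono) auto
      then have "(M - y) * y\<^sup>2 \<le> (M - y) * (M * (M + y))"
        using y par(1) by (intro mult_left_mono) (auto simp: power2_eq_square algebra_simps intro: order_trans)
      then have "((M - y) * y\<^sup>2) / (M ^ 3 * y\<^sup>2) \<le> ((M - y) * (M * (M + y))) / (M ^ 3 * y\<^sup>2)"
        using y par(1) by (intro divide_right_mono) auto
      moreover have "((M - y) * y\<^sup>2) / (M ^ 3 * y\<^sup>2) = (M - y) / M ^ 3" using y by simp
      moreover have "((M - y) * (M * (M + y))) / (M ^ 3 * y\<^sup>2) = 1 / y\<^sup>2 - 1 / M\<^sup>2"
        using y par(1) by (simp add: field_simps power2_eq_square power3_eq_cube)
      ultimately show ?thesis by simp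
    qed
    finally show "c / M ^ 3 * \<bar>x\<bar> powr m \<le> 1 / (h x)\<^sup>2 - 1 / M\<^sup>2" by (simp add: y_def)
  qed (use c par in simp)
qed

lemma measurable_on_interval:
  fixes f :: "real \<Rightarrow> real"
  assumes "continuous_on ({-a..b} - {0}) f" shows "f \<in> borel_measurable (leb {-a..b})"
proof -
  have "(\<lambda>x. indicator ({-a..b} - {0}) x *\<^sub>R f x + indicator {0} x * f 0) \<in> borel_measurable borel"
    by (intro borel_measurable_add borel_measurable_continuous_on_indicator assms borel_measurable_times) auto
  also have "(\<lambda>x. indicator ({-a..b} - {0}) x *\<^sub>R f x + indicator {0} x * f 0) = (\<lambda>x. indicator {-a..b} x *\<^sub>R f x)"
    using ab by (auto simp: fun_eq_iff indicator_def)
  finally show ?thesis unfolding leb_measurable_iff[OF interval_borel(1)] .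
qed

lemma slope_continuous: "continuous_on ({-a..b} - {0}) (\<lambda>x. h' x / h x)"
  by (intro continuous_intros hc' continuous_on_subset[OF hc]) (use hpos in force)+

text \<open>The form domain is all of $H^1_0$ only if $h'$ is square integrable at the origin, as one sees
  by testing with a bump.\<close>

lemma slope_L2: "(\<lambda>x. h' x / h x) \<in> L2 (leb {-a..b})"
proof -
  define ql where "ql x = h' x / h x" for x
  have lm: "ql \<in> borel_measurable (leb {-a..b})" unfolding ql_def by (rule measurable_on_interval[OF slope_continuous])
  \<comment> \<open>A bump positive around 0. Testing the assumed integrability with it at
    \<epsilon> = 1 and removing the continuous part of the potential isolates (h'/h)^2 near
    0.\<close>
  define \<eta> where "\<eta> = box_bump (- a / 2) (b / 2) 0"
  have sm: "smooth \<eta>" unfolding \<eta>_def by (rule smooth_box_bump)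
  have ec: "continuous_on A \<eta>" for A by (rule smooth_continuous_on[OF sm])
  have "\<eta> \<in> test_functions {-a..b}"
  proof (rule test_functionsI[OF sm])
    show "compact {- a / 2..b / 2}" by simp
    show "{- a / 2..b / 2} \<subseteq> interior {-a..b}" using ab by auto
    show "\<eta> x = 0" if "x \<notin> {- a / 2..b / 2}" for x
      using that box_bump_nonzero[of "- a / 2" "b / 2" 0 x] by (auto simp: \<eta>_def box_real)
  qed
  then have "\<eta> \<in> H10 {-a..b}" unfolding H10_def using has_H10_gradient_test[OF interval_borel(1)] by blast
  then have i1: "integrable (leb {-a..b}) (\<lambda>x. W_pot h h' M 1 x * (\<eta> x)\<^sup>2)" by (intro form_domain) auto
  have "continuous_on {-a..b} (\<lambda>x. (1 / (h x)\<^sup>2 - 1 / M\<^sup>2) * (\<eta> x)\<^sup>2)"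
    using hpos par(1) by (intro continuous_intros hc ec) force+
  then have i2: "integrable (leb {-a..b}) (\<lambda>x. (1 / (h x)\<^sup>2 - 1 / M\<^sup>2) * (\<eta> x)\<^sup>2)"
    unfolding integrable_leb[OF interval_borel(1)] by (intro borel_integrable_compact) auto
  have "integrable (leb {-a..b}) (\<lambda>x. W_pot h h' M 1 x * (\<eta> x)\<^sup>2 - pi\<^sup>2 * ((1 / (h x)\<^sup>2 - 1 / M\<^sup>2) * (\<eta> x)\<^sup>2))"
    by (intro Bochner_Integration.integrable_diff i1 integrable_mult_right i2)
  also have "(\<lambda>x. W_pot h h' M 1 x * (\<eta> x)\<^sup>2 - pi\<^sup>2 * ((1 / (h x)\<^sup>2 - 1 / M\<^sup>2) * (\<eta> x)\<^sup>2)) =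
    (\<lambda>x. (pi\<^sup>2 / 3 + 1 / 4) * ((ql x)\<^sup>2 * (\<eta> x)\<^sup>2))"
    by (simp add: fun_eq_iff W_pot_def ql_def power_divide algebra_simps add_divide_distrib)
  finally have i3: "integrable (leb {-a..b}) (\<lambda>x. (pi\<^sup>2 / 3 + 1 / 4) * ((ql x)\<^sup>2 * (\<eta> x)\<^sup>2))" .
  have J: "pi\<^sup>2 / 3 + 1 / 4 > 0" by (simp add: add_pos_pos)
  have i4: "integrable (leb {-a..b}) (\<lambda>x. (ql x)\<^sup>2 * (\<eta> x)\<^sup>2)"
    using integrable_mult_right[OF i3, of "1 / (pi\<^sup>2 / 3 + 1 / 4)"] J by simp
  \<comment> \<open>Between -a/4 and b/4 the bump is bounded below by a positive constant; on the
    rest of the interval h'/h is continuous on a compact set.\<close>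
  obtain y where y: "y \<in> {- a / 4..b / 4}" "\<forall>x\<in>{- a / 4..b / 4}. \<eta> y \<le> \<eta> x"
    using continuous_attains_inf[of "{- a / 4..b / 4}" \<eta>] ec ab by fastforce
  have "\<eta> y \<noteq> 0" unfolding \<eta>_def box_bump_nonzero box_real using y(1) ab by auto
  then have e0: "\<eta> y > 0" using box_bump_bounds(1)[of "- a / 2" "b / 2" 0 y] unfolding \<eta>_def by linarith
  have "compact (ql ` ({-a..b} - {- a / 4<..<b / 4}))"
    unfolding ql_def
    by (rule compact_continuous_image[OF continuous_on_subset[OF slope_continuous]]) (use ab in \<open>auto intro: compact_diff\<close>)
  then have "bounded (ql ` ({-a..b} - {- a / 4<..<b / 4}))" by (rule compact_imp_bounded)
  then obtain B where "\<forall>y\<in>ql ` ({-a..b} - {- a / 4<..<b / 4}). \<bar>y\<bar> \<le> B" unfolding bounded_real by blast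
  then have B: "\<bar>ql x\<bar> \<le> B" if "x \<in> {-a..b} - {- a / 4<..<b / 4}" for x using that by blast
  have "ql \<in> L2 (leb {-a..b})"
  proof (rule L2_dominated[OF lm])
    interpret F: finite_measure "leb {-a..b}" by (rule finite_measure_leb[OF interval_borel])
    show "integrable (leb {-a..b}) (\<lambda>x. B\<^sup>2 + 1 / (\<eta> y)\<^sup>2 * ((ql x)\<^sup>2 * (\<eta> x)\<^sup>2))"
      by (intro Bochner_Integration.integrable_add integrable_mult_right i4 F.integrable_const)
    fix x assume "x \<in> space (leb {-a..b})"
    then have x: "x \<in> {-a..b}" by simp
    show "(norm (ql x))\<^sup>2 \<le> B\<^sup>2 + 1 / (\<eta> y)\<^sup>2 * ((ql x)\<^sup>2 * (\<eta> x)\<^sup>2)"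
    proof (cases "x \<in> {- a / 4<..<b / 4}")
      case True
      then have "\<eta> y \<le> \<eta> x" using y(2) by auto
      then have "(\<eta> y)\<^sup>2 \<le> (\<eta> x)\<^sup>2" using e0 by (intro power_mono) auto
      then have "(ql x)\<^sup>2 * (\<eta> y)\<^sup>2 \<le> (ql x)\<^sup>2 * (\<eta> x)\<^sup>2" by (intro mult_left_mono) auto
      then have "(ql x)\<^sup>2 \<le> 1 / (\<eta> y)\<^sup>2 * ((ql x)\<^sup>2 * (\<eta> x)\<^sup>2)" using e0 by (simp add: field_simps)
      then show ?thesis by (simp add: add_increasing)
    next
      case False
      then have "\<bar>ql x\<bar>\<^sup>2 \<le> B\<^sup>2" using B[of x] x by (intro power_mono) auto
      then show ?thesis by (simp add: add_increasing2)
    qed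
  qed
  then show ?thesis by (simp add: ql_def[abs_def])
qed

text \<open>\<open>h\<close> need not be differentiable at 0, so the fundamental theorem is applied
  to the Henstock-Kurzweil integral with one exceptional point; square integrability of h'/h
  identifies that integral with the Lebesgue integral.\<close>

lemma log_profile:
  assumes \<epsilon>: "\<epsilon> > 0" and x: "x \<in> {-a..b}"
  shows "ln (\<epsilon> * h x) = ln (\<epsilon> * h (- a)) + (\<integral>t. indicator {-a..x} t * (h' t / h t) \<partial>leb {-a..b})"
proof -
  define ql where "ql x = h' x / h x" for x
  interpret F: finite_measure "leb {-a..b}" by (rule finite_measure_leb[OF interval_borel])
  have "integrable (leb {-a..b}) ql" unfolding ql_def by (rule F.L2_norm_integral_le(1)[OF slope_L2])
  then have "integrable lborel (\<lambda>t. indicator {-a..b} t *\<^sub>R ql t)" unfolding integrable_leb[OF interval_borel(1)] .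
  then have "integrable lborel (\<lambda>t. indicator {-a..x} t *\<^sub>R (indicator {-a..b} t *\<^sub>R ql t))"
    by (rule integrable_mult_indicator[rotated]) simp
  also have "(\<lambda>t. indicator {-a..x} t *\<^sub>R (indicator {-a..b} t *\<^sub>R ql t)) = (\<lambda>t. if t \<in> {-a..x} then ql t else 0)"
    using x by (auto simp: fun_eq_iff indicator_def)
  finally have "((\<lambda>t. if t \<in> {-a..x} then ql t else 0) has_integral (\<integral>t. (if t \<in> {-a..x} then ql t else 0) \<partial>lborel)) UNIV"
    by (rule has_integral_integral_lborel)
  then have "(ql has_integral (\<integral>t. (if t \<in> {-a..x} then ql t else 0) \<partial>lborel)) {-a..x}"
    unfolding has_integral_restrict_UNIV .
  moreover have "(ql has_integral (ln (h x) - ln (h (- a)))) {-a..x}"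
  proof (rule fundamental_theorem_of_calculus_interior_strong[of "{0}"])
    show "continuous_on {-a..x} (\<lambda>x. ln (h x))"
      using x hpos by (intro continuous_on_ln continuous_on_subset[OF hc]) force+
    fix t assume t: "t \<in> {-a<..<x} - {0}"
    then have "t \<in> interior {-a..b}" using x by auto
    then have "at t within {-a..b} = at t" by (rule at_within_interior)
    then have "(h has_real_derivative h' t) (at t)" using hd[of t] t x by auto
    moreover have "h t > 0" using t x by (intro hpos) auto
    ultimately have "((\<lambda>x. ln (h x)) has_real_derivative ql t) (at t)"
      unfolding ql_def by (auto intro!: derivative_eq_intros)
    then show "((\<lambda>x. ln (h x)) has_vector_derivative ql t) (at t)" by (simp add: has_real_derivative_iff_has_vector_derivative)
  qed (use x in auto)
  ultimately have "ln (h x) - ln (h (- a)) = (\<integral>t. (if t \<in> {-a..x} then ql t else 0) \<partial>lborel)" by (rule has_integral_unique[rotated])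
  also have "\<dots> = (\<integral>t. indicator {-a..x} t * ql t \<partial>leb {-a..b})"
    unfolding integral_leb[OF interval_borel(1)] using x
    by (intro Bochner_Integration.integral_cong) (auto simp: indicator_def)
  finally show ?thesis using \<epsilon> hpos[OF x] hpos[of "- a"] ab by (simp add: ln_mult_pos ql_def)
qed

lemma tube:
  assumes "\<epsilon> > 0" shows "tube (- a) b (\<lambda>x. \<epsilon> * h x) (\<lambda>x. h' x / h x)"
proof
  show "- a < b" using ab by simp
  show "continuous_on {-a..b} (\<lambda>x. \<epsilon> * h x)" by (intro continuous_intros hc)
  show "0 < \<epsilon> * h x" if "x \<in> {-a..b}" for x using assms hpos[OF that] by simp
  show "(\<lambda>x. h' x / h x) \<in> L2 (leb {-a..b})" by (rule slope_L2)
  show "ln (\<epsilon> * h x) = ln (\<epsilon> * h (- a)) + (\<integral>t. indicator {-a..x} t * (h' t / h t) \<partial>leb {-a..b})"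
    if "x \<in> {-a..b}" for x by (rule log_profile[OF assms that])
qed

text \<open>In the scaling $\epsilon^2=r^{m+2}$ the potential dominates $r^{-2}$ outside $|x|\le r/2$, while the
  uncertainty principle supplies the same bound inside.\<close>

lemma profile_coercive:
  obtains C where "C > 0" "\<And>\<epsilon> r \<xi> \<xi>'. \<epsilon> > 0 \<Longrightarrow> r > 0 \<Longrightarrow> \<epsilon>\<^sup>2 = r powr (m + 2) \<Longrightarrow>
    has_H10_gradient {-a..b} \<xi> \<xi>' \<Longrightarrow> (l2norm (leb {-a..b}) \<xi>)\<^sup>2 \<le>
      (C * r)\<^sup>2 * ((l2norm (leb {-a..b}) \<xi>')\<^sup>2 + (\<integral>x. pi\<^sup>2 / \<epsilon>\<^sup>2 * (1 / (h x)\<^sup>2 - 1 / M\<^sup>2) * (\<xi> x)\<^sup>2 \<partial>leb {-a..b}))"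
proof -
  let ?M = "leb {-a..b}"
  obtain \<kappa> where k: "\<kappa> > 0" "\<And>x. x \<in> {-a..b} \<Longrightarrow> \<kappa> * \<bar>x\<bar> powr m \<le> 1 / (h x)\<^sup>2 - 1 / M\<^sup>2"
    by (rule potential_lower_bound, rule that)
  \<comment> \<open>\<theta> <= 1 lets \<theta> times the uncertainty bound be absorbed by
    |\<xi>'|^2; the other entry makes the potential at least \<theta> / r^2 where |x| >=
    r/2.\<close>
  define \<theta> where "\<theta> = min 1 (pi\<^sup>2 * \<kappa> * (1 / 2) powr m)"
  have \<theta>: "0 < \<theta>" "\<theta> \<le> 1" "\<theta> \<le> pi\<^sup>2 * \<kappa> * (1 / 2) powr m" using k(1) by (auto simp: \<theta>_def)
  show thesis
  proof (rule that[of "sqrt (25 / (8 * \<theta>))"])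
    show "0 < sqrt (25 / (8 * \<theta>))" using \<theta> by simp
    fix \<epsilon> r \<xi> \<xi>' assume er: "\<epsilon> > 0" "r > 0" "\<epsilon>\<^sup>2 = r powr (m + 2)" and \<xi>: "has_H10_gradient {-a..b} \<xi> \<xi>'"
    define P where "P x = pi\<^sup>2 / \<epsilon>\<^sup>2 * (1 / (h x)\<^sup>2 - 1 / M\<^sup>2)" for x
    define w where "w x = (r\<^sup>2 - 2 * x\<^sup>2) / (r\<^sup>2 + x\<^sup>2)\<^sup>2" for x
    \<comment> \<open>In this scaling r^m / \<epsilon>^2 is exactly 1 / r^2, which balances
      potential and kinetic energy at distance r.\<close>
    have e2: "\<epsilon>\<^sup>2 = r powr m * r\<^sup>2" using er by (simp add: powr_add)
    have P: "8 * \<theta> / (25 * r\<^sup>2) \<le> \<theta> * w x + P x" if x: "x \<in> {-a..b}" for x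
      unfolding w_def
    proof (rule quartic_weight_bounds[OF er(2)])
      have low: "pi\<^sup>2 / \<epsilon>\<^sup>2 * (\<kappa> * \<bar>x\<bar> powr m) \<le> P x" unfolding P_def by (intro mult_left_mono k x) simp
      show "0 \<le> P x" by (rule order_trans[OF _ low]) (use k(1) in simp)
      assume "r / 2 \<le> \<bar>x\<bar>"
      then have "(r / 2) powr m \<le> \<bar>x\<bar> powr m" using er(2) par(4) by (intro powr_mono2) auto
      then have "pi\<^sup>2 / \<epsilon>\<^sup>2 * (\<kappa> * (r / 2) powr m) \<le> pi\<^sup>2 / \<epsilon>\<^sup>2 * (\<kappa> * \<bar>x\<bar> powr m)" using k(1) by (intro mult_left_mono) auto
      also note low
      also have "(r / 2) powr m = r powr m * (1 / 2) powr m" using powr_mult[of r "1 / 2" m] er(2) by simp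
      also have "pi\<^sup>2 / \<epsilon>\<^sup>2 * (\<kappa> * (r powr m * (1 / 2) powr m)) = (pi\<^sup>2 * \<kappa> * (1 / 2) powr m) / r\<^sup>2"
        unfolding e2 using er(2) by (simp add: field_simps)
      finally show "\<theta> / r\<^sup>2 \<le> P x" using divide_right_mono[OF \<theta>(3), of "r\<^sup>2"] by simp
    qed (use \<theta> in simp)
    have i: "integrable ?M (\<lambda>x. q x * (\<xi> x)\<^sup>2)" if "continuous_on {-a..b} q" for q
    proof -
      have "bounded (q ` {-a..b})" by (intro compact_imp_bounded compact_continuous_image that) simp
      then obtain B where B: "\<forall>y\<in>q ` {-a..b}. \<bar>y\<bar> \<le> B" unfolding bounded_real by blast
      have "(\<lambda>x. q x *\<^sub>R \<xi> x) \<in> L2 ?M"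
        by (rule L2_bounded_mult[OF has_H10_gradient_L2(1)[OF \<xi>] measurable_on_interval, where B=B])
          (use B continuous_on_subset[OF that] in auto)
      from L2_mult_integrable[OF this has_H10_gradient_L2(1)[OF \<xi>]] show ?thesis by (simp add: power2_eq_square mult.assoc)
    qed
    have pos: "r\<^sup>2 + x\<^sup>2 \<noteq> 0" for x using er(2) by (simp add: add_pos_nonneg less_imp_neq[symmetric])
    have iw: "integrable ?M (\<lambda>x. w x * (\<xi> x)\<^sup>2)" unfolding w_def using pos by (intro i continuous_intros) simp
    have iP: "integrable ?M (\<lambda>x. P x * (\<xi> x)\<^sup>2)" unfolding P_def using hpos er(1) par(1) by (intro i continuous_intros hc) force+
    have i1: "integrable ?M (\<lambda>x. 1 * (\<xi> x)\<^sup>2)" by (intro i continuous_intros)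
    have "8 * \<theta> / (25 * r\<^sup>2) * (l2norm ?M \<xi>)\<^sup>2 = (\<integral>x. 8 * \<theta> / (25 * r\<^sup>2) * (1 * (\<xi> x)\<^sup>2) \<partial>?M)"
      unfolding l2norm_sq l2inner_def by (simp add: power2_eq_square)
    also have "\<dots> \<le> (\<integral>x. \<theta> * (w x * (\<xi> x)\<^sup>2) + P x * (\<xi> x)\<^sup>2 \<partial>?M)"
    proof (rule integral_mono)
      fix x assume "x \<in> space ?M"
      then have "8 * \<theta> / (25 * r\<^sup>2) * (\<xi> x)\<^sup>2 \<le> (\<theta> * w x + P x) * (\<xi> x)\<^sup>2" by (intro mult_right_mono P) auto
      then show "8 * \<theta> / (25 * r\<^sup>2) * (1 * (\<xi> x)\<^sup>2) \<le> \<theta> * (w x * (\<xi> x)\<^sup>2) + P x * (\<xi> x)\<^sup>2" by (simp only: mult_1 distrib_right mult.assoc)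
    qed (intro integrable_mult_right i1 Bochner_Integration.integrable_add iw iP)+
    also have "\<dots> = \<theta> * (\<integral>x. w x * (\<xi> x)\<^sup>2 \<partial>?M) + (\<integral>x. P x * (\<xi> x)\<^sup>2 \<partial>?M)"
      by (subst Bochner_Integration.integral_add) (simp_all only: integrable_mult_right iw iP integral_mult_right_zero)
    also have "\<theta> * (\<integral>x. w x * (\<xi> x)\<^sup>2 \<partial>?M) \<le> 1 * (l2norm ?M \<xi>')\<^sup>2"
    proof -
      have "\<theta> * (\<integral>x. w x * (\<xi> x)\<^sup>2 \<partial>?M) \<le> \<theta> * (l2norm ?M \<xi>')\<^sup>2"
        unfolding w_def by (intro mult_left_mono uncertainty_bound[OF \<xi> er(2)]) (use \<theta> in simp)
      also have "\<dots> \<le> 1 * (l2norm ?M \<xi>')\<^sup>2" by (intro mult_right_mono \<theta>) simp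
      finally show ?thesis .
    qed
    finally have le: "8 * \<theta> / (25 * r\<^sup>2) * (l2norm ?M \<xi>)\<^sup>2 \<le> (l2norm ?M \<xi>')\<^sup>2 + (\<integral>x. P x * (\<xi> x)\<^sup>2 \<partial>?M)" by simp
    have "(l2norm ?M \<xi>)\<^sup>2 = (25 / (8 * \<theta>) * r\<^sup>2) * (8 * \<theta> / (25 * r\<^sup>2) * (l2norm ?M \<xi>)\<^sup>2)"
      using er(2) \<theta>(1) by simp
    also have "\<dots> \<le> (25 / (8 * \<theta>) * r\<^sup>2) * ((l2norm ?M \<xi>')\<^sup>2 + (\<integral>x. P x * (\<xi> x)\<^sup>2 \<partial>?M))"
      by (intro mult_left_mono le) (use \<theta> in simp)
    finally show "(l2norm ?M \<xi>)\<^sup>2 \<le> (sqrt (25 / (8 * \<theta>)) * r)\<^sup>2 * ((l2norm ?M \<xi>')\<^sup>2 +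
        (\<integral>x. pi\<^sup>2 / \<epsilon>\<^sup>2 * (1 / (h x)\<^sup>2 - 1 / M\<^sup>2) * (\<xi> x)\<^sup>2 \<partial>?M))"
      using \<theta>(1) by (simp add: power_mult_distrib P_def)
  qed
qed

lemma narrow_tube:
  obtains C where "C > 0" "\<And>\<epsilon> r. \<epsilon> > 0 \<Longrightarrow> r > 0 \<Longrightarrow> \<epsilon>\<^sup>2 = r powr (m + 2) \<Longrightarrow>
    narrow_tube (- a) b (\<lambda>x. \<epsilon> * h x) (\<lambda>x. h' x / h x) (\<epsilon> * M) (C * r)"
proof -
  let ?M = "leb {-a..b}"
  obtain C where C: "C > 0" and co: "\<And>\<epsilon> r \<xi> \<xi>'. \<epsilon> > 0 \<Longrightarrow> r > 0 \<Longrightarrow> \<epsilon>\<^sup>2 = r powr (m + 2) \<Longrightarrow>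
    has_H10_gradient {-a..b} \<xi> \<xi>' \<Longrightarrow> (l2norm ?M \<xi>)\<^sup>2 \<le>
      (C * r)\<^sup>2 * ((l2norm ?M \<xi>')\<^sup>2 + (\<integral>x. pi\<^sup>2 / \<epsilon>\<^sup>2 * (1 / (h x)\<^sup>2 - 1 / M\<^sup>2) * (\<xi> x)\<^sup>2 \<partial>?M))"
    by (rule profile_coercive, rule that)
  show thesis
  proof (rule that[OF C])
    fix \<epsilon> r assume er: "\<epsilon> > 0" "r > 0" "\<epsilon>\<^sup>2 = r powr (m + 2)"
    interpret T: tube "- a" b "\<lambda>x. \<epsilon> * h x" "\<lambda>x. h' x / h x" by (rule tube[OF er(1)])
    show "narrow_tube (- a) b (\<lambda>x. \<epsilon> * h x) (\<lambda>x. h' x / h x) (\<epsilon> * M) (C * r)"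
    proof
      show "0 < \<epsilon> * M" "0 < C * r" using er C par by simp_all
      show "\<epsilon> * h x \<le> \<epsilon> * M" if "x \<in> {-a..b}" for x using h_le[OF that] er(1) by simp
      fix \<xi> \<xi>' assume \<xi>: "has_H10_gradient {-a..b} \<xi> \<xi>'"
      note L = has_H10_gradient_L2(1)[OF \<xi>]
      have "(\<integral>x. pi\<^sup>2 / \<epsilon>\<^sup>2 * (1 / (h x)\<^sup>2 - 1 / M\<^sup>2) * (\<xi> x)\<^sup>2 \<partial>?M) =
        (\<integral>x. (pi / T.Lb x * \<xi> x) * (pi / T.Lb x * \<xi> x) - (pi / (\<epsilon> * M))\<^sup>2 * (\<xi> x * \<xi> x) \<partial>?M)"
      proof (rule Bochner_Integration.integral_cong)
        fix x assume "x \<in> space ?M"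
        then show "pi\<^sup>2 / \<epsilon>\<^sup>2 * (1 / (h x)\<^sup>2 - 1 / M\<^sup>2) * (\<xi> x)\<^sup>2 =
          (pi / T.Lb x * \<xi> x) * (pi / T.Lb x * \<xi> x) - (pi / (\<epsilon> * M))\<^sup>2 * (\<xi> x * \<xi> x)"
          by (simp add: T.Lb_eq power2_eq_square algebra_simps)
      qed simp
      also have "\<dots> = (l2norm ?M (\<lambda>x. pi / T.Lb x * \<xi> x))\<^sup>2 - (pi / (\<epsilon> * M))\<^sup>2 * (l2norm ?M \<xi>)\<^sup>2"
        unfolding l2norm_sq l2inner_def inner_real_def
        by (simp only: Bochner_Integration.integral_diff L2_mult_integrable[OF T.invL_mult_L2[OF L] T.invL_mult_L2[OF L]]
          integrable_mult_right L2_mult_integrable[OF L L] integral_mult_right_zero)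
      finally show "(l2norm ?M \<xi>)\<^sup>2 \<le> (C * r)\<^sup>2 * ((l2norm ?M \<xi>')\<^sup>2 +
          (l2norm ?M (\<lambda>x. pi / T.Lb x * \<xi> x))\<^sup>2 - (pi / (\<epsilon> * M))\<^sup>2 * (l2norm ?M \<xi>)\<^sup>2)"
        using co[OF er \<xi>] by (simp add: add_diff_eq)
    qed
  qed
qed

end

text \<open>Inverses are picked by \<open>SOME\<close>, so bounded invertibility is part of the
  claim and gives the norm estimate its meaning. The integrability assumption expresses that the
  form of Q is defined on all of H^1_0; the expansions restrict \<open>h\<close> but leave
  \<open>h'\<close> uncontrolled near 0.\<close>

theorem theorem1p2:
  fixes a b M m cp cm \<alpha> :: real and h h' :: "real \<Rightarrow> real"
  assumes "a > 0" and "b > 0"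
    and "continuous_on {-a..b} h"
    and "\<And>x. x \<in> {-a..b} \<Longrightarrow> h x > 0"
    and "\<And>x. x \<in> {-a..b} \<Longrightarrow> x \<noteq> 0 \<Longrightarrow> h x < h 0"
    and "\<And>x. x \<in> {-a..b} - {0} \<Longrightarrow> (h has_real_derivative h' x) (at x within {-a..b})"
    and "continuous_on ({-a..b} - {0}) h'"
    and "M > 0" and "cp > 0" and "cm > 0" and "m \<ge> 1"
    and "(\<lambda>x. h x - (M - cp * x powr m)) \<in> O[at_right 0](\<lambda>x. x powr (m + 1))"
    and "(\<lambda>x. h x - (M - cm * \<bar>x\<bar> powr m)) \<in> O[at_left 0](\<lambda>x. \<bar>x\<bar> powr (m + 1))"
    and q_defined_on_H10: "\<And>\<epsilon> \<eta>. \<epsilon> > 0 \<Longrightarrow> \<eta> \<in> H10 {-a..b} \<Longrightarrow>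
           integrable (leb {-a..b}) (\<lambda>x. W_pot h h' M \<epsilon> x * (\<eta> x)\<^sup>2)"
    and "\<alpha> = 2 / (m + 2)"
  shows "\<exists>R0>0. \<exists>\<epsilon>0>0. \<forall>\<epsilon>\<in>{0<..<\<epsilon>0}.
    (let \<Omega> = strip a b h \<epsilon>;
         A = minus_scalar (dirichlet_laplacian \<Omega>) (pi\<^sup>2 / (M\<^sup>2 * \<epsilon>\<^sup>2));
         Q = schroedinger {-a..b} (W_pot h h' M \<epsilon>)
     in boundedly_invertible (leb \<Omega>) A \<and>
        boundedly_invertible (leb {-a..b}) Q \<and>
        l2_opnorm (leb \<Omega>)
          (\<lambda>f p. inv_op A f p -
             direct_sum (leb \<Omega>) (mode_space a b h \<epsilon>)
               (on_modes a b h \<epsilon> (inv_op Q)) (\<lambda>_ _. 0) f p)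
          \<le> ereal (R0 * \<epsilon> powr (3 * \<alpha>)))"
proof -
  interpret waist a b M m cp cm h h'
    by (rule waist.intro) (fact assms(1-14))+
  obtain C where C: "C > 0" and tb: "\<And>\<epsilon> r. \<epsilon> > 0 \<Longrightarrow> r > 0 \<Longrightarrow> \<epsilon>\<^sup>2 = r powr (m + 2) \<Longrightarrow>
      narrow_tube (- a) b (\<lambda>x. \<epsilon> * h x) (\<lambda>x. h' x / h x) (\<epsilon> * M) (C * r)"
    by (rule narrow_tube, rule that)
  have m: "m \<ge> 1" and M: "M > 0" and \<alpha>: "\<alpha> > 0" "\<alpha> * (m + 2) = 2" "3 * \<alpha> / 2 \<le> 1"
    unfolding assms(15) using par by (simp_all add: field_simps)
  define \<Lambda> where "\<Lambda> = l2norm (leb {-a..b}) (\<lambda>x. h' x / h x)"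
  have L0: "\<Lambda> \<ge> 0" unfolding \<Lambda>_def by (rule l2norm_nonneg)
  \<comment> \<open>The coupling constant with the powers of \<epsilon> taken out:
    \<open>T.DD\<close> turns out to be at most K s.\<close>
  define K where "K = sqrt (J tau tau) * (\<Lambda> * (2 * sqrt (M / pi)) + \<Lambda> * sqrt (2 * C))"
  have J: "J tau tau > 0" by (simp add: J_tau_tau add_pos_pos)
  have K0: "K \<ge> 0" unfolding K_def using L0 J M C by (intro mult_nonneg_nonneg add_nonneg_nonneg) auto
  define R0 where "R0 = 2 * (M / pi + K * C)\<^sup>2"
  \<comment> \<open>Chosen so that K s <= 1/2 for s = \<epsilon>^(\<alpha>/2), and at most 1 so that
    higher powers of \<epsilon> are smaller.\<close>
  define \<epsilon>0 where "\<epsilon>0 = min 1 ((1 / (2 * (K + 1))) powr (2 / \<alpha>))"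
  show ?thesis
  proof (rule exI[of _ R0], intro conjI exI[of _ \<epsilon>0] ballI)
    have "M / pi + K * C > 0" using M K0 C by (intro add_pos_nonneg) auto
    then show "R0 > 0" by (simp add: R0_def)
    show "\<epsilon>0 > 0" using K0 by (simp add: \<epsilon>0_def)
    fix \<epsilon> assume "\<epsilon> \<in> {0<..<\<epsilon>0}"
    then have e: "0 < \<epsilon>" "\<epsilon> < 1" "\<epsilon> \<le> (1 / (2 * (K + 1))) powr (2 / \<alpha>)" by (auto simp: \<epsilon>0_def)
    \<comment> \<open>The square root of the length scale r = \<epsilon>^\<alpha>: then R = C s^2,
      the coupling is O(s), and the claimed rate is s^6.\<close>
    define s where "s = \<epsilon> powr (\<alpha> / 2)"
    have s0: "s > 0" using e by (simp add: s_def)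
    have sp: "s ^ n = \<epsilon> powr (n * \<alpha> / 2)" for n :: nat unfolding s_def using e(1) by (subst powr_power) auto
    have s1: "s \<le> 1" unfolding s_def using e \<alpha>(1) powr_mono2[of "\<alpha> / 2" \<epsilon> 1] by simp
    have "s \<le> ((1 / (2 * (K + 1))) powr (2 / \<alpha>)) powr (\<alpha> / 2)"
      unfolding s_def using e \<alpha>(1) by (intro powr_mono2) auto
    also have "\<dots> = 1 / (2 * (K + 1))" using \<alpha>(1) K0 by (simp add: powr_powr)
    finally have "s * (2 * (K + 1)) \<le> 1" using K0 by (simp add: pos_le_divide_eq)
    then have Ks: "K * s \<le> 1 / 2" using s0 by (simp add: algebra_simps)
    have s6: "s ^ 6 = \<epsilon> powr (3 * \<alpha>)" unfolding sp by simp
    \<comment> \<open>This is where m >= 1 enters, as 3 \<alpha> / 2 <= 1: the transverse length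
      \<epsilon> is no larger than s^3, the order of coupling times R.\<close>
    have s3: "\<epsilon> \<le> s ^ 3" unfolding sp using powr_mono'[of "3 * \<alpha> / 2" 1 \<epsilon>] \<alpha>(3) e by simp
    also have "s ^ 3 \<le> s\<^sup>2" using s0 s1 by (intro power_decreasing) auto
    finally have s2: "\<epsilon> \<le> s\<^sup>2" .
    have "s\<^sup>2 powr (m + 2) = \<epsilon> powr 2" unfolding sp by (simp add: powr_powr \<alpha>(2))
    then have er: "\<epsilon>\<^sup>2 = s\<^sup>2 powr (m + 2)" using e(1) by simp
    interpret T: narrow_tube "- a" b "\<lambda>x. \<epsilon> * h x" "\<lambda>x. h' x / h x" "\<epsilon> * M" "C * s\<^sup>2"
      by (rule tb[OF e(1) _ er]) (use s0 in simp)
    have "T.DD \<le> K * s"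
    proof -
      have "\<epsilon> * M / pi \<le> s\<^sup>2 * (M / pi)" using s2 M by (simp add: divide_right_mono)
      then have "sqrt (\<epsilon> * M / pi) \<le> sqrt (s\<^sup>2 * (M / pi))" by (rule real_sqrt_le_mono)
      then have 1: "sqrt (\<epsilon> * M / pi) \<le> s * sqrt (M / pi)" unfolding real_sqrt_mult[of "s\<^sup>2"] using s0 by simp
      have 2: "sqrt (2 * (C * s\<^sup>2)) = s * sqrt (2 * C)" using s0 by (simp add: real_sqrt_mult)
      have "T.DD \<le> sqrt (J tau tau) * (\<Lambda> * (2 * (s * sqrt (M / pi))) + \<Lambda> * (s * sqrt (2 * C)))"
        unfolding T.DD_def \<Lambda>_def[symmetric] 2 using J L0 1 by (intro mult_left_mono add_right_mono) auto
      also have "\<dots> = K * s" by (simp add: K_def algebra_simps)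
      finally show ?thesis .
    qed
    then have DD: "T.DD \<le> 1 / 2" "T.DD \<le> K * s" using Ks by auto
    have bound: "2 * (\<epsilon> * M / pi + T.DD * (C * s\<^sup>2))\<^sup>2 \<le> R0 * \<epsilon> powr (3 * \<alpha>)"
    proof -
      have "0 \<le> \<epsilon> * M / pi + T.DD * (C * s\<^sup>2)" using e(1) M C T.DD_nonneg by (intro add_nonneg_nonneg mult_nonneg_nonneg) auto
      moreover have "\<epsilon> * M / pi \<le> s ^ 3 * M / pi" using s3 M by (intro divide_right_mono mult_right_mono) auto
      moreover have "T.DD * (C * s\<^sup>2) \<le> K * s * (C * s\<^sup>2)" using DD(2) C by (intro mult_right_mono) auto
      ultimately have "(\<epsilon> * M / pi + T.DD * (C * s\<^sup>2))\<^sup>2 \<le> (s ^ 3 * M / pi + K * s * (C * s\<^sup>2))\<^sup>2" by (intro power_mono add_mono)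
      also have "s ^ 3 * M / pi + K * s * (C * s\<^sup>2) = s ^ 3 * (M / pi + K * C)" by (simp add: power2_eq_square power3_eq_cube algebra_simps)
      also have "\<dots>\<^sup>2 = s ^ 6 * (M / pi + K * C)\<^sup>2" by (simp add: power_mult_distrib)
      finally show ?thesis by (simp add: R0_def s6 mult.commute)
    qed
    have S: "strip a b h \<epsilon> = T.S" by (auto simp: strip_def T.S_def)
    have mu: "pi\<^sup>2 / (M\<^sup>2 * \<epsilon>\<^sup>2) = T.mu" unfolding T.mu_def by (simp add: power_divide power_mult_distrib mult.commute)
    have mo: "mode h \<epsilon> \<eta> p = T.md \<eta> p" if "p \<in> T.S" for \<eta> p
      using that T.Lb_eq[of "fst p"] by (cases p) (simp add: mode_def T.md_def T.ker_def T.S_def)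
    have W: "W_pot h h' M \<epsilon> x = (pi / (\<epsilon> * h x))\<^sup>2 - T.mu + J tau tau * (h' x / h x)\<^sup>2" for x
      unfolding T.mu_def by (simp add: W_pot_def J_tau_tau power_divide power_mult_distrib algebra_simps)
    show "let \<Omega> = strip a b h \<epsilon>;
         A = minus_scalar (dirichlet_laplacian \<Omega>) (pi\<^sup>2 / (M\<^sup>2 * \<epsilon>\<^sup>2));
         Q = schroedinger {-a..b} (W_pot h h' M \<epsilon>)
     in boundedly_invertible (leb \<Omega>) A \<and>
        boundedly_invertible (leb {-a..b}) Q \<and>
        l2_opnorm (leb \<Omega>)
          (\<lambda>f p. inv_op A f p -
             direct_sum (leb \<Omega>) (mode_space a b h \<epsilon>)
               (on_modes a b h \<epsilon> (inv_op Q)) (\<lambda>_ _. 0) f p)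
          \<le> ereal (R0 * \<epsilon> powr (3 * \<alpha>))"
      unfolding Let_def S mu mode_space_def on_modes_def[abs_def]
    proof (intro conjI)
      show "boundedly_invertible T.MO (minus_scalar (dirichlet_laplacian T.S) T.mu)"
        by (rule T.dirichlet_boundedly_invertible[OF DD(1)])
      show "boundedly_invertible (leb {-a..b}) (schroedinger {-a..b} (W_pot h h' M \<epsilon>))"
        by (rule T.schroedinger_boundedly_invertible[OF W])
    qed (rule order_trans, rule T.operator_estimate[OF DD(1) mo W], assumption, rule ereal_less_eq(3)[THEN iffD2, OF bound])
  qed
qed

end
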